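(* Let $\mathcal{C}$ be a Hom-finite triangulated category with Serre duality, i.e. having a Serre functor $\mathbb{S}:\mathcal{C}\to\mathcal{C}$, and let $(\mathcal{U},\mathcal{V})$ be a $t$-structure in $\mathcal{C}$ with heart $\mathcal{H}(\mathcal{U})=\mathcal{U}\cap\mathcal{V}$. If the embedding $\mathcal{H}(\mathcal{U})\to\mathcal{C}$ can be extended to a triangle equivalence $G:D^b(\mathcal{H}(\mathcal{U}))\to\mathcal{C}$, then $(\mathcal{U},\mathcal{V})$ is bounded and $\mathbb{S}\,\mathcal{U}\subseteq\mathcal{U}$.
   Context: Fix a field $k$; all categories and functors are $k$-linear and all categories are essentially small. A category is Hom-finite if all Hom-spaces are finite-dimensional over $k$. $[1]$ denotes suspension. A Serre functor on a Hom-finite category $\mathcal{C}$ is an autoequivalence $\mathbb{S}:\mathcal{C}\to\mathcal{C}$ with isomorphisms $\operatorname{Hom}(A,B)\cong\operatorname{Hom}(B,\mathbb{S}A)^*$ natural in $A,B$, where $(-)^*$ is the $k$-dual. A $t$-structure on a triangulated category $\mathcal{C}$ is a pair $(\mathcal{U},\mathcal{V})$ of full subcategories (closed under isomorphisms, finite direct sums and retracts) such that $\mathcal{U}[1]\subseteq\mathcal{U}$, $\mathcal{V}\subseteq\mathcal{V}[1]$, $\operatorname{Hom}(\mathcal{U}[1],\mathcal{V})=0$, and every $C\in\mathcal{C}$ sits in a triangle $U\to C\to V\to U[1]$ with $U\in\mathcal{U}$ and $V\in\mathcal{V}[-1]$. Its heart $\mathcal{U}\cap\mathcal{V}$ is abelian.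 It is bounded if $\bigcup_{n\in\mathbb{Z}}\mathcal{U}[n]=\mathcal{C}=\bigcup_{n\in\mathbb{Z}}\mathcal{V}[n]$. $G$ extends the embedding $\mathcal{H}(\mathcal{U})\to\mathcal{C}$ if the composition of $G$ with the natural embedding $\mathcal{H}(\mathcal{U})\to D^b(\mathcal{H}(\mathcal{U}))$ (stalk complexes in degree zero) is naturally isomorphic to the embedding $\mathcal{H}(\mathcal{U})\to\mathcal{C}$. *)

theory Defs
  imports "HOL-Algebra.Module"
begin

section \<open>Linear categories and functors\<close>

text \<open>
  Hom-spaces are modules in the sense of HOL-Algebra; of the underlying ring record only the
  carrier, zero and addition are used, never the multiplicative fields.
\<close>

record ('o, 'm, 'k) lin_cat =
  Ob :: "'o set"
  Hom :: "'o \<Rightarrow> 'o \<Rightarrow> ('k, 'm) module"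
  Idt :: "'o \<Rightarrow> 'm"
  Cmp :: "'m \<Rightarrow> 'm \<Rightarrow> 'm" (infixl "\<cdot>\<index>" 75)

abbreviation Mor :: "('o, 'm, 'k, 'z) lin_cat_scheme \<Rightarrow> 'o \<Rightarrow> 'o \<Rightarrow> 'm set" where
  "Mor C X Y \<equiv> carrier (Hom C X Y)"

locale linear_category = field K
  for K :: "('k, 'r) ring_scheme" (structure) and C :: "('o, 'm, 'k, 'z) lin_cat_scheme" +
  assumes Hom_module: "\<lbrakk>X \<in> Ob C; Y \<in> Ob C\<rbrakk> \<Longrightarrow> module K (Hom C X Y)"
    and Hom_disjoint: "\<lbrakk>X \<in> Ob C; Y \<in> Ob C; X' \<in> Ob C; Y' \<in> Ob C;
          f \<in> Mor C X Y; f \<in> Mor C X' Y'\<rbrakk> \<Longrightarrow> X = X' \<and> Y = Y'"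
    and Idt_closed: "X \<in> Ob C \<Longrightarrow> Idt C X \<in> Mor C X X"
    and Cmp_closed: "\<lbrakk>X \<in> Ob C; Y \<in> Ob C; Z \<in> Ob C; f \<in> Mor C X Y; g \<in> Mor C Y Z\<rbrakk>
          \<Longrightarrow> g \<cdot>\<^bsub>C\<^esub> f \<in> Mor C X Z"
    and Cmp_Idt_right: "\<lbrakk>X \<in> Ob C; Y \<in> Ob C; f \<in> Mor C X Y\<rbrakk> \<Longrightarrow> f \<cdot>\<^bsub>C\<^esub> Idt C X = f"
    and Cmp_Idt_left: "\<lbrakk>X \<in> Ob C; Y \<in> Ob C; f \<in> Mor C X Y\<rbrakk> \<Longrightarrow> Idt C Y \<cdot>\<^bsub>C\<^esub> f = f"
    and Cmp_assoc: "\<lbrakk>W \<in> Ob C; X \<in> Ob C; Y \<in> Ob C; Z \<in> Ob C;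
          f \<in> Mor C W X; g \<in> Mor C X Y; h \<in> Mor C Y Z\<rbrakk>
          \<Longrightarrow> h \<cdot>\<^bsub>C\<^esub> g \<cdot>\<^bsub>C\<^esub> f = h \<cdot>\<^bsub>C\<^esub> (g \<cdot>\<^bsub>C\<^esub> f)"
    and Cmp_add_left: "\<lbrakk>X \<in> Ob C; Y \<in> Ob C; Z \<in> Ob C;
          f \<in> Mor C X Y; g \<in> Mor C Y Z; g' \<in> Mor C Y Z\<rbrakk>
          \<Longrightarrow> (g \<oplus>\<^bsub>Hom C Y Z\<^esub> g') \<cdot>\<^bsub>C\<^esub> f = g \<cdot>\<^bsub>C\<^esub> f \<oplus>\<^bsub>Hom C X Z\<^esub> g' \<cdot>\<^bsub>C\<^esub> f"
    and Cmp_add_right: "\<lbrakk>X \<in> Ob C; Y \<in> Ob C; Z \<in> Ob C;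
          f \<in> Mor C X Y; f' \<in> Mor C X Y; g \<in> Mor C Y Z\<rbrakk>
          \<Longrightarrow> g \<cdot>\<^bsub>C\<^esub> (f \<oplus>\<^bsub>Hom C X Y\<^esub> f') = g \<cdot>\<^bsub>C\<^esub> f \<oplus>\<^bsub>Hom C X Z\<^esub> g \<cdot>\<^bsub>C\<^esub> f'"
    and Cmp_smult_left: "\<lbrakk>X \<in> Ob C; Y \<in> Ob C; Z \<in> Ob C; c \<in> carrier K;
          f \<in> Mor C X Y; g \<in> Mor C Y Z\<rbrakk>
          \<Longrightarrow> (c \<odot>\<^bsub>Hom C Y Z\<^esub> g) \<cdot>\<^bsub>C\<^esub> f = c \<odot>\<^bsub>Hom C X Z\<^esub> (g \<cdot>\<^bsub>C\<^esub> f)"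
    and Cmp_smult_right: "\<lbrakk>X \<in> Ob C; Y \<in> Ob C; Z \<in> Ob C; c \<in> carrier K;
          f \<in> Mor C X Y; g \<in> Mor C Y Z\<rbrakk>
          \<Longrightarrow> g \<cdot>\<^bsub>C\<^esub> (c \<odot>\<^bsub>Hom C X Y\<^esub> f) = c \<odot>\<^bsub>Hom C X Z\<^esub> (g \<cdot>\<^bsub>C\<^esub> f)"

definition iso_arrow :: "('o, 'm, 'k, 'z) lin_cat_scheme \<Rightarrow> 'o \<Rightarrow> 'o \<Rightarrow> 'm \<Rightarrow> bool" where
  "iso_arrow C X Y f \<longleftrightarrow> f \<in> Mor C X Y \<and>
     (\<exists>g \<in> Mor C Y X. g \<cdot>\<^bsub>C\<^esub> f = Idt C X \<and> f \<cdot>\<^bsub>C\<^esub> g = Idt C Y)"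

definition isomorphic :: "('o, 'm, 'k, 'z) lin_cat_scheme \<Rightarrow> 'o \<Rightarrow> 'o \<Rightarrow> bool" where
  "isomorphic C X Y \<longleftrightarrow> (\<exists>f. iso_arrow C X Y f)"

definition retract_of :: "('o, 'm, 'k, 'z) lin_cat_scheme \<Rightarrow> 'o \<Rightarrow> 'o \<Rightarrow> bool" where
  "retract_of C X Y \<longleftrightarrow> (\<exists>i \<in> Mor C X Y. \<exists>r \<in> Mor C Y X. r \<cdot>\<^bsub>C\<^esub> i = Idt C X)"

definition zero_object :: "('o, 'm, 'k, 'z) lin_cat_scheme \<Rightarrow> 'o \<Rightarrow> bool" where
  "zero_object C Z \<longleftrightarrow> Z \<in> Ob C \<and>
     (\<forall>X \<in> Ob C. (\<exists>!f. f \<in> Mor C X Z) \<and> (\<exists>!f. f \<in> Mor C Z X))"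

definition biproduct ::
  "('o, 'm, 'k, 'z) lin_cat_scheme \<Rightarrow> 'o \<Rightarrow> 'o \<Rightarrow> 'o \<Rightarrow> 'm \<Rightarrow> 'm \<Rightarrow> 'm \<Rightarrow> 'm \<Rightarrow> bool" where
  "biproduct C X Y S i j p q \<longleftrightarrow> S \<in> Ob C \<and>
     i \<in> Mor C X S \<and> j \<in> Mor C Y S \<and> p \<in> Mor C S X \<and> q \<in> Mor C S Y \<and>
     p \<cdot>\<^bsub>C\<^esub> i = Idt C X \<and> q \<cdot>\<^bsub>C\<^esub> j = Idt C Y \<and>
     p \<cdot>\<^bsub>C\<^esub> j = \<zero>\<^bsub>Hom C Y X\<^esub> \<and> q \<cdot>\<^bsub>C\<^esub> i = \<zero>\<^bsub>Hom C X Y\<^esub> \<and>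
     i \<cdot>\<^bsub>C\<^esub> p \<oplus>\<^bsub>Hom C S S\<^esub> j \<cdot>\<^bsub>C\<^esub> q = Idt C S"

definition is_kernel :: "('o, 'm, 'k, 'z) lin_cat_scheme \<Rightarrow> 'o \<Rightarrow> 'o \<Rightarrow> 'm \<Rightarrow> 'o \<Rightarrow> 'm \<Rightarrow> bool" where
  "is_kernel C X Y f Z i \<longleftrightarrow> Z \<in> Ob C \<and> i \<in> Mor C Z X \<and> f \<cdot>\<^bsub>C\<^esub> i = \<zero>\<^bsub>Hom C Z Y\<^esub> \<and>
     (\<forall>T \<in> Ob C. \<forall>t \<in> Mor C T X. f \<cdot>\<^bsub>C\<^esub> t = \<zero>\<^bsub>Hom C T Y\<^esub> \<longrightarrow>
        (\<exists>!u. u \<in> Mor C T Z \<and> i \<cdot>\<^bsub>C\<^esub> u = t))"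

definition is_cokernel :: "('o, 'm, 'k, 'z) lin_cat_scheme \<Rightarrow> 'o \<Rightarrow> 'o \<Rightarrow> 'm \<Rightarrow> 'o \<Rightarrow> 'm \<Rightarrow> bool" where
  "is_cokernel C X Y f Q p \<longleftrightarrow> Q \<in> Ob C \<and> p \<in> Mor C Y Q \<and> p \<cdot>\<^bsub>C\<^esub> f = \<zero>\<^bsub>Hom C X Q\<^esub> \<and>
     (\<forall>T \<in> Ob C. \<forall>t \<in> Mor C Y T. t \<cdot>\<^bsub>C\<^esub> f = \<zero>\<^bsub>Hom C X T\<^esub> \<longrightarrow>
        (\<exists>!u. u \<in> Mor C Q T \<and> u \<cdot>\<^bsub>C\<^esub> p = t))"

definition full_subcategory :: "('o, 'm, 'k, 'z) lin_cat_scheme \<Rightarrow> 'o set \<Rightarrow> ('o, 'm, 'k) lin_cat" where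
  "full_subcategory C S = \<lparr>Ob = S, Hom = Hom C, Idt = Idt C, Cmp = Cmp C\<rparr>"

record ('o, 'm, 'o2, 'm2) lin_functor =
  fob :: "'o \<Rightarrow> 'o2"
  fmor :: "'m \<Rightarrow> 'm2"

definition linear_functor ::
  "('k, 'r) ring_scheme \<Rightarrow> ('o, 'm, 'k, 'y) lin_cat_scheme \<Rightarrow> ('o2, 'm2, 'k, 'z) lin_cat_scheme \<Rightarrow>
   ('o, 'm, 'o2, 'm2) lin_functor \<Rightarrow> bool" where
  "linear_functor K C D F \<longleftrightarrow>
     (\<forall>X \<in> Ob C. fob F X \<in> Ob D \<and> fmor F (Idt C X) = Idt D (fob F X)) \<and>
     (\<forall>X \<in> Ob C. \<forall>Y \<in> Ob C. \<forall>f \<in> Mor C X Y. fmor F f \<in> Mor D (fob F X) (fob F Y)) \<and>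
     (\<forall>X \<in> Ob C. \<forall>Y \<in> Ob C. \<forall>Z \<in> Ob C. \<forall>f \<in> Mor C X Y. \<forall>g \<in> Mor C Y Z.
        fmor F (g \<cdot>\<^bsub>C\<^esub> f) = fmor F g \<cdot>\<^bsub>D\<^esub> fmor F f) \<and>
     (\<forall>X \<in> Ob C. \<forall>Y \<in> Ob C. \<forall>f \<in> Mor C X Y. \<forall>g \<in> Mor C X Y.
        fmor F (f \<oplus>\<^bsub>Hom C X Y\<^esub> g) = fmor F f \<oplus>\<^bsub>Hom D (fob F X) (fob F Y)\<^esub> fmor F g) \<and>
     (\<forall>X \<in> Ob C. \<forall>Y \<in> Ob C. \<forall>c \<in> carrier K. \<forall>f \<in> Mor C X Y.
        fmor F (c \<odot>\<^bsub>Hom C X Y\<^esub> f) = c \<odot>\<^bsub>Hom D (fob F X) (fob F Y)\<^esub> fmor F f)"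

definition inclusion_functor :: "('o, 'm, 'o, 'm) lin_functor" where
  "inclusion_functor = \<lparr>fob = (\<lambda>X. X), fmor = (\<lambda>f. f)\<rparr>"

definition functor_comp ::
  "('o2, 'm2, 'o3, 'm3) lin_functor \<Rightarrow> ('o, 'm, 'o2, 'm2) lin_functor \<Rightarrow> ('o, 'm, 'o3, 'm3) lin_functor"
  where "functor_comp G F = \<lparr>fob = fob G \<circ> fob F, fmor = fmor G \<circ> fmor F\<rparr>"

definition natural_iso ::
  "('o, 'm, 'k, 'y) lin_cat_scheme \<Rightarrow> ('o2, 'm2, 'k, 'z) lin_cat_scheme \<Rightarrow>
   ('o, 'm, 'o2, 'm2) lin_functor \<Rightarrow> ('o, 'm, 'o2, 'm2) lin_functor \<Rightarrow> ('o \<Rightarrow> 'm2) \<Rightarrow> bool" where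
  "natural_iso C D F G \<tau> \<longleftrightarrow>
     (\<forall>X \<in> Ob C. iso_arrow D (fob F X) (fob G X) (\<tau> X)) \<and>
     (\<forall>X \<in> Ob C. \<forall>Y \<in> Ob C. \<forall>f \<in> Mor C X Y. \<tau> Y \<cdot>\<^bsub>D\<^esub> fmor F f = fmor G f \<cdot>\<^bsub>D\<^esub> \<tau> X)"

definition naturally_isomorphic ::
  "('o, 'm, 'k, 'y) lin_cat_scheme \<Rightarrow> ('o2, 'm2, 'k, 'z) lin_cat_scheme \<Rightarrow>
   ('o, 'm, 'o2, 'm2) lin_functor \<Rightarrow> ('o, 'm, 'o2, 'm2) lin_functor \<Rightarrow> bool" where
  "naturally_isomorphic C D F G \<longleftrightarrow> (\<exists>\<tau>. natural_iso C D F G \<tau>)"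

definition equivalence_functor ::
  "('k, 'r) ring_scheme \<Rightarrow> ('o, 'm, 'k, 'y) lin_cat_scheme \<Rightarrow> ('o2, 'm2, 'k, 'z) lin_cat_scheme \<Rightarrow>
   ('o, 'm, 'o2, 'm2) lin_functor \<Rightarrow> bool" where
  "equivalence_functor K C D F \<longleftrightarrow> linear_functor K C D F \<and>
     (\<exists>F'. linear_functor K D C F' \<and>
        naturally_isomorphic C C (functor_comp F' F) inclusion_functor \<and>
        naturally_isomorphic D D (functor_comp F F') inclusion_functor)"


section \<open>Hom-finiteness and Serre functors\<close>

definition linear_map ::
  "('k, 'r) ring_scheme \<Rightarrow> ('k, 'a, 'y) module_scheme \<Rightarrow> ('k, 'b, 'z) module_scheme \<Rightarrow> ('a \<Rightarrow> 'b) set" where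
  "linear_map K M N = {\<phi> \<in> carrier M \<rightarrow> carrier N.
     (\<forall>x \<in> carrier M. \<forall>y \<in> carrier M. \<phi> (x \<oplus>\<^bsub>M\<^esub> y) = \<phi> x \<oplus>\<^bsub>N\<^esub> \<phi> y) \<and>
     (\<forall>c \<in> carrier K. \<forall>x \<in> carrier M. \<phi> (c \<odot>\<^bsub>M\<^esub> x) = c \<odot>\<^bsub>N\<^esub> \<phi> x)}"

definition finite_dimensional :: "('k, 'r) ring_scheme \<Rightarrow> ('k, 'a, 'z) module_scheme \<Rightarrow> bool" where
  "finite_dimensional K M \<longleftrightarrow> (\<exists>B. finite B \<and> B \<subseteq> carrier M \<and>
     (\<forall>x \<in> carrier M. \<exists>c \<in> B \<rightarrow> carrier K. x = (\<Oplus>\<^bsub>M\<^esub>b \<in> B. c b \<odot>\<^bsub>M\<^esub> b)))"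

definition hom_finite :: "('k, 'r) ring_scheme \<Rightarrow> ('o, 'm, 'k, 'z) lin_cat_scheme \<Rightarrow> bool" where
  "hom_finite K C \<longleftrightarrow> (\<forall>X \<in> Ob C. \<forall>Y \<in> Ob C. finite_dimensional K (Hom C X Y))"

definition ground_module :: "('k, 'r) ring_scheme \<Rightarrow> ('k, 'k) module" where
  "ground_module K = \<lparr>carrier = carrier K, mult = mult K, one = one K, zero = zero K, add = add K,
     smult = mult K\<rparr>"

text \<open>Functionals are kept extensional, so that equality in the dual is equality on the carrier.\<close>

definition dual :: "('k, 'r) ring_scheme \<Rightarrow> ('k, 'a, 'z) module_scheme \<Rightarrow> ('k, 'a \<Rightarrow> 'k) module" where
  "dual K M = \<lparr>carrier = linear_map K M (ground_module K) \<inter> extensional (carrier M),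
     mult = undefined, one = undefined,
     zero = (\<lambda>x \<in> carrier M. \<zero>\<^bsub>K\<^esub>),
     add = (\<lambda>\<phi> \<psi>. \<lambda>x \<in> carrier M. \<phi> x \<oplus>\<^bsub>K\<^esub> \<psi> x),
     smult = (\<lambda>c \<phi>. \<lambda>x \<in> carrier M. c \<otimes>\<^bsub>K\<^esub> \<phi> x)\<rparr>"

text \<open>
  Naturality of \<open>\<eta> A B : Hom(A, B) \<rightarrow> Hom(B, S A)\<^sup>*\<close> in both variables at once:
  \<open>Hom(A, B)\<close> is precomposed with \<open>u : A' \<rightarrow> A\<close> and postcomposed with \<open>v : B \<rightarrow> B'\<close>.
\<close>

definition serre_functor ::
  "('k, 'r) ring_scheme \<Rightarrow> ('o, 'm, 'k, 'z) lin_cat_scheme \<Rightarrow> ('o, 'm, 'o, 'm) lin_functor \<Rightarrow> bool" where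
  "serre_functor K C S \<longleftrightarrow> equivalence_functor K C C S \<and>
     (\<exists>\<eta>. (\<forall>A \<in> Ob C. \<forall>B \<in> Ob C.
             \<eta> A B \<in> linear_map K (Hom C A B) (dual K (Hom C B (fob S A))) \<and>
             bij_betw (\<eta> A B) (Mor C A B) (carrier (dual K (Hom C B (fob S A))))) \<and>
          (\<forall>A \<in> Ob C. \<forall>A' \<in> Ob C. \<forall>B \<in> Ob C. \<forall>B' \<in> Ob C.
             \<forall>u \<in> Mor C A' A. \<forall>v \<in> Mor C B B'. \<forall>f \<in> Mor C A B. \<forall>g \<in> Mor C B' (fob S A').
               \<eta> A' B' (v \<cdot>\<^bsub>C\<^esub> f \<cdot>\<^bsub>C\<^esub> u) g = \<eta> A B f (fmor S u \<cdot>\<^bsub>C\<^esub> g \<cdot>\<^bsub>C\<^esub> v)))"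


section \<open>Triangulated categories\<close>

text \<open>\<open>tri C X Y Z f g h\<close> says that \<open>X \<rightarrow> Y \<rightarrow> Z \<rightarrow> X[1]\<close> with maps \<open>f\<close>, \<open>g\<close>, \<open>h\<close> is distinguished.\<close>

record ('o, 'm, 'k) tri_cat = "('o, 'm, 'k) lin_cat" +
  shift :: "('o, 'm, 'o, 'm) lin_functor"
  tri :: "'o \<Rightarrow> 'o \<Rightarrow> 'o \<Rightarrow> 'm \<Rightarrow> 'm \<Rightarrow> 'm \<Rightarrow> bool"

definition candidate_triangle ::
  "('o, 'm, 'k, 'z) lin_cat_scheme \<Rightarrow> ('o, 'm, 'o, 'm) lin_functor \<Rightarrow>
   'o \<Rightarrow> 'o \<Rightarrow> 'o \<Rightarrow> 'm \<Rightarrow> 'm \<Rightarrow> 'm \<Rightarrow> bool" where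
  "candidate_triangle C T X Y Z f g h \<longleftrightarrow> X \<in> Ob C \<and> Y \<in> Ob C \<and> Z \<in> Ob C \<and>
     f \<in> Mor C X Y \<and> g \<in> Mor C Y Z \<and> h \<in> Mor C Z (fob T X)"

definition triangle_iso ::
  "('o, 'm, 'k, 'z) lin_cat_scheme \<Rightarrow> ('o, 'm, 'o, 'm) lin_functor \<Rightarrow>
   'o \<Rightarrow> 'o \<Rightarrow> 'o \<Rightarrow> 'm \<Rightarrow> 'm \<Rightarrow> 'm \<Rightarrow> 'o \<Rightarrow> 'o \<Rightarrow> 'o \<Rightarrow> 'm \<Rightarrow> 'm \<Rightarrow> 'm \<Rightarrow> bool" where
  "triangle_iso C T X Y Z f g h X' Y' Z' f' g' h' \<longleftrightarrow>
     (\<exists>a b c. iso_arrow C X X' a \<and> iso_arrow C Y Y' b \<and> iso_arrow C Z Z' c \<and>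
        b \<cdot>\<^bsub>C\<^esub> f = f' \<cdot>\<^bsub>C\<^esub> a \<and> c \<cdot>\<^bsub>C\<^esub> g = g' \<cdot>\<^bsub>C\<^esub> b \<and> fmor T a \<cdot>\<^bsub>C\<^esub> h = h' \<cdot>\<^bsub>C\<^esub> c)"

locale triangulated_category = linear_category K C
  for K :: "('k, 'r) ring_scheme" (structure) and C :: "('o, 'm, 'k, 'z) tri_cat_scheme" +
  assumes zero_object_exists: "\<exists>Z. zero_object C Z"
    and biproduct_exists: "\<lbrakk>X \<in> Ob C; Y \<in> Ob C\<rbrakk> \<Longrightarrow> \<exists>S i j p q. biproduct C X Y S i j p q"
    and shift_equivalence: "equivalence_functor K C C (shift C)"
    and tri_candidate: "tri C X Y Z f g h \<Longrightarrow> candidate_triangle C (shift C) X Y Z f g h"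
    and tri_replete: "\<lbrakk>tri C X Y Z f g h; candidate_triangle C (shift C) X' Y' Z' f' g' h';
          triangle_iso C (shift C) X Y Z f g h X' Y' Z' f' g' h'\<rbrakk>
          \<Longrightarrow> tri C X' Y' Z' f' g' h'"
    and TR1_identity: "\<lbrakk>X \<in> Ob C; zero_object C Z\<rbrakk>
          \<Longrightarrow> tri C X X Z (Idt C X) \<zero>\<^bsub>Hom C X Z\<^esub> \<zero>\<^bsub>Hom C Z (fob (shift C) X)\<^esub>"
    and TR1_completion: "\<lbrakk>X \<in> Ob C; Y \<in> Ob C; f \<in> Mor C X Y\<rbrakk> \<Longrightarrow> \<exists>Z g h. tri C X Y Z f g h"
    and TR2: "candidate_triangle C (shift C) X Y Z f g h \<Longrightarrow>
          tri C X Y Z f g h \<longleftrightarrow>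
          tri C Y Z (fob (shift C) X) g h
            (\<ominus>\<^bsub>Hom C (fob (shift C) X) (fob (shift C) Y)\<^esub> fmor (shift C) f)"
    and TR3: "\<lbrakk>tri C X Y Z f g h; tri C X' Y' Z' f' g' h';
          a \<in> Mor C X X'; b \<in> Mor C Y Y'; b \<cdot>\<^bsub>C\<^esub> f = f' \<cdot>\<^bsub>C\<^esub> a\<rbrakk>
          \<Longrightarrow> \<exists>c \<in> Mor C Z Z'. c \<cdot>\<^bsub>C\<^esub> g = g' \<cdot>\<^bsub>C\<^esub> b \<and> fmor (shift C) a \<cdot>\<^bsub>C\<^esub> h = h' \<cdot>\<^bsub>C\<^esub> c"
    and TR4: "\<lbrakk>tri C X Y A f i p; tri C Y Z B g j q; tri C X Z E (g \<cdot>\<^bsub>C\<^esub> f) k r\<rbrakk>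
          \<Longrightarrow> \<exists>u v. tri C A E B u v (fmor (shift C) i \<cdot>\<^bsub>C\<^esub> q) \<and>
                u \<cdot>\<^bsub>C\<^esub> i = k \<cdot>\<^bsub>C\<^esub> g \<and> r \<cdot>\<^bsub>C\<^esub> u = p \<and>
                v \<cdot>\<^bsub>C\<^esub> k = j \<and> q \<cdot>\<^bsub>C\<^esub> v = fmor (shift C) f \<cdot>\<^bsub>C\<^esub> r"

definition triangle_functor ::
  "('k, 'r) ring_scheme \<Rightarrow> ('o, 'm, 'k, 'y) tri_cat_scheme \<Rightarrow> ('o2, 'm2, 'k, 'z) tri_cat_scheme \<Rightarrow>
   ('o, 'm, 'o2, 'm2) lin_functor \<Rightarrow> bool" where
  "triangle_functor K C D F \<longleftrightarrow> linear_functor K C D F \<and>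
     (\<exists>\<xi>. natural_iso C D (functor_comp F (shift C)) (functor_comp (shift D) F) \<xi> \<and>
        (\<forall>X Y Z f g h. tri C X Y Z f g h \<longrightarrow>
           tri D (fob F X) (fob F Y) (fob F Z) (fmor F f) (fmor F g) (\<xi> X \<cdot>\<^bsub>D\<^esub> fmor F h)))"

definition triangle_equivalence ::
  "('k, 'r) ring_scheme \<Rightarrow> ('o, 'm, 'k, 'y) tri_cat_scheme \<Rightarrow> ('o2, 'm2, 'k, 'z) tri_cat_scheme \<Rightarrow>
   ('o, 'm, 'o2, 'm2) lin_functor \<Rightarrow> bool" where
  "triangle_equivalence K C D F \<longleftrightarrow> triangle_functor K C D F \<and> equivalence_functor K C D F"


section \<open>t-structures\<close>

text \<open>
  The shift is only an autoequivalence, so \<open>U[n]\<close> is taken closed under isomorphism; for negative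
  \<open>n\<close> it consists of the objects whose \<open>-n\<close>-fold suspension is isomorphic to an object of \<open>U\<close>.
\<close>

definition shifted :: "('o, 'm, 'k, 'z) tri_cat_scheme \<Rightarrow> int \<Rightarrow> 'o set \<Rightarrow> 'o set" where
  "shifted C n U = {X \<in> Ob C. \<exists>A \<in> U.
     if n \<ge> 0 then isomorphic C X ((fob (shift C) ^^ nat n) A)
     else isomorphic C ((fob (shift C) ^^ nat (- n)) X) A}"

definition closed_subcategory :: "('o, 'm, 'k, 'z) lin_cat_scheme \<Rightarrow> 'o set \<Rightarrow> bool" where
  "closed_subcategory C U \<longleftrightarrow> U \<subseteq> Ob C \<and>
     (\<forall>X \<in> U. \<forall>Y \<in> Ob C. isomorphic C X Y \<longrightarrow> Y \<in> U) \<and>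
     (\<forall>Z. zero_object C Z \<longrightarrow> Z \<in> U) \<and>
     (\<forall>X \<in> U. \<forall>Y \<in> U. \<forall>S i j p q. biproduct C X Y S i j p q \<longrightarrow> S \<in> U) \<and>
     (\<forall>Y \<in> U. \<forall>X \<in> Ob C. retract_of C X Y \<longrightarrow> X \<in> U)"

definition t_structure :: "('o, 'm, 'k, 'z) tri_cat_scheme \<Rightarrow> 'o set \<Rightarrow> 'o set \<Rightarrow> bool" where
  "t_structure C U V \<longleftrightarrow> closed_subcategory C U \<and> closed_subcategory C V \<and>
     shifted C 1 U \<subseteq> U \<and> V \<subseteq> shifted C 1 V \<and>
     (\<forall>X \<in> shifted C 1 U. \<forall>Y \<in> V. Mor C X Y = {\<zero>\<^bsub>Hom C X Y\<^esub>}) \<and>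
     (\<forall>X \<in> Ob C. \<exists>A \<in> U. \<exists>B \<in> shifted C (-1) V. \<exists>f g h. tri C A X B f g h)"

definition heart :: "('o, 'm, 'k, 'z) tri_cat_scheme \<Rightarrow> 'o set \<Rightarrow> 'o set \<Rightarrow> ('o, 'm, 'k) lin_cat" where
  "heart C U V = full_subcategory C (U \<inter> V)"

definition bounded_t_structure :: "('o, 'm, 'k, 'z) tri_cat_scheme \<Rightarrow> 'o set \<Rightarrow> 'o set \<Rightarrow> bool" where
  "bounded_t_structure C U V \<longleftrightarrow> t_structure C U V \<and>
     (\<Union>n. shifted C n U) = Ob C \<and> (\<Union>n. shifted C n V) = Ob C"


section \<open>Quotients and localizations of linear categories\<close>

text \<open>\<open>R\<close> is meant to be a congruence, relating only parallel arrows.\<close>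

definition quotient_category ::
  "('o, 'm, 'k, 'z) lin_cat_scheme \<Rightarrow> 'm rel \<Rightarrow> ('o, 'm set, 'k) lin_cat" where
  "quotient_category C R = \<lparr>Ob = Ob C,
     Hom = (\<lambda>X Y. \<lparr>carrier = Mor C X Y // R, mult = undefined, one = undefined,
       zero = R `` {\<zero>\<^bsub>Hom C X Y\<^esub>},
       add = (\<lambda>F G. \<Union>f \<in> F. \<Union>g \<in> G. R `` {f \<oplus>\<^bsub>Hom C X Y\<^esub> g}),
       smult = (\<lambda>c F. \<Union>f \<in> F. R `` {c \<odot>\<^bsub>Hom C X Y\<^esub> f})\<rparr>),
     Idt = (\<lambda>X. R `` {Idt C X}),
     Cmp = (\<lambda>G F. \<Union>g \<in> G. \<Union>f \<in> F. R `` {g \<cdot>\<^bsub>C\<^esub> f})\<rparr>"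

text \<open>
  Localization at a class \<open>W\<close> of arrows admitting a calculus of fractions. A roof \<open>(A, s, f)\<close> from
  \<open>X\<close> to \<open>Y\<close> stands for \<open>f s\<^sup>-\<^sup>1\<close>, where \<open>s : A \<rightarrow> X\<close> lies in \<open>W\<close> and \<open>f : A \<rightarrow> Y\<close>. Operations on
  classes are unions over all choices of representatives (for sums: with a common denominator) and,
  for composites, of Ore squares; all choices give the same class.
\<close>

definition roofs :: "('o, 'm, 'k, 'z) lin_cat_scheme \<Rightarrow> 'm set \<Rightarrow> 'o \<Rightarrow> 'o \<Rightarrow> ('o \<times> 'm \<times> 'm) set" where
  "roofs C W X Y = {(A, s, f). A \<in> Ob C \<and> s \<in> Mor C A X \<inter> W \<and> f \<in> Mor C A Y}"

definition roof_rel :: "('o, 'm, 'k, 'z) lin_cat_scheme \<Rightarrow> 'm set \<Rightarrow> ('o \<times> 'm \<times> 'm) rel" where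
  "roof_rel C W = {((A, s, f), (B, t, g)) | A s f B t g.
     \<exists>X \<in> Ob C. \<exists>Y \<in> Ob C. (A, s, f) \<in> roofs C W X Y \<and> (B, t, g) \<in> roofs C W X Y \<and>
       (\<exists>E \<in> Ob C. \<exists>u \<in> Mor C E A. \<exists>v \<in> Mor C E B.
          s \<cdot>\<^bsub>C\<^esub> u = t \<cdot>\<^bsub>C\<^esub> v \<and> s \<cdot>\<^bsub>C\<^esub> u \<in> W \<and> f \<cdot>\<^bsub>C\<^esub> u = g \<cdot>\<^bsub>C\<^esub> v)}"

definition localization ::
  "('o, 'm, 'k, 'z) lin_cat_scheme \<Rightarrow> 'm set \<Rightarrow> ('o, ('o \<times> 'm \<times> 'm) set, 'k) lin_cat" where
  "localization C W = \<lparr>Ob = Ob C,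
     Hom = (\<lambda>X Y. \<lparr>carrier = roofs C W X Y // roof_rel C W, mult = undefined, one = undefined,
       zero = roof_rel C W `` {(X, Idt C X, \<zero>\<^bsub>Hom C X Y\<^esub>)},
       add = (\<lambda>F G. \<Union>{roof_rel C W `` {(A, s, f \<oplus>\<^bsub>Hom C A Y\<^esub> g)} | A s f g.
         (A, s, f) \<in> F \<and> (A, s, g) \<in> G}),
       smult = (\<lambda>c F. \<Union>{roof_rel C W `` {(A, s, c \<odot>\<^bsub>Hom C A Y\<^esub> f)} | A s f. (A, s, f) \<in> F})\<rparr>),
     Idt = (\<lambda>X. roof_rel C W `` {(X, Idt C X, Idt C X)}),
     Cmp = (\<lambda>G F. \<Union>{roof_rel C W `` {(E, s \<cdot>\<^bsub>C\<^esub> u, g \<cdot>\<^bsub>C\<^esub> v)} | A s f B t g E u v.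
       (A, s, f) \<in> F \<and> (B, t, g) \<in> G \<and> E \<in> Ob C \<and> u \<in> Mor C E A \<inter> W \<and> v \<in> Mor C E B \<and>
       f \<cdot>\<^bsub>C\<^esub> u = t \<cdot>\<^bsub>C\<^esub> v})\<rparr>"

definition localize_arrow ::
  "('o, 'm, 'k, 'z) lin_cat_scheme \<Rightarrow> 'm set \<Rightarrow> 'o \<Rightarrow> 'm \<Rightarrow> ('o \<times> 'm \<times> 'm) set" where
  "localize_arrow C W X f = roof_rel C W `` {(X, Idt C X, f)}"


section \<open>The bounded derived category\<close>

text \<open>Complexes are cohomological: \<open>cdiff X n : cob X n \<rightarrow> cob X (n + 1)\<close>.\<close>

record ('o, 'm) cochain =
  cob :: "int \<Rightarrow> 'o"
  cdiff :: "int \<Rightarrow> 'm"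

definition bounded_complex :: "('o, 'm, 'k, 'z) lin_cat_scheme \<Rightarrow> ('o, 'm) cochain \<Rightarrow> bool" where
  "bounded_complex A X \<longleftrightarrow>
     (\<forall>n. cob X n \<in> Ob A \<and> cdiff X n \<in> Mor A (cob X n) (cob X (n + 1)) \<and>
        cdiff X (n + 1) \<cdot>\<^bsub>A\<^esub> cdiff X n = \<zero>\<^bsub>Hom A (cob X n) (cob X (n + 2))\<^esub>) \<and>
     finite {n. \<not> zero_object A (cob X n)}"

definition chain_map ::
  "('o, 'm, 'k, 'z) lin_cat_scheme \<Rightarrow> ('o, 'm) cochain \<Rightarrow> ('o, 'm) cochain \<Rightarrow> (int \<Rightarrow> 'm) \<Rightarrow> bool" where
  "chain_map A X Y f \<longleftrightarrow> (\<forall>n. f n \<in> Mor A (cob X n) (cob Y n) \<and>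
     cdiff Y n \<cdot>\<^bsub>A\<^esub> f n = f (n + 1) \<cdot>\<^bsub>A\<^esub> cdiff X n)"

type_synonym ('o, 'm) ch_arrow = "('o, 'm) cochain \<times> ('o, 'm) cochain \<times> (int \<Rightarrow> 'm)"

definition Chb :: "('o, 'm, 'k, 'z) lin_cat_scheme \<Rightarrow> (('o, 'm) cochain, ('o, 'm) ch_arrow, 'k) lin_cat" where
  "Chb A = \<lparr>Ob = {X. bounded_complex A X},
     Hom = (\<lambda>X Y. \<lparr>carrier = {(X, Y, f) | f. chain_map A X Y f}, mult = undefined, one = undefined,
       zero = (X, Y, \<lambda>n. \<zero>\<^bsub>Hom A (cob X n) (cob Y n)\<^esub>),
       add = (\<lambda>(_, _, f) (_, _, g). (X, Y, \<lambda>n. f n \<oplus>\<^bsub>Hom A (cob X n) (cob Y n)\<^esub> g n)),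
       smult = (\<lambda>c (_, _, f). (X, Y, \<lambda>n. c \<odot>\<^bsub>Hom A (cob X n) (cob Y n)\<^esub> f n))\<rparr>),
     Idt = (\<lambda>X. (X, X, \<lambda>n. Idt A (cob X n))),
     Cmp = (\<lambda>(_, Z, g) (X, _, f). (X, Z, \<lambda>n. g n \<cdot>\<^bsub>A\<^esub> f n))\<rparr>"

definition homotopy :: "('o, 'm, 'k, 'z) lin_cat_scheme \<Rightarrow> ('o, 'm) ch_arrow rel" where
  "homotopy A = {((X, Y, f), (X, Y, g)) | X Y f g.
     bounded_complex A X \<and> bounded_complex A Y \<and> chain_map A X Y f \<and> chain_map A X Y g \<and>
     (\<exists>s. \<forall>n. s n \<in> Mor A (cob X n) (cob Y (n - 1)) \<and>
        f n = g n \<oplus>\<^bsub>Hom A (cob X n) (cob Y n)\<^esub>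
          (cdiff Y (n - 1) \<cdot>\<^bsub>A\<^esub> s n \<oplus>\<^bsub>Hom A (cob X n) (cob Y n)\<^esub> s (n + 1) \<cdot>\<^bsub>A\<^esub> cdiff X n))}"

definition Kb :: "('o, 'm, 'k, 'z) lin_cat_scheme \<Rightarrow> (('o, 'm) cochain, ('o, 'm) ch_arrow set, 'k) lin_cat" where
  "Kb A = quotient_category (Chb A) (homotopy A)"

definition is_cohomology ::
  "('o, 'm, 'k, 'z) lin_cat_scheme \<Rightarrow> ('o, 'm) cochain \<Rightarrow> int \<Rightarrow> 'o \<Rightarrow> 'm \<Rightarrow> 'o \<Rightarrow> 'm \<Rightarrow> bool" where
  "is_cohomology A X n Z i H p \<longleftrightarrow> is_kernel A (cob X n) (cob X (n + 1)) (cdiff X n) Z i \<and>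
     (\<exists>c \<in> Mor A (cob X (n - 1)) Z. i \<cdot>\<^bsub>A\<^esub> c = cdiff X (n - 1) \<and>
        is_cokernel A (cob X (n - 1)) Z c H p)"

text \<open>
  \<open>z\<close> is the map induced on cocycles and \<open>h\<close> the map induced on cohomology; all data are determined
  up to isomorphism, and they exist when \<open>A\<close> is abelian.
\<close>

definition quasi_iso ::
  "('o, 'm, 'k, 'z) lin_cat_scheme \<Rightarrow> ('o, 'm) cochain \<Rightarrow> ('o, 'm) cochain \<Rightarrow> (int \<Rightarrow> 'm) \<Rightarrow> bool" where
  "quasi_iso A X Y f \<longleftrightarrow> chain_map A X Y f \<and>
     (\<forall>n. \<exists>Z i H p Z' i' H' p' z h.
        is_cohomology A X n Z i H p \<and> is_cohomology A Y n Z' i' H' p' \<and>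
        z \<in> Mor A Z Z' \<and> i' \<cdot>\<^bsub>A\<^esub> z = f n \<cdot>\<^bsub>A\<^esub> i \<and>
        iso_arrow A H H' h \<and> h \<cdot>\<^bsub>A\<^esub> p = p' \<cdot>\<^bsub>A\<^esub> z)"

definition Kb_quasi_isos :: "('o, 'm, 'k, 'z) lin_cat_scheme \<Rightarrow> ('o, 'm) ch_arrow set set" where
  "Kb_quasi_isos A = {homotopy A `` {(X, Y, f)} | X Y f.
     bounded_complex A X \<and> bounded_complex A Y \<and> quasi_iso A X Y f}"

type_synonym ('o, 'm) db_arrow =
  "(('o, 'm) cochain \<times> ('o, 'm) ch_arrow set \<times> ('o, 'm) ch_arrow set) set"

definition Db_lin :: "('o, 'm, 'k, 'z) lin_cat_scheme \<Rightarrow> (('o, 'm) cochain, ('o, 'm) db_arrow, 'k) lin_cat" where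
  "Db_lin A = localization (Kb A) (Kb_quasi_isos A)"

definition Db_arrow ::
  "('o, 'm, 'k, 'z) lin_cat_scheme \<Rightarrow> ('o, 'm) cochain \<Rightarrow> ('o, 'm) cochain \<Rightarrow> (int \<Rightarrow> 'm) \<Rightarrow> ('o, 'm) db_arrow" where
  "Db_arrow A X Y f = localize_arrow (Kb A) (Kb_quasi_isos A) X (homotopy A `` {(X, Y, f)})"

definition shift_complex :: "('o, 'm, 'k, 'z) lin_cat_scheme \<Rightarrow> ('o, 'm) cochain \<Rightarrow> ('o, 'm) cochain" where
  "shift_complex A X = \<lparr>cob = (\<lambda>n. cob X (n + 1)),
     cdiff = (\<lambda>n. \<ominus>\<^bsub>Hom A (cob X (n + 1)) (cob X (n + 2))\<^esub> cdiff X (n + 1))\<rparr>"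

definition shift_Kb_arrow ::
  "('o, 'm, 'k, 'z) lin_cat_scheme \<Rightarrow> ('o, 'm) ch_arrow set \<Rightarrow> ('o, 'm) ch_arrow set" where
  "shift_Kb_arrow A F = \<Union>{homotopy A `` {(shift_complex A X, shift_complex A Y, \<lambda>n. f (n + 1))} |
     X Y f. (X, Y, f) \<in> F}"

definition Db_shift ::
  "('o, 'm, 'k, 'z) lin_cat_scheme \<Rightarrow>
   (('o, 'm) cochain, ('o, 'm) db_arrow, ('o, 'm) cochain, ('o, 'm) db_arrow) lin_functor" where
  "Db_shift A = \<lparr>fob = shift_complex A,
     fmor = (\<lambda>F. \<Union>{roof_rel (Kb A) (Kb_quasi_isos A) ``
       {(shift_complex A B, shift_Kb_arrow A s, shift_Kb_arrow A f)} | B s f. (B, s, f) \<in> F})\<rparr>"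

text \<open>
  \<open>M\<close> is a cone of \<open>f : X \<rightarrow> Y\<close>, that is \<open>M\<^sup>n = X\<^sup>n\<^sup>+\<^sup>1 \<oplus> Y\<^sup>n\<close> with differential
  \<open>(x, y) \<mapsto> (- d x, f x + d y)\<close>; \<open>j : Y \<rightarrow> M\<close> and \<open>p : M \<rightarrow> X[1]\<close> are the canonical maps.
\<close>

definition mapping_cone ::
  "('o, 'm, 'k, 'z) lin_cat_scheme \<Rightarrow> ('o, 'm) cochain \<Rightarrow> ('o, 'm) cochain \<Rightarrow> (int \<Rightarrow> 'm) \<Rightarrow>
   ('o, 'm) cochain \<Rightarrow> (int \<Rightarrow> 'm) \<Rightarrow> (int \<Rightarrow> 'm) \<Rightarrow> bool" where
  "mapping_cone A X Y f M j p \<longleftrightarrow> bounded_complex A M \<and>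
     (\<exists>i q. \<forall>n. biproduct A (cob X (n + 1)) (cob Y n) (cob M n) (i n) (j n) (p n) (q n) \<and>
        cdiff M n =
          i (n + 1) \<cdot>\<^bsub>A\<^esub> cdiff (shift_complex A X) n \<cdot>\<^bsub>A\<^esub> p n \<oplus>\<^bsub>Hom A (cob M n) (cob M (n + 1))\<^esub>
          (j (n + 1) \<cdot>\<^bsub>A\<^esub> f (n + 1) \<cdot>\<^bsub>A\<^esub> p n \<oplus>\<^bsub>Hom A (cob M n) (cob M (n + 1))\<^esub>
           j (n + 1) \<cdot>\<^bsub>A\<^esub> cdiff Y n \<cdot>\<^bsub>A\<^esub> q n))"

definition Db_tri ::
  "('o, 'm, 'k, 'z) lin_cat_scheme \<Rightarrow> ('o, 'm) cochain \<Rightarrow> ('o, 'm) cochain \<Rightarrow> ('o, 'm) cochain \<Rightarrow>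
   ('o, 'm) db_arrow \<Rightarrow> ('o, 'm) db_arrow \<Rightarrow> ('o, 'm) db_arrow \<Rightarrow> bool" where
  "Db_tri A X Y Z f g h \<longleftrightarrow> candidate_triangle (Db_lin A) (Db_shift A) X Y Z f g h \<and>
     (\<exists>X' Y' M f' j p. bounded_complex A X' \<and> bounded_complex A Y' \<and>
        chain_map A X' Y' f' \<and> mapping_cone A X' Y' f' M j p \<and>
        triangle_iso (Db_lin A) (Db_shift A) X Y Z f g h X' Y' M
          (Db_arrow A X' Y' f') (Db_arrow A Y' M j) (Db_arrow A M (shift_complex A X') p))"

definition Db :: "('o, 'm, 'k, 'z) lin_cat_scheme \<Rightarrow> (('o, 'm) cochain, ('o, 'm) db_arrow, 'k) tri_cat" where
  "Db A = lin_cat.extend (Db_lin A) (tri_cat.fields (Db_shift A) (Db_tri A))"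

definition stalk_complex :: "('o, 'm, 'k, 'z) lin_cat_scheme \<Rightarrow> 'o \<Rightarrow> ('o, 'm) cochain" where
  "stalk_complex A M =
     (let X = (\<lambda>n::int. if n = 0 then M else SOME Z. zero_object A Z)
      in \<lparr>cob = X, cdiff = (\<lambda>n. \<zero>\<^bsub>Hom A (X n) (X (n + 1))\<^esub>)\<rparr>)"

text \<open>The source and target of \<open>f\<close> are recovered from \<open>f\<close>, Hom-sets being disjoint.\<close>

definition stalk_functor ::
  "('o, 'm, 'k, 'z) lin_cat_scheme \<Rightarrow> ('o, 'm, ('o, 'm) cochain, ('o, 'm) db_arrow) lin_functor" where
  "stalk_functor A = \<lparr>fob = stalk_complex A,
     fmor = (\<lambda>f. THE F. \<exists>M \<in> Ob A. \<exists>N \<in> Ob A. f \<in> Mor A M N \<and>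
       F = Db_arrow A (stalk_complex A M) (stalk_complex A N)
         (\<lambda>n. if n = 0 then f
              else \<zero>\<^bsub>Hom A (cob (stalk_complex A M) n) (cob (stalk_complex A N) n)\<^esub>))\<rparr>"

definition extends_heart_embedding ::
  "('o, 'm, 'k, 'z) tri_cat_scheme \<Rightarrow> 'o set \<Rightarrow> 'o set \<Rightarrow>
   (('o, 'm) cochain, ('o, 'm) db_arrow, 'o, 'm) lin_functor \<Rightarrow> bool" where
  "extends_heart_embedding C U V G \<longleftrightarrow>
     naturally_isomorphic (heart C U V) C
       (functor_comp G (stalk_functor (heart C U V))) inclusion_functor"

end

theory Submission
  imports Defs
begin

text \<open>
  Stupid truncation exhibits every bounded complex over the heart as an iterated extension of complexes
  concentrated in one degree, and \<open>G\<close> sends these to shifts of objects of the heart. Hence every object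
  of \<open>C\<close> is a finite extension of shifts of objects of the heart, and the t-structure is bounded.

  An arrow \<open>Y \<rightarrow> M[i]\<close> with \<open>i \<ge> 1\<close> in the derived category is a roof; it vanishes on the cycles of
  degree \<open>0\<close> of the middle complex, and these surject onto \<open>Y\<close>. By devissage, every arrow from an object
  \<open>Y\<close> of the heart to an object of \<open>U[1]\<close> is killed by an epimorphism \<open>Z \<rightarrow> Y\<close> of the heart.

  Let \<open>X \<in> U\<close> and suppose \<open>T = (S X)[n] \<in> U\<close> with \<open>n \<ge> 1\<close>. In the truncation triangle
  \<open>A[1] \<rightarrow> T \<rightarrow> Y \<rightarrow> A[2]\<close> the object \<open>Y\<close> lies in the heart. An epimorphism \<open>Z \<rightarrow> Y\<close> killing \<open>Y \<rightarrow> A[2]\<close>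
  lifts to \<open>Z \<rightarrow> T\<close>, but \<open>Hom(Z, T)\<close> is dual to \<open>Hom(X[n], Z) = 0\<close>. So \<open>Y = 0\<close> and \<open>T \<in> U[1]\<close>, that is
  \<open>(S X)[n - 1] \<in> U\<close>; descending induction starts because the t-structure is bounded.
\<close>

section \<open>Arrows of a linear category\<close>

text \<open>For a general t-structure an arrow Y -> M[i] with i >= 2 between objects of the heart
  need not be killed by an epimorphism of the heart. This is where \<open>G\<close> enters: being
  full it turns the arrow into a roof, and being compatible with the embedding of the heart it
  carries the epimorphism found for the roof back to C. The derived category is a concrete
  localization whose operations are unions over all representatives, so a calculus of fractions has
  to be established first, over a heart that is known only through triangles; the exactness
  properties collected in \<open>site\<close> carry that part. Zero arrows of the derived category
  are recognised as multiples by the scalar 0, since a scalar acts on a roof without changing its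
  denominator. The devissage ends because every object is bounded on the side of V as well, so
  boundedness comes before effaceability. Hom-finiteness acts through one fact: a nonzero
  finite-dimensional space has a nonzero functional, so a vanishing dual forces a vanishing
  Hom-space.\<close>

locale category =
  fixes C :: "('o, 'm, 'k, 'z) lin_cat_scheme"
  assumes cat_disjoint: "\<lbrakk>X \<in> Ob C; Y \<in> Ob C; X' \<in> Ob C; Y' \<in> Ob C;
          f \<in> Mor C X Y; f \<in> Mor C X' Y'\<rbrakk> \<Longrightarrow> X = X' \<and> Y = Y'"
    and cat_Idt: "X \<in> Ob C \<Longrightarrow> Idt C X \<in> Mor C X X"
    and cat_Cmp: "\<lbrakk>X \<in> Ob C; Y \<in> Ob C; Z \<in> Ob C; f \<in> Mor C X Y; g \<in> Mor C Y Z\<rbrakk>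
          \<Longrightarrow> g \<cdot>\<^bsub>C\<^esub> f \<in> Mor C X Z"
    and cat_Idt_right: "\<lbrakk>X \<in> Ob C; Y \<in> Ob C; f \<in> Mor C X Y\<rbrakk> \<Longrightarrow> f \<cdot>\<^bsub>C\<^esub> Idt C X = f"
    and cat_Idt_left: "\<lbrakk>X \<in> Ob C; Y \<in> Ob C; f \<in> Mor C X Y\<rbrakk> \<Longrightarrow> Idt C Y \<cdot>\<^bsub>C\<^esub> f = f"
    and cat_assoc: "\<lbrakk>W \<in> Ob C; X \<in> Ob C; Y \<in> Ob C; Z \<in> Ob C;
          f \<in> Mor C W X; g \<in> Mor C X Y; h \<in> Mor C Y Z\<rbrakk>
          \<Longrightarrow> h \<cdot>\<^bsub>C\<^esub> g \<cdot>\<^bsub>C\<^esub> f = h \<cdot>\<^bsub>C\<^esub> (g \<cdot>\<^bsub>C\<^esub> f)"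
begin

abbreviation cmp (infixl "\<bullet>" 75) where "g \<bullet> f \<equiv> Cmp C g f"

text \<open>Hom-sets being disjoint, source and target are functions of an arrow; stated with these,
  all typing conditions are solved by rewriting.\<close>

definition hm :: "'m \<Rightarrow> 'o \<Rightarrow> 'o \<Rightarrow> bool" where
  "hm f X Y \<longleftrightarrow> X \<in> Ob C \<and> Y \<in> Ob C \<and> f \<in> Mor C X Y"

definition arr :: "'m \<Rightarrow> bool" where
  "arr f \<longleftrightarrow> (\<exists>X Y. hm f X Y)"

definition dm :: "'m \<Rightarrow> 'o" where
  "dm f = (THE X. \<exists>Y. hm f X Y)"

definition cd :: "'m \<Rightarrow> 'o" where
  "cd f = (THE Y. \<exists>X. hm f X Y)"

lemma hm_unique: "hm f X Y \<Longrightarrow> hm f X' Y' \<Longrightarrow> X = X' \<and> Y = Y'"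
  unfolding hm_def using cat_disjoint by blast

lemma hm_dm: "hm f X Y \<Longrightarrow> dm f = X"
  unfolding dm_def by (rule the_equality) (use hm_unique in blast)+

lemma hm_cd: "hm f X Y \<Longrightarrow> cd f = Y"
  unfolding cd_def by (rule the_equality) (use hm_unique in blast)+

lemma hm_iff: "hm f X Y \<longleftrightarrow> arr f \<and> dm f = X \<and> cd f = Y"
  using hm_dm hm_cd arr_def by metis

lemma arr_Ob [simp]: "arr f \<Longrightarrow> dm f \<in> Ob C" "arr f \<Longrightarrow> cd f \<in> Ob C"
  using hm_def hm_iff by blast+

lemma MorI: "X \<in> Ob C \<Longrightarrow> Y \<in> Ob C \<Longrightarrow> f \<in> Mor C X Y \<Longrightarrow> arr f \<and> dm f = X \<and> cd f = Y"
  using hm_def hm_iff by blast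

lemma Mor_iff: "X \<in> Ob C \<Longrightarrow> Y \<in> Ob C \<Longrightarrow> f \<in> Mor C X Y \<longleftrightarrow> arr f \<and> dm f = X \<and> cd f = Y"
  using hm_def hm_iff by blast

lemma arr_in_Mor: "arr f \<Longrightarrow> f \<in> Mor C (dm f) (cd f)"
  using Mor_iff by auto

lemma Idt_arr [simp]: "X \<in> Ob C \<Longrightarrow> arr (Idt C X)" "X \<in> Ob C \<Longrightarrow> dm (Idt C X) = X"
  "X \<in> Ob C \<Longrightarrow> cd (Idt C X) = X"
  using MorI cat_Idt by blast+

lemma cmp_arr [simp]:
  assumes "arr f" "arr g" "dm g = cd f"
  shows "arr (g \<bullet> f)" "dm (g \<bullet> f) = dm f" "cd (g \<bullet> f) = cd g"
  using MorI[OF _ _ cat_Cmp[of "dm f" "cd f" "cd g" f g]] assms arr_in_Mor[of f] arr_in_Mor[of g]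
  by auto

lemma cmp_id [simp]: "arr f \<Longrightarrow> dm f = X \<Longrightarrow> f \<bullet> Idt C X = f"
  "arr f \<Longrightarrow> cd f = X \<Longrightarrow> Idt C X \<bullet> f = f"
  using cat_Idt_right cat_Idt_left arr_in_Mor arr_Ob by blast+

lemma cmp_assoc [simp]:
  "arr f \<Longrightarrow> arr g \<Longrightarrow> arr h \<Longrightarrow> dm g = cd f \<Longrightarrow> dm h = cd g \<Longrightarrow> h \<bullet> g \<bullet> f = h \<bullet> (g \<bullet> f)"
  using cat_assoc[of "dm f" "cd f" "cd g" "cd h" f g h] arr_in_Mor arr_Ob by metis

lemma hm_cmp: "hm f X Y \<Longrightarrow> hm g Y Z \<Longrightarrow> hm (g \<bullet> f) X Z"
  by (auto simp: hm_iff)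

lemma hm_Ob: "hm f X Y \<Longrightarrow> X \<in> Ob C" "hm f X Y \<Longrightarrow> Y \<in> Ob C" by (auto simp: hm_def)

lemma iso_arrow_iff: "X \<in> Ob C \<Longrightarrow> Y \<in> Ob C \<Longrightarrow> iso_arrow C X Y f \<longleftrightarrow> hm f X Y \<and>
   (\<exists>g. hm g Y X \<and> g \<bullet> f = Idt C X \<and> f \<bullet> g = Idt C Y)"
  unfolding iso_arrow_def hm_def by auto

lemma isomorphicI: "hm f X Y \<Longrightarrow> hm g Y X \<Longrightarrow> g \<bullet> f = Idt C X \<Longrightarrow> f \<bullet> g = Idt C Y \<Longrightarrow> isomorphic C X Y"
  unfolding isomorphic_def using iso_arrow_iff hm_Ob by metis

lemma isomorphicE: "isomorphic C X Y \<Longrightarrow> X \<in> Ob C \<Longrightarrow> Y \<in> Ob C \<Longrightarrow> \<exists>f g. hm f X Y \<and> hm g Y X \<and> g \<bullet> f = Idt C X \<and> f \<bullet> g = Idt C Y"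
  unfolding isomorphic_def using iso_arrow_iff by metis

lemma iso_refl: "X \<in> Ob C \<Longrightarrow> isomorphic C X X"
  by (rule isomorphicI[of "Idt C X" _ _ "Idt C X"]) (auto simp: hm_iff)

lemma iso_sym: "isomorphic C X Y \<Longrightarrow> X \<in> Ob C \<Longrightarrow> Y \<in> Ob C \<Longrightarrow> isomorphic C Y X"
  using isomorphicE isomorphicI by metis

lemma iso_arrow_comp:
  assumes "X \<in> Ob C" "Y \<in> Ob C" "Z \<in> Ob C" "iso_arrow C X Y f" "iso_arrow C Y Z g" shows "iso_arrow C X Z (g \<bullet> f)"
proof -
  obtain f' where f: "hm f X Y" "hm f' Y X" "f' \<bullet> f = Idt C X" "f \<bullet> f' = Idt C Y"
    using assms iso_arrow_iff by metis
  obtain g' where g: "hm g Y Z" "hm g' Z Y" "g' \<bullet> g = Idt C Y" "g \<bullet> g' = Idt C Z"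
    using assms iso_arrow_iff by metis
  have "g \<bullet> f \<bullet> (f' \<bullet> g') = g \<bullet> (f \<bullet> f' \<bullet> g')" "f' \<bullet> g' \<bullet> (g \<bullet> f) = f' \<bullet> (g' \<bullet> g \<bullet> f)"
    using f(1,2) g(1,2) by (simp_all add: hm_iff)
  then have "g \<bullet> f \<bullet> (f' \<bullet> g') = Idt C Z" "f' \<bullet> g' \<bullet> (g \<bullet> f) = Idt C X"
    using f g by (simp_all only: f(3,4) g(3,4)) (auto simp: hm_iff f g)
  then show ?thesis using iso_arrow_iff[OF assms(1,3)] hm_cmp[OF f(1) g(1)] hm_cmp[OF g(2) f(2)] by blast
qed

lemma iso_trans: "isomorphic C X Y \<Longrightarrow> isomorphic C Y Z \<Longrightarrow> X \<in> Ob C \<Longrightarrow> Y \<in> Ob C \<Longrightarrow> Z \<in> Ob C \<Longrightarrow> isomorphic C X Z"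
  unfolding isomorphic_def using iso_arrow_comp by metis

text \<open>\<open>cmp_assoc\<close> nests composites to the right, where an equation between two
  adjacent factors no longer matches. The trailing factor x restores it; most rewriting guided by
  hand goes through this form.\<close>

lemma cmp_red: "g \<bullet> f = k \<Longrightarrow> arr x \<Longrightarrow> arr f \<Longrightarrow> arr g \<Longrightarrow> dm f = cd x \<Longrightarrow> dm g = cd f \<Longrightarrow> g \<bullet> (f \<bullet> x) = k \<bullet> x"
  using cmp_assoc[of x f g] by simp

end

sublocale linear_category \<subseteq> category C
  by unfold_locales (fact Hom_disjoint Idt_closed Cmp_closed Cmp_Idt_right Cmp_Idt_left Cmp_assoc)+

section \<open>Addition and negation of arrows\<close>

context linear_category
begin

definition zr :: "'o \<Rightarrow> 'o \<Rightarrow> 'm" where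
  "zr X Y = \<zero>\<^bsub>Hom C X Y\<^esub>"

text \<open>The Hom-group is read off the first summand, so sums carry no annotation and bilinearity
  becomes plain rewriting.\<close>

definition pl :: "'m \<Rightarrow> 'm \<Rightarrow> 'm" (infixl "\<boxplus>" 65) where
  "f \<boxplus> g = f \<oplus>\<^bsub>Hom C (dm f) (cd f)\<^esub> g"

definition mn :: "'m \<Rightarrow> 'm" where
  "mn f = \<ominus>\<^bsub>Hom C (dm f) (cd f)\<^esub> f"

lemma Hom_ag: "X \<in> Ob C \<Longrightarrow> Y \<in> Ob C \<Longrightarrow> abelian_group (Hom C X Y)"
  using Hom_module module.axioms(2) by blast

lemma zr_arr [simp]:
  assumes "X \<in> Ob C" "Y \<in> Ob C"
  shows "arr (zr X Y)" "dm (zr X Y) = X" "cd (zr X Y) = Y"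
proof -
  interpret abelian_group "Hom C X Y" using assms by (rule Hom_ag)
  show "arr (zr X Y)" "dm (zr X Y) = X" "cd (zr X Y) = Y"
    using MorI[OF assms zero_closed] unfolding zr_def by auto
qed

lemma pl_arr [simp]:
  assumes "arr f" "arr g" "dm g = dm f" "cd g = cd f"
  shows "arr (f \<boxplus> g)" "dm (f \<boxplus> g) = dm f" "cd (f \<boxplus> g) = cd f"
proof -
  interpret abelian_group "Hom C (dm f) (cd f)" using assms by (intro Hom_ag) auto
  have "f \<boxplus> g \<in> Mor C (dm f) (cd f)"
    unfolding pl_def using arr_in_Mor[of f] arr_in_Mor[of g] assms by auto
  then show "arr (f \<boxplus> g)" "dm (f \<boxplus> g) = dm f" "cd (f \<boxplus> g) = cd f" using MorI assms arr_Ob by blast+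
qed

lemma mn_arr [simp]:
  assumes "arr f"
  shows "arr (mn f)" "dm (mn f) = dm f" "cd (mn f) = cd f"
proof -
  interpret abelian_group "Hom C (dm f) (cd f)" using assms by (intro Hom_ag) auto
  have "mn f \<in> Mor C (dm f) (cd f)"
    unfolding mn_def using arr_in_Mor[of f] assms by auto
  then show "arr (mn f)" "dm (mn f) = dm f" "cd (mn f) = cd f" using MorI assms arr_Ob by blast+
qed

lemma mn_eq: "X \<in> Ob C \<Longrightarrow> Y \<in> Ob C \<Longrightarrow> f \<in> Mor C X Y \<Longrightarrow> \<ominus>\<^bsub>Hom C X Y\<^esub> f = mn f"
  using MorI mn_def by metis

lemma pl_comm: "arr f \<Longrightarrow> arr g \<Longrightarrow> dm g = dm f \<Longrightarrow> cd g = cd f \<Longrightarrow> f \<boxplus> g = g \<boxplus> f"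
  unfolding pl_def using abelian_monoid.a_comm[OF abelian_group.axioms(1)[OF Hom_ag], of "dm f" "cd f" f g] arr_in_Mor arr_Ob
  by metis

lemma pl_assoc: "arr f \<Longrightarrow> arr g \<Longrightarrow> arr h \<Longrightarrow> dm g = dm f \<Longrightarrow> cd g = cd f \<Longrightarrow> dm h = dm f \<Longrightarrow> cd h = cd f
  \<Longrightarrow> f \<boxplus> g \<boxplus> h = f \<boxplus> (g \<boxplus> h)"
  using pl_arr[of f g] unfolding pl_def
  using abelian_monoid.a_assoc[OF abelian_group.axioms(1)[OF Hom_ag], of "dm f" "cd f" f g h] arr_in_Mor arr_Ob by metis

lemma pl_lcomm: "arr f \<Longrightarrow> arr g \<Longrightarrow> arr h \<Longrightarrow> dm g = dm f \<Longrightarrow> cd g = cd f \<Longrightarrow> dm h = dm f \<Longrightarrow> cd h = cd f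
  \<Longrightarrow> f \<boxplus> (g \<boxplus> h) = g \<boxplus> (f \<boxplus> h)"
  using pl_assoc[of f g h] pl_assoc[of g f h] pl_comm[of f g] by simp

lemmas pl_ac = pl_assoc pl_comm pl_lcomm

lemma pl_zr [simp]:
  "arr f \<Longrightarrow> dm f = X \<Longrightarrow> cd f = Y \<Longrightarrow> f \<boxplus> zr X Y = f"
  "arr f \<Longrightarrow> dm f = X \<Longrightarrow> cd f = Y \<Longrightarrow> zr X Y \<boxplus> f = f"
proof -
  show 1: "arr f \<Longrightarrow> dm f = X \<Longrightarrow> cd f = Y \<Longrightarrow> f \<boxplus> zr X Y = f"
    unfolding pl_def zr_def using abelian_monoid.r_zero[OF abelian_group.axioms(1)[OF Hom_ag]] arr_in_Mor arr_Ob by metis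
  then show "arr f \<Longrightarrow> dm f = X \<Longrightarrow> cd f = Y \<Longrightarrow> zr X Y \<boxplus> f = f"
    using pl_comm[of f "zr X Y"] by fastforce
qed

lemma pl_mn [simp]:
  "arr f \<Longrightarrow> f \<boxplus> mn f = zr (dm f) (cd f)"
  "arr f \<Longrightarrow> mn f \<boxplus> f = zr (dm f) (cd f)"
proof -
  show 1: "arr f \<Longrightarrow> f \<boxplus> mn f = zr (dm f) (cd f)"
    unfolding pl_def zr_def mn_def using abelian_group.r_neg[OF Hom_ag] arr_in_Mor arr_Ob by metis
  then show "arr f \<Longrightarrow> mn f \<boxplus> f = zr (dm f) (cd f)"
    using pl_comm[of f "mn f"] by simp
qed

lemma pl_mn2 [simp]:
  assumes "arr f" "arr g" "dm g = dm f" "cd g = cd f"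
  shows "f \<boxplus> (mn f \<boxplus> g) = g" "mn f \<boxplus> (f \<boxplus> g) = g"
  using assms pl_assoc[of f "mn f" g] pl_assoc[of "mn f" f g] by auto

lemma pl_cancel:
  assumes "f \<boxplus> g = f \<boxplus> h" "arr f" "arr g" "arr h" "dm g = dm f" "cd g = cd f" "dm h = dm f" "cd h = cd f"
  shows "g = h"
  using pl_mn2(2)[of f g] pl_mn2(2)[of f h] assms by metis

lemma mn_unique:
  assumes "f \<boxplus> g = zr (dm f) (cd f)" "arr f" "arr g" "dm g = dm f" "cd g = cd f"
  shows "g = mn f"
  by (rule pl_cancel[of f]) (simp_all add: assms)

lemma mn_mn [simp]: "arr f \<Longrightarrow> mn (mn f) = f"
  by (rule mn_unique[symmetric]) simp_all

lemma mn_zr [simp]: "X \<in> Ob C \<Longrightarrow> Y \<in> Ob C \<Longrightarrow> mn (zr X Y) = zr X Y"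
  by (rule mn_unique[symmetric]) simp_all

lemma mn_pl [simp]: "arr f \<Longrightarrow> arr g \<Longrightarrow> dm g = dm f \<Longrightarrow> cd g = cd f \<Longrightarrow> mn (f \<boxplus> g) = mn f \<boxplus> mn g"
  by (rule mn_unique[symmetric]) (auto simp: pl_ac)

lemma cmp_pl_left [simp]:
  "arr f \<Longrightarrow> arr g \<Longrightarrow> arr h \<Longrightarrow> dm g = cd f \<Longrightarrow> dm h = dm g \<Longrightarrow> cd h = cd g \<Longrightarrow> (g \<boxplus> h) \<bullet> f = g \<bullet> f \<boxplus> h \<bullet> f"
  using Cmp_add_left[of "dm f" "cd f" "cd g" f g h] arr_in_Mor arr_Ob cmp_arr unfolding pl_def by metis

lemma cmp_pl_right [simp]:
  "arr f \<Longrightarrow> arr g \<Longrightarrow> arr h \<Longrightarrow> dm h = cd f \<Longrightarrow> dm g = dm f \<Longrightarrow> cd g = cd f \<Longrightarrow> h \<bullet> (f \<boxplus> g) = h \<bullet> f \<boxplus> h \<bullet> g"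
  using Cmp_add_right[of "dm f" "cd f" "cd h" f g h] arr_in_Mor arr_Ob cmp_arr unfolding pl_def by metis

lemma cmp_zr [simp]:
  "arr f \<Longrightarrow> cd f = X \<Longrightarrow> Y \<in> Ob C \<Longrightarrow> zr X Y \<bullet> f = zr (dm f) Y"
  "arr f \<Longrightarrow> dm f = Y \<Longrightarrow> X \<in> Ob C \<Longrightarrow> f \<bullet> zr X Y = zr X (cd f)"
proof -
  \<comment> \<open>An arrow with g + g = g is zero; bilinearity gives this equation for both
    composites.\<close>
  have *: "g = zr (dm g) (cd g)" if "arr g" "g \<boxplus> g = g" for g
    using pl_cancel[of g g "zr (dm g) (cd g)"] that by simp
  show "arr f \<Longrightarrow> cd f = X \<Longrightarrow> Y \<in> Ob C \<Longrightarrow> zr X Y \<bullet> f = zr (dm f) Y"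
    using *[of "zr X Y \<bullet> f"] cmp_pl_left[of f "zr X Y" "zr X Y"] arr_Ob(2)[of f] by force
  show "arr f \<Longrightarrow> dm f = Y \<Longrightarrow> X \<in> Ob C \<Longrightarrow> f \<bullet> zr X Y = zr X (cd f)"
    using *[of "f \<bullet> zr X Y"] cmp_pl_right[of "zr X Y" "zr X Y" f] arr_Ob(1)[of f] by force
qed

lemma cmp_mn [simp]:
  "arr f \<Longrightarrow> arr g \<Longrightarrow> dm g = cd f \<Longrightarrow> g \<bullet> mn f = mn (g \<bullet> f)"
  "arr f \<Longrightarrow> arr g \<Longrightarrow> dm g = cd f \<Longrightarrow> mn g \<bullet> f = mn (g \<bullet> f)"
  using cmp_pl_right[of f "mn f" g] cmp_pl_left[of f g "mn g"]
    mn_unique[of "g \<bullet> f" "g \<bullet> mn f"]  mn_unique[of "g \<bullet> f" "mn g \<bullet> f"] by auto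

lemma mn_eq_zr: "arr f \<Longrightarrow> mn f = zr X Y \<Longrightarrow> X \<in> Ob C \<Longrightarrow> Y \<in> Ob C \<Longrightarrow> f = zr X Y"
  using mn_mn mn_zr by metis

lemma diff_eq: "f \<boxplus> mn g = zr X Y \<Longrightarrow> arr f \<Longrightarrow> arr g \<Longrightarrow> dm g = dm f \<Longrightarrow> cd g = cd f \<Longrightarrow> X = dm f \<Longrightarrow> Y = cd f \<Longrightarrow> f = g"
  using mn_unique[of f "mn g"] mn_mn by (metis mn_arr)

text \<open>An equation between two arrows passes through additive functors directly, which the
  universal property does not; this is how zero objects are transported.\<close>

lemma zero_iff: "zero_object C Z \<longleftrightarrow> Z \<in> Ob C \<and> Idt C Z = zr Z Z"
proof
  assume "zero_object C Z"
  then have Z: "Z \<in> Ob C" and "\<exists>!f. f \<in> Mor C Z Z" by (auto simp: zero_object_def)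
  moreover have "zr Z Z \<in> Mor C Z Z" "Idt C Z \<in> Mor C Z Z" using Z by (auto simp: Mor_iff)
  ultimately show "Z \<in> Ob C \<and> Idt C Z = zr Z Z" by blast
next
  assume a: "Z \<in> Ob C \<and> Idt C Z = zr Z Z"
  have 1: "f = zr X Z" if "X \<in> Ob C" "f \<in> Mor C X Z" for f X
    using that a cmp_id(2)[of f Z] cmp_zr(1)[of f Z Z] by (auto simp: Mor_iff)
  have 2: "f = zr Z X" if "X \<in> Ob C" "f \<in> Mor C Z X" for f X
    using that a cmp_id(1)[of f Z] cmp_zr(2)[of f Z Z] by (auto simp: Mor_iff)
  have 3: "zr Z X \<in> Mor C Z X" "zr X Z \<in> Mor C X Z" if "X \<in> Ob C" for X
    using that a by (auto simp: Mor_iff)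
  show "zero_object C Z" unfolding zero_object_def using 1 2 3 a by metis
qed

lemma zero_to: "zero_object C Z \<Longrightarrow> arr f \<Longrightarrow> cd f = Z \<Longrightarrow> f = zr (dm f) Z"
  using zero_iff cmp_id(2)[of f Z] cmp_zr(1)[of f Z Z] by simp

lemma zero_from: "zero_object C Z \<Longrightarrow> arr f \<Longrightarrow> dm f = Z \<Longrightarrow> f = zr Z (cd f)"
  using zero_iff cmp_id(1)[of f Z] cmp_zr(2)[of f Z Z] by simp

end

section \<open>Triangulated categories and t-structures\<close>

context linear_category
begin

lemma linear_functorD:
  assumes "linear_functor K C C F"
  shows "X \<in> Ob C \<Longrightarrow> fob F X \<in> Ob C" "X \<in> Ob C \<Longrightarrow> fmor F (Idt C X) = Idt C (fob F X)"
    "hm f X Y \<Longrightarrow> hm (fmor F f) (fob F X) (fob F Y)"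
    "hm f X Y \<Longrightarrow> hm g Y Z \<Longrightarrow> fmor F (g \<bullet> f) = fmor F g \<bullet> fmor F f"
    "hm f X Y \<Longrightarrow> hm g X Y \<Longrightarrow> fmor F (f \<boxplus> g) = fmor F f \<boxplus> fmor F g"
proof -
  show 1: "X \<in> Ob C \<Longrightarrow> fob F X \<in> Ob C" "X \<in> Ob C \<Longrightarrow> fmor F (Idt C X) = Idt C (fob F X)" for X
    using assms unfolding linear_functor_def by blast+
  show 2: "hm f X Y \<Longrightarrow> hm (fmor F f) (fob F X) (fob F Y)" for f X Y
    using assms unfolding linear_functor_def hm_def by blast
  show "hm f X Y \<Longrightarrow> hm g Y Z \<Longrightarrow> fmor F (g \<bullet> f) = fmor F g \<bullet> fmor F f"
    using assms unfolding linear_functor_def hm_def by blast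
  assume a: "hm f X Y" "hm g X Y"
  then have "fmor F (f \<oplus>\<^bsub>Hom C X Y\<^esub> g) = fmor F f \<oplus>\<^bsub>Hom C (fob F X) (fob F Y)\<^esub> fmor F g"
    using assms unfolding linear_functor_def hm_def by blast
  moreover have "dm f = X" "cd f = Y" "dm (fmor F f) = fob F X" "cd (fmor F f) = fob F Y"
    using a 2[of f X Y] by (auto simp: hm_iff)
  ultimately show "fmor F (f \<boxplus> g) = fmor F f \<boxplus> fmor F g"
    by (simp add: pl_def)
qed

text \<open>With tau : F' F -> 1 the natural isomorphism, h = tau_Y F'(F h) tau_X^-1 recovers h from
  F h.\<close>

lemma functor_faithful:
  assumes F: "linear_functor K C C F" and F': "linear_functor K C C F'"
    and n: "naturally_isomorphic C C (functor_comp F' F) inclusion_functor"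
    and f: "hm f X Y" and g: "hm g X Y" and e: "fmor F f = fmor F g"
  shows "f = g"
proof -
  obtain \<tau> where t: "natural_iso C C (functor_comp F' F) inclusion_functor \<tau>"
    using n naturally_isomorphic_def by blast
  have XY: "X \<in> Ob C" "Y \<in> Ob C" using f hm_Ob by blast+
  have "iso_arrow C (fob F' (fob F X)) X (\<tau> X)"
    using t XY unfolding natural_iso_def by (auto simp: functor_comp_def inclusion_functor_def)
  moreover have "fob F' (fob F X) \<in> Ob C" using XY linear_functorD(1) F F' by blast
  ultimately obtain s where s: "hm (\<tau> X) (fob F' (fob F X)) X" "hm s X (fob F' (fob F X))" "\<tau> X \<bullet> s = Idt C X"
    using iso_arrow_iff XY by metis
  have *: "h \<bullet> \<tau> X = \<tau> Y \<bullet> fmor F' (fmor F h)" if "hm h X Y" for h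
  proof -
    have "h \<in> Mor C X Y" using that by (simp add: hm_def)
    then show ?thesis using t XY unfolding natural_iso_def
      by (auto simp: functor_comp_def inclusion_functor_def)
  qed
  have **: "h = \<tau> Y \<bullet> fmor F' (fmor F h) \<bullet> s" if "hm h X Y" for h
  proof -
    have "h = h \<bullet> (\<tau> X \<bullet> s)" using that s by (simp add: hm_iff)
    also have "\<dots> = h \<bullet> \<tau> X \<bullet> s" using that s by (simp add: hm_iff)
    finally show ?thesis using * that by simp
  qed
  show ?thesis using **[OF f] **[OF g] e by simp
qed

lemma equivalence_faithful:
  assumes "equivalence_functor K C C F" "hm f X Y" "hm g X Y" "fmor F f = fmor F g"
  shows "f = g"
  using assms functor_faithful unfolding equivalence_functor_def by metis

lemma equivalence_surj:
  assumes "equivalence_functor K C C F" "Y \<in> Ob C"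
  shows "\<exists>X \<in> Ob C. isomorphic C (fob F X) Y"
proof -
  obtain F' \<sigma> where F': "linear_functor K C C F'" and "natural_iso C C (functor_comp F F') inclusion_functor \<sigma>"
    using assms(1) unfolding equivalence_functor_def naturally_isomorphic_def by blast
  then have "isomorphic C (fob F (fob F' Y)) Y" using assms(2)
    unfolding natural_iso_def by (auto simp: functor_comp_def inclusion_functor_def isomorphic_def)
  then show ?thesis using linear_functorD(1)[OF F'] assms(2) by blast
qed

text \<open>The candidate is f = tau_Y F'(p) tau_X^-1. Naturality gives F'(F f) = F' p, and
  \<open>F'\<close> is faithful because F F' is isomorphic to the identity too.\<close>

lemma equivalence_full:
  assumes eq: "equivalence_functor K C C F" and XY: "X \<in> Ob C" "Y \<in> Ob C" and p: "hm p (fob F X) (fob F Y)"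
  shows "\<exists>f. hm f X Y \<and> fmor F f = p"
proof -
  obtain F' \<tau> where F: "linear_functor K C C F" and F': "linear_functor K C C F'"
    and t: "natural_iso C C (functor_comp F' F) inclusion_functor \<tau>"
    and n2: "naturally_isomorphic C C (functor_comp F F') inclusion_functor"
    using eq unfolding equivalence_functor_def naturally_isomorphic_def by blast
  let ?H = "\<lambda>X. fob F' (fob F X)"
  have H: "?H X \<in> Ob C" "?H Y \<in> Ob C" using XY linear_functorD(1) F F' by blast+
  have "iso_arrow C (?H X) X (\<tau> X)" "iso_arrow C (?H Y) Y (\<tau> Y)"
    using t XY unfolding natural_iso_def by (auto simp: functor_comp_def inclusion_functor_def)
  then obtain s s' where s: "hm (\<tau> X) (?H X) X" "hm s X (?H X)" "\<tau> X \<bullet> s = Idt C X" "s \<bullet> \<tau> X = Idt C (?H X)"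
    and s': "hm (\<tau> Y) (?H Y) Y" "hm s' Y (?H Y)" "\<tau> Y \<bullet> s' = Idt C Y" "s' \<bullet> \<tau> Y = Idt C (?H Y)"
    using iso_arrow_iff XY H by metis
  define q where "q = fmor F' p"
  have q: "hm q (?H X) (?H Y)" using linear_functorD(3)[OF F' p] by (simp add: q_def)
  define f where "f = \<tau> Y \<bullet> (q \<bullet> s)"
  have f: "hm f X Y" using q s s' by (auto simp: f_def hm_iff)
  then have "f \<in> Mor C X Y" by (simp add: hm_def)
  then have *: "f \<bullet> \<tau> X = \<tau> Y \<bullet> fmor F' (fmor F f)"
    using t XY unfolding natural_iso_def by (auto simp: functor_comp_def inclusion_functor_def)
  define r where "r = fmor F' (fmor F f)"
  have r: "hm r (?H X) (?H Y)" using linear_functorD(3)[OF F' linear_functorD(3)[OF F f]] by (simp add: r_def)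
  have "f \<bullet> \<tau> X = \<tau> Y \<bullet> (q \<bullet> (s \<bullet> \<tau> X))" using q s s' by (simp add: f_def hm_iff)
  also have "\<dots> = \<tau> Y \<bullet> q" using q unfolding s by (simp add: hm_iff)
  finally have "s' \<bullet> (\<tau> Y \<bullet> r) = s' \<bullet> (\<tau> Y \<bullet> q)" using * r_def by simp
  moreover have "s' \<bullet> (\<tau> Y \<bullet> r) = r" "s' \<bullet> (\<tau> Y \<bullet> q) = q"
    using cmp_red[OF s'(4), of r] cmp_red[OF s'(4), of q] r q s'(1,2) by (simp_all add: hm_iff)
  ultimately have "r = q" by simp
  then have "fmor F' (fmor F f) = fmor F' p" by (simp add: r_def q_def)
  then have "fmor F f = p"
    using functor_faithful[OF F' F n2 linear_functorD(3)[OF F f] p] by blast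
  then show ?thesis using f by blast
qed

end

section \<open>Suspension, rotation and the exact Hom-sequences\<close>

context triangulated_category
begin

abbreviation sh where "sh X \<equiv> fob (shift C) X"
abbreviation shm where "shm f \<equiv> fmor (shift C) f"

lemma shift_linear: "linear_functor K C C (shift C)"
  using shift_equivalence unfolding equivalence_functor_def by blast

lemmas shD = linear_functorD[OF shift_linear]
lemmas sh_Ob [simp] = shD(1)

lemma sh_full: "X \<in> Ob C \<Longrightarrow> Y \<in> Ob C \<Longrightarrow> hm p (sh X) (sh Y) \<Longrightarrow> \<exists>f. hm f X Y \<and> shm f = p"
  using equivalence_full[OF shift_equivalence] .

lemmas sh_faithful = equivalence_faithful[OF shift_equivalence]
lemmas sh_surj = equivalence_surj[OF shift_equivalence]

lemma shm_arr [simp]: "arr f \<Longrightarrow> arr (shm f)" "arr f \<Longrightarrow> dm (shm f) = sh (dm f)" "arr f \<Longrightarrow> cd (shm f) = sh (cd f)"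
  using shD(3)[of f "dm f" "cd f"] by (auto simp: hm_iff)

lemma shm_cmp: "arr f \<Longrightarrow> arr g \<Longrightarrow> dm g = cd f \<Longrightarrow> shm (g \<bullet> f) = shm g \<bullet> shm f"
  using shD(4)[of f "dm f" "cd f" g "cd g"] by (auto simp: hm_iff)

lemma shm_zr [simp]: assumes "X \<in> Ob C" "Y \<in> Ob C" shows "shm (zr X Y) = zr (sh X) (sh Y)"
proof -
  have "shm (zr X Y \<boxplus> zr X Y) = shm (zr X Y) \<boxplus> shm (zr X Y)"
    by (rule shD(5)) (use assms in \<open>auto simp: hm_iff\<close>)
  then have "shm (zr X Y) \<boxplus> shm (zr X Y) = shm (zr X Y) \<boxplus> zr (sh X) (sh Y)"
    using assms by simp
  then show ?thesis by (rule pl_cancel) (use assms in auto)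
qed

lemma sh_iso: assumes "isomorphic C X Y" "X \<in> Ob C" "Y \<in> Ob C" shows "isomorphic C (sh X) (sh Y)"
proof -
  obtain f g where f: "hm f X Y" "hm g Y X" "g \<bullet> f = Idt C X" "f \<bullet> g = Idt C Y"
    using isomorphicE assms by metis
  show ?thesis
    by (rule isomorphicI[of "shm f" _ _ "shm g"]) (use f shD assms in \<open>auto simp flip: shD(4)\<close>)
qed

lemma sh_iso_rev: assumes "isomorphic C (sh X) (sh Y)" "X \<in> Ob C" "Y \<in> Ob C" shows "isomorphic C X Y"
proof -
  obtain f' g' where f': "hm f' (sh X) (sh Y)" "hm g' (sh Y) (sh X)" "g' \<bullet> f' = Idt C (sh X)" "f' \<bullet> g' = Idt C (sh Y)"
    using isomorphicE assms by (metis sh_Ob)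
  then obtain f g where f: "hm f X Y" "shm f = f'" "hm g Y X" "shm g = g'" using sh_full assms by metis
  have "g \<bullet> f = Idt C X"
    by (rule sh_faithful[of _ X X]) (use f f' assms in \<open>auto simp: hm_iff shm_cmp shD(2)\<close>)
  moreover have "f \<bullet> g = Idt C Y"
    by (rule sh_faithful[of _ Y Y]) (use f f' assms in \<open>auto simp: hm_iff shm_cmp shD(2)\<close>)
  ultimately show ?thesis using f isomorphicI by metis
qed

lemma sh_zero: "zero_object C Z \<Longrightarrow> zero_object C (sh Z)"
  unfolding zero_iff using shD(2)[of Z] by simp

lemma tri_hm: "tri C X Y Z f g h \<Longrightarrow> hm f X Y" "tri C X Y Z f g h \<Longrightarrow> hm g Y Z"
  "tri C X Y Z f g h \<Longrightarrow> hm h Z (sh X)"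
  using tri_candidate unfolding candidate_triangle_def hm_def by auto

lemma cand_iff: "candidate_triangle C (shift C) X Y Z f g h \<longleftrightarrow> hm f X Y \<and> hm g Y Z \<and> hm h Z (sh X)"
  unfolding candidate_triangle_def hm_def by auto

lemma tri_rot_iff:
  assumes "hm f X Y" "hm g Y Z" "hm h Z (sh X)"
  shows "tri C X Y Z f g h \<longleftrightarrow> tri C Y Z (sh X) g h (mn (shm f))"
proof -
  have "shm f \<in> Mor C (sh X) (sh Y)" using shD(3)[OF assms(1)] by (simp add: hm_def)
  then show ?thesis using TR2[of X Y Z f g h] assms cand_iff mn_eq[of "sh X" "sh Y" "shm f"] hm_Ob by auto
qed

lemma tri_rot: "tri C X Y Z f g h \<Longrightarrow> tri C Y Z (sh X) g h (mn (shm f))"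
  using tri_rot_iff tri_hm by metis

lemma tri_sh: "tri C X Y Z f g h \<Longrightarrow> tri C (sh X) (sh Y) (sh Z) (mn (shm f)) (mn (shm g)) (mn (shm h))"
  using tri_rot by blast

lemma tri_id: "X \<in> Ob C \<Longrightarrow> zero_object C Z \<Longrightarrow> tri C X X Z (Idt C X) (zr X Z) (zr Z (sh X))"
  using TR1_identity by (simp add: zr_def)

text \<open>Its rotation is the identity triangle of X with the zero object Z[1], so rotation is
  undone; the sign is absorbed by a zero arrow.\<close>

lemma tri_id2: assumes "X \<in> Ob C" "zero_object C Z" shows "tri C Z X X (zr Z X) (Idt C X) (zr X (sh Z))"
proof -
  have "tri C X X (sh Z) (Idt C X) (zr X (sh Z)) (zr (sh Z) (sh X))"
    using tri_id sh_zero assms by blast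
  then show ?thesis using tri_rot_iff[of "zr Z X" Z X "Idt C X" X "zr X (sh Z)"] assms
    by (auto simp: hm_iff zero_iff)
qed

lemma TR3h: "\<lbrakk>tri C X Y Z f g h; tri C X' Y' Z' f' g' h'; hm a X X'; hm b Y Y'; b \<bullet> f = f' \<bullet> a\<rbrakk>
   \<Longrightarrow> \<exists>c. hm c Z Z' \<and> c \<bullet> g = g' \<bullet> b \<and> shm a \<bullet> h = h' \<bullet> c"
  using TR3[of X Y Z f g h X' Y' Z' f' g' h' a b] tri_hm[of X Y Z f g h] tri_hm[of X' Y' Z' f' g' h']
  unfolding hm_def by blast

text \<open>TR3 maps the identity triangle of X to the given one by (1, f), and this makes g f
  factor through a zero object.\<close>

lemma tri_comp: assumes "tri C X Y Z f g h" shows "g \<bullet> f = zr X Z"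
proof -
  obtain Zo where Zo: "zero_object C Zo" using zero_object_exists by blast
  have f: "hm f X Y" "hm g Y Z" using tri_hm assms by blast+
  then have t: "tri C X X Zo (Idt C X) (zr X Zo) (zr Zo (sh X))" using tri_id Zo hm_Ob by blast
  obtain c where "hm c Zo Z" "c \<bullet> zr X Zo = g \<bullet> f"
    using TR3h[OF t assms, of "Idt C X" f] f by (auto simp: hm_iff)
  then show ?thesis using f Zo by (auto simp: hm_iff zero_iff)
qed

text \<open>TR3 towards the triangle 0 -> T -> T with t in the middle; the third component is the
  factorization.\<close>

lemma exact_from:
  assumes t: "tri C X Y Z f g h" "hm t Y T" "t \<bullet> f = zr X T"
  shows "\<exists>u. hm u Z T \<and> u \<bullet> g = t"
proof -
  obtain Zo where Zo: "zero_object C Zo" using zero_object_exists by blast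
  have f: "hm f X Y" "hm g Y Z" "hm h Z (sh X)" using tri_hm t by blast+
  have T: "T \<in> Ob C" "X \<in> Ob C" using t f hm_Ob by blast+
  obtain c where "hm c Z T" "c \<bullet> g = Idt C T \<bullet> t"
    using TR3h[OF t(1) tri_id2[OF T(1) Zo], of "zr X Zo" t] f Zo t T by (auto simp: hm_iff zero_iff)
  then show ?thesis using t by (auto simp: hm_iff)
qed

lemma exact_from2: "tri C X Y Z f g h \<Longrightarrow> hm t Z T \<Longrightarrow> t \<bullet> g = zr Y T \<Longrightarrow> \<exists>u. hm u (sh X) T \<and> u \<bullet> h = t"
  using exact_from tri_rot by blast

text \<open>Dual to \<open>exact_from\<close>, but the wanted arrow would be the first component of
  a map of triangles. Rotating T -> T -> 0 and the given triangle once makes it the third component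
  up to suspension; fullness and faithfulness of the suspension bring it back.\<close>

lemma exact_to:
  assumes t: "tri C X Y Z f g h" "hm t T Y" "g \<bullet> t = zr T Z"
  shows "\<exists>u. hm u T X \<and> f \<bullet> u = t"
proof -
  obtain Zo where Zo: "zero_object C Zo" using zero_object_exists by blast
  have f: "hm f X Y" "hm g Y Z" "hm h Z (sh X)" using tri_hm t by blast+
  have T: "T \<in> Ob C" "X \<in> Ob C" using t f hm_Ob by blast+
  have 1: "tri C T Zo (sh T) (zr T Zo) (zr Zo (sh T)) (mn (shm (Idt C T)))"
    using tri_rot[OF tri_id[OF T(1) Zo]] .
  obtain c where c: "hm c (sh T) (sh X)" "shm t \<bullet> mn (shm (Idt C T)) = mn (shm f) \<bullet> c"
    using TR3h[OF 1 tri_rot[OF t(1)], of t "zr Zo Z"] f Zo t T by (auto simp: hm_iff zero_iff)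
  obtain u where u: "hm u T X" "shm u = c" using sh_full c T by metis
  have "shm t \<bullet> mn (shm (Idt C T)) = mn (shm t)" using t(2) T by (simp add: hm_iff shD(2))
  moreover have "mn (shm f) \<bullet> c = mn (shm (f \<bullet> u))" unfolding u(2)[symmetric] using u(1) f by (simp add: hm_iff shm_cmp)
  ultimately have "mn (shm t) = mn (shm (f \<bullet> u))" using c(2) by simp
  moreover have "arr (shm t)" "arr (shm (f \<bullet> u))" using t(2) u(1) f(1) by (simp_all add: hm_iff)
  ultimately have "shm t = shm (f \<bullet> u)" using mn_mn by metis
  then have "t = f \<bullet> u" using sh_faithful t(2) hm_cmp u f by metis
  then show ?thesis using u by blast
qed

lemma exact_to2: "tri C X Y Z f g h \<Longrightarrow> hm t T Z \<Longrightarrow> h \<bullet> t = zr T (sh X) \<Longrightarrow> \<exists>u. hm u T Y \<and> g \<bullet> u = t"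
  using exact_to tri_rot by blast

lemma mk_cone: "hm f X Y \<Longrightarrow> \<exists>Z g h. tri C X Y Z f g h"
  using TR1_completion hm_def by metis

lemma tri_iso:
  assumes t: "tri C X Y Z f g h"
    and a: "hm a X X'" "hm a' X' X" "a' \<bullet> a = Idt C X" "a \<bullet> a' = Idt C X'"
    and b: "hm b Y Y'" "hm b' Y' Y" "b' \<bullet> b = Idt C Y" "b \<bullet> b' = Idt C Y'"
    and c: "hm c Z Z'" "hm c' Z' Z" "c' \<bullet> c = Idt C Z" "c \<bullet> c' = Idt C Z'"
  shows "tri C X' Y' Z' (b \<bullet> (f \<bullet> a')) (c \<bullet> (g \<bullet> b')) (shm a \<bullet> (h \<bullet> c'))"
proof (rule tri_replete[OF t])
  have f: "hm f X Y" "hm g Y Z" "hm h Z (sh X)" using tri_hm t by blast+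
  show "candidate_triangle C (shift C) X' Y' Z' (b \<bullet> (f \<bullet> a')) (c \<bullet> (g \<bullet> b')) (shm a \<bullet> (h \<bullet> c'))"
    unfolding cand_iff using f a b c by (auto simp: hm_iff)
  have "iso_arrow C X X' a" "iso_arrow C Y Y' b" "iso_arrow C Z Z' c"
    using a b c iso_arrow_iff hm_Ob by metis+
  moreover have "b \<bullet> f = b \<bullet> (f \<bullet> a') \<bullet> a" "c \<bullet> g = c \<bullet> (g \<bullet> b') \<bullet> b" "shm a \<bullet> h = shm a \<bullet> (h \<bullet> c') \<bullet> c"
    using f a b c by (auto simp: hm_iff)
  ultimately show "triangle_iso C (shift C) X Y Z f g h X' Y' Z' (b \<bullet> (f \<bullet> a')) (c \<bullet> (g \<bullet> b')) (shm a \<bullet> (h \<bullet> c'))"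
    unfolding triangle_iso_def by blast
qed

text \<open>Completion yields a cone Q of g that is only isomorphic to a suspension X[1], so the
  triangle is moved along that isomorphism before it is rotated back.\<close>

lemma mk_fiber: assumes g: "hm g Y Z" shows "\<exists>X f h. tri C X Y Z f g h"
proof -
  obtain Q h k where t: "tri C Y Z Q g h k" using mk_cone g by blast
  have f: "hm h Z Q" "hm k Q (sh Y)" using tri_hm t by blast+
  have O: "Y \<in> Ob C" "Z \<in> Ob C" "Q \<in> Ob C" using g f hm_Ob by blast+
  obtain X where X: "X \<in> Ob C" "isomorphic C (sh X) Q" using sh_surj O by blast
  then obtain c c' where c: "hm c Q (sh X)" "hm c' (sh X) Q" "c' \<bullet> c = Idt C Q" "c \<bullet> c' = Idt C (sh X)"
    using isomorphicE O sh_Ob by metis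
  have *: "tri C Y Z (sh X) (Idt C Z \<bullet> (g \<bullet> Idt C Y)) (c \<bullet> (h \<bullet> Idt C Z)) (shm (Idt C Y) \<bullet> (k \<bullet> c'))"
    by (rule tri_iso[OF t _ _ _ _ _ _ _ _ c]) (use O in \<open>auto simp: hm_iff\<close>)
  have **: "tri C Y Z (sh X) g (c \<bullet> h) (k \<bullet> c')"
    using * g f c O by (simp add: hm_iff shD(2))
  \<comment> \<open>Rotation places -f[1] in the last position, so the negative of the connecting
    arrow is desuspended.\<close>
  have "hm (mn (k \<bullet> c')) (sh X) (sh Y)" using f c by (auto simp: hm_iff)
  then obtain f' where f': "hm f' X Y" "shm f' = mn (k \<bullet> c')" using sh_full O X by metis
  have "mn (shm f') = k \<bullet> c'" using f' f c by (auto simp: hm_iff)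
  then have "tri C X Y Z f' g (c \<bullet> h)" using tri_rot_iff[of f' X Y g Z "c \<bullet> h"] ** f' g f c by (auto simp: hm_iff)
  then show ?thesis by blast
qed

text \<open>An extension of Z by X with prescribed connecting arrow w. Coverings in the heart are
  pulled back with it.\<close>

lemma mk_mid: assumes w: "hm w Z (sh X)" and X: "X \<in> Ob C" shows "\<exists>Y f g. tri C X Y Z f g w"
proof -
  obtain Y g k where t: "tri C Y Z (sh X) g w k" using mk_fiber w by blast
  have f: "hm g Y Z" "hm k (sh X) (sh Y)" using tri_hm t by blast+
  have O: "Y \<in> Ob C" using f hm_Ob by blast
  have "hm (mn k) (sh X) (sh Y)" using f by (auto simp: hm_iff)
  then obtain f' where f': "hm f' X Y" "shm f' = mn k" using sh_full O X by metis
  have "mn (shm f') = k" using f' f by (auto simp: hm_iff)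
  then have "tri C X Y Z f' g w" using tri_rot_iff[of f' X Y g Z w] t f' w f by auto
  then show ?thesis by blast
qed

section \<open>Vanishing of Hom-spaces\<close>

definition H0 where "H0 X Y \<longleftrightarrow> (\<forall>t. hm t X Y \<longrightarrow> t = zr X Y)"

lemma H0D: "H0 X Y \<Longrightarrow> hm t X Y \<Longrightarrow> t = zr X Y" by (simp add: H0_def)

lemma H0_iso1: assumes "H0 X Y" "isomorphic C X X'" "X \<in> Ob C" "X' \<in> Ob C" "Y \<in> Ob C" shows "H0 X' Y"
  unfolding H0_def
proof (intro allI impI)
  fix t assume t: "hm t X' Y"
  obtain f g where f: "hm f X X'" "hm g X' X" "f \<bullet> g = Idt C X'" using isomorphicE assms by metis
  have "t = t \<bullet> (f \<bullet> g)" unfolding f using t by (simp add: hm_iff)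
  also have "\<dots> = (t \<bullet> f) \<bullet> g" using t f by (simp add: hm_iff)
  also have "t \<bullet> f = zr X Y" using assms t f hm_cmp H0D by metis
  finally show "t = zr X' Y" using f t assms by (simp add: hm_iff)
qed

lemma H0_iso2: assumes "H0 X Y" "isomorphic C Y Y'" "X \<in> Ob C" "Y' \<in> Ob C" "Y \<in> Ob C" shows "H0 X Y'"
  unfolding H0_def
proof (intro allI impI)
  fix t assume t: "hm t X Y'"
  obtain f g where f: "hm f Y Y'" "hm g Y' Y" "f \<bullet> g = Idt C Y'" using isomorphicE assms by metis
  have "t = f \<bullet> (g \<bullet> t)" using t f(1,2) cmp_red[OF f(3), of t] by (simp add: hm_iff)
  also have "g \<bullet> t = zr X Y" using assms t f hm_cmp H0D by metis
  finally show "t = zr X Y'" using f t assms by (simp add: hm_iff)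
qed

lemma H0_sh: assumes "X \<in> Ob C" "Y \<in> Ob C" shows "H0 (sh X) (sh Y) \<longleftrightarrow> H0 X Y"
proof
  assume *: "H0 (sh X) (sh Y)"
  show "H0 X Y" unfolding H0_def
  proof (intro allI impI)
    fix t assume t: "hm t X Y"
    then have "shm t = shm (zr X Y)" using * shD(3) H0D assms by fastforce
    then show "t = zr X Y" by (rule sh_faithful[rotated 2]) (use t assms in \<open>auto simp: hm_iff\<close>)
  qed
next
  assume *: "H0 X Y"
  show "H0 (sh X) (sh Y)" unfolding H0_def
  proof (intro allI impI)
    fix t assume t: "hm t (sh X) (sh Y)"
    then obtain f where "hm f X Y" "shm f = t" using sh_full assms by blast
    then show "t = zr (sh X) (sh Y)" using H0D[OF * \<open>hm f X Y\<close>] assms by simp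
  qed
qed

lemma H0_from: assumes t: "tri C X Y Z f g h" and z: "H0 X T" "H0 Z T" shows "H0 Y T"
  unfolding H0_def
proof (intro allI impI)
  fix s assume s: "hm s Y T"
  have f: "hm f X Y" "hm g Y Z" using tri_hm t by blast+
  have "s \<bullet> f = zr X T" using z H0D s f hm_cmp by metis
  then obtain u where u: "hm u Z T" "u \<bullet> g = s" using exact_from t s by blast
  have "u = zr Z T" using H0D[OF z(2) u(1)] .
  then show "s = zr Y T" using f u(2) hm_Ob[OF u(1)] by (simp add: hm_iff)
qed

lemma H0_to: assumes t: "tri C X Y Z f g h" and z: "H0 T X" "H0 T Z" shows "H0 T Y"
  unfolding H0_def
proof (intro allI impI)
  fix s assume s: "hm s T Y"
  have f: "hm f X Y" "hm g Y Z" using tri_hm t by blast+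
  have "g \<bullet> s = zr T Z" using z H0D s f hm_cmp by metis
  then obtain u where u: "hm u T X" "f \<bullet> u = s" using exact_to t s by blast
  have "u = zr T X" using H0D[OF z(1) u(1)] .
  then show "s = zr T Y" using f u(2) hm_Ob[OF u(1)] by (simp add: hm_iff)
qed

lemma H0_zero: "zero_object C Z \<Longrightarrow> H0 Z X" "zero_object C Z \<Longrightarrow> H0 X Z"
  unfolding H0_def using zero_from zero_to by (auto simp: hm_iff)

lemma H0_self: "X \<in> Ob C \<Longrightarrow> H0 X X \<Longrightarrow> zero_object C X"
  unfolding zero_iff using H0D[of X X "Idt C X"] by (auto simp: hm_iff)

lemma shn_Ob [simp]: "X \<in> Ob C \<Longrightarrow> (fob (shift C) ^^ n) X \<in> Ob C" by (induct n) auto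

end

section \<open>Truncation and orthogonality\<close>

locale t_structure_category = triangulated_category K C
  for K :: "('k, 'r) ring_scheme" (structure) and C :: "('o, 'm, 'k, 'z) tri_cat_scheme" +
  fixes U V :: "'o set"
  assumes tstr: "t_structure C U V"
begin

abbreviation "U1 \<equiv> shifted C 1 U"

lemma UV_closed: "closed_subcategory C U" "closed_subcategory C V"
  using tstr unfolding t_structure_def by blast+

lemma closedD:
  assumes "closed_subcategory C W"
  shows "X \<in> W \<Longrightarrow> X \<in> Ob C" "X \<in> W \<Longrightarrow> isomorphic C X Y \<Longrightarrow> Y \<in> Ob C \<Longrightarrow> Y \<in> W"
    "Y \<in> W \<Longrightarrow> hm i X Y \<Longrightarrow> hm r Y X \<Longrightarrow> r \<bullet> i = Idt C X \<Longrightarrow> X \<in> W" "zero_object C X \<Longrightarrow> X \<in> W"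
proof -
  show "X \<in> W \<Longrightarrow> X \<in> Ob C" "X \<in> W \<Longrightarrow> isomorphic C X Y \<Longrightarrow> Y \<in> Ob C \<Longrightarrow> Y \<in> W" "zero_object C X \<Longrightarrow> X \<in> W"
    using assms unfolding closed_subcategory_def by (elim conjE, blast)+
  show "Y \<in> W \<Longrightarrow> hm i X Y \<Longrightarrow> hm r Y X \<Longrightarrow> r \<bullet> i = Idt C X \<Longrightarrow> X \<in> W"
    using assms unfolding closed_subcategory_def retract_of_def hm_def by (elim conjE) blast
qed

lemmas U_Ob = closedD(1)[OF UV_closed(1)] and V_Ob = closedD(1)[OF UV_closed(2)]
  and U_iso = closedD(2)[OF UV_closed(1)] and V_iso = closedD(2)[OF UV_closed(2)]
  and U_retract = closedD(3)[OF UV_closed(1)] and V_retract = closedD(3)[OF UV_closed(2)]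
  and U_zero = closedD(4)[OF UV_closed(1)] and V_zero = closedD(4)[OF UV_closed(2)]

lemma U1_iff: "X \<in> U1 \<longleftrightarrow> X \<in> Ob C \<and> (\<exists>A \<in> U. isomorphic C X (sh A))"
  by (simp add: shifted_def)

lemma U1_sh: "A \<in> U \<Longrightarrow> sh A \<in> U1" using U1_iff[of "sh A"] iso_refl[of "sh A"] U_Ob sh_Ob by blast

lemma U1_U: "X \<in> U1 \<Longrightarrow> X \<in> U" using tstr unfolding t_structure_def by blast

lemma U_sh: "X \<in> U \<Longrightarrow> sh X \<in> U" using U1_sh U1_U by blast

lemma U1V: assumes "X \<in> U1" "Y \<in> V" shows "H0 X Y"
proof -
  have "Mor C X Y = {\<zero>\<^bsub>Hom C X Y\<^esub>}" using tstr assms unfolding t_structure_def by blast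
  then show ?thesis by (auto simp: H0_def hm_def zr_def)
qed

lemma UV: "X \<in> U \<Longrightarrow> Y \<in> V \<Longrightarrow> H0 (sh X) Y" using U1V U1_sh by blast

lemma UVm: "X \<in> U \<Longrightarrow> sh Y \<in> V \<Longrightarrow> Y \<in> Ob C \<Longrightarrow> H0 X Y"
  using UV[of X "sh Y"] H0_sh U_Ob by blast

text \<open>Membership of B in V[-1] is recorded as B[1] in V, so that only the forward suspension
  occurs.\<close>

lemma trunc: assumes "X \<in> Ob C"
  shows "\<exists>A B f g h. A \<in> U \<and> B \<in> Ob C \<and> sh B \<in> V \<and> tri C A X B f g h"
proof -
  obtain A B f g h where *: "A \<in> U" "B \<in> shifted C (-1) V" "tri C A X B f g h"
    using tstr assms unfolding t_structure_def by meson
  then obtain D where "D \<in> V" "B \<in> Ob C" "isomorphic C (sh B) D" by (auto simp: shifted_def)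
  then have "sh B \<in> V" "B \<in> Ob C" using V_iso iso_sym V_Ob sh_Ob by metis+
  then show ?thesis using * by blast
qed

text \<open>The decomposition with U[1] and V in place of U and V[-1]: truncate a desuspension of X
  and suspend the triangle.\<close>

lemma trunc1: assumes X: "X \<in> Ob C"
  shows "\<exists>A B f g h. A \<in> U \<and> B \<in> V \<and> tri C (sh A) X B f g h"
proof -
  obtain X0 where X0: "X0 \<in> Ob C" "isomorphic C (sh X0) X" using sh_surj X by blast
  obtain A B f g h where *: "A \<in> U" "B \<in> Ob C" "sh B \<in> V" "tri C A X0 B f g h" using trunc X0 by blast
  obtain b b' where b: "hm b (sh X0) X" "hm b' X (sh X0)" "b' \<bullet> b = Idt C (sh X0)" "b \<bullet> b' = Idt C X"
    using X0 X isomorphicE sh_Ob by metis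
  have O: "A \<in> Ob C" using * U_Ob by blast
  have "\<exists>f g h. tri C (sh A) X (sh B) f g h"
    by (intro exI, rule tri_iso[OF tri_sh[OF *(4)] _ _ _ _ b, of "Idt C (sh A)" "sh A" "Idt C (sh A)" "Idt C (sh B)" "sh B" "Idt C (sh B)"])
      (use * O in \<open>simp_all add: hm_iff\<close>)
  then show ?thesis using * by blast
qed

text \<open>The arrow X -> B of the truncation triangle vanishes, so the identity of X factors
  through A, and X is a retract of an object of U. Closure of U, U[1] and V under extensions follows
  from such orthogonality criteria.\<close>

lemma U_orth: assumes X: "X \<in> Ob C" and H: "\<And>B. B \<in> Ob C \<Longrightarrow> sh B \<in> V \<Longrightarrow> H0 X B" shows "X \<in> U"
proof -
  obtain A B f g h where *: "A \<in> U" "B \<in> Ob C" "sh B \<in> V" "tri C A X B f g h" using trunc X by blast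
  have f: "hm f A X" "hm g X B" using tri_hm * by blast+
  then have "g = zr X B" using H H0D * by blast
  then obtain u where "hm u X A" "f \<bullet> u = Idt C X" using exact_to[OF *(4), of "Idt C X" X] X * by (auto simp: hm_iff)
  then show ?thesis using U_retract * f by blast
qed

lemma V_orth: assumes X: "X \<in> Ob C" and H: "\<And>A. A \<in> U \<Longrightarrow> H0 (sh A) X" shows "X \<in> V"
proof -
  obtain A B f g h where *: "A \<in> U" "B \<in> V" "tri C (sh A) X B f g h" using trunc1 X by blast
  have f: "hm f (sh A) X" "hm g X B" using tri_hm * by blast+
  then have "f = zr (sh A) X" using H H0D * by blast
  then obtain u where "hm u B X" "u \<bullet> g = Idt C X" using exact_from[OF *(3), of "Idt C X" X] X * U_Ob by (auto simp: hm_iff)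
  then show ?thesis using V_retract * f by blast
qed

lemma U1_orth: assumes X: "X \<in> Ob C" and H: "\<And>B. B \<in> V \<Longrightarrow> H0 X B" shows "X \<in> U1"
proof -
  obtain X0 where X0: "X0 \<in> Ob C" "isomorphic C (sh X0) X" using sh_surj X by blast
  have "X0 \<in> U"
  proof (rule U_orth[OF X0(1)])
    fix B assume B: "B \<in> Ob C" "sh B \<in> V"
    then have "H0 (sh X0) (sh B)" using H H0_iso1 iso_sym X X0 sh_Ob by metis
    then show "H0 X0 B" using H0_sh B X0 by blast
  qed
  then show ?thesis using U1_iff X X0 iso_sym sh_Ob by metis
qed

lemma U_ext: "tri C X Y Z f g h \<Longrightarrow> X \<in> U \<Longrightarrow> Z \<in> U \<Longrightarrow> Y \<in> U"
  using U_orth H0_from UVm tri_hm(2) hm_Ob(1) by metis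

lemma V_ext: "tri C X Y Z f g h \<Longrightarrow> X \<in> V \<Longrightarrow> Z \<in> V \<Longrightarrow> Y \<in> V"
  using V_orth H0_to UV tri_hm(2) hm_Ob(1) by metis

lemma U1_ext: "tri C X Y Z f g h \<Longrightarrow> X \<in> U1 \<Longrightarrow> Z \<in> U1 \<Longrightarrow> Y \<in> U1"
  using U1_orth H0_from U1V tri_hm(2) hm_Ob(1) by metis

lemma V_unsh: "sh B \<in> V \<Longrightarrow> B \<in> Ob C \<Longrightarrow> B \<in> V"
  using V_orth UVm U_sh by metis

end

section \<open>The heart\<close>

text \<open>What is used of the abelian heart, with \<open>surj\<close> the class of arrows whose cone lies in \<open>U[1]\<close>.\<close>

locale site = linear_category K C
  for K :: "('k, 'r) ring_scheme" (structure) and C :: "('o, 'm, 'k, 'z) lin_cat_scheme" +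
  fixes surj :: "'m \<Rightarrow> bool"
  assumes site_zero: "\<exists>Z. zero_object C Z"
    and site_biproduct: "\<lbrakk>X \<in> Ob C; Y \<in> Ob C\<rbrakk> \<Longrightarrow> \<exists>S i j p q. biproduct C X Y S i j p q"
    and surj_arr [simp]: "surj e \<Longrightarrow> arr e"
    and surj_iso: "\<lbrakk>hm f X Y; hm g Y X; g \<cdot>\<^bsub>C\<^esub> f = Idt C X; f \<cdot>\<^bsub>C\<^esub> g = Idt C Y\<rbrakk> \<Longrightarrow> surj f"
    and surj_comp: "\<lbrakk>surj e; surj e'; dm e' = cd e\<rbrakk> \<Longrightarrow> surj (e' \<cdot>\<^bsub>C\<^esub> e)"
    and surj_pull: "\<lbrakk>surj e; arr t; cd t = cd e\<rbrakk> \<Longrightarrow> \<exists>e' t'. surj e' \<and> arr t' \<and> cd e' = dm t \<and>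
          dm t' = dm e' \<and> cd t' = dm e \<and> t \<cdot>\<^bsub>C\<^esub> e' = e \<cdot>\<^bsub>C\<^esub> t'"
    and surj_epi: "\<lbrakk>surj e; arr g; dm g = cd e; g \<cdot>\<^bsub>C\<^esub> e = zr (dm e) (cd g)\<rbrakk> \<Longrightarrow> g = zr (cd e) (cd g)"
    and kernel_exists: "arr f \<Longrightarrow> \<exists>Z i. is_kernel C (dm f) (cd f) f Z i"
    and cokernel_exists: "arr c \<Longrightarrow> \<exists>Q p. is_cokernel C (dm c) (cd c) c Q p \<and> surj p \<and>
          (\<forall>t. arr t \<and> cd t = cd c \<and> p \<cdot>\<^bsub>C\<^esub> t = zr (dm t) Q \<longrightarrow>
            (\<exists>e x. surj e \<and> cd e = dm t \<and> arr x \<and> dm x = dm e \<and> cd x = dm c \<and> t \<cdot>\<^bsub>C\<^esub> e = c \<cdot>\<^bsub>C\<^esub> x))"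
    and mono_surj_iso: "\<lbrakk>arr h; \<And>t. arr t \<Longrightarrow> cd t = dm h \<Longrightarrow> h \<cdot>\<^bsub>C\<^esub> t = zr (dm t) (cd h) \<Longrightarrow> t = zr (dm t) (dm h);
          arr l; cd l = dm h; surj (h \<cdot>\<^bsub>C\<^esub> l)\<rbrakk> \<Longrightarrow> iso_arrow C (dm h) (cd h) h"

section \<open>Fibres, and arrows that are monic or epic against given objects\<close>

context triangulated_category
begin

text \<open>After two rotations X[1] sits between Z and Y[1]; arrows T -> X are tested one
  suspension up.\<close>

lemma H0_fib: assumes t: "tri C X Y Z f g h" and z: "H0 T Y" "H0 (sh T) Z" and T: "T \<in> Ob C" shows "H0 T X"
proof -
  have "tri C Z (sh X) (sh Y) h (mn (shm f)) (mn (shm g))" using tri_rot tri_rot t by blast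
  moreover have "X \<in> Ob C" "Y \<in> Ob C" using tri_hm(1)[OF t] hm_Ob by blast+
  ultimately show ?thesis using H0_to[of Z "sh X" "sh Y" _ _ _ "sh T"] H0_sh z T by blast
qed

text \<open>If f v = 0 then v factors through Z[-1], from which T is separated. The argument runs
  one suspension higher, where v[1] factors through h by an arrow T[1] -> Z.\<close>

lemma mono_lemma:
  assumes t: "tri C X Y Z f g h" and z: "H0 (sh T) Z" and v: "hm v T X" "f \<bullet> v = zr T Y"
  shows "v = zr T X"
proof -
  have f: "hm f X Y" "hm g Y Z" "hm h Z (sh X)" using tri_hm t by blast+
  have O: "T \<in> Ob C" "X \<in> Ob C" "Y \<in> Ob C" using v f hm_Ob by blast+
  have sf: "hm (shm f) (sh X) (sh Y)" "hm (shm v) (sh T) (sh X)" using f v shD(3) by blast+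
  have "shm f \<bullet> shm v = shm (f \<bullet> v)" using v(1) f by (simp add: shm_cmp hm_iff)
  also have "\<dots> = zr (sh T) (sh Y)" unfolding v(2) using O by simp
  finally have "mn (shm f) \<bullet> shm v = zr (sh T) (sh Y)" using sf O by (simp add: hm_iff)
  then obtain s where s: "hm s (sh T) Z" "h \<bullet> s = shm v"
    using exact_to2[OF tri_rot[OF t], of "shm v" "sh T"] sf by blast
  have "s = zr (sh T) Z" using H0D z s by blast
  then have "shm v = shm (zr T X)" using s(2) f hm_Ob[OF s(1)] O by (simp add: hm_iff)
  then show ?thesis by (rule sh_faithful[rotated 2]) (use v O in \<open>auto simp: hm_iff\<close>)
qed

lemma epi_lemma:
  assumes t: "tri C X Y Z f g h" and z: "H0 (sh X) T" and v: "hm v Z T" "v \<bullet> g = zr Y T"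
  shows "v = zr Z T"
proof -
  have f: "hm f X Y" "hm g Y Z" "hm h Z (sh X)" using tri_hm t by blast+
  obtain s where s: "hm s (sh X) T" "s \<bullet> h = v" using exact_from2[OF t v] by blast
  have "s = zr (sh X) T" using H0D z s by blast
  then show ?thesis using s(2) f hm_Ob[OF s(1)] by (simp add: hm_iff)
qed

lemma tri_unsh:
  assumes t: "tri C (sh X) (sh Y) (sh Z) u v z" and O: "X \<in> Ob C" "Y \<in> Ob C" "Z \<in> Ob C"
  shows "\<exists>f g h. mn (shm f) = u \<and> tri C X Y Z f g h"
proof -
  have f: "hm u (sh X) (sh Y)" "hm v (sh Y) (sh Z)" "hm z (sh Z) (sh (sh X))" using tri_hm t by blast+
  have f': "hm (mn u) (sh X) (sh Y)" "hm (mn v) (sh Y) (sh Z)" "hm (mn z) (sh Z) (sh (sh X))"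
    using f by (auto simp: hm_iff)
  obtain x y w where x: "hm x X Y" "shm x = mn u" "hm y Y Z" "shm y = mn v" "hm w Z (sh X)" "shm w = mn z"
    using sh_full f' O sh_Ob by metis
  have *: "mn (shm x) = u" "mn (shm y) = v" "mn (shm w) = z" unfolding x using f by (auto simp: hm_iff)
  have "hm (shm x) (sh X) (sh Y)" "hm (shm y) (sh Y) (sh Z)" using x shD(3) by blast+
  then have "hm (mn (shm x)) (sh X) (sh Y)" "hm (mn (shm y)) (sh Y) (sh Z)" by (auto simp: hm_iff)
  then have "tri C X Y Z x y w \<longleftrightarrow> tri C (sh X) (sh Y) (sh Z) (mn (shm x)) (mn (shm y)) (mn (shm w))"
    using tri_rot_iff x by metis
  then show ?thesis using * t by blast
qed

lemma tri_unrot: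
  assumes t: "tri C Y Z (sh X) g h k" and O: "X \<in> Ob C"
  shows "\<exists>f. tri C X Y Z f g h"
proof -
  have f: "hm g Y Z" "hm h Z (sh X)" "hm k (sh X) (sh Y)" using tri_hm t by blast+
  then have "hm (mn k) (sh X) (sh Y)" by (auto simp: hm_iff)
  then obtain r where r: "hm r X Y" "shm r = mn k" using sh_full O f hm_Ob by metis
  then have "mn (shm r) = k" using f by (simp add: hm_iff)
  then show ?thesis using tri_rot_iff[of r X Y g Z h] r f t by auto
qed

end

section \<open>Short exact sequences, kernels and cokernels in the heart\<close>

context t_structure_category
begin

abbreviation "\<H> \<equiv> U \<inter> V"

lemma V_fib: "tri C X Y Z f g h \<Longrightarrow> Y \<in> V \<Longrightarrow> Z \<in> V \<Longrightarrow> X \<in> V"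
  using V_orth H0_fib UV U_sh U_Ob sh_Ob tri_hm(1) hm_Ob(1) by metis

lemma U_cone: "tri C X Y Z f g h \<Longrightarrow> X \<in> U \<Longrightarrow> Y \<in> U \<Longrightarrow> Z \<in> U"
  using U_ext tri_rot U_sh by metis

lemma sh_U1: assumes "sh X \<in> U1" "X \<in> Ob C" shows "X \<in> U"
proof -
  obtain A where "A \<in> U" "isomorphic C (sh X) (sh A)" using U1_iff assms by blast
  then show ?thesis using sh_iso_rev U_iso iso_sym U_Ob assms by metis
qed

text \<open>Triangles with all three vertices in the heart are its short exact sequences, so these
  are the epimorphisms of the heart, with N the kernel.\<close>

definition surjH :: "'m \<Rightarrow> bool" where
  "surjH e \<longleftrightarrow> (\<exists>N X Y k w. tri C N X Y k e w \<and> N \<in> \<H> \<and> X \<in> \<H> \<and> Y \<in> \<H>)"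

lemma surjHE: assumes "surjH e" "hm e X Y"
  obtains N k w where "tri C N X Y k e w" "N \<in> \<H>" "X \<in> \<H>" "Y \<in> \<H>"
  using assms unfolding surjH_def using tri_hm(2) hm_unique by metis

lemma surjH_iso:
  assumes "hm f X Y" "hm g Y X" "g \<bullet> f = Idt C X" "f \<bullet> g = Idt C Y" and X: "X \<in> \<H>" "Y \<in> \<H>"
  shows "surjH f"
proof -
  obtain Zo where Zo: "zero_object C Zo" using zero_object_exists by blast
  have O: "X \<in> Ob C" "Zo \<in> Ob C" using X U_Ob Zo zero_iff by blast+
  have "tri C Zo X Y (Idt C X \<bullet> (zr Zo X \<bullet> Idt C Zo)) (f \<bullet> (Idt C X \<bullet> Idt C X)) (shm (Idt C Zo) \<bullet> (zr X (sh Zo) \<bullet> g))"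
    by (rule tri_iso[OF tri_id2[OF O(1) Zo] _ _ _ _ _ _ _ _ assms(1-4)]) (use O in \<open>auto simp: hm_iff\<close>)
  moreover have "f \<bullet> (Idt C X \<bullet> Idt C X) = f" using assms by (auto simp: hm_iff)
  moreover have "Zo \<in> \<H>" using Zo U_zero V_zero by blast
  ultimately show ?thesis unfolding surjH_def using X by metis
qed

text \<open>By the octahedral axiom for the rotated triangles, M[1] is an extension of N'[1] by
  N[1], so the fibre M of the composite lies in U. As the fibre of an arrow between objects of V it
  lies in V.\<close>

lemma surjH_comp: assumes "surjH e" "surjH e'" "hm e X Y" "hm e' Y Z" shows "surjH (e' \<bullet> e)"
proof -
  obtain N k w where 1: "tri C N X Y k e w" "N \<in> \<H>" "X \<in> \<H>" "Y \<in> \<H>" using surjHE assms by metis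
  obtain N' k' w' where 2: "tri C N' Y Z k' e' w'" "N' \<in> \<H>" "Y \<in> \<H>" "Z \<in> \<H>" using surjHE assms by metis
  obtain M m n where 3: "tri C M X Z m (e' \<bullet> e) n" using mk_fiber[OF hm_cmp[OF assms(3,4)]] by blast
  obtain u v z where t: "tri C (sh N) (sh M) (sh N') u v z"
    using TR4[OF tri_rot[OF 1(1)] tri_rot[OF 2(1)] tri_rot[OF 3(1)]] by blast
  have M: "M \<in> Ob C" using hm_Ob[OF tri_hm(1)[OF 3]] by blast
  have "sh M \<in> U1" using U1_ext[OF t] U1_sh 1 2 by blast
  then have "M \<in> U" using sh_U1 M by blast
  moreover have "M \<in> V" using V_fib[OF 3] 1 2 by blast
  ultimately show ?thesis unfolding surjH_def using 1 2 3 by blast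
qed

text \<open>Precomposing the connecting arrow w : Y -> N[1] with t defines an extension P of T by
  the same kernel N, and its projection is the wanted covering.\<close>

lemma surjH_pull: assumes "surjH e" "hm e X Y" "hm t T Y" "T \<in> \<H>"
  shows "\<exists>P e' t'. P \<in> \<H> \<and> surjH e' \<and> hm e' P T \<and> hm t' P X \<and> t \<bullet> e' = e \<bullet> t'"
proof -
  obtain N k w where 1: "tri C N X Y k e w" "N \<in> \<H>" "X \<in> \<H>" "Y \<in> \<H>" using surjHE assms by metis
  have w: "hm w Y (sh N)" using 1 tri_hm by blast
  obtain P a b where 2: "tri C N P T a b (w \<bullet> t)" using mk_mid[OF hm_cmp[OF assms(3) w]] U_Ob 1 by blast
  have b: "hm b P T" using tri_hm 2 by blast
  have P: "P \<in> \<H>" using U_ext[OF 2] V_ext[OF 2] 1 assms by blast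
  have "w \<bullet> (t \<bullet> b) = w \<bullet> t \<bullet> b" using b w assms by (simp add: hm_iff)
  also have "\<dots> = zr P (sh N)" using tri_comp[OF tri_rot[OF 2]] .
  finally obtain u where "hm u P X" "e \<bullet> u = t \<bullet> b" using exact_to2[OF 1(1) hm_cmp[OF b assms(3)]] by blast
  moreover have "surjH b" unfolding surjH_def using 1 2 P assms by blast
  ultimately show ?thesis using P b by metis
qed

lemma surjH_epi: assumes "surjH e" "hm e X Y" "hm g Y T" "T \<in> \<H>" "g \<bullet> e = zr X T" shows "g = zr Y T"
proof -
  obtain N k w where 1: "tri C N X Y k e w" "N \<in> \<H>" "X \<in> \<H>" "Y \<in> \<H>" using surjHE assms by metis
  then show ?thesis using epi_lemma[OF 1(1) _ assms(3,5)] UV assms by blast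
qed

text \<open>For the kernel k of h l, h (l k) = 0 and h monic give l k = 0, so l = g (h l) for some
  g. Then h g = 1 by cancelling the epimorphism h l, and g h = 1 by cancelling h.\<close>

lemma mono_surjH_iso:
  assumes h: "hm h X Y" "X \<in> \<H>" "Y \<in> \<H>"
    and mono: "\<And>T t. T \<in> \<H> \<Longrightarrow> hm t T X \<Longrightarrow> h \<bullet> t = zr T Y \<Longrightarrow> t = zr T X"
    and l: "hm l T X" "surjH (h \<bullet> l)"
  shows "\<exists>g. hm g Y X \<and> g \<bullet> h = Idt C X \<and> h \<bullet> g = Idt C Y"
proof -
  note e = hm_cmp[OF l(1) h(1)]
  obtain N k w where 1: "tri C N T Y k (h \<bullet> l) w" "N \<in> \<H>" "T \<in> \<H>" "Y \<in> \<H>" using surjHE[OF l(2) e] by metis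
  have k: "hm k N T" using tri_hm 1 by blast
  have "h \<bullet> (l \<bullet> k) = zr N Y" using tri_comp[OF 1(1)] h l k by (simp add: hm_iff)
  then have "l \<bullet> k = zr N X" using mono[OF 1(2) hm_cmp[OF k l(1)]] by blast
  then obtain g where g: "hm g Y X" "g \<bullet> (h \<bullet> l) = l" using exact_from[OF 1(1) l(1)] by blast
  have O: "X \<in> Ob C" "Y \<in> Ob C" using h hm_Ob by blast+
  define d where "d = h \<bullet> g \<boxplus> mn (Idt C Y)"
  have hg: "h \<bullet> (g \<bullet> (h \<bullet> l)) = h \<bullet> l" unfolding g(2) ..
  have d: "hm d Y Y" using h g(1) O by (simp add: d_def hm_iff)
  have "d \<bullet> (h \<bullet> l) = h \<bullet> (g \<bullet> (h \<bullet> l)) \<boxplus> mn (h \<bullet> l)"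
    unfolding d_def using h g(1) l O by (simp add: hm_iff)
  also have "\<dots> = zr T Y" unfolding hg using h l by (simp add: hm_iff)
  finally have "d = zr Y Y" using surjH_epi[OF l(2) e d] 1 by blast
  then have hg: "h \<bullet> g = Idt C Y" unfolding d_def by (rule diff_eq) (use h g(1) O in \<open>auto simp: hm_iff\<close>)
  define c where "c = g \<bullet> h \<boxplus> mn (Idt C X)"
  have c: "hm c X X" using h g(1) O by (simp add: c_def hm_iff)
  have "h \<bullet> c = h \<bullet> (g \<bullet> h) \<boxplus> mn h"
    unfolding c_def using h g(1) O by (simp add: hm_iff)
  also have "\<dots> = zr X Y" using cmp_red[OF hg, of h] h g(1) by (simp add: hm_iff)
  finally have "c = zr X X" using mono[OF h(2) c] by blast
  then have "g \<bullet> h = Idt C X" unfolding c_def by (rule diff_eq) (use h g(1) O in \<open>auto simp: hm_iff\<close>)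
  then show ?thesis using g hg by blast
qed

text \<open>The fibre F of f lies in V but need not lie in U; its truncation A to U is the kernel.
  Arrows from the heart to F lift to A because they cannot reach B in V[-1], and both A -> F and F
  -> X are monic against the heart.\<close>

lemma kernelH: assumes f: "hm f X Y" "X \<in> \<H>" "Y \<in> \<H>"
  shows "\<exists>Z i. Z \<in> \<H> \<and> hm i Z X \<and> f \<bullet> i = zr Z Y \<and>
     (\<forall>T \<in> \<H>. \<forall>t. hm t T X \<longrightarrow> f \<bullet> t = zr T Y \<longrightarrow> (\<exists>v. hm v T Z \<and> i \<bullet> v = t)) \<and>
     (\<forall>T \<in> \<H>. \<forall>v. hm v T Z \<longrightarrow> i \<bullet> v = zr T X \<longrightarrow> v = zr T Z)"
proof -
  obtain F \<phi> w where F: "tri C F X Y \<phi> f w" using mk_fiber f by blast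
  have p: "hm \<phi> F X" using tri_hm F by blast
  then obtain A B a b c where A: "A \<in> U" "B \<in> Ob C" "sh B \<in> V" "tri C A F B a b c" using trunc hm_Ob by meson
  have a: "hm a A F" "hm b F B" using tri_hm A by blast+
  have BV: "B \<in> V" using V_unsh A by blast
  have "F \<in> V" using V_fib[OF F] f by blast
  then have AV: "A \<in> V" using V_fib[OF A(4)] BV by blast
  have "f \<bullet> (\<phi> \<bullet> a) = zr F Y \<bullet> a" using tri_comp[OF F] cmp_red[of f \<phi> _ a] f p a by (simp add: hm_iff)
  then have fi: "f \<bullet> (\<phi> \<bullet> a) = zr A Y" using a hm_Ob[OF f(1)] by (simp add: hm_iff)
  have 1: "\<exists>v. hm v T A \<and> \<phi> \<bullet> a \<bullet> v = t" if T: "T \<in> \<H>" "hm t T X" "f \<bullet> t = zr T Y" for T t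
  proof -
    obtain u where u: "hm u T F" "\<phi> \<bullet> u = t" using exact_to[OF F T(2,3)] by blast
    have "b \<bullet> u = zr T B" using H0D UVm A hm_cmp u a T by blast
    then obtain v where v: "hm v T A" "a \<bullet> v = u" using exact_to[OF A(4)] u by blast
    have "\<phi> \<bullet> a \<bullet> v = \<phi> \<bullet> (a \<bullet> v)" using v(1) p a by (simp add: hm_iff)
    then show ?thesis using v u by auto
  qed
  have 2: "v = zr T A" if "T \<in> \<H>" "hm v T A" "\<phi> \<bullet> a \<bullet> v = zr T X" for T v
  proof -
    have "\<phi> \<bullet> (a \<bullet> v) = zr T X" using that p a by (simp add: hm_iff)
    then have "a \<bullet> v = zr T F" using mono_lemma[OF F _ hm_cmp[OF that(2) a(1)]] UV f that by blast
    then show ?thesis using mono_lemma[OF A(4) _ that(2)] UV BV that by blast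
  qed
  show ?thesis using fi 1 2 A AV hm_cmp[OF a(1) p] by blast
qed

text \<open>Dually the cokernel B is the truncation to V of the cone D. The last clause, that arrows
  killed by p come locally from X, holds because X maps onto the image of c.\<close>

lemma cokernelH: assumes c: "hm c X Z" "X \<in> \<H>" "Z \<in> \<H>"
  shows "\<exists>B p. B \<in> \<H> \<and> hm p Z B \<and> p \<bullet> c = zr X B \<and> surjH p \<and>
     (\<forall>T \<in> \<H>. \<forall>t. hm t Z T \<longrightarrow> t \<bullet> c = zr X T \<longrightarrow> (\<exists>v. hm v B T \<and> v \<bullet> p = t)) \<and>
     (\<forall>T \<in> \<H>. \<forall>t. hm t T Z \<longrightarrow> p \<bullet> t = zr T B \<longrightarrow>
       (\<exists>P e x. P \<in> \<H> \<and> surjH e \<and> hm e P T \<and> hm x P X \<and> t \<bullet> e = c \<bullet> x))"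
proof -
  obtain D j d where D: "tri C X Z D c j d" using mk_cone c by blast
  have j: "hm j Z D" "hm d D (sh X)" using tri_hm D by blast+
  then obtain A B a b w where A: "A \<in> U" "B \<in> V" "tri C (sh A) D B a b w" using trunc1 hm_Ob by meson
  have a: "hm a (sh A) D" "hm b D B" using tri_hm A by blast+
  have AO: "A \<in> Ob C" using A U_Ob by blast
  have "D \<in> U" using U_cone[OF D] c by blast
  then have BU: "B \<in> U" using U_cone[OF A(3)] A U_sh by blast
  define p where "p = b \<bullet> j"
  have p: "hm p Z B" unfolding p_def using a j hm_cmp by blast
  have pc: "p \<bullet> c = zr X B" unfolding p_def using tri_comp[OF D] c j a hm_Ob[OF c(1)] by (simp add: hm_iff)
  \<comment> \<open>I, the fibre of p, is the image of c up to sign.\<close>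
  obtain I m n where I: "tri C I Z B m p n" using mk_fiber p by blast
  have m: "hm m I Z" using tri_hm I by blast
  have IO: "I \<in> Ob C" using m hm_Ob by blast
  \<comment> \<open>The octahedron over p = b j shows that X -> I has fibre A; it is an epimorphism
    of the heart once A and I are seen to lie there.\<close>
  obtain u v where t: "tri C (sh X) (sh I) (sh (sh A)) u v (shm d \<bullet> mn (shm a))" and u: "mn (shm m) \<bullet> u = mn (shm c)"
    using TR4[OF tri_rot[OF D] tri_rot[OF A(3)] tri_rot[OF I, unfolded p_def]] by blast
  have "sh I \<in> U1" using U1_ext[OF t] U1_sh U_sh A c by blast
  then have IU: "I \<in> U" using sh_U1 IO by blast
  have IV: "I \<in> V" using V_fib[OF I] c A by blast
  have surj: "surjH p" unfolding surjH_def using I IU IV c A BU by blast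
  obtain x0 v' z' where x0: "mn (shm x0) = u" "tri C X I (sh A) x0 v' z'"
    using tri_unsh[OF t hm_Ob(1)[OF c(1)] IO sh_Ob[OF AO]] by blast
  obtain r where r: "tri C A X I r x0 v'" using tri_unrot[OF x0(2)] AO by blast
  have xx: "hm x0 X I" using tri_hm r by blast
  have "A \<in> V" using V_fib[OF r] c IV by blast
  then have sx: "surjH x0" unfolding surjH_def using r A IU IV c by blast
  \<comment> \<open>Desuspending the triangle costs a sign, so m x0 = -c; the sign reappears as -x
    in the local lift.\<close>
  have "shm (m \<bullet> x0) = mn (shm c)" using u x0(1)[symmetric] m xx by (simp add: hm_iff shm_cmp)
  also have "\<dots> = shm (mn c)"
  proof (rule mn_unique[symmetric])
    have "shm c \<boxplus> shm (mn c) = shm (c \<boxplus> mn c)"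
      by (rule shD(5)[symmetric]) (use c in \<open>auto simp: hm_iff\<close>)
    then show "shm c \<boxplus> shm (mn c) = zr (dm (shm c)) (cd (shm c))" using c hm_Ob[OF c(1)] by (simp add: hm_iff)
  qed (use c in \<open>auto simp: hm_iff\<close>)
  finally have cm: "m \<bullet> x0 = mn c" by (rule sh_faithful[rotated 2]) (use c m xx in \<open>auto simp: hm_iff\<close>)
  have 1: "\<exists>v. hm v B T \<and> v \<bullet> p = t" if T: "T \<in> \<H>" "hm t Z T" "t \<bullet> c = zr X T" for T t
  proof -
    obtain u where u: "hm u D T" "u \<bullet> j = t" using exact_from[OF D T(2,3)] by blast
    have "u \<bullet> a = zr (sh A) T" using H0D UV A hm_cmp u a T by blast
    then obtain v where v: "hm v B T" "v \<bullet> b = u" using exact_from[OF A(3)] u by blast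
    have "v \<bullet> p = v \<bullet> b \<bullet> j" unfolding p_def using v(1) j a by (simp add: hm_iff)
    then show ?thesis using v u by auto
  qed
  have 2: "\<exists>P e x. P \<in> \<H> \<and> surjH e \<and> hm e P T \<and> hm x P X \<and> t \<bullet> e = c \<bullet> x"
    if T: "T \<in> \<H>" "hm t T Z" "p \<bullet> t = zr T B" for T t
  proof -
    obtain s where s: "hm s T I" "m \<bullet> s = t" using exact_to[OF I T(2,3)] by blast
    obtain P e x where e: "P \<in> \<H>" "surjH e" "hm e P T" "hm x P X" "s \<bullet> e = x0 \<bullet> x"
      using surjH_pull[OF sx xx s(1) T(1)] by blast
    have "t \<bullet> e = m \<bullet> (s \<bullet> e)" using s(2)[symmetric] s(1) m e by (simp add: hm_iff)
    also have "\<dots> = m \<bullet> x0 \<bullet> x" unfolding e(5) using xx m e(4) by (simp add: hm_iff)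
    also have "\<dots> = c \<bullet> mn x" unfolding cm using e(4) c by (simp add: hm_iff)
    finally have "t \<bullet> e = c \<bullet> mn x" .
    moreover have "hm (mn x) P X" using e by (simp add: hm_iff)
    ultimately show ?thesis using e by blast
  qed
  show ?thesis using p pc surj 1 2 A BU by blast
qed

section \<open>The heart as a linear category with a class of epimorphisms\<close>

definition "\<A> = heart C U V"

lemma heart_simps: "Ob \<A> = \<H>" "Hom \<A> = Hom C" "Idt \<A> = Idt C" "Cmp \<A> = Cmp C"
  by (simp_all add: \<A>_def heart_def full_subcategory_def)

lemma H_Ob: "X \<in> \<H> \<Longrightarrow> X \<in> Ob C" using U_Ob by blast

lemma heart_linear: "linear_category K \<A>"
proof (intro linear_category.intro linear_category_axioms.intro, unfold heart_simps, goal_cases)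
  case 1 show ?case by (rule field_axioms)
next
  case (2 X Y) then show ?case by (intro Hom_module H_Ob)
next
  case (3 X Y X' Y' f) then show ?case using Hom_disjoint[OF H_Ob H_Ob H_Ob H_Ob, of X Y X' Y' f] by blast
next
  case (4 X) then show ?case using Idt_closed[of X] H_Ob by blast
next
  case (5 X Y Z f g) then show ?case using Cmp_closed[of X Y Z f g] H_Ob by blast
next
  case (6 X Y f) then show ?case using Cmp_Idt_right[of X Y f] H_Ob by blast
next
  case (7 X Y f) then show ?case using Cmp_Idt_left[of X Y f] H_Ob by blast
next
  case (8 W X Y Z f g h) then show ?case using Cmp_assoc[of W X Y Z f g h] H_Ob by blast
next
  case (9 X Y Z f g g') then show ?case using Cmp_add_left[of X Y Z f g g'] H_Ob by blast
next
  case (10 X Y Z f f' g) then show ?case using Cmp_add_right[of X Y Z f f' g] H_Ob by blast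
next
  case (11 X Y Z c f g) then show ?case using Cmp_smult_left[of X Y Z c f g] H_Ob by blast
next
  case (12 X Y Z c f g) then show ?case using Cmp_smult_right[of X Y Z c f g] H_Ob by blast
qed

sublocale H: linear_category K \<A> by (rule heart_linear)

lemma H_hm: "H.hm f X Y \<longleftrightarrow> X \<in> \<H> \<and> Y \<in> \<H> \<and> hm f X Y"
  unfolding H.hm_def hm_def heart_simps using H_Ob by auto

lemma H_arr: "H.arr f \<longleftrightarrow> arr f \<and> dm f \<in> \<H> \<and> cd f \<in> \<H>"
  unfolding H.arr_def H_hm hm_iff by blast

lemma H_zr: "H.zr X Y = zr X Y"
  unfolding H.zr_def zr_def heart_simps ..

lemma surjH_H: "surjH e \<Longrightarrow> \<exists>X Y. X \<in> \<H> \<and> Y \<in> \<H> \<and> hm e X Y"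
  unfolding surjH_def using tri_hm(2) by blast

text \<open>Uniqueness in the universal properties comes from cancelling differences: by the monic
  clause of \<open>kernelH\<close> for kernels, by \<open>surjH_epi\<close> for cokernels.\<close>

lemma heart_site: "site K \<A> surjH"
proof (unfold_locales, goal_cases)
  case 1
  obtain Zo where "zero_object C Zo" using zero_object_exists by blast
  then have "zero_object \<A> Zo" unfolding zero_object_def heart_simps using U_zero V_zero H_Ob
    by (metis \<open>zero_object C Zo\<close> IntI)
  then show ?case by blast
next
  case (2 X Y)
  then have X: "X \<in> \<H>" "Y \<in> \<H>" by (auto simp: heart_simps)
  then obtain S i j p q where S: "biproduct C X Y S i j p q" using biproduct_exists H_Ob by meson
  then have "S \<in> \<H>" using X UV_closed unfolding closed_subcategory_def by blast
  then have "biproduct \<A> X Y S i j p q" using S unfolding biproduct_def heart_simps by auto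
  then show ?case by blast
next
  case (3 e) then show ?case using surjH_H H_arr hm_iff by metis
next
  case (4 f X Y g) then show ?case using surjH_iso[of f X Y g] by (auto simp: H_hm heart_simps)
next
  case (5 e e')
  then obtain X Y X' Y' where "hm e X Y" "hm e' X' Y'" "X \<in> \<H>" "Y \<in> \<H>" "X' \<in> \<H>" "Y' \<in> \<H>" using surjH_H by metis
  moreover have "Y = X'" using calculation 5 by (metis H.hm_iff H_hm)
  ultimately show ?case using surjH_comp 5 heart_simps by metis
next
  case (6 e t)
  then obtain X Y where e: "hm e X Y" "X \<in> \<H>" "Y \<in> \<H>" using surjH_H by metis
  then have "H.hm e X Y" by (simp add: H_hm)
  then have e': "H.dm e = X" "H.cd e = Y" by (auto simp: H.hm_iff)
  have "H.hm t (H.dm t) Y" using 6 e' by (auto simp: H.hm_iff)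
  then have t: "hm t (H.dm t) Y" "H.dm t \<in> \<H>" using H_hm by auto
  obtain P f g where "P \<in> \<H>" "surjH f" "hm f P (H.dm t)" "hm g P X" "t \<bullet> f = e \<bullet> g"
    using surjH_pull[OF 6(1) e(1) t] by blast
  moreover have "H.hm f P (H.dm t)" "H.hm g P X" using calculation t e H_hm by blast+
  ultimately show ?case using e' by (metis H.hm_iff heart_simps(4))
next
  case (7 e g)
  then obtain X Y where e: "hm e X Y" "X \<in> \<H>" "Y \<in> \<H>" using surjH_H by metis
  then have "H.hm e X Y" by (simp add: H_hm)
  then have e': "H.dm e = X" "H.cd e = Y" by (auto simp: H.hm_iff)
  have "H.hm g Y (H.cd g)" using 7 e' by (auto simp: H.hm_iff)
  then have "hm g Y (H.cd g)" "H.cd g \<in> \<H>" using H_hm by auto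
  then show ?case using surjH_epi[OF 7(1) e(1)] 7(4) e' by (simp add: H_zr heart_simps)
next
  case (8 f)
  then have f: "H.hm f (H.dm f) (H.cd f)" by (simp add: H.hm_iff)
  let ?X = "H.dm f" and ?Y = "H.cd f"
  have f: "hm f ?X ?Y" "?X \<in> \<H>" "?Y \<in> \<H>" using f by (auto simp: H_hm)
  obtain Z i where Z: "Z \<in> \<H>" "hm i Z ?X" "f \<bullet> i = zr Z ?Y"
     and ex: "\<forall>T \<in> \<H>. \<forall>t. hm t T ?X \<longrightarrow> f \<bullet> t = zr T ?Y \<longrightarrow> (\<exists>v. hm v T Z \<and> i \<bullet> v = t)"
     and un: "\<forall>T \<in> \<H>. \<forall>v. hm v T Z \<longrightarrow> i \<bullet> v = zr T ?X \<longrightarrow> v = zr T Z"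
    using kernelH[OF f] by blast
  have un': "v = v'" if "T \<in> \<H>" "hm v T Z" "hm v' T Z" "i \<bullet> v = i \<bullet> v'" for T v v'
  proof -
    have "i \<bullet> (v \<boxplus> mn v') = zr T ?X" using that Z by (simp add: hm_iff)
    then have "v \<boxplus> mn v' = zr T Z" using un that by (simp add: hm_iff)
    then show ?thesis by (rule diff_eq) (use that in \<open>auto simp: hm_iff\<close>)
  qed
  have "is_kernel \<A> ?X ?Y f Z i"
    unfolding is_kernel_def heart_simps
  proof (intro conjI ballI impI)
    fix T t assume t: "T \<in> \<H>" "t \<in> Mor C T ?X" "f \<bullet> t = \<zero>\<^bsub>Hom C T ?Y\<^esub>"
    then have "hm t T ?X" "f \<bullet> t = zr T ?Y" using H_Ob f by (auto simp: hm_def zr_def)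
    then obtain v where v: "hm v T Z" "i \<bullet> v = t" using ex t by blast
    show "\<exists>!u. u \<in> Mor C T Z \<and> i \<bullet> u = t"
    proof (rule ex1I[of _ v])
      show "v \<in> Mor C T Z \<and> i \<bullet> v = t" using v by (auto simp: hm_def)
      fix u assume "u \<in> Mor C T Z \<and> i \<bullet> u = t"
      then have "hm u T Z" "i \<bullet> u = i \<bullet> v" using t Z v H_Ob by (auto simp: hm_def)
      then show "u = v" using un' v t by blast
    qed
  qed (use Z f in \<open>auto simp: hm_def zr_def\<close>)
  then show ?case by blast
next
  case (9 c)
  then have c: "H.hm c (H.dm c) (H.cd c)" by (simp add: H.hm_iff)
  let ?X = "H.dm c" and ?Z = "H.cd c"
  have c: "hm c ?X ?Z" "?X \<in> \<H>" "?Z \<in> \<H>" using c by (auto simp: H_hm)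
  obtain B p where B: "B \<in> \<H>" "hm p ?Z B" "p \<bullet> c = zr ?X B" "surjH p"
     and ex: "\<forall>T \<in> \<H>. \<forall>t. hm t ?Z T \<longrightarrow> t \<bullet> c = zr ?X T \<longrightarrow> (\<exists>v. hm v B T \<and> v \<bullet> p = t)"
     and lift: "\<forall>T \<in> \<H>. \<forall>t. hm t T ?Z \<longrightarrow> p \<bullet> t = zr T B \<longrightarrow>
       (\<exists>P e x. P \<in> \<H> \<and> surjH e \<and> hm e P T \<and> hm x P ?X \<and> t \<bullet> e = c \<bullet> x)"
    using cokernelH[OF c] by blast
  have un': "v = v'" if "T \<in> \<H>" "hm v B T" "hm v' B T" "v \<bullet> p = v' \<bullet> p" for T v v'
  proof -
    have "(v \<boxplus> mn v') \<bullet> p = zr ?Z T" using that B by (simp add: hm_iff)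
    then have "v \<boxplus> mn v' = zr B T" using surjH_epi[OF B(4,2), of "v \<boxplus> mn v'" T] that by (simp add: hm_iff)
    then show ?thesis by (rule diff_eq) (use that in \<open>auto simp: hm_iff\<close>)
  qed
  have "is_cokernel \<A> ?X ?Z c B p"
    unfolding is_cokernel_def heart_simps
  proof (intro conjI ballI impI)
    fix T t assume t: "T \<in> \<H>" "t \<in> Mor C ?Z T" "t \<bullet> c = \<zero>\<^bsub>Hom C ?X T\<^esub>"
    then have "hm t ?Z T" "t \<bullet> c = zr ?X T" using H_Ob c by (auto simp: hm_def zr_def)
    then obtain v where v: "hm v B T" "v \<bullet> p = t" using ex t by blast
    show "\<exists>!u. u \<in> Mor C B T \<and> u \<bullet> p = t"
    proof (rule ex1I[of _ v])
      show "v \<in> Mor C B T \<and> v \<bullet> p = t" using v by (auto simp: hm_def)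
      fix u assume "u \<in> Mor C B T \<and> u \<bullet> p = t"
      then have "hm u B T" "u \<bullet> p = v \<bullet> p" using t B v H_Ob by (auto simp: hm_def)
      then show "u = v" using un' v t by blast
    qed
  qed (use B c in \<open>auto simp: hm_def zr_def\<close>)
  moreover have "\<exists>e x. surjH e \<and> H.cd e = H.dm t \<and> H.arr x \<and> H.dm x = H.dm e \<and> H.cd x = ?X \<and> Cmp \<A> t e = Cmp \<A> c x"
    if t: "H.arr t" "H.cd t = ?Z" "Cmp \<A> p t = H.zr (H.dm t) B" for t
  proof -
    let ?T = "H.dm t"
    have "H.hm t ?T ?Z" using t by (simp add: H.hm_iff)
    then have T: "hm t ?T ?Z" "?T \<in> \<H>" by (auto simp: H_hm)
    have "p \<bullet> t = zr ?T B" using t by (simp add: heart_simps H_zr)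
    then obtain P e x where e: "P \<in> \<H>" "surjH e" "hm e P ?T" "hm x P ?X" "t \<bullet> e = c \<bullet> x"
      using lift T by blast
    then have "H.hm e P ?T" "H.hm x P ?X" using T c by (auto simp: H_hm)
    then show ?thesis using e by (metis H.hm_iff heart_simps(4))
  qed
  ultimately show ?case using B by blast
next
  case (10 h l)
  let ?X = "H.dm h" and ?Y = "H.cd h" and ?T = "H.dm l"
  have "H.hm h ?X ?Y" "H.hm l ?T ?X" using 10 by (auto simp: H.hm_iff)
  then have h: "hm h ?X ?Y" "?X \<in> \<H>" "?Y \<in> \<H>" "hm l ?T ?X" by (auto simp: H_hm)
  have mono: "t = zr T ?X" if "T \<in> \<H>" "hm t T ?X" "h \<bullet> t = zr T ?Y" for T t
  proof -
    have "H.hm t T ?X" using that h by (auto simp: H_hm)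
    then show ?thesis using 10(2)[of t] that by (simp add: H.hm_iff heart_simps H_zr)
  qed
  obtain g where "hm g ?Y ?X" "g \<bullet> h = Idt C ?X" "h \<bullet> g = Idt C ?Y"
    using mono_surjH_iso[OF h(1-3) mono h(4)] 10(5) heart_simps by metis
  then show ?case using h unfolding iso_arrow_def heart_simps hm_def by blast
qed

end

section \<open>Complexes and quasi-isomorphisms\<close>

context linear_category
begin

text \<open>Sorting a sum by \<open>pl_ac\<close> need not bring \<open>f\<close> next to \<open>mn f\<close>, hence cancellation across up to three
  summands.\<close>

lemma cancel_p1:
  assumes "arr f" "arr a" "dm a = dm f" "cd a = cd f"
  shows "f \<boxplus> (a \<boxplus> mn f) = a"
  using assms by (simp add: pl_comm[of a])

lemma cancel_p1t:
  assumes "arr f" "arr a" "arr g" "dm a = dm f" "cd a = cd f" "dm g = dm f" "cd g = cd f"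
  shows "f \<boxplus> (a \<boxplus> (mn f \<boxplus> g)) = a \<boxplus> g"
  by (subst pl_lcomm) (simp_all add: assms )

lemma cancel_p2:
  assumes "arr f" "arr a" "arr b" "dm a = dm f" "cd a = cd f" "dm b = dm f" "cd b = cd f"
  shows "f \<boxplus> (a \<boxplus> (b \<boxplus> mn f)) = a \<boxplus> b"
  by (subst pl_lcomm) (simp_all add: assms cancel_p1 cancel_p1t)

lemma cancel_p2t:
  assumes "arr f" "arr a" "arr b" "arr g" "dm a = dm f" "cd a = cd f" "dm b = dm f" "cd b = cd f" "dm g = dm f" "cd g = cd f"
  shows "f \<boxplus> (a \<boxplus> (b \<boxplus> (mn f \<boxplus> g))) = a \<boxplus> (b \<boxplus> g)"
  by (subst pl_lcomm) (simp_all add: assms cancel_p1t cancel_p2)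

lemma cancel_p3:
  assumes "arr f" "arr a" "arr b" "arr c" "dm a = dm f" "cd a = cd f" "dm b = dm f" "cd b = cd f" "dm c = dm f" "cd c = cd f"
  shows "f \<boxplus> (a \<boxplus> (b \<boxplus> (c \<boxplus> mn f))) = a \<boxplus> (b \<boxplus> c)"
  by (subst pl_lcomm) (simp_all add: assms cancel_p2 cancel_p2t)

lemma cancel_p3t:
  assumes "arr f" "arr a" "arr b" "arr c" "arr g" "dm a = dm f" "cd a = cd f" "dm b = dm f" "cd b = cd f" "dm c = dm f" "cd c = cd f" "dm g = dm f" "cd g = cd f"
  shows "f \<boxplus> (a \<boxplus> (b \<boxplus> (c \<boxplus> (mn f \<boxplus> g)))) = a \<boxplus> (b \<boxplus> (c \<boxplus> g))"
  by (subst pl_lcomm) (simp_all add: assms cancel_p2t cancel_p3)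

lemmas pl_simps = pl_ac cancel_p1 cancel_p1t cancel_p2 cancel_p2t cancel_p3 cancel_p3t

text \<open>Complexes, chain maps and homotopies are first treated without boundedness and in terms
  of \<open>hm\<close>; \<open>bounded_iff\<close>, \<open>chain_map_iff\<close> and
  \<open>homotopy_iff\<close> link them to the derived category.\<close>

definition cplx :: "('o, 'm) cochain \<Rightarrow> bool" where
  "cplx X \<longleftrightarrow> (\<forall>n. hm (cdiff X n) (cob X n) (cob X (n + 1)) \<and>
     cdiff X (n + 1) \<bullet> cdiff X n = zr (cob X n) (cob X (n + 2)))"

definition chn :: "('o, 'm) cochain \<Rightarrow> ('o, 'm) cochain \<Rightarrow> (int \<Rightarrow> 'm) \<Rightarrow> bool" where
  "chn X Y f \<longleftrightarrow> cplx X \<and> cplx Y \<and> (\<forall>n. hm (f n) (cob X n) (cob Y n) \<and>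
     cdiff Y n \<bullet> f n = f (n + 1) \<bullet> cdiff X n)"

definition htp :: "('o, 'm) cochain \<Rightarrow> ('o, 'm) cochain \<Rightarrow> (int \<Rightarrow> 'm) \<Rightarrow> (int \<Rightarrow> 'm) \<Rightarrow> bool" where
  "htp X Y f g \<longleftrightarrow> (\<exists>s. \<forall>n. hm (s n) (cob X n) (cob Y (n - 1)) \<and>
     f n = g n \<boxplus> (cdiff Y (n - 1) \<bullet> s n \<boxplus> s (n + 1) \<bullet> cdiff X n))"

lemma cplx_simps [simp]:
  assumes "cplx X"
  shows "cob X n \<in> Ob C" "arr (cdiff X n)" "dm (cdiff X n) = cob X n" "cd (cdiff X n) = cob X (n + 1)"
proof -
  have "hm (cdiff X n) (cob X n) (cob X (n + 1))" using assms cplx_def by blast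
  then show "cob X n \<in> Ob C" "arr (cdiff X n)" "dm (cdiff X n) = cob X n" "cd (cdiff X n) = cob X (n + 1)"
    using hm_Ob hm_iff by blast+
qed

lemma dd [simp]: "cplx X \<Longrightarrow> m = n + 1 \<Longrightarrow> cdiff X m \<bullet> cdiff X n = zr (cob X n) (cob X (m + 1))"
  unfolding cplx_def using add.commute[of 2 n] by (metis add.assoc one_add_one)

lemma ddt [simp]: "cplx X \<Longrightarrow> m = n + 1 \<Longrightarrow> arr t \<Longrightarrow> cd t = cob X n \<Longrightarrow>
    cdiff X m \<bullet> (cdiff X n \<bullet> t) = zr (dm t) (cob X (m + 1))"
  using cmp_red[OF dd, of X "n + 1" n t] by simp

lemma chnD:
  assumes "chn X Y f"
  shows "cplx X" "cplx Y" "arr (f n)" "dm (f n) = cob X n" "cd (f n) = cob Y n"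
  using assms unfolding chn_def hm_iff by blast+

lemma chn_comm: "chn X Y f \<Longrightarrow> cdiff Y n \<bullet> f n = f (n + 1) \<bullet> cdiff X n"
  unfolding chn_def by blast

lemma chn_commt: "chn X Y f \<Longrightarrow> arr t \<Longrightarrow> cd t = cob X n \<Longrightarrow> cdiff Y n \<bullet> (f n \<bullet> t) = f (n + 1) \<bullet> (cdiff X n \<bullet> t)"
  using cmp_red[OF chn_comm, of X Y f t n] chnD[of X Y f] by simp

lemma chn_id: "cplx X \<Longrightarrow> chn X X (\<lambda>n. Idt C (cob X n))"
  unfolding chn_def by (auto simp: hm_iff)

lemma chn_cmp: assumes f: "chn X Y f" and g: "chn Y Z g" shows "chn X Z (\<lambda>n. g n \<bullet> f n)"
  using chnD[OF f] chnD[OF g] chn_comm[OF f] chn_commt[OF g]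
  unfolding chn_def by (auto simp: hm_iff)

lemma chn_zr: "cplx X \<Longrightarrow> cplx Y \<Longrightarrow> chn X Y (\<lambda>n. zr (cob X n) (cob Y n))"
  unfolding chn_def by (auto simp: hm_iff)

lemma htp_refl: "chn X Y f \<Longrightarrow> htp X Y f f"
  unfolding htp_def by (rule exI[of _ "\<lambda>n. zr (cob X n) (cob Y (n - 1))"]) (auto simp: hm_iff chnD)

lemma htp_sym: assumes f: "chn X Y f" and g: "chn X Y g" and h: "htp X Y f g" shows "htp X Y g f"
proof -
  obtain s where s: "\<And>n. hm (s n) (cob X n) (cob Y (n - 1))"
    "\<And>n. f n = g n \<boxplus> (cdiff Y (n - 1) \<bullet> s n \<boxplus> s (n + 1) \<bullet> cdiff X n)" using h htp_def by blast
  have a: "arr (s n)" "dm (s n) = cob X n" "cd (s n) = cob Y (n - 1)" for n using s(1) hm_iff by blast+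
  show ?thesis unfolding htp_def
    by (rule exI[of _ "\<lambda>n. mn (s n)"]) (auto simp: hm_iff a s(2) chnD[OF f] chnD[OF g] pl_simps)
qed

lemma htp_trans: assumes f: "chn X Y f" and g: "chn X Y g" and k: "chn X Y k" and h: "htp X Y f g" and h': "htp X Y g k" shows "htp X Y f k"
proof -
  obtain s where s: "\<And>n. hm (s n) (cob X n) (cob Y (n - 1))"
    "\<And>n. f n = g n \<boxplus> (cdiff Y (n - 1) \<bullet> s n \<boxplus> s (n + 1) \<bullet> cdiff X n)" using h htp_def by blast
  obtain s' where s': "\<And>n. hm (s' n) (cob X n) (cob Y (n - 1))"
    "\<And>n. g n = k n \<boxplus> (cdiff Y (n - 1) \<bullet> s' n \<boxplus> s' (n + 1) \<bullet> cdiff X n)" using h' htp_def by blast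
  have a: "arr (s n)" "dm (s n) = cob X n" "cd (s n) = cob Y (n - 1)"
    "arr (s' n)" "dm (s' n) = cob X n" "cd (s' n) = cob Y (n - 1)" for n using s(1) s'(1) hm_iff by blast+
  show ?thesis unfolding htp_def
    by (rule exI[of _ "\<lambda>n. s n \<boxplus> s' n"]) (auto simp: hm_iff a s(2) s'(2) chnD[OF f] chnD[OF k] pl_simps)
qed

lemma htp_post: assumes f: "chn X Y f" and g: "chn X Y g" and k: "chn Y Z k" and h: "htp X Y f g" shows "htp X Z (\<lambda>n. k n \<bullet> f n) (\<lambda>n. k n \<bullet> g n)"
proof -
  obtain s where s: "\<And>n. hm (s n) (cob X n) (cob Y (n - 1))"
    "\<And>n. f n = g n \<boxplus> (cdiff Y (n - 1) \<bullet> s n \<boxplus> s (n + 1) \<bullet> cdiff X n)" using h htp_def by blast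
  have a: "arr (s n)" "dm (s n) = cob X n" "cd (s n) = cob Y (n - 1)" for n using s(1) hm_iff by blast+
  show ?thesis unfolding htp_def
    by (rule exI[of _ "\<lambda>n. k (n - 1) \<bullet> s n"]) (auto simp: hm_iff a s(2) chnD[OF f] chnD[OF g] chnD[OF k] chn_commt[OF k])
qed

lemma htp_pre: assumes f: "chn X Y f" and g: "chn X Y g" and k: "chn W X k" and h: "htp X Y f g" shows "htp W Y (\<lambda>n. f n \<bullet> k n) (\<lambda>n. g n \<bullet> k n)"
proof -
  obtain s where s: "\<And>n. hm (s n) (cob X n) (cob Y (n - 1))"
    "\<And>n. f n = g n \<boxplus> (cdiff Y (n - 1) \<bullet> s n \<boxplus> s (n + 1) \<bullet> cdiff X n)" using h htp_def by blast
  have a: "arr (s n)" "dm (s n) = cob X n" "cd (s n) = cob Y (n - 1)" for n using s(1) hm_iff by blast+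
  show ?thesis unfolding htp_def
    by (rule exI[of _ "\<lambda>n. s n \<bullet> k n"]) (auto simp: hm_iff a s(2) chnD[OF f] chnD[OF g] chnD[OF k] chn_comm[OF k])
qed

lemma htp_cmp: assumes f: "chn X Y f" "chn X Y f'" and g: "chn Y Z g" "chn Y Z g'" and h: "htp X Y f f'" "htp Y Z g g'"
  shows "htp X Z (\<lambda>n. g n \<bullet> f n) (\<lambda>n. g' n \<bullet> f' n)"
  using htp_trans[OF chn_cmp[OF f(1) g(1)] chn_cmp[OF f(2) g(1)] chn_cmp[OF f(2) g(2)]
    htp_post[OF f g(1) h(1)] htp_pre[OF g f(2) h(2)]] .

end

section \<open>Quasi-isomorphisms tested on generalized elements\<close>

context site
begin

text \<open>Generalized elements: exactness is tested on arrows \<open>t\<close> into a complex, up to precomposition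
  with a surjection. This replaces diagram chasing in the abelian heart.\<close>

definition cyc :: "('o, 'm) cochain \<Rightarrow> int \<Rightarrow> 'm \<Rightarrow> bool" where
  "cyc X n t \<longleftrightarrow> arr t \<and> cd t = cob X n \<and> cdiff X n \<bullet> t = zr (dm t) (cob X (n + 1))"

abbreviation locally_boundary :: "('o, 'm) cochain \<Rightarrow> int \<Rightarrow> 'm \<Rightarrow> bool" where
  "locally_boundary X n t \<equiv> \<exists>e x. surj e \<and> cd e = dm t \<and> arr x \<and> dm x = dm e \<and> cd x = cob X (n - 1) \<and>
     t \<bullet> e = cdiff X (n - 1) \<bullet> x"

abbreviation locally_lifts :: "('o, 'm) cochain \<Rightarrow> ('o, 'm) cochain \<Rightarrow> 'm \<Rightarrow> int \<Rightarrow> 'm \<Rightarrow> bool" where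
  "locally_lifts X Y g n y \<equiv> \<exists>e x w. surj e \<and> cd e = dm y \<and> cyc X n x \<and> dm x = dm e \<and> arr w \<and> dm w = dm e \<and>
     cd w = cob Y (n - 1) \<and> y \<bullet> e = g \<bullet> x \<boxplus> cdiff Y (n - 1) \<bullet> w"

text \<open>Injectivity on cohomology. The hypothesis is an exact equation: a relation valid only
  after a cover e is applied to t e, and e is absorbed in the conclusion.\<close>

definition ginj :: "('o, 'm) cochain \<Rightarrow> ('o, 'm) cochain \<Rightarrow> (int \<Rightarrow> 'm) \<Rightarrow> bool" where
  "ginj X Y f \<longleftrightarrow> (\<forall>n t y. cyc X n t \<longrightarrow> arr y \<longrightarrow> dm y = dm t \<longrightarrow> cd y = cob Y (n - 1) \<longrightarrow>
     f n \<bullet> t = cdiff Y (n - 1) \<bullet> y \<longrightarrow>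
     (locally_boundary X n t))"

text \<open>Surjectivity on cohomology, lifts of cycles being taken up to a boundary and a
  cover.\<close>

definition gsur :: "('o, 'm) cochain \<Rightarrow> ('o, 'm) cochain \<Rightarrow> (int \<Rightarrow> 'm) \<Rightarrow> bool" where
  "gsur X Y f \<longleftrightarrow> (\<forall>n y. cyc Y n y \<longrightarrow>
     (locally_lifts X Y (f n) n y))"

definition gqi :: "('o, 'm) cochain \<Rightarrow> ('o, 'm) cochain \<Rightarrow> (int \<Rightarrow> 'm) \<Rightarrow> bool" where
  "gqi X Y f \<longleftrightarrow> chn X Y f \<and> ginj X Y f \<and> gsur X Y f"

lemma cycD: "cyc X n t \<Longrightarrow> arr t" "cyc X n t \<Longrightarrow> cd t = cob X n"
  "cyc X n t \<Longrightarrow> cdiff X n \<bullet> t = zr (dm t) (cob X (n + 1))"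
  unfolding cyc_def by blast+

lemma cyc_pre: "cplx X \<Longrightarrow> cyc X n t \<Longrightarrow> arr e \<Longrightarrow> cd e = dm t \<Longrightarrow> cyc X n (t \<bullet> e)"
  using cmp_red[OF cycD(3), of X n t e] cycD[of X n t] unfolding cyc_def[of _ _ "t \<bullet> e"] by simp

lemma cyc_chn: assumes "chn X Y f" "cyc X n t" shows "cyc Y n (f n \<bullet> t)"
  using assms chnD[OF assms(1)] chn_commt[OF assms(1)] by (auto simp: cyc_def)

lemma gqi_chn: "gqi X Y f \<Longrightarrow> chn X Y f" by (simp add: gqi_def)

lemma gqi_injE:
  assumes "gqi X Y f" "cyc X n t" "arr y" "dm y = dm t" "cd y = cob Y m" "m = n - 1" "f n \<bullet> t = cdiff Y m \<bullet> y"
  obtains e x where "surj e" "cd e = dm t" "arr x" "dm x = dm e" "cd x = cob X m" "t \<bullet> e = cdiff X m \<bullet> x"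
  using assms unfolding gqi_def ginj_def by blast

lemma gqi_inj:
  assumes "gqi X Y f" "cyc X n t" "f n \<bullet> t = cdiff Y (n - 1) \<bullet> y" "arr y" "dm y = dm t" "cd y = cob Y (n - 1)"
  shows "locally_boundary X n t"
  using assms unfolding gqi_def ginj_def by blast

lemma gqi_surE:
  assumes "gqi X Y f" "cyc Y n y" "m = n - 1"
  obtains e x w where "surj e" "cd e = dm y" "cyc X n x" "dm x = dm e" "arr w" "dm w = dm e" "cd w = cob Y m"
       "y \<bullet> e = f n \<bullet> x \<boxplus> cdiff Y m \<bullet> w"
  using assms unfolding gqi_def gsur_def by blast

lemma surj_Idt: "X \<in> Ob C \<Longrightarrow> surj (Idt C X)"
  by (rule surj_iso[of _ X X "Idt C X"]) (auto simp: hm_iff)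

lemma gqi_id: assumes "cplx X" shows "gqi X X (\<lambda>n. Idt C (cob X n))"
  unfolding gqi_def ginj_def gsur_def
proof (intro conjI allI impI)
  fix n t y assume t: "cyc X n t" "arr y" "dm y = dm t" "cd y = cob X (n - 1)" "Idt C (cob X n) \<bullet> t = cdiff X (n - 1) \<bullet> y"
  show "locally_boundary X n t"
  proof (rule exI[of _ "Idt C (dm t)"], rule exI[of _ y], intro conjI)
    show "t \<bullet> Idt C (dm t) = cdiff X (n - 1) \<bullet> y" using t(5) cycD(1,2)[OF t(1)] by simp
  qed (simp_all add: t(2-4) cycD[OF t(1)] surj_Idt)
next
  fix n t assume t: "cyc X n t"
  show "locally_lifts X X (Idt C (cob X n)) n t"
    by (rule exI[of _ "Idt C (dm t)"], rule exI[of _ t], rule exI[of _ "zr (dm t) (cob X (n - 1))"])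
      (use t assms cycD[OF t(1)] in \<open>auto simp: surj_Idt\<close>)
qed (use assms chn_id in blast)

lemma gqi_cmp: assumes a: "gqi X Y a" and s: "gqi Y Z s" shows "gqi X Z (\<lambda>n. s n \<bullet> a n)"
  unfolding gqi_def ginj_def gsur_def
proof (intro conjI allI impI)
  note ca = gqi_chn[OF a] and cs = gqi_chn[OF s]
  note simps [simp] = chnD[OF ca] chnD[OF cs]
  show "chn X Z (\<lambda>n. s n \<bullet> a n)" using chn_cmp ca cs by blast
  {
    fix n t y assume t: "cyc X n t" "arr y" "dm y = dm t" "cd y = cob Z (n - 1)" "s n \<bullet> a n \<bullet> t = cdiff Z (n - 1) \<bullet> y"
    note [simp] = cycD[OF t(1)] t(2-4)
    have "s n \<bullet> (a n \<bullet> t) = cdiff Z (n - 1) \<bullet> y" using t(5) by simp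
    then obtain e x where e: "surj e" "cd e = dm (a n \<bullet> t)" "arr x" "dm x = dm e" "cd x = cob Y (n - 1)" "a n \<bullet> t \<bullet> e = cdiff Y (n - 1) \<bullet> x"
      using gqi_injE[OF s cyc_chn[OF ca t(1)] t(2) _ t(4)] by (auto simp del: cmp_assoc)
    note [simp] = e(1-5)
    have "a n \<bullet> (t \<bullet> e) = cdiff Y (n - 1) \<bullet> x" using e(6) by simp
    then obtain e' x' where e': "surj e'" "cd e' = dm (t \<bullet> e)" "arr x'" "dm x' = dm e'" "cd x' = cob X (n - 1)" "t \<bullet> e \<bullet> e' = cdiff X (n - 1) \<bullet> x'"
      using gqi_injE[OF a cyc_pre[OF _ t(1), of e] e(3) _ e(5)] by (auto simp del: cmp_assoc)
    show "locally_boundary X n t"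
      by (rule exI[of _ "e \<bullet> e'"], rule exI[of _ x']) (use e' in \<open>auto intro!: surj_comp\<close>)
  next
    fix n y assume t: "cyc Z n y"
    note [simp] = cycD[OF t]
    obtain e x w where e: "surj e" "cd e = dm y" "cyc Y n x" "dm x = dm e" "arr w" "dm w = dm e" "cd w = cob Z (n - 1)"
       "y \<bullet> e = s n \<bullet> x \<boxplus> cdiff Z (n - 1) \<bullet> w" using gqi_surE[OF s t] by metis
    note [simp] = e(1,2,4-7) cycD[OF e(3)]
    obtain e' x' v where e': "surj e'" "cd e' = dm x" "cyc X n x'" "dm x' = dm e'" "arr v" "dm v = dm e'" "cd v = cob Y (n - 1)"
       "x \<bullet> e' = a n \<bullet> x' \<boxplus> cdiff Y (n - 1) \<bullet> v" using gqi_surE[OF a e(3)] by metis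
    note [simp] = e'(1,2,4-7) cycD[OF e'(3)]
    have "y \<bullet> (e \<bullet> e') = y \<bullet> e \<bullet> e'" by simp
    also have "\<dots> = s n \<bullet> (x \<bullet> e') \<boxplus> cdiff Z (n - 1) \<bullet> (w \<bullet> e')" unfolding e(8) by simp
    also have "\<dots> = s n \<bullet> a n \<bullet> x' \<boxplus> cdiff Z (n - 1) \<bullet> (s (n - 1) \<bullet> v \<boxplus> w \<bullet> e')"
      unfolding e'(8) using chn_commt[OF cs, of v "n - 1"] by (simp add: pl_ac)
    finally have *: "y \<bullet> (e \<bullet> e') = s n \<bullet> a n \<bullet> x' \<boxplus> cdiff Z (n - 1) \<bullet> (s (n - 1) \<bullet> v \<boxplus> w \<bullet> e')" .
    show "locally_lifts X Z (s n \<bullet> a n) n y"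
      by (rule exI[of _ "e \<bullet> e'"], rule exI[of _ x'], rule exI[of _ "s (n - 1) \<bullet> v \<boxplus> w \<bullet> e'"]) (use * e'(3) in \<open>auto intro!: surj_comp\<close>)
  }
qed

text \<open>Together with \<open>gqi_cmp\<close> this is what a calculus of fractions takes from
  two-out-of-three. For surjectivity, lift s y through s a to x; then y - a x is a cycle that s
  sends to a boundary, so injectivity of s makes it a boundary locally.\<close>

lemma gqi_cancel: assumes a: "chn X Y a" and s: "gqi Y Z s" and sa: "gqi X Z (\<lambda>n. s n \<bullet> a n)" shows "gqi X Y a"
  unfolding gqi_def ginj_def gsur_def
proof (intro conjI allI impI)
  note ca = a and cs = gqi_chn[OF s]
  note simps [simp] = chnD[OF ca] chnD[OF cs]
  show "chn X Y a" using a .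
  {
    fix n t y assume t: "cyc X n t" "arr y" "dm y = dm t" "cd y = cob Y (n - 1)" "a n \<bullet> t = cdiff Y (n - 1) \<bullet> y"
    note [simp] = cycD[OF t(1)] t(2-4)
    have "s n \<bullet> a n \<bullet> t = cdiff Z (n - 1) \<bullet> (s (n - 1) \<bullet> y)" using t(5) chn_commt[OF cs, of y "n - 1"] by simp
    then show "locally_boundary X n t"
      by (rule gqi_inj[OF sa t(1)]) simp_all
  next
    fix n y assume t: "cyc Y n y"
    note [simp] = cycD[OF t]
    obtain e x w where e: "surj e" "cd e = dm (s n \<bullet> y)" "cyc X n x" "dm x = dm e" "arr w" "dm w = dm e" "cd w = cob Z (n - 1)"
       "s n \<bullet> y \<bullet> e = s n \<bullet> a n \<bullet> x \<boxplus> cdiff Z (n - 1) \<bullet> w" using gqi_surE[OF sa cyc_chn[OF cs t]] by metis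
    note [simp] = e(1,2,4-7) cycD[OF e(3)]
    define d where "d = y \<bullet> e \<boxplus> mn (a n \<bullet> x)"
    have [simp]: "arr d" "dm d = dm e" "cd d = cob Y n" unfolding d_def by auto
    have cd: "cyc Y n d" using cycD(3)[OF cyc_pre[OF _ t, of e]] cycD(3)[OF cyc_chn[OF a e(3)]]
      unfolding cyc_def d_def by simp
    have "s n \<bullet> d = s n \<bullet> y \<bullet> e \<boxplus> mn (s n \<bullet> a n \<bullet> x)" unfolding d_def by simp
    also have "\<dots> = cdiff Z (n - 1) \<bullet> w" unfolding e(8) by (simp add: pl_simps)
    finally obtain e' v where e': "surj e'" "cd e' = dm d" "arr v" "dm v = dm e'" "cd v = cob Y (n - 1)"
       "d \<bullet> e' = cdiff Y (n - 1) \<bullet> v" using gqi_injE[OF s cd, of w] by (auto simp del: cmp_assoc)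
    note [simp] = e'(1-5)
    have "d \<bullet> e' = y \<bullet> (e \<bullet> e') \<boxplus> mn (a n \<bullet> (x \<bullet> e'))" unfolding d_def by simp
    then have "y \<bullet> (e \<bullet> e') \<boxplus> mn (a n \<bullet> (x \<bullet> e')) = cdiff Y (n - 1) \<bullet> v" using e'(6) by metis
    then have "a n \<bullet> (x \<bullet> e') \<boxplus> cdiff Y (n - 1) \<bullet> v = a n \<bullet> (x \<bullet> e') \<boxplus> (y \<bullet> (e \<bullet> e') \<boxplus> mn (a n \<bullet> (x \<bullet> e')))" by metis
    also have "\<dots> = y \<bullet> (e \<bullet> e')" by (simp add: pl_simps)
    finally have *: "y \<bullet> (e \<bullet> e') = a n \<bullet> (x \<bullet> e') \<boxplus> cdiff Y (n - 1) \<bullet> v" ..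
    show "locally_lifts X Y (a n) n y"
      by (rule exI[of _ "e \<bullet> e'"], rule exI[of _ "x \<bullet> e'"], rule exI[of _ v]) (use * cyc_pre[OF _ e(3), of e'] in \<open>auto intro!: surj_comp\<close>)
  }
qed

lemma gqi_htp: assumes f: "gqi X Y f" and g: "chn X Y g" and h: "htp X Y f g" shows "gqi X Y g"
  unfolding gqi_def ginj_def gsur_def
proof (intro conjI allI impI)
  note cf = gqi_chn[OF f]
  note simps [simp] = chnD[OF cf] chnD[OF g]
  show "chn X Y g" using g .
  obtain s where s: "\<And>n. hm (s n) (cob X n) (cob Y (n - 1))"
    "\<And>n. f n = g n \<boxplus> (cdiff Y (n - 1) \<bullet> s n \<boxplus> s (n + 1) \<bullet> cdiff X n)" using h htp_def by blast
  have [simp]: "arr (s n)" "dm (s n) = cob X n" "cd (s n) = cob Y (n - 1)" for n using s(1) hm_iff by blast+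
  \<comment> \<open>On cycles one half of the homotopy dies and the other half is a
    boundary.\<close>
  have ft: "f n \<bullet> t = g n \<bullet> t \<boxplus> cdiff Y (n - 1) \<bullet> (s n \<bullet> t)" if "cyc X n t" for n t
    unfolding s(2)[of n] using cycD[OF that] by simp
  {
    fix n t y assume t: "cyc X n t" "arr y" "dm y = dm t" "cd y = cob Y (n - 1)" "g n \<bullet> t = cdiff Y (n - 1) \<bullet> y"
    note [simp] = cycD[OF t(1)] t(2-4)
    have "f n \<bullet> t = cdiff Y (n - 1) \<bullet> (y \<boxplus> s n \<bullet> t)" using ft[OF t(1)] t(5) by simp
    then show "locally_boundary X n t"
      by (rule gqi_inj[OF f t(1)]) simp_all
  next
    fix n y assume t: "cyc Y n y"
    note [simp] = cycD[OF t]
    obtain e x w where e: "surj e" "cd e = dm y" "cyc X n x" "dm x = dm e" "arr w" "dm w = dm e" "cd w = cob Y (n - 1)"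
       "y \<bullet> e = f n \<bullet> x \<boxplus> cdiff Y (n - 1) \<bullet> w" using gqi_surE[OF f t] by metis
    note [simp] = e(1,2,4-7) cycD[OF e(3)]
    have *: "y \<bullet> e = g n \<bullet> x \<boxplus> cdiff Y (n - 1) \<bullet> (s n \<bullet> x \<boxplus> w)" using e(8) ft[OF e(3)] by (simp add: pl_ac)
    show "locally_lifts X Y (g n) n y"
      by (rule exI[of _ e], rule exI[of _ x], rule exI[of _ "s n \<bullet> x \<boxplus> w"]) (use * e(3) in auto)
  }
qed

end

section \<open>Comparison with kernels, cokernels and cohomology objects\<close>

context linear_category
begin

lemma kernelD:
  assumes k: "is_kernel C X Y f Z i" and f: "hm f X Y"
  shows "hm i Z X" "f \<bullet> i = zr Z Y"
    "\<And>T t. hm t T X \<Longrightarrow> f \<bullet> t = zr T Y \<Longrightarrow> \<exists>u. hm u T Z \<and> i \<bullet> u = t"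
    "\<And>T u v. hm u T Z \<Longrightarrow> hm v T Z \<Longrightarrow> i \<bullet> u = i \<bullet> v \<Longrightarrow> u = v"
proof -
  have O: "X \<in> Ob C" "Y \<in> Ob C" using f hm_Ob by blast+
  show i: "hm i Z X" "f \<bullet> i = zr Z Y" using k O unfolding is_kernel_def hm_def zr_def by blast+
  have *: "\<exists>!u. u \<in> Mor C T Z \<and> i \<bullet> u = t" if "hm t T X" "f \<bullet> t = zr T Y" for T t
    using k that unfolding is_kernel_def hm_def zr_def by blast
  have Z: "Z \<in> Ob C" using i hm_Ob by blast
  show "\<exists>u. hm u T Z \<and> i \<bullet> u = t" if t: "hm t T X" "f \<bullet> t = zr T Y" for T t
    using *[OF t] hm_Ob[OF t(1)] Z unfolding hm_def by blast
  show "u = v" if t: "hm u T Z" "hm v T Z" "i \<bullet> u = i \<bullet> v" for T u v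
  proof -
    have "f \<bullet> (i \<bullet> u) = zr T Y" using t(1) i cmp_red[OF i(2), of u] f O by (simp add: hm_iff)
    then show ?thesis using *[OF hm_cmp[OF t(1) i(1)]] t unfolding hm_def by metis
  qed
qed

lemma cokernelD:
  assumes k: "is_cokernel C X Y f Q p" and f: "hm f X Y"
  shows "hm p Y Q" "p \<bullet> f = zr X Q"
    "\<And>T t. hm t Y T \<Longrightarrow> t \<bullet> f = zr X T \<Longrightarrow> \<exists>u. hm u Q T \<and> u \<bullet> p = t"
    "\<And>T u v. hm u Q T \<Longrightarrow> hm v Q T \<Longrightarrow> u \<bullet> p = v \<bullet> p \<Longrightarrow> u = v"
proof -
  have O: "X \<in> Ob C" "Y \<in> Ob C" using f hm_Ob by blast+
  show i: "hm p Y Q" "p \<bullet> f = zr X Q" using k O unfolding is_cokernel_def hm_def zr_def by blast+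
  have *: "\<exists>!u. u \<in> Mor C Q T \<and> u \<bullet> p = t" if "hm t Y T" "t \<bullet> f = zr X T" for T t
    using k that unfolding is_cokernel_def hm_def zr_def by blast
  have Q: "Q \<in> Ob C" using i hm_Ob by blast
  show "\<exists>u. hm u Q T \<and> u \<bullet> p = t" if t: "hm t Y T" "t \<bullet> f = zr X T" for T t
    using *[OF t] hm_Ob[OF t(1)] Q unfolding hm_def by blast
  show "u = v" if t: "hm u Q T" "hm v Q T" "u \<bullet> p = v \<bullet> p" for T u v
  proof -
    have "u \<bullet> p \<bullet> f = zr X T" using t(1) i f O hm_Ob[OF t(1)] by (simp add: hm_iff)
    then show ?thesis using *[OF hm_cmp[OF i(1) t(1)]] t unfolding hm_def by metis
  qed
qed

end

context site
begin

text \<open>Cokernels are unique up to isomorphism, so the exactness of the chosen ones carries over to all.\<close>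

lemma cokernel_surj:
  assumes k: "is_cokernel C X Y c Q p" and c: "hm c X Y"
  shows "surj p"
    "hm t T Y \<Longrightarrow> p \<bullet> t = zr T Q \<Longrightarrow> \<exists>e x. surj e \<and> cd e = T \<and> hm x (dm e) X \<and> t \<bullet> e = c \<bullet> x"
proof -
  note p = cokernelD[OF k c]
  have cc: "arr c" "dm c = X" "cd c = Y" using c hm_iff by auto
  obtain Q' p' where k': "is_cokernel C X Y c Q' p'" "surj p'" and
    ex: "\<And>t. arr t \<Longrightarrow> cd t = Y \<Longrightarrow> p' \<bullet> t = zr (dm t) Q' \<Longrightarrow>
            (\<exists>e x. surj e \<and> cd e = dm t \<and> arr x \<and> dm x = dm e \<and> cd x = X \<and> t \<bullet> e = c \<bullet> x)"
    using cokernel_exists[OF cc(1)] unfolding cc(2,3) by metis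
  note p' = cokernelD[OF k'(1) c]
  obtain u where u: "hm u Q' Q" "u \<bullet> p' = p" using p'(3)[OF p(1,2)] by blast
  obtain v where v: "hm v Q Q'" "v \<bullet> p = p'" using p(3)[OF p'(1,2)] by blast
  have "u \<bullet> v \<bullet> p = Idt C Q \<bullet> p" using u v p(1) by (simp add: hm_iff)
  then have uv: "u \<bullet> v = Idt C Q"
    by (rule p(4)[rotated 2]) (use u(1) v(1) hm_Ob in \<open>auto simp: hm_iff\<close>)
  have "v \<bullet> u \<bullet> p' = Idt C Q' \<bullet> p'" using u v p'(1) by (simp add: hm_iff)
  then have vu: "v \<bullet> u = Idt C Q'"
    by (rule p'(4)[rotated 2]) (use u(1) v(1) hm_Ob in \<open>auto simp: hm_iff\<close>)
  have "surj u" using surj_iso[OF u(1) v(1) vu uv] .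
  then have "surj (u \<bullet> p')" using surj_comp k' u(1) p'(1) by (auto simp: hm_iff)
  then show "surj p" using u by simp
  assume t: "hm t T Y" "p \<bullet> t = zr T Q"
  have "p' \<bullet> t = v \<bullet> (p \<bullet> t)" using v(2)[symmetric] v(1) p(1) t(1) by (simp add: hm_iff)
  also have "\<dots> = zr T Q'" unfolding t(2) using v(1) hm_Ob[OF t(1)] by (simp add: hm_iff)
  finally show "\<exists>e x. surj e \<and> cd e = T \<and> hm x (dm e) X \<and> t \<bullet> e = c \<bullet> x"
    using ex[of t] t(1) by (auto simp: hm_iff)
qed

lemma cohomology_exists:
  assumes X: "cplx X"
  shows "\<exists>Z i N p. is_cohomology C X n Z i N p"
proof -
  obtain Z i where k: "is_kernel C (cob X n) (cob X (n + 1)) (cdiff X n) Z i"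
    using kernel_exists[of "cdiff X n"] X by auto
  have d: "hm (cdiff X n) (cob X n) (cob X (n + 1))" "hm (cdiff X (n - 1)) (cob X (n - 1)) (cob X n)"
    using X by (auto simp: hm_iff)
  have "cdiff X n \<bullet> cdiff X (n - 1) = zr (cob X (n - 1)) (cob X (n + 1))" using X by simp
  then obtain c where c: "hm c (cob X (n - 1)) Z" "i \<bullet> c = cdiff X (n - 1)" using kernelD(3)[OF k d(1) d(2)] by blast
  obtain N p where "is_cokernel C (cob X (n - 1)) Z c N p" using cokernel_exists[of c] c(1) by (auto simp: hm_iff)
  then show ?thesis unfolding is_cohomology_def using k c(1)[unfolded hm_def] c(2) by blast
qed

lemma cohomologyE:
  assumes "is_cohomology C X n Z i N p" "cplx X"
  obtains c where "is_kernel C (cob X n) (cob X (n + 1)) (cdiff X n) Z i" "hm c (cob X (n - 1)) Z" "i \<bullet> c = cdiff X (n - 1)"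
    "is_cokernel C (cob X (n - 1)) Z c N p"
  using assms unfolding is_cohomology_def hm_def is_kernel_def by auto

text \<open>The induced arrow h on cohomology is an isomorphism by \<open>mono_surj_iso\<close>:
  surjectivity on generalized elements, applied to the universal cycle i', gives l with h l
  surjective, and injectivity makes h monic.\<close>

lemma gqi_quasi_iso:
  assumes f: "gqi X Y f"
  shows "quasi_iso C X Y f"
  unfolding quasi_iso_def
proof (intro conjI allI)
  note cf = gqi_chn[OF f]
  note simps [simp] = chnD[OF cf]
  show "chain_map C X Y f" unfolding chain_map_def using cf unfolding chn_def hm_def by simp
  fix n
  have d: "hm (cdiff X n) (cob X n) (cob X (n + 1))" "hm (cdiff Y n) (cob Y n) (cob Y (n + 1))"
    "hm (f n) (cob X n) (cob Y n)" "hm (f (n - 1)) (cob X (n - 1)) (cob Y (n - 1))" by (auto simp: hm_iff)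
  obtain Z i N p where h: "is_cohomology C X n Z i N p" using cohomology_exists[OF chnD(1)[OF cf], of n] by blast
  obtain Z' i' N' p' where h': "is_cohomology C Y n Z' i' N' p'" using cohomology_exists[OF chnD(2)[OF cf], of n] by blast
  obtain c where c: "is_kernel C (cob X n) (cob X (n + 1)) (cdiff X n) Z i" "hm c (cob X (n - 1)) Z" "i \<bullet> c = cdiff X (n - 1)"
    "is_cokernel C (cob X (n - 1)) Z c N p" using cohomologyE[OF h] simps by metis
  obtain c' where c': "is_kernel C (cob Y n) (cob Y (n + 1)) (cdiff Y n) Z' i'" "hm c' (cob Y (n - 1)) Z'" "i' \<bullet> c' = cdiff Y (n - 1)"
    "is_cokernel C (cob Y (n - 1)) Z' c' N' p'" using cohomologyE[OF h'] simps by metis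
  note k = kernelD[OF c(1) d(1)] and k' = kernelD[OF c'(1) d(2)]
    and q = cokernelD[OF c(4,2)] and q' = cokernelD[OF c'(4,2)]
    and s = cokernel_surj[OF c(4,2)] and s' = cokernel_surj[OF c'(4,2)]
  note [simp] = k(1)[unfolded hm_iff] k'(1)[unfolded hm_iff] q(1)[unfolded hm_iff] q'(1)[unfolded hm_iff]
    c(2)[unfolded hm_iff] c'(2)[unfolded hm_iff] hm_Ob[OF k(1)] hm_Ob[OF k'(1)] hm_Ob[OF q(1)] hm_Ob[OF q'(1)]
  have "cdiff Y n \<bullet> (f n \<bullet> i) = zr Z (cob Y (n + 1))" using chn_commt[OF cf, of i n] k(2) by simp
  then obtain z where z: "hm z Z Z'" "i' \<bullet> z = f n \<bullet> i" using k'(3)[OF hm_cmp[OF k(1) d(3)]] by blast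
  note [simp] = z(1)[unfolded hm_iff]
  have "i' \<bullet> (z \<bullet> c) = f n \<bullet> (i \<bullet> c)" using cmp_red[OF z(2), of c] by simp
  also have "\<dots> = cdiff Y (n - 1) \<bullet> f (n - 1)" unfolding c(3) using chn_comm[OF cf, of "n - 1"] by simp
  also have "\<dots> = i' \<bullet> (c' \<bullet> f (n - 1))" using cmp_red[OF c'(3), of "f (n - 1)"] by simp
  finally have zc: "z \<bullet> c = c' \<bullet> f (n - 1)" by (rule k'(4)[rotated 2]) (auto simp: hm_iff)
  have "p' \<bullet> z \<bullet> c = zr (cob X (n - 1)) N'" using zc cmp_red[OF q'(2), of "f (n - 1)"] by simp
  then obtain h where hh: "hm h N N'" "h \<bullet> p = p' \<bullet> z" using q(3)[OF hm_cmp[OF z(1) q'(1)]] by blast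
  note [simp] = hh(1)[unfolded hm_iff]
  have "\<exists>l. arr l \<and> cd l = dm h \<and> surj (h \<bullet> l)"
  proof -
    have "cyc Y n i'" unfolding cyc_def using k'(2) by simp
    then obtain e x w where e: "surj e" "cd e = dm i'" "cyc X n x" "dm x = dm e" "arr w" "dm w = dm e" "cd w = cob Y (n - 1)"
       "i' \<bullet> e = f n \<bullet> x \<boxplus> cdiff Y (n - 1) \<bullet> w" using gqi_surE[OF f] by metis
    note [simp] = e(1,2,4-7) cycD[OF e(3)]
    obtain u where u: "hm u (dm x) Z" "i \<bullet> u = x" using k(3)[of x "dm x"] by (auto simp: hm_iff)
    note [simp] = u(1)[unfolded hm_iff]
    have "i' \<bullet> (z \<bullet> u \<boxplus> c' \<bullet> w) = f n \<bullet> (i \<bullet> u) \<boxplus> cdiff Y (n - 1) \<bullet> w"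
      using cmp_red[OF z(2), of u] cmp_red[OF c'(3), of w] by simp
    also have "\<dots> = i' \<bullet> e" unfolding u(2) e(8) ..
    finally have "z \<bullet> u \<boxplus> c' \<bullet> w = e" by (rule k'(4)[rotated 2]) (auto simp: hm_iff)
    then have "p' \<bullet> e = p' \<bullet> (z \<bullet> u \<boxplus> c' \<bullet> w)" by simp
    also have "\<dots> = p' \<bullet> z \<bullet> u" using cmp_red[OF q'(2), of w] by simp
    also have "\<dots> = h \<bullet> (p \<bullet> u)" unfolding hh(2)[symmetric] by simp
    finally have "h \<bullet> (p \<bullet> u) = p' \<bullet> e" ..
    then have "surj (h \<bullet> (p \<bullet> u))" using surj_comp[OF e(1) s'(1)] by simp
    then show ?thesis by (rule_tac exI[of _ "p \<bullet> u"]) simp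
  qed
  then obtain l where l: "arr l" "cd l = dm h" "surj (h \<bullet> l)" by blast
  have "iso_arrow C (dm h) (cd h) h"
  proof (rule mono_surj_iso[OF _ _ l])
    fix t assume t: "arr t" "cd t = dm h" "h \<bullet> t = zr (dm t) (cd h)"
    note [simp] = t(1,2)
    \<comment> \<open>Locally t is the class of a cycle u of X. Its image in Y has zero class, hence
      is locally a boundary; by injectivity u is one as well, so t vanishes after a cover.\<close>
    obtain e u where e: "surj e" "arr u" "cd e = dm t" "dm u = dm e" "cd u = Z" "t \<bullet> e = p \<bullet> u"
      using surj_pull[OF s(1), of t] by auto
    note [simp] = e(1-5)
    have "p' \<bullet> (z \<bullet> u) = h \<bullet> (p \<bullet> u)" using cmp_red[OF hh(2), of u] by simp
    also have "\<dots> = h \<bullet> t \<bullet> e" unfolding e(6)[symmetric] by simp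
    also have "\<dots> = zr (dm e) N'" unfolding t(3) by simp
    finally obtain e2 y where e2: "surj e2" "cd e2 = dm u" "hm y (dm e2) (cob Y (n - 1))" "z \<bullet> u \<bullet> e2 = c' \<bullet> y"
      using s'(2)[of "z \<bullet> u" "dm u"] by (auto simp: hm_iff simp del: cmp_assoc)
    note [simp] = e2(1,2) e2(3)[unfolded hm_iff]
    have "f n \<bullet> (i \<bullet> (u \<bullet> e2)) = i' \<bullet> (z \<bullet> u \<bullet> e2)" using cmp_red[OF z(2), of "u \<bullet> e2"] by simp
    also have "\<dots> = cdiff Y (n - 1) \<bullet> y" unfolding e2(4) using cmp_red[OF c'(3), of y] by simp
    finally have fi: "f n \<bullet> (i \<bullet> (u \<bullet> e2)) = cdiff Y (n - 1) \<bullet> y" .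
    have "cyc X n (i \<bullet> (u \<bullet> e2))" unfolding cyc_def using cmp_red[OF k(2), of "u \<bullet> e2"] by simp
    from gqi_inj[OF f this fi]
    obtain e3 x where e3: "surj e3" "cd e3 = dm e2" "arr x" "dm x = dm e3" "cd x = cob X (n - 1)"
      "i \<bullet> (u \<bullet> e2) \<bullet> e3 = cdiff X (n - 1) \<bullet> x" by auto
    note [simp] = e3(1-5)
    have "i \<bullet> (u \<bullet> e2 \<bullet> e3) = i \<bullet> (c \<bullet> x)" using e3(6) cmp_red[OF c(3), of x] by simp
    then have ux: "u \<bullet> e2 \<bullet> e3 = c \<bullet> x" by (rule k(4)[rotated 2]) (auto simp: hm_iff)
    have "t \<bullet> (e \<bullet> (e2 \<bullet> e3)) = t \<bullet> e \<bullet> (e2 \<bullet> e3)" by simp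
    also have "\<dots> = p \<bullet> (u \<bullet> e2 \<bullet> e3)" unfolding e(6) by simp
    also have "\<dots> = zr (dm e3) N" unfolding ux using cmp_red[OF q(2), of x] by simp
    finally have "t \<bullet> (e \<bullet> (e2 \<bullet> e3)) = zr (dm e3) N" .
    moreover have "surj (e \<bullet> (e2 \<bullet> e3))" by (simp add: surj_comp)
    ultimately show "t = zr (dm t) (dm h)" using surj_epi[of "e \<bullet> (e2 \<bullet> e3)" t] by simp
  qed auto
  then have "iso_arrow C N N' h" by simp
  then show "\<exists>Z i N p Z' i' N' p' z h. is_cohomology C X n Z i N p \<and> is_cohomology C Y n Z' i' N' p' \<and>
        z \<in> Mor C Z Z' \<and> i' \<bullet> z = f n \<bullet> i \<and> iso_arrow C N N' h \<and> h \<bullet> p = p' \<bullet> z"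
    using h h' z hh unfolding hm_def by blast
qed

text \<open>\<open>Kb_quasi_isos\<close> is defined through cohomology objects, whereas the calculus
  of fractions is proved for \<open>gqi\<close>; hence the converse.\<close>

lemma quasi_iso_gqi:
  assumes X: "cplx X" and Y: "cplx Y" and qi: "quasi_iso C X Y f"
  shows "gqi X Y f"
proof -
  have cf: "chn X Y f" using qi X Y unfolding quasi_iso_def chain_map_def chn_def hm_def by simp
  note simps [simp] = chnD[OF cf]
  {
    fix n
    have d: "hm (cdiff X n) (cob X n) (cob X (n + 1))" "hm (cdiff Y n) (cob Y n) (cob Y (n + 1))"
      "hm (f n) (cob X n) (cob Y n)" by (auto simp: hm_iff)
    obtain Z i N p Z' i' N' p' z h where h: "is_cohomology C X n Z i N p" "is_cohomology C Y n Z' i' N' p'"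
      and z: "z \<in> Mor C Z Z'" "i' \<bullet> z = f n \<bullet> i" and hh: "iso_arrow C N N' h" "h \<bullet> p = p' \<bullet> z"
      using qi unfolding quasi_iso_def by meson
    obtain c where c: "is_kernel C (cob X n) (cob X (n + 1)) (cdiff X n) Z i" "hm c (cob X (n - 1)) Z" "i \<bullet> c = cdiff X (n - 1)"
      "is_cokernel C (cob X (n - 1)) Z c N p" using cohomologyE[OF h(1)] simps by metis
    obtain c' where c': "is_kernel C (cob Y n) (cob Y (n + 1)) (cdiff Y n) Z' i'" "hm c' (cob Y (n - 1)) Z'" "i' \<bullet> c' = cdiff Y (n - 1)"
      "is_cokernel C (cob Y (n - 1)) Z' c' N' p'" using cohomologyE[OF h(2)] simps by metis
    note k = kernelD[OF c(1) d(1)] and k' = kernelD[OF c'(1) d(2)]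
      and q = cokernelD[OF c(4,2)] and q' = cokernelD[OF c'(4,2)]
      and s = cokernel_surj[OF c(4,2)] and s' = cokernel_surj[OF c'(4,2)]
    note [simp] = k(1)[unfolded hm_iff] k'(1)[unfolded hm_iff] q(1)[unfolded hm_iff] q'(1)[unfolded hm_iff]
      c(2)[unfolded hm_iff] c'(2)[unfolded hm_iff] hm_Ob[OF k(1)] hm_Ob[OF k'(1)] hm_Ob[OF q(1)] hm_Ob[OF q'(1)]
    have zz [simp]: "arr z" "dm z = Z" "cd z = Z'" using MorI[OF _ _ z(1)] by simp_all
    obtain g where g: "hm h N N'" "hm g N' N" "g \<bullet> h = Idt C N" "h \<bullet> g = Idt C N'"
      using iso_arrow_iff[of N N' h] hh(1) by auto
    note [simp] = g(1)[unfolded hm_iff] g(2)[unfolded hm_iff]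
    have "locally_boundary X n t"
      if t: "cyc X n t" "arr y" "dm y = dm t" "cd y = cob Y (n - 1)" "f n \<bullet> t = cdiff Y (n - 1) \<bullet> y" for t y
    proof -
      note [simp] = t(2-4) cycD[OF t(1)]
      obtain u where u: "hm u (dm t) Z" "i \<bullet> u = t" using k(3)[of t "dm t"] by (auto simp: hm_iff)
      note [simp] = u(1)[unfolded hm_iff]
      have "i' \<bullet> (z \<bullet> u) = f n \<bullet> t" using cmp_red[OF z(2), of u] u(2) by simp
      also have "\<dots> = i' \<bullet> (c' \<bullet> y)" using t(5) cmp_red[OF c'(3), of y] by simp
      finally have zu: "z \<bullet> u = c' \<bullet> y" by (rule k'(4)[rotated 2]) (auto simp: hm_iff)
      have "h \<bullet> (p \<bullet> u) = p' \<bullet> (z \<bullet> u)" using cmp_red[OF hh(2), of u] by simp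
      also have "\<dots> = zr (dm t) N'" unfolding zu using cmp_red[OF q'(2), of y] by simp
      finally have "g \<bullet> (h \<bullet> (p \<bullet> u)) = zr (dm t) N" by simp
      then have "p \<bullet> u = zr (dm t) N" using cmp_red[OF g(3), of "p \<bullet> u"] by simp
      then obtain e x where e: "surj e" "cd e = dm t" "hm x (dm e) (cob X (n - 1))" "u \<bullet> e = c \<bullet> x"
        using s(2)[OF u(1)] by blast
      note [simp] = e(1,2) e(3)[unfolded hm_iff]
      have "t \<bullet> e = i \<bullet> (u \<bullet> e)" using u(2) cmp_red[OF u(2), of e] by simp
      also have "\<dots> = cdiff X (n - 1) \<bullet> x" unfolding e(4) using cmp_red[OF c(3), of x] by simp
      finally have "t \<bullet> e = cdiff X (n - 1) \<bullet> x" .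
      then show ?thesis by (rule_tac exI[of _ e], rule_tac exI[of _ x]) simp
    qed
    moreover have "locally_lifts X Y (f n) n y" if t: "cyc Y n y" for y
    proof -
      note [simp] = cycD[OF t(1)]
      obtain v where v: "hm v (dm y) Z'" "i' \<bullet> v = y" using k'(3)[of y "dm y"] by (auto simp: hm_iff)
      note [simp] = v(1)[unfolded hm_iff]
      \<comment> \<open>Pulling p back along g p' v, with g inverse to h, gives locally a cycle u
        whose class corresponds to that of v. Then v - z u has zero class and is locally a
        boundary.\<close>
      obtain e u where e: "surj e" "cd e = dm y" "arr u" "dm u = dm e" "cd u = Z" "g \<bullet> (p' \<bullet> v) \<bullet> e = p \<bullet> u"
        using surj_pull[OF s(1), of "g \<bullet> (p' \<bullet> v)"] by auto
      note [simp] = e(1-5)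
      have "p' \<bullet> (v \<bullet> e) = h \<bullet> (g \<bullet> (p' \<bullet> v) \<bullet> e)" using cmp_red[OF g(4), of "p' \<bullet> (v \<bullet> e)"] by simp
      also have "\<dots> = p' \<bullet> (z \<bullet> u)" unfolding e(6) using cmp_red[OF hh(2), of u] by simp
      finally have "p' \<bullet> (v \<bullet> e \<boxplus> mn (z \<bullet> u)) = zr (dm e) N'" by simp
      then obtain e2 w where e2: "surj e2" "cd e2 = dm e" "hm w (dm e2) (cob Y (n - 1))" "(v \<bullet> e \<boxplus> mn (z \<bullet> u)) \<bullet> e2 = c' \<bullet> w"
        using s'(2)[of "v \<bullet> e \<boxplus> mn (z \<bullet> u)" "dm e"] by (auto simp: hm_iff simp del: cmp_pl_right cmp_pl_left)
      note [simp] = e2(1,2) e2(3)[unfolded hm_iff]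
      have "v \<bullet> (e \<bullet> e2) = z \<bullet> (u \<bullet> e2) \<boxplus> (v \<bullet> e \<boxplus> mn (z \<bullet> u)) \<bullet> e2" by (simp add: pl_simps)
      then have ve: "v \<bullet> (e \<bullet> e2) = z \<bullet> (u \<bullet> e2) \<boxplus> c' \<bullet> w" unfolding e2(4) .
      have "y \<bullet> (e \<bullet> e2) = i' \<bullet> (v \<bullet> (e \<bullet> e2))" using cmp_red[OF v(2), of "e \<bullet> e2"] by simp
      also have "\<dots> = f n \<bullet> (i \<bullet> (u \<bullet> e2)) \<boxplus> cdiff Y (n - 1) \<bullet> w"
        unfolding ve using cmp_red[OF z(2), of "u \<bullet> e2"] cmp_red[OF c'(3), of w] by simp
      finally have *: "y \<bullet> (e \<bullet> e2) = f n \<bullet> (i \<bullet> (u \<bullet> e2)) \<boxplus> cdiff Y (n - 1) \<bullet> w" .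
      have "cyc X n (i \<bullet> (u \<bullet> e2))" unfolding cyc_def using cmp_red[OF k(2), of "u \<bullet> e2"] by simp
      then show ?thesis using *
        by (rule_tac exI[of _ "e \<bullet> e2"], rule_tac exI[of _ "i \<bullet> (u \<bullet> e2)"], rule_tac exI[of _ w]) (simp add: surj_comp)
    qed
    ultimately have "(\<forall>t y. cyc X n t \<longrightarrow> arr y \<longrightarrow> dm y = dm t \<longrightarrow> cd y = cob Y (n - 1) \<longrightarrow>
        f n \<bullet> t = cdiff Y (n - 1) \<bullet> y \<longrightarrow>
        (locally_boundary X n t)) \<and>
      (\<forall>y. cyc Y n y \<longrightarrow> (locally_lifts X Y (f n) n y))" by blast
  }
  then show ?thesis using cf unfolding gqi_def ginj_def gsur_def by blast
qed

end

section \<open>Ore squares and cancellation\<close>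

context linear_category
begin

definition triple_sum where
  "triple_sum X Y Z E i j k p q r \<longleftrightarrow> hm i X E \<and> hm j Y E \<and> hm k Z E \<and> hm p E X \<and> hm q E Y \<and> hm r E Z \<and>
     p \<bullet> i = Idt C X \<and> q \<bullet> j = Idt C Y \<and> r \<bullet> k = Idt C Z \<and> p \<bullet> j = zr Y X \<and> p \<bullet> k = zr Z X \<and>
     q \<bullet> i = zr X Y \<and> q \<bullet> k = zr Z Y \<and> r \<bullet> i = zr X Z \<and> r \<bullet> j = zr Y Z \<and>
     i \<bullet> p \<boxplus> (j \<bullet> q \<boxplus> k \<bullet> r) = Idt C E"

lemma biproduct_iff: "X \<in> Ob C \<Longrightarrow> Y \<in> Ob C \<Longrightarrow> biproduct C X Y S i j p q \<longleftrightarrow>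
     hm i X S \<and> hm j Y S \<and> hm p S X \<and> hm q S Y \<and> p \<bullet> i = Idt C X \<and> q \<bullet> j = Idt C Y \<and>
     p \<bullet> j = zr Y X \<and> q \<bullet> i = zr X Y \<and> i \<bullet> p \<boxplus> j \<bullet> q = Idt C S"
proof -
  assume O: "X \<in> Ob C" "Y \<in> Ob C"
  have "i \<bullet> p \<oplus>\<^bsub>Hom C S S\<^esub> j \<bullet> q = i \<bullet> p \<boxplus> j \<bullet> q" if "hm i X S" "hm p S X" for i p j q
    using that by (simp add: pl_def hm_iff)
  then show ?thesis unfolding biproduct_def using O by (auto simp: zr_def[symmetric] hm_def)
qed

lemma triple_sum_exists:
  assumes bp: "\<And>X Y. X \<in> Ob C \<Longrightarrow> Y \<in> Ob C \<Longrightarrow> \<exists>S i j p q. biproduct C X Y S i j p q"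
    and O: "X \<in> Ob C" "Y \<in> Ob C" "Z \<in> Ob C"
  shows "\<exists>E i j k p q r. triple_sum X Y Z E i j k p q r"
proof -
  obtain S i j p q where "biproduct C X Y S i j p q" using bp O by meson
  then have 1: "hm i X S" "hm j Y S" "hm p S X" "hm q S Y" "p \<bullet> i = Idt C X" "q \<bullet> j = Idt C Y"
     "p \<bullet> j = zr Y X" "q \<bullet> i = zr X Y" "i \<bullet> p \<boxplus> j \<bullet> q = Idt C S" using biproduct_iff O by blast+
  then have S: "S \<in> Ob C" using hm_Ob by blast
  obtain E i' k p' r where "biproduct C S Z E i' k p' r" using bp O S by meson
  then have 2: "hm i' S E" "hm k Z E" "hm p' E S" "hm r E Z" "p' \<bullet> i' = Idt C S" "r \<bullet> k = Idt C Z"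
     "p' \<bullet> k = zr Z S" "r \<bullet> i' = zr S Z" "i' \<bullet> p' \<boxplus> k \<bullet> r = Idt C E" using biproduct_iff O S by blast+
  note [simp] = 1(1-4)[unfolded hm_iff] 2(1-4)[unfolded hm_iff] O S hm_Ob(2)[OF 2(1)]
  have 3: "p' \<bullet> (i' \<bullet> t) = t" "r \<bullet> (i' \<bullet> t) = zr (dm t) Z" if "arr t" "cd t = S" for t
    using cmp_red[OF 2(5), of t] cmp_red[OF 2(8), of t] that by simp_all
  have "i' \<bullet> (i \<bullet> p \<boxplus> j \<bullet> q) \<bullet> p' \<boxplus> k \<bullet> r = Idt C E" unfolding 1(9) using 2(9) by simp
  then have 4: "i' \<bullet> (i \<bullet> (p \<bullet> p')) \<boxplus> (i' \<bullet> (j \<bullet> (q \<bullet> p')) \<boxplus> k \<bullet> r) = Idt C E" by (simp add: pl_ac)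
  have "triple_sum X Y Z E (i' \<bullet> i) (i' \<bullet> j) k (p \<bullet> p') (q \<bullet> p') r"
    unfolding triple_sum_def hm_iff using 3 4 by (simp add: 1(5-8) 2(6,7))
  then show ?thesis by blast
qed

text \<open>Equations between arrows into E, such as D D = 0 in the homotopy fibre, can thus be
  checked in three coordinates.\<close>

lemma triple_sum_monic:
  assumes S: "triple_sum X Y Z E i j k p q r" and t: "arr t" "cd t = E" "arr u" "cd u = E" "dm u = dm t"
    and e: "p \<bullet> t = p \<bullet> u" "q \<bullet> t = q \<bullet> u" "r \<bullet> t = r \<bullet> u"
  shows "t = u"
proof -
  have h: "hm i X E" "hm j Y E" "hm k Z E" "hm p E X" "hm q E Y" "hm r E Z"
    and s: "i \<bullet> p \<boxplus> (j \<bullet> q \<boxplus> k \<bullet> r) = Idt C E"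
    using S unfolding triple_sum_def by blast+
  note [simp] = h[unfolded hm_iff]
  have *: "v = i \<bullet> (p \<bullet> v) \<boxplus> (j \<bullet> (q \<bullet> v) \<boxplus> k \<bullet> (r \<bullet> v))" if "arr v" "cd v = E" for v
  proof -
    have "v = (i \<bullet> p \<boxplus> (j \<bullet> q \<boxplus> k \<bullet> r)) \<bullet> v" using s that by simp
    also have "\<dots> = i \<bullet> (p \<bullet> v) \<boxplus> (j \<bullet> (q \<bullet> v) \<boxplus> k \<bullet> (r \<bullet> v))" using that by simp
    finally show ?thesis .
  qed
  show ?thesis using *[OF t(1,2)] *[OF t(3,4)] e by simp
qed

lemma bounded_iff: "bounded_complex C X \<longleftrightarrow> cplx X \<and> finite {n. \<not> zero_object C (cob X n)}"
  unfolding bounded_complex_def cplx_def hm_def zr_def by auto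

lemma bounded_cplx: "bounded_complex C X \<Longrightarrow> cplx X" by (simp add: bounded_iff)

end

context site
begin

text \<open>The homotopy fibre of a chain map from \<open>X\<close> to the cone of \<open>s : Y \<rightarrow> Z\<close>, given by its
  components \<open>\<alpha>\<close> and \<open>\<beta>\<close>. It yields both Ore squares (\<open>\<alpha> = 0\<close>) and, after a shift of \<open>Y\<close> and \<open>Z\<close>,
  cancellation.\<close>

lemma fibre_of_cone:
  assumes X: "bounded_complex C X" and Y: "bounded_complex C Y" and Z: "bounded_complex C Z" and s: "chn Y Z s"
    and a: "\<And>n. hm (\<alpha> n) (cob X n) (cob Y (n + 1))" and b: "\<And>n. hm (\<beta> n) (cob X n) (cob Z n)"
    and a1: "\<And>n. \<alpha> (n + 1) \<bullet> cdiff X n = mn (cdiff Y (n + 1) \<bullet> \<alpha> n)"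
    and a2: "\<And>n. \<beta> (n + 1) \<bullet> cdiff X n = s (n + 1) \<bullet> \<alpha> n \<boxplus> cdiff Z n \<bullet> \<beta> n"
  shows "\<exists>E p q r. bounded_complex C E \<and> chn E X p \<and>
     (\<forall>n. hm (q n) (cob E n) (cob Y n) \<and> hm (r n) (cob E n) (cob Z (n - 1)) \<and>
       q (n + 1) \<bullet> cdiff E n = \<alpha> n \<bullet> p n \<boxplus> cdiff Y n \<bullet> q n \<and>
       r (n + 1) \<bullet> cdiff E n = \<beta> n \<bullet> p n \<boxplus> (mn (s n \<bullet> q n) \<boxplus> mn (cdiff Z (n - 1) \<bullet> r n))) \<and>
     (gqi Y Z s \<longrightarrow> gqi E X p)"
proof -
  note [simp] = bounded_cplx[OF X] bounded_cplx[OF Y] bounded_cplx[OF Z] chnD[OF s]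
    a[unfolded hm_iff] b[unfolded hm_iff]
  have "\<forall>n. \<exists>E i j k p q r. triple_sum (cob X n) (cob Y n) (cob Z (n - 1)) E i j k p q r"
    by (intro allI triple_sum_exists site_biproduct) simp_all
  then obtain EE i j k p q r where S: "\<And>n. triple_sum (cob X n) (cob Y n) (cob Z (n - 1)) (EE n) (i n) (j n) (k n) (p n) (q n) (r n)"
    by metis
  note s' = S[unfolded triple_sum_def]
  have h: "hm (i n) (cob X n) (EE n)" "hm (j n) (cob Y n) (EE n)" "hm (k n) (cob Z (n - 1)) (EE n)"
    "hm (p n) (EE n) (cob X n)" "hm (q n) (EE n) (cob Y n)" "hm (r n) (EE n) (cob Z (n - 1))" for n
    using s' by blast+
  note [simp] = h[unfolded hm_iff] hm_Ob(1)[OF h(4)]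
  have pid: "p n \<bullet> i n = Idt C (cob X n)" "q n \<bullet> j n = Idt C (cob Y n)" "r n \<bullet> k n = Idt C (cob Z (n - 1))"
     "p n \<bullet> j n = zr (cob Y n) (cob X n)" "p n \<bullet> k n = zr (cob Z (n - 1)) (cob X n)" "q n \<bullet> i n = zr (cob X n) (cob Y n)"
     "q n \<bullet> k n = zr (cob Z (n - 1)) (cob Y n)" "r n \<bullet> i n = zr (cob X n) (cob Z (n - 1))" "r n \<bullet> j n = zr (cob Y n) (cob Z (n - 1))"
     and sid: "i n \<bullet> p n \<boxplus> (j n \<bullet> q n \<boxplus> k n \<bullet> r n) = Idt C (EE n)" for n using s' by blast+
  have pidt: "p n \<bullet> (i n \<bullet> t) = t" "q n \<bullet> (i n \<bullet> t) = zr (dm t) (cob Y n)" "r n \<bullet> (i n \<bullet> t) = zr (dm t) (cob Z (n - 1))"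
    if "arr t" "cd t = cob X n" for n t
    using that cmp_red[OF pid(1), of t n] cmp_red[OF pid(6), of t n] cmp_red[OF pid(8), of t n] by simp_all
  have qidt: "p n \<bullet> (j n \<bullet> t) = zr (dm t) (cob X n)" "q n \<bullet> (j n \<bullet> t) = t" "r n \<bullet> (j n \<bullet> t) = zr (dm t) (cob Z (n - 1))"
    if "arr t" "cd t = cob Y n" for n t
    using that cmp_red[OF pid(2), of t n] cmp_red[OF pid(4), of t n] cmp_red[OF pid(9), of t n] by simp_all
  have ridt: "p n \<bullet> (k n \<bullet> t) = zr (dm t) (cob X n)" "q n \<bullet> (k n \<bullet> t) = zr (dm t) (cob Y n)" "r n \<bullet> (k n \<bullet> t) = t"
    if "arr t" "cd t = cob Z (n - 1)" for n t
    using that cmp_red[OF pid(3), of t n] cmp_red[OF pid(5), of t n] cmp_red[OF pid(7), of t n] by simp_all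
  \<comment> \<open>In coordinates D(x, y, z) = (d x, alpha x + d y, beta x - s y - d z).\<close>
  define D where "D n = i (n + 1) \<bullet> (cdiff X n \<bullet> p n) \<boxplus> (j (n + 1) \<bullet> (\<alpha> n \<bullet> p n \<boxplus> cdiff Y n \<bullet> q n) \<boxplus>
     k (n + 1) \<bullet> (\<beta> n \<bullet> p n \<boxplus> (mn (s n \<bullet> q n) \<boxplus> mn (cdiff Z (n - 1) \<bullet> r n))))" for n
  have Dh [simp]: "arr (D n)" "dm (D n) = EE n" "cd (D n) = EE (n + 1)" for n unfolding D_def by simp_all
  have pD: "p m \<bullet> D n = cdiff X n \<bullet> p n" "q m \<bullet> D n = \<alpha> n \<bullet> p n \<boxplus> cdiff Y n \<bullet> q n"
    "r m \<bullet> D n = \<beta> n \<bullet> p n \<boxplus> (mn (s n \<bullet> q n) \<boxplus> mn (cdiff Z (n - 1) \<bullet> r n))" if "m = n + 1" for n m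
    unfolding D_def that by (simp_all add: pidt qidt ridt)
  have pDt: "p m \<bullet> (D n \<bullet> t) = cdiff X n \<bullet> (p n \<bullet> t)" "q m \<bullet> (D n \<bullet> t) = \<alpha> n \<bullet> (p n \<bullet> t) \<boxplus> cdiff Y n \<bullet> (q n \<bullet> t)"
    "r m \<bullet> (D n \<bullet> t) = \<beta> n \<bullet> (p n \<bullet> t) \<boxplus> (mn (s n \<bullet> (q n \<bullet> t)) \<boxplus> mn (cdiff Z (n - 1) \<bullet> (r n \<bullet> t)))"
    if "m = n + 1" "arr t" "cd t = EE n" for n m t
    using that cmp_red[OF pD(1)[of m n], of t] cmp_red[OF pD(2)[of m n], of t] cmp_red[OF pD(3)[of m n], of t] by simp_all
  have a1t: "\<alpha> m \<bullet> (cdiff X n \<bullet> t) = mn (cdiff Y m \<bullet> (\<alpha> n \<bullet> t))"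
    and a2t: "\<beta> m \<bullet> (cdiff X n \<bullet> t) = s m \<bullet> (\<alpha> n \<bullet> t) \<boxplus> cdiff Z n \<bullet> (\<beta> n \<bullet> t)"
    if "m = n + 1" "arr t" "cd t = cob X n" for n m t
    using that cmp_red[OF a1, of t n] cmp_red[OF a2, of t n] by simp_all
  have st: "cdiff Z n \<bullet> (s n \<bullet> t) = s (n + 1) \<bullet> (cdiff Y n \<bullet> t)" if "arr t" "cd t = cob Y n" for n t
    using chn_commt[OF s] that by blast
  define E where "E = \<lparr>cob = EE, cdiff = D\<rparr>"
  have E [simp]: "cob E = EE" "cdiff E = D" by (simp_all add: E_def)
  have mon: "t = u" if "arr t" "cd t = EE n" "arr u" "cd u = EE n" "dm u = dm t"
    "p n \<bullet> t = p n \<bullet> u" "q n \<bullet> t = q n \<bullet> u" "r n \<bullet> t = r n \<bullet> u" for t u n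
    using triple_sum_monic[OF S[of n]] that by blast
  have DD: "D m \<bullet> D n = zr (EE n) (EE l)" if "n + 1 = m" "m + 1 = l" "m - 1 = n" "l - 1 = m" for n m l
  proof (rule mon[of _ l])
    note [simp] = that
    show "cd (D m \<bullet> D n) = EE l" "cd (zr (EE n) (EE l)) = EE l" "arr (D m \<bullet> D n)" "dm (zr (EE n) (EE l)) = dm (D m \<bullet> D n)"  by simp_all
    have *: "\<alpha> m \<bullet> (cdiff X n \<bullet> p n) = mn (cdiff Y m \<bullet> (\<alpha> n \<bullet> p n))"
      "\<beta> m \<bullet> (cdiff X n \<bullet> p n) = s m \<bullet> (\<alpha> n \<bullet> p n) \<boxplus> cdiff Z n \<bullet> (\<beta> n \<bullet> p n)"
      "cdiff Z n \<bullet> (s n \<bullet> q n) = s m \<bullet> (cdiff Y n \<bullet> q n)"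
      using a1t[of m n "p n"] a2t[of m n "p n"] st[of "q n" n] by simp_all
    show "p l \<bullet> (D m \<bullet> D n) = p l \<bullet> zr (EE n) (EE l)"
      by (simp add: pDt pD)
    show "q l \<bullet> (D m \<bullet> D n) = q l \<bullet> zr (EE n) (EE l)"
      by (simp add: pDt pD * pl_simps)
    show "r l \<bullet> (D m \<bullet> D n) = r l \<bullet> zr (EE n) (EE l)"
      by (simp add: pDt pD * pl_simps)
  qed auto
  have cE: "cplx E" unfolding cplx_def using DD[of n "n + 1" "n + 2" for n] by (simp add: hm_iff)
  have "{n. \<not> zero_object C (EE n)} \<subseteq> {n. \<not> zero_object C (cob X n)} \<union> {n. \<not> zero_object C (cob Y n)} \<union>
     (\<lambda>n. n + 1) ` {n. \<not> zero_object C (cob Z n)}"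
  proof
    fix n assume "n \<in> {n. \<not> zero_object C (EE n)}"
    moreover have "zero_object C (EE n)" if z: "zero_object C (cob X n)" "zero_object C (cob Y n)" "zero_object C (cob Z (n - 1))"
      unfolding zero_iff sid[of n, symmetric]
      using zero_to[OF z(1), of "p n"] zero_to[OF z(2), of "q n"] zero_to[OF z(3), of "r n"] by simp
    ultimately show "n \<in> {n. \<not> zero_object C (cob X n)} \<union> {n. \<not> zero_object C (cob Y n)} \<union> (\<lambda>n. n + 1) ` {n. \<not> zero_object C (cob Z n)}"
      by (auto intro: rev_image_eqI[of "n - 1"])
  qed
  then have "finite {n. \<not> zero_object C (EE n)}" using X Y Z unfolding bounded_iff
    by (meson finite_UnI finite_imageI finite_subset)
  then have bE: "bounded_complex C E" using cE by (simp add: bounded_iff)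
  have cp: "chn E X p" unfolding chn_def using cE by (simp add: hm_iff pD)
  have "gqi E X p" if sq: "gqi Y Z s"
    unfolding gqi_def ginj_def gsur_def
  proof (intro conjI allI impI)
    show "chn E X p" using cp .
  next
    fix n t x assume t: "cyc E n t" "arr x" "dm x = dm t" "cd x = cob X (n - 1)" "p n \<bullet> t = cdiff X (n - 1) \<bullet> x"
    note [simp] = t(2-4) cycD(1,2)[OF t(1), simplified]
    define y z where "y = q n \<bullet> t" and "z = r n \<bullet> t"
    have [simp]: "arr y" "dm y = dm t" "cd y = cob Y n" "arr z" "dm z = dm t" "cd z = cob Z (n - 1)"
      by (simp_all add: y_def z_def)
    have Dt: "D n \<bullet> t = zr (dm t) (EE (n + 1))" using cycD(3)[OF t(1)] by simp
    have "q (n + 1) \<bullet> (D n \<bullet> t) = zr (dm t) (cob Y (n + 1))" "r (n + 1) \<bullet> (D n \<bullet> t) = zr (dm t) (cob Z n)"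
      unfolding Dt by simp_all
    then have qr: "mn (cdiff Y n \<bullet> (\<alpha> (n - 1) \<bullet> x)) \<boxplus> cdiff Y n \<bullet> y = zr (dm t) (cob Y (n + 1))"
      "s n \<bullet> (\<alpha> (n - 1) \<bullet> x) \<boxplus> cdiff Z (n - 1) \<bullet> (\<beta> (n - 1) \<bullet> x) \<boxplus> (mn (s n \<bullet> y) \<boxplus> mn (cdiff Z (n - 1) \<bullet> z)) = zr (dm t) (cob Z n)"
      by (simp_all add: pDt t(5) a1t a2t y_def z_def del: pl_assoc)
    \<comment> \<open>t - D(x, 0, 0) has no component in X. Its Y-part y1 is a cycle that s sends to
      a boundary, so y1 is locally d y2.\<close>
    define y1 where "y1 = y \<boxplus> mn (\<alpha> (n - 1) \<bullet> x)"
    have [simp]: "arr y1" "dm y1 = dm t" "cd y1 = cob Y n" by (simp_all add: y1_def)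
    have c1: "cyc Y n y1" unfolding cyc_def using qr(1) by (simp add: y1_def pl_comm)
    have s1: "s n \<bullet> y1 = cdiff Z (n - 1) \<bullet> (\<beta> (n - 1) \<bullet> x \<boxplus> mn z)"
    proof (rule sym, rule diff_eq)
      show "cdiff Z (n - 1) \<bullet> (\<beta> (n - 1) \<bullet> x \<boxplus> mn z) \<boxplus> mn (s n \<bullet> y1) = zr (dm t) (cob Z n)"
        unfolding qr(2)[symmetric] y1_def by (simp add: pl_simps)
    qed simp_all
    obtain e y2 where e: "surj e" "cd e = dm t" "arr y2" "dm y2 = dm e" "cd y2 = cob Y (n - 1)"
      "y1 \<bullet> e = cdiff Y (n - 1) \<bullet> y2" using gqi_inj[OF sq c1 s1] by auto
    note [simp] = e(1-5)
    \<comment> \<open>The choice of y2 leaves the cycle u in Z. Lifting u to y3 up to d w corrects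
      y2, and v = (x, y2 - y3, -w) locally bounds t.\<close>
    define u where "u = s (n - 1) \<bullet> y2 \<boxplus> mn ((\<beta> (n - 1) \<bullet> x \<boxplus> mn z) \<bullet> e)"
    have [simp]: "arr u" "dm u = dm e" "cd u = cob Z (n - 1)" by (simp_all add: u_def)
    have "cdiff Z (n - 1) \<bullet> u = s n \<bullet> (cdiff Y (n - 1) \<bullet> y2) \<boxplus> mn (cdiff Z (n - 1) \<bullet> (\<beta> (n - 1) \<bullet> x \<boxplus> mn z) \<bullet> e)"
      unfolding u_def by (simp add: st)
    also have "\<dots> = zr (dm e) (cob Z n)" unfolding e(6)[symmetric] s1[symmetric] by simp
    finally have cu: "cyc Z (n - 1) u" unfolding cyc_def by simp
    obtain e' y3 w where e': "surj e'" "cd e' = dm u" "cyc Y (n - 1) y3" "dm y3 = dm e'" "arr w" "dm w = dm e'"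
      "cd w = cob Z (n - 1 - 1)" "u \<bullet> e' = s (n - 1) \<bullet> y3 \<boxplus> cdiff Z (n - 1 - 1) \<bullet> w"
      using gqi_surE[OF sq cu refl] by metis
    note [simp] = e'(1,2,4-7) cycD[OF e'(3)]
    define v where "v = i (n - 1) \<bullet> (x \<bullet> (e \<bullet> e')) \<boxplus> (j (n - 1) \<bullet> (y2 \<bullet> e' \<boxplus> mn y3) \<boxplus> k (n - 1) \<bullet> mn w)"
    have [simp]: "arr v" "dm v = dm e'" "cd v = EE (n - 1)" by (simp_all add: v_def)
    have pv: "p (n - 1) \<bullet> v = x \<bullet> (e \<bullet> e')" "q (n - 1) \<bullet> v = y2 \<bullet> e' \<boxplus> mn y3" "r (n - 1) \<bullet> v = mn w"
      unfolding v_def by (simp_all add: pidt qidt ridt)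
    have dy2: "cdiff Y (n - 1) \<bullet> (y2 \<bullet> e') = y \<bullet> (e \<bullet> e') \<boxplus> mn (\<alpha> (n - 1) \<bullet> (x \<bullet> (e \<bullet> e')))"
      using cmp_red[OF e(6)[symmetric], of e'] by (simp add: y1_def)
    have sy2: "s (n - 1) \<bullet> (y2 \<bullet> e') = (s (n - 1) \<bullet> y3 \<boxplus> cdiff Z (n - 1 - 1) \<bullet> w) \<boxplus> (\<beta> (n - 1) \<bullet> x \<boxplus> mn z) \<bullet> (e \<bullet> e')"
      unfolding e'(8)[symmetric] u_def by (simp add: pl_simps)
    have "t \<bullet> (e \<bullet> e') = D (n - 1) \<bullet> v"
    proof (rule mon[of _ n])
      show "p n \<bullet> (t \<bullet> (e \<bullet> e')) = p n \<bullet> (D (n - 1) \<bullet> v)"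
        using cmp_red[OF t(5), of "e \<bullet> e'"] by (simp add: pDt pv)
      show "q n \<bullet> (t \<bullet> (e \<bullet> e')) = q n \<bullet> (D (n - 1) \<bullet> v)"
        using cmp_red[OF y_def[symmetric], of "e \<bullet> e'"] by (simp add: pDt pv dy2 pl_simps)
      show "r n \<bullet> (t \<bullet> (e \<bullet> e')) = r n \<bullet> (D (n - 1) \<bullet> v)"
        using cmp_red[OF z_def[symmetric], of "e \<bullet> e'"] by (simp add: pDt pv sy2 pl_simps)
    qed simp_all
    then show "locally_boundary E n t"
      by (rule_tac exI[of _ "e \<bullet> e'"], rule_tac exI[of _ v]) (simp add: surj_comp)
  next
    fix n x assume t: "cyc X n x"
    note [simp] = cycD[OF t]
    have "mn (cdiff Y (n + 1) \<bullet> (\<alpha> n \<bullet> x)) = zr (dm x) (cob Y (n + 1 + 1))" using a1t[of "n + 1" n x] by simp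
    then have "cdiff Y (n + 1) \<bullet> (\<alpha> n \<bullet> x) = zr (dm x) (cob Y (n + 1 + 1))" by (rule mn_eq_zr[rotated]) simp_all
    then have c1: "cyc Y (n + 1) (\<alpha> n \<bullet> x)" unfolding cyc_def by simp
    have "s (n + 1) \<bullet> (\<alpha> n \<bullet> x) \<boxplus> cdiff Z n \<bullet> (\<beta> n \<bullet> x) = zr (dm x) (cob Z (n + 1))" using a2t[of "n + 1" n x] by simp
    \<comment> \<open>The cycle alpha x is sent by s to -d (beta x), so alpha x = d y locally. Then
      s y + beta x is a cycle of Z, equal to s y3 + d w after a cover, and v = (x, y3 - y, w) is a
      cycle over x.\<close>
    then have sa: "s (n + 1) \<bullet> (\<alpha> n \<bullet> x) = cdiff Z n \<bullet> mn (\<beta> n \<bullet> x)" by (simp add: diff_eq)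
    obtain e y where e: "surj e" "cd e = dm x" "arr y" "dm y = dm e" "cd y = cob Y n"
      "\<alpha> n \<bullet> x \<bullet> e = cdiff Y n \<bullet> y" using gqi_inj[OF sq c1, of "mn (\<beta> n \<bullet> x)"] sa by auto
    note [simp] = e(1-5)
    have e6: "\<alpha> n \<bullet> (x \<bullet> e) = cdiff Y n \<bullet> y" using e(6) by simp
    define u where "u = s n \<bullet> y \<boxplus> \<beta> n \<bullet> (x \<bullet> e)"
    have [simp]: "arr u" "dm u = dm e" "cd u = cob Z n" by (simp_all add: u_def)
    have "cdiff Z n \<bullet> u = s (n + 1) \<bullet> (\<alpha> n \<bullet> x) \<bullet> e \<boxplus> cdiff Z n \<bullet> (\<beta> n \<bullet> (x \<bullet> e))" unfolding u_def by (simp add: st e6)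
    also have "\<dots> = zr (dm e) (cob Z (n + 1))" unfolding sa by simp
    finally have cu: "cyc Z n u" unfolding cyc_def by simp
    obtain e' y3 w where e': "surj e'" "cd e' = dm u" "cyc Y n y3" "dm y3 = dm e'" "arr w" "dm w = dm e'"
      "cd w = cob Z (n - 1)" "u \<bullet> e' = s n \<bullet> y3 \<boxplus> cdiff Z (n - 1) \<bullet> w"
      using gqi_surE[OF sq cu refl] by metis
    note [simp] = e'(1,2,4-7) cycD[OF e'(3)]
    define v where "v = i n \<bullet> (x \<bullet> (e \<bullet> e')) \<boxplus> (j n \<bullet> (mn (y \<bullet> e') \<boxplus> y3) \<boxplus> k n \<bullet> w)"
    have [simp]: "arr v" "dm v = dm e'" "cd v = EE n" by (simp_all add: v_def)
    have pv: "p n \<bullet> v = x \<bullet> (e \<bullet> e')" "q n \<bullet> v = mn (y \<bullet> e') \<boxplus> y3" "r n \<bullet> v = w"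
      unfolding v_def by (simp_all add: pidt qidt ridt)
    have bx: "\<beta> n \<bullet> (x \<bullet> (e \<bullet> e')) = u \<bullet> e' \<boxplus> mn (s n \<bullet> (y \<bullet> e'))" unfolding u_def by (simp add: pl_simps)
    have "D n \<bullet> v = zr (dm v) (EE (n + 1))"
    proof (rule mon[of _ "n + 1"])
      show "p (n + 1) \<bullet> (D n \<bullet> v) = p (n + 1) \<bullet> zr (dm v) (EE (n + 1))"
        using cmp_red[OF cycD(3)[OF t], of "e \<bullet> e'"] by (simp add: pDt pv)
      show "q (n + 1) \<bullet> (D n \<bullet> v) = q (n + 1) \<bullet> zr (dm v) (EE (n + 1))"
        using cmp_red[OF e(6), of e'] by (simp add: pDt pv pl_simps)
      show "r (n + 1) \<bullet> (D n \<bullet> v) = r (n + 1) \<bullet> zr (dm v) (EE (n + 1))"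
        by (simp add: pDt pv bx e'(8) pl_simps)
    qed simp_all
    then have "cyc E n v" unfolding cyc_def by simp
    then show "locally_lifts E X (p n) n x"
      by (rule_tac exI[of _ "e \<bullet> e'"], rule_tac exI[of _ v], rule_tac exI[of _ "zr (dm e') (cob X (n - 1))"])
        (simp add: surj_comp pv)
  qed
  then show ?thesis using bE cp by (intro exI[of _ E] exI[of _ p] exI[of _ q] exI[of _ r]) (simp add: pD hm_iff)
qed

text \<open>With alpha = 0 and beta = f the construction is the homotopy fibre product of f and s.
  The component r is a homotopy, so the square commutes in the homotopy category and not among chain
  maps.\<close>

lemma ore_square:
  assumes X: "bounded_complex C X" and Y: "bounded_complex C Y" and Z: "bounded_complex C Z"
    and s: "gqi Y Z s" and f: "chn X Z f"
  shows "\<exists>E p q. bounded_complex C E \<and> gqi E X p \<and> chn E Y q \<and> htp E Z (\<lambda>n. f n \<bullet> p n) (\<lambda>n. s n \<bullet> q n)"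
proof -
  note cs = gqi_chn[OF s]
  note [simp] = chnD[OF cs] chnD[OF f]
  have "\<exists>E p q r. bounded_complex C E \<and> chn E X p \<and>
     (\<forall>n. hm (q n) (cob E n) (cob Y n) \<and> hm (r n) (cob E n) (cob Z (n - 1)) \<and>
       q (n + 1) \<bullet> cdiff E n = zr (cob X n) (cob Y (n + 1)) \<bullet> p n \<boxplus> cdiff Y n \<bullet> q n \<and>
       r (n + 1) \<bullet> cdiff E n = f n \<bullet> p n \<boxplus> (mn (s n \<bullet> q n) \<boxplus> mn (cdiff Z (n - 1) \<bullet> r n))) \<and>
     (gqi Y Z s \<longrightarrow> gqi E X p)"
    by (rule fibre_of_cone[OF X Y Z cs]) (simp_all add: hm_iff chn_comm[OF f])
  then obtain E p q r where E: "bounded_complex C E" "chn E X p" "gqi E X p" and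
    qr: "\<forall>n. hm (q n) (cob E n) (cob Y n) \<and> hm (r n) (cob E n) (cob Z (n - 1)) \<and>
       q (n + 1) \<bullet> cdiff E n = zr (cob X n) (cob Y (n + 1)) \<bullet> p n \<boxplus> cdiff Y n \<bullet> q n \<and>
       r (n + 1) \<bullet> cdiff E n = f n \<bullet> p n \<boxplus> (mn (s n \<bullet> q n) \<boxplus> mn (cdiff Z (n - 1) \<bullet> r n))"
    using s by blast
  then have q: "\<And>n. hm (q n) (cob E n) (cob Y n)" "\<And>n. hm (r n) (cob E n) (cob Z (n - 1))"
      "\<And>n. q (n + 1) \<bullet> cdiff E n = zr (cob X n) (cob Y (n + 1)) \<bullet> p n \<boxplus> cdiff Y n \<bullet> q n"
      "\<And>n. r (n + 1) \<bullet> cdiff E n = f n \<bullet> p n \<boxplus> (mn (s n \<bullet> q n) \<boxplus> mn (cdiff Z (n - 1) \<bullet> r n))"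
    by blast+
  note [simp] = q(1,2)[unfolded hm_iff] chnD[OF E(2)]
  have "chn E Y q" unfolding chn_def using q by (simp add: hm_iff)
  moreover have "htp E Z (\<lambda>n. f n \<bullet> p n) (\<lambda>n. s n \<bullet> q n)"
    unfolding htp_def by (rule exI[of _ r]) (simp add: q hm_iff pl_simps)
  ultimately show ?thesis using E by blast
qed

text \<open>The complex \<open>Y[a]\<close> with the sign of the differential correct for odd \<open>a\<close> only.\<close>

definition reindex :: "int \<Rightarrow> ('o, 'm) cochain \<Rightarrow> ('o, 'm) cochain" where
  "reindex a Y = \<lparr>cob = (\<lambda>n. cob Y (n + a)), cdiff = (\<lambda>n. mn (cdiff Y (n + a)))\<rparr>"

lemma reindex_simps [simp]: "cob (reindex a Y) n = cob Y (n + a)" "cdiff (reindex a Y) n = mn (cdiff Y (n + a))"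
  by (simp_all add: reindex_def)

lemma reindex_cplx: assumes "cplx Y" shows "cplx (reindex a Y)"
proof -
  have "n + 1 + a = n + a + 1" "n + 2 + a = n + a + 1 + 1" for n by simp_all
  then show ?thesis unfolding cplx_def reindex_simps using assms dd[OF assms refl] by (simp only:) (simp add: hm_iff)
qed

lemma reindex_bounded: assumes "bounded_complex C Y" shows "bounded_complex C (reindex a Y)"
proof -
  have "{n. \<not> zero_object C (cob Y (n + a))} \<subseteq> (\<lambda>n. n - a) ` {n. \<not> zero_object C (cob Y n)}"
    by (auto intro: rev_image_eqI[of "n + a" for n])
  then show ?thesis using assms reindex_cplx unfolding bounded_iff
    by (auto intro: finite_subset)
qed

lemma reindex_cyc: assumes "cplx Y" shows "cyc (reindex a Y) n t \<longleftrightarrow> cyc Y (n + a) t"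
proof -
  have [simp]: "n + 1 + a = n + a + 1" by simp
  show ?thesis unfolding cyc_def using assms mn_eq_zr[of "cdiff Y (n + a) \<bullet> t"] by auto
qed

lemma reindex_chn: assumes s: "chn Y Z s" shows "chn (reindex a Y) (reindex a Z) (\<lambda>n. s (n + a))"
proof -
  have [simp]: "n + 1 + a = n + a + 1" for n by simp
  note [simp] = chnD[OF s]
  show ?thesis unfolding chn_def
    using chn_comm[OF s] reindex_cplx by (simp add: hm_iff)
qed

lemma reindex_htp: assumes f: "chn Y Z f" and g: "chn Y Z g" and h: "htp Y Z f g"
  shows "htp (reindex a Y) (reindex a Z) (\<lambda>n. f (n + a)) (\<lambda>n. g (n + a))"
proof -
  obtain s where s: "\<And>n. hm (s n) (cob Y n) (cob Z (n - 1))"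
    "\<And>n. f n = g n \<boxplus> (cdiff Z (n - 1) \<bullet> s n \<boxplus> s (n + 1) \<bullet> cdiff Y n)" using h[unfolded htp_def] by blast
  have [simp]: "n + 1 + a = n + a + 1" "n - 1 + a = n + a - 1" for n by simp_all
  note [simp] = chnD[OF f] chnD[OF g] s(1)[unfolded hm_iff]
  \<comment> \<open>Both differentials change sign under \<open>reindex\<close>, so the homotopy
    does too.\<close>
  show ?thesis unfolding htp_def
    by (rule exI[of _ "\<lambda>n. mn (s (n + a))"]) (simp add: s(2) hm_iff)
qed

lemma reindex_gqi: assumes s: "gqi Y Z s" shows "gqi (reindex a Y) (reindex a Z) (\<lambda>n. s (n + a))"
  unfolding gqi_def ginj_def gsur_def
proof (intro conjI allI impI)
  note cs = gqi_chn[OF s]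
  note [simp] = chnD[OF cs]
  show "chn (reindex a Y) (reindex a Z) (\<lambda>n. s (n + a))" using reindex_chn cs by blast
  fix n
  have [simp]: "n - 1 + a = n + a - 1" by simp
  {
    fix t y assume t: "cyc (reindex a Y) n t" "arr y" "dm y = dm t" "cd y = cob (reindex a Z) (n - 1)" "s (n + a) \<bullet> t = cdiff (reindex a Z) (n - 1) \<bullet> y"
    have c: "cyc Y (n + a) t" using t(1) reindex_cyc by simp
    note [simp] = t(2-4) cycD[OF c]
    have e: "s (n + a) \<bullet> t = cdiff Z (n + a - 1) \<bullet> mn y" using t(5) by simp
    obtain e x where e: "surj e" "cd e = dm t" "arr x" "dm x = dm e" "cd x = cob Y (n + a - 1)" "t \<bullet> e = cdiff Y (n + a - 1) \<bullet> x"
      using gqi_inj[OF s c e] by auto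
    then show "locally_boundary (reindex a Y) n t"
      by (rule_tac exI[of _ e], rule_tac exI[of _ "mn x"]) simp
  next
    fix y assume t: "cyc (reindex a Z) n y"
    have c: "cyc Z (n + a) y" using t reindex_cyc by simp
    note [simp] = cycD[OF c]
    obtain e x w where e: "surj e" "cd e = dm y" "cyc Y (n + a) x" "dm x = dm e" "arr w" "dm w = dm e" "cd w = cob Z (n + a - 1)"
       "y \<bullet> e = s (n + a) \<bullet> x \<boxplus> cdiff Z (n + a - 1) \<bullet> w" using gqi_surE[OF s c refl] by metis
    then show "locally_lifts (reindex a Y) (reindex a Z) (s (n + a)) n y"
      by (rule_tac exI[of _ e], rule_tac exI[of _ x], rule_tac exI[of _ "mn w"]) (simp add: reindex_cyc)
  }
qed

text \<open>If b is a homotopy from s f to s g, the pair (f - g, b) is a chain map from X to the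
  cone of s desuspended once. Its homotopy fibre E maps to X by a quasi-isomorphism p, and the
  component q is a homotopy from f p to g p.\<close>

lemma cancellation:
  assumes X: "bounded_complex C X" and Y: "bounded_complex C Y" and Z: "bounded_complex C Z"
    and s: "gqi Y Z s" and f: "chn X Y f" and g: "chn X Y g"
    and h: "htp X Z (\<lambda>n. s n \<bullet> f n) (\<lambda>n. s n \<bullet> g n)"
  shows "\<exists>E p. bounded_complex C E \<and> gqi E X p \<and> htp E Y (\<lambda>n. f n \<bullet> p n) (\<lambda>n. g n \<bullet> p n)"
proof -
  note cs = gqi_chn[OF s]
  note [simp] = chnD[OF cs] chnD[OF f] chnD[OF g]
  obtain b where b: "\<And>n. hm (b n) (cob X n) (cob Z (n - 1))"
    "\<And>n. s n \<bullet> f n = s n \<bullet> g n \<boxplus> (cdiff Z (n - 1) \<bullet> b n \<boxplus> b (n + 1) \<bullet> cdiff X n)" using h[unfolded htp_def] by blast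
  note [simp] = b(1)[unfolded hm_iff]
  define a where "a n = f n \<boxplus> mn (g n)" for n
  have [simp]: "arr (a n)" "dm (a n) = cob X n" "cd (a n) = cob Y n" for n by (simp_all add: a_def)
  have da: "cdiff Y n \<bullet> a n = a (n + 1) \<bullet> cdiff X n" for n
    unfolding a_def using chn_comm[OF f] chn_comm[OF g] by simp
  have sa: "s n \<bullet> a n = cdiff Z (n - 1) \<bullet> b n \<boxplus> b (n + 1) \<bullet> cdiff X n" for n
    unfolding a_def by (simp add: b(2) pl_simps)
  note us = reindex_gqi[OF s, of "-1", simplified]
  have "\<exists>E p q r. bounded_complex C E \<and> chn E X p \<and>
     (\<forall>n. hm (q n) (cob E n) (cob (reindex (-1) Y) n) \<and> hm (r n) (cob E n) (cob (reindex (-1) Z) (n - 1)) \<and>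
       q (n + 1) \<bullet> cdiff E n = a n \<bullet> p n \<boxplus> cdiff (reindex (-1) Y) n \<bullet> q n \<and>
       r (n + 1) \<bullet> cdiff E n = b n \<bullet> p n \<boxplus> (mn (s (n - 1) \<bullet> q n) \<boxplus> mn (cdiff (reindex (-1) Z) (n - 1) \<bullet> r n))) \<and>
     (gqi (reindex (-1) Y) (reindex (-1) Z) (\<lambda>n. s (n - 1)) \<longrightarrow> gqi E X p)"
  proof (rule fibre_of_cone[OF X reindex_bounded[OF Y] reindex_bounded[OF Z] gqi_chn[OF us]])
    fix n
    show "a (n + 1) \<bullet> cdiff X n = mn (cdiff (reindex (-1) Y) (n + 1) \<bullet> a n)" by (simp add: da)
    show "b (n + 1) \<bullet> cdiff X n = s (n + 1 - 1) \<bullet> a n \<boxplus> cdiff (reindex (-1) Z) n \<bullet> b n" by (simp add: sa pl_simps)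
  qed (simp_all add: hm_iff)
  then obtain E p q where E: "bounded_complex C E" "chn E X p" "gqi E X p" and
    qr: "\<forall>n. hm (q n) (cob E n) (cob (reindex (-1) Y) n) \<and> q (n + 1) \<bullet> cdiff E n = a n \<bullet> p n \<boxplus> cdiff (reindex (-1) Y) n \<bullet> q n"
    using us by blast
  then have q: "\<And>n. hm (q n) (cob E n) (cob Y (n - 1))"
      "\<And>n. q (n + 1) \<bullet> cdiff E n = a n \<bullet> p n \<boxplus> cdiff (reindex (-1) Y) n \<bullet> q n"
    by simp_all
  note [simp] = q(1)[unfolded hm_iff] chnD[OF E(2)]
  have "htp E Y (\<lambda>n. f n \<bullet> p n) (\<lambda>n. g n \<bullet> p n)"
    unfolding htp_def by (rule exI[of _ q]) (simp add: q hm_iff pl_simps a_def)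
  then show ?thesis using E by blast
qed

end

section \<open>Localization and the homotopy category\<close>

text \<open>Right fractions, with the denominator on the source side. \<open>W_cancel\<close> is
  included because \<open>roof_rel\<close> asks only that s u lie in W; together with s in W it puts
  u in W, as the Ore condition demands.\<close>

locale fractions = category C
  for C :: "('o, 'm, 'k, 'z) lin_cat_scheme" +
  fixes W :: "'m set"
  assumes W_id: "X \<in> Ob C \<Longrightarrow> Idt C X \<in> W"
    and W_comp: "\<lbrakk>arr s; arr t; s \<in> W; t \<in> W; dm t = cd s\<rbrakk> \<Longrightarrow> t \<bullet> s \<in> W"
    and W_cancel: "\<lbrakk>arr a; arr s; dm s = cd a; s \<in> W; s \<bullet> a \<in> W\<rbrakk> \<Longrightarrow> a \<in> W"
    and W_ore: "\<lbrakk>arr f; arr s; s \<in> W; cd s = cd f\<rbrakk> \<Longrightarrow>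
      \<exists>p q. arr p \<and> p \<in> W \<and> arr q \<and> cd p = dm f \<and> cd q = dm s \<and> dm q = dm p \<and> f \<bullet> p = s \<bullet> q"
    and W_equalize: "\<lbrakk>arr f; arr g; dm g = dm f; cd g = cd f; arr s; s \<in> W; dm s = cd f; s \<bullet> f = s \<bullet> g\<rbrakk> \<Longrightarrow>
      \<exists>p. arr p \<and> p \<in> W \<and> cd p = dm f \<and> f \<bullet> p = g \<bullet> p"
begin

definition rf :: "'o \<Rightarrow> 'o \<Rightarrow> 'm \<Rightarrow> 'm \<Rightarrow> bool" where
  "rf X Y s f \<longleftrightarrow> arr s \<and> s \<in> W \<and> cd s = X \<and> arr f \<and> dm f = dm s \<and> cd f = Y"

definition req :: "'m \<Rightarrow> 'm \<Rightarrow> 'm \<Rightarrow> 'm \<Rightarrow> bool" where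
  "req s f t g \<longleftrightarrow> (\<exists>u v. arr u \<and> arr v \<and> cd u = dm s \<and> cd v = dm t \<and> dm v = dm u \<and>
     s \<bullet> u = t \<bullet> v \<and> s \<bullet> u \<in> W \<and> f \<bullet> u = g \<bullet> v)"

text \<open>The apex of a roof is the source of its denominator, so two arrows name a class.\<close>

definition rcl :: "'m \<Rightarrow> 'm \<Rightarrow> ('o \<times> 'm \<times> 'm) set" where
  "rcl s f = roof_rel C W `` {(dm s, s, f)}"

lemma rf_roofs: "X \<in> Ob C \<Longrightarrow> Y \<in> Ob C \<Longrightarrow> (A, s, f) \<in> roofs C W X Y \<longleftrightarrow> rf X Y s f \<and> A = dm s"
  unfolding roofs_def rf_def using Mor_iff arr_Ob by auto

lemma rf_Ob: "rf X Y s f \<Longrightarrow> X \<in> Ob C" "rf X Y s f \<Longrightarrow> Y \<in> Ob C"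
  unfolding rf_def by auto

lemma rel_iff:
  assumes "rf X Y s f"
  shows "((dm s, s, f), (B, t, g)) \<in> roof_rel C W \<longleftrightarrow> rf X Y t g \<and> B = dm t \<and> req s f t g"
proof
  assume "((dm s, s, f), (B, t, g)) \<in> roof_rel C W"
  then obtain X' Y' E u v where X': "X' \<in> Ob C" "Y' \<in> Ob C" "(dm s, s, f) \<in> roofs C W X' Y'" "(B, t, g) \<in> roofs C W X' Y'"
     and E: "E \<in> Ob C" "u \<in> Mor C E (dm s)" "v \<in> Mor C E B" "s \<bullet> u = t \<bullet> v" "s \<bullet> u \<in> W" "f \<bullet> u = g \<bullet> v"
    unfolding roof_rel_def by blast
  have "rf X' Y' s f" "rf X' Y' t g" "B = dm t" using X' rf_roofs by blast+
  moreover have "X' = X" "Y' = Y" using assms calculation(1) unfolding rf_def by auto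
  moreover have "arr u" "arr v" "cd u = dm s" "cd v = dm t" "dm v = dm u"
    using E MorI[of E "dm s" u] MorI[of E B v] calculation unfolding rf_def by auto
  ultimately show "rf X Y t g \<and> B = dm t \<and> req s f t g" unfolding req_def using E by blast
next
  assume a: "rf X Y t g \<and> B = dm t \<and> req s f t g"
  then obtain u v where u: "arr u" "arr v" "cd u = dm s" "cd v = dm t" "dm v = dm u"
     "s \<bullet> u = t \<bullet> v" "s \<bullet> u \<in> W" "f \<bullet> u = g \<bullet> v" unfolding req_def by blast
  have "u \<in> Mor C (dm u) (dm s)" "v \<in> Mor C (dm u) B" "dm u \<in> Ob C" using u a arr_in_Mor[of u] arr_in_Mor[of v] by auto
  moreover have "(dm s, s, f) \<in> roofs C W X Y" "(B, t, g) \<in> roofs C W X Y" using a assms rf_roofs rf_Ob by blast+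
  moreover have "X \<in> Ob C" "Y \<in> Ob C" using rf_Ob assms by blast+
  ultimately show "((dm s, s, f), (B, t, g)) \<in> roof_rel C W" unfolding roof_rel_def using u(6-8) by blast
qed

lemma req_refl: "rf X Y s f \<Longrightarrow> req s f s f"
  unfolding req_def rf_def by (rule exI[of _ "Idt C (dm s)"], rule exI[of _ "Idt C (dm s)"]) auto

lemma req_sym: "req s f t g \<Longrightarrow> req t g s f"
  unfolding req_def by metis

text \<open>By cancellation v lies in W, so the two comparisons can be joined by an Ore square over
  the apex of the middle roof.\<close>

lemma req_trans:
  assumes rf: "rf X Y s f" "rf X Y t g" "rf X Y r h" and r: "req s f t g" "req t g r h" shows "req s f r h"
proof -
  obtain u v where u: "arr u" "arr v" "cd u = dm s" "cd v = dm t" "dm v = dm u"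
     "s \<bullet> u = t \<bullet> v" "s \<bullet> u \<in> W" "f \<bullet> u = g \<bullet> v" using r unfolding req_def by blast
  obtain u' v' where u': "arr u'" "arr v'" "cd u' = dm t" "cd v' = dm r" "dm v' = dm u'"
     "t \<bullet> u' = r \<bullet> v'" "t \<bullet> u' \<in> W" "g \<bullet> u' = h \<bullet> v'" using r unfolding req_def by blast
  note [simp] = rf[unfolded rf_def] u(1-5) u'(1-5)
  have "v \<in> W" using W_cancel[of v t] u by simp
  then obtain p q where p: "arr p" "p \<in> W" "arr q" "cd p = dm u'" "cd q = dm v" "dm q = dm p" "u' \<bullet> p = v \<bullet> q"
    using W_ore[of u' v] by auto
  note [simp] = p(1,3-6)
  have 1: "s \<bullet> (u \<bullet> q) = t \<bullet> (u' \<bullet> p)" using cmp_red[OF u(6), of q] p(7) by simp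
  have 2: "t \<bullet> (u' \<bullet> p) = r \<bullet> (v' \<bullet> p)" using cmp_red[OF u'(6), of p] by simp
  have 3: "f \<bullet> (u \<bullet> q) = h \<bullet> (v' \<bullet> p)" using cmp_red[OF u(8), of q] cmp_red[OF u'(8), of p] p(7) by simp
  have 4: "t \<bullet> (u' \<bullet> p) \<in> W" using W_comp[of p "t \<bullet> u'"] p(2) u'(7) by simp
  show ?thesis unfolding req_def
    by (rule exI[of _ "u \<bullet> q"], rule exI[of _ "v' \<bullet> p"]) (use 1 2 3 4 in simp)
qed

lemma rcl_mem: "rf X Y s f \<Longrightarrow> (B, t, g) \<in> rcl s f \<longleftrightarrow> rf X Y t g \<and> B = dm t \<and> req s f t g"
  unfolding rcl_def using rel_iff by auto

lemma rcl_self: "rf X Y s f \<Longrightarrow> (dm s, s, f) \<in> rcl s f"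
  using rcl_mem req_refl by blast

lemma rcl_eq:
  assumes "rf X Y s f" "rf X Y t g"
  shows "rcl s f = rcl t g \<longleftrightarrow> req s f t g"
proof
  assume "rcl s f = rcl t g"
  then show "req s f t g" using rcl_self[OF assms(2)] rcl_mem[OF assms(1)] by blast
next
  assume r: "req s f t g"
  have "P \<in> rcl s f \<longleftrightarrow> P \<in> rcl t g" for P
    using rcl_mem[OF assms(1)] rcl_mem[OF assms(2)] req_trans[OF assms] req_trans[OF assms(2,1)] r req_sym[OF r]
    by (cases P) blast
  then show "rcl s f = rcl t g" by blast
qed

abbreviation "L \<equiv> localization C W"

lemma L_Ob: "Ob L = Ob C" by (simp add: localization_def)

lemma L_Mor: "X \<in> Ob C \<Longrightarrow> Y \<in> Ob C \<Longrightarrow> F \<in> Mor L X Y \<longleftrightarrow> (\<exists>s f. rf X Y s f \<and> F = rcl s f)"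
proof -
  assume O: "X \<in> Ob C" "Y \<in> Ob C"
  have "F \<in> Mor L X Y \<longleftrightarrow> (\<exists>A s f. (A, s, f) \<in> roofs C W X Y \<and> F = roof_rel C W `` {(A, s, f)})"
    unfolding localization_def quotient_def by auto
  then show ?thesis unfolding rcl_def by (auto simp: rf_roofs[OF O])
qed

lemma L_Idt: "X \<in> Ob C \<Longrightarrow> Idt L X = rcl (Idt C X) (Idt C X)"
  by (simp add: localization_def rcl_def)

lemma rf_id: "arr f \<Longrightarrow> rf (dm f) (cd f) (Idt C (dm f)) f"
  unfolding rf_def using W_id by simp

text \<open>Composition of classes is a union over representatives and over Ore squares, so
  independence of both choices is proved at once. Three Ore squares bring all data under one apex;
  x4 equalizes b' y2 x3 and v' w, which until then agree only after composition with t'.\<close>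

lemma L_comp_wd:
  assumes rf: "rf X Y s f" "rf Y Z t g" "rf X Y s' f'" "rf Y Z t' g'" and r: "req s f s' f'" "req t g t' g'"
    and u: "arr u" "u \<in> W" "cd u = dm s" "arr v" "cd v = dm t" "dm v = dm u" "f \<bullet> u = t \<bullet> v"
    and u': "arr u'" "u' \<in> W" "cd u' = dm s'" "arr v'" "cd v' = dm t'" "dm v' = dm u'" "f' \<bullet> u' = t' \<bullet> v'"
  shows "req (s \<bullet> u) (g \<bullet> v) (s' \<bullet> u') (g' \<bullet> v')"
proof -
  obtain a a' where a: "arr a" "arr a'" "cd a = dm s" "cd a' = dm s'" "dm a' = dm a"
     "s \<bullet> a = s' \<bullet> a'" "s \<bullet> a \<in> W" "f \<bullet> a = f' \<bullet> a'" using r unfolding req_def by blast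
  obtain b b' where b: "arr b" "arr b'" "cd b = dm t" "cd b' = dm t'" "dm b' = dm b"
     "t \<bullet> b = t' \<bullet> b'" "t \<bullet> b \<in> W" "g \<bullet> b = g' \<bullet> b'" using r unfolding req_def by blast
  note [simp] = rf[unfolded rf_def] u(1,3-6) u'(1,3-6) a(1-5) b(1-5)
  have W: "a \<in> W" "b \<in> W" using W_cancel[of a s] W_cancel[of b t] a b by simp_all
  obtain x1 y1 where 1: "arr x1" "x1 \<in> W" "arr y1" "cd x1 = dm u" "cd y1 = dm a" "dm y1 = dm x1" "u \<bullet> x1 = a \<bullet> y1"
    using W_ore[of u a] W by auto
  note [simp] = 1(1,3-6)
  obtain x2 y2 where 2: "arr x2" "x2 \<in> W" "arr y2" "cd x2 = dm x1" "cd y2 = dm b" "dm y2 = dm x2" "v \<bullet> x1 \<bullet> x2 = b \<bullet> y2"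
    using W_ore[of "v \<bullet> x1" b] W by auto
  note [simp] = 2(1,3-6)
  obtain x3 w where 3: "arr x3" "x3 \<in> W" "arr w" "cd x3 = dm x2" "cd w = dm u'" "dm w = dm x3" "a' \<bullet> (y1 \<bullet> x2) \<bullet> x3 = u' \<bullet> w"
    using W_ore[of "a' \<bullet> (y1 \<bullet> x2)" u'] u'(2) by auto
  note [simp] = 3(1,3-6)
  have "t' \<bullet> (b' \<bullet> (y2 \<bullet> x3)) = t \<bullet> (b \<bullet> y2 \<bullet> x3)" using cmp_red[OF b(6)[symmetric], of "y2 \<bullet> x3"] by simp
  also have "\<dots> = t \<bullet> v \<bullet> (x1 \<bullet> (x2 \<bullet> x3))" unfolding 2(7)[symmetric] by simp
  also have "\<dots> = f \<bullet> (u \<bullet> x1 \<bullet> (x2 \<bullet> x3))" unfolding u(7)[symmetric] by simp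
  also have "\<dots> = f \<bullet> a \<bullet> (y1 \<bullet> (x2 \<bullet> x3))" unfolding 1(7) by simp
  also have "\<dots> = f' \<bullet> (a' \<bullet> (y1 \<bullet> x2) \<bullet> x3)" unfolding a(8) by simp
  also have "\<dots> = t' \<bullet> (v' \<bullet> w)" unfolding 3(7) using cmp_red[OF u'(7), of w] by simp
  finally have t'e: "t' \<bullet> (b' \<bullet> (y2 \<bullet> x3)) = t' \<bullet> (v' \<bullet> w)" .
  have t'W: "t' \<in> W" using rf(4) by (simp add: rf_def)
  have "\<exists>p. arr p \<and> p \<in> W \<and> cd p = dm (b' \<bullet> (y2 \<bullet> x3)) \<and> b' \<bullet> (y2 \<bullet> x3) \<bullet> p = v' \<bullet> w \<bullet> p"
    by (rule W_equalize[OF _ _ _ _ _ t'W _ t'e]) simp_all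
  then obtain x4 where 4: "arr x4" "x4 \<in> W" "cd x4 = dm (b' \<bullet> (y2 \<bullet> x3))" "b' \<bullet> (y2 \<bullet> x3) \<bullet> x4 = v' \<bullet> w \<bullet> x4"
    by blast
  have 43: "cd x4 = dm x3" using 4(3) by simp
  note [simp] = 4(1) 43
  have "s \<bullet> u \<bullet> (x1 \<bullet> (x2 \<bullet> (x3 \<bullet> x4))) = s \<bullet> (u \<bullet> x1 \<bullet> (x2 \<bullet> (x3 \<bullet> x4)))" by simp
  also have "\<dots> = s \<bullet> a \<bullet> (y1 \<bullet> (x2 \<bullet> (x3 \<bullet> x4)))" unfolding 1(7) by simp
  also have "\<dots> = s' \<bullet> (a' \<bullet> (y1 \<bullet> x2) \<bullet> x3 \<bullet> x4)" unfolding a(6) by simp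
  also have "\<dots> = s' \<bullet> u' \<bullet> (w \<bullet> x4)" unfolding 3(7) by simp
  finally have e1: "s \<bullet> u \<bullet> (x1 \<bullet> (x2 \<bullet> (x3 \<bullet> x4))) = s' \<bullet> u' \<bullet> (w \<bullet> x4)" .
  have "g \<bullet> v \<bullet> (x1 \<bullet> (x2 \<bullet> (x3 \<bullet> x4))) = g \<bullet> (v \<bullet> x1 \<bullet> x2 \<bullet> (x3 \<bullet> x4))" by simp
  also have "\<dots> = g \<bullet> b \<bullet> (y2 \<bullet> (x3 \<bullet> x4))" unfolding 2(7) by simp
  also have "\<dots> = g' \<bullet> (b' \<bullet> (y2 \<bullet> x3) \<bullet> x4)" unfolding b(8) by simp
  also have "\<dots> = g' \<bullet> v' \<bullet> (w \<bullet> x4)" unfolding 4(4) by simp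
  finally have e2: "g \<bullet> v \<bullet> (x1 \<bullet> (x2 \<bullet> (x3 \<bullet> x4))) = g' \<bullet> v' \<bullet> (w \<bullet> x4)" .
  have "s \<in> W" using rf(1) by (simp add: rf_def)
  then have e3: "s \<bullet> u \<bullet> (x1 \<bullet> (x2 \<bullet> (x3 \<bullet> x4))) \<in> W"
    using u(2) 1(2) 2(2) 3(2) 4(2) by (intro W_comp) simp_all
  show ?thesis unfolding req_def
    by (rule exI[of _ "x1 \<bullet> (x2 \<bullet> (x3 \<bullet> x4))"], rule exI[of _ "w \<bullet> x4"])
      (use e1 e2 e3 in \<open>simp del: cmp_assoc\<close>)
qed

lemma rf_comp:
  assumes rf: "rf X Y s f" "rf Y Z t g"
    and u: "arr u" "u \<in> W" "cd u = dm s" "arr v" "cd v = dm t" "dm v = dm u"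
  shows "rf X Z (s \<bullet> u) (g \<bullet> v)"
  using assms W_comp[of u s] unfolding rf_def by simp

text \<open>By \<open>L_comp_wd\<close> the union in \<open>localization\<close> runs over equal
  classes, so any one Ore square computes the composite.\<close>

lemma L_Cmp:
  assumes rf: "rf X Y s f" "rf Y Z t g"
    and u: "arr u" "u \<in> W" "cd u = dm s" "arr v" "cd v = dm t" "dm v = dm u" "f \<bullet> u = t \<bullet> v"
  shows "Cmp L (rcl t g) (rcl s f) = rcl (s \<bullet> u) (g \<bullet> v)"
proof -
  have e: "roof_rel C W `` {(E, s' \<bullet> u', g' \<bullet> v')} = rcl (s \<bullet> u) (g \<bullet> v)"
    if h: "(A, s', f') \<in> rcl s f" "(B, t', g') \<in> rcl t g" "E \<in> Ob C" "u' \<in> Mor C E A \<inter> W" "v' \<in> Mor C E B" "f' \<bullet> u' = t' \<bullet> v'"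
    for A s' f' B t' g' E u' v'
  proof -
    have r: "rf X Y s' f'" "A = dm s'" "req s f s' f'" "rf Y Z t' g'" "B = dm t'" "req t g t' g'"
      using h rcl_mem[OF rf(1)] rcl_mem[OF rf(2)] by blast+
    then have "A \<in> Ob C" "B \<in> Ob C" unfolding rf_def by auto
    then have u': "arr u'" "u' \<in> W" "cd u' = dm s'" "dm u' = E" "arr v'" "cd v' = dm t'" "dm v' = dm u'"
      using h MorI[of E A u'] MorI[of E B v'] r by auto
    have "req (s \<bullet> u) (g \<bullet> v) (s' \<bullet> u') (g' \<bullet> v')"
      by (rule L_comp_wd[OF rf r(1,4,3,6) u u'(1-3,5-7) h(6)])
    then have "rcl (s \<bullet> u) (g \<bullet> v) = rcl (s' \<bullet> u') (g' \<bullet> v')"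
      using rcl_eq[OF rf_comp[OF rf u(1-6)] rf_comp[OF r(1,4) u'(1-3,5-7)]] by blast
    moreover have "dm (s' \<bullet> u') = E" using u' r unfolding rf_def by simp
    ultimately show ?thesis by (simp add: rcl_def)
  qed
  have ex: "(dm s, s, f) \<in> rcl s f" "(dm t, t, g) \<in> rcl t g" "dm u \<in> Ob C" "u \<in> Mor C (dm u) (dm s) \<inter> W" "v \<in> Mor C (dm u) (dm t)"
    using rcl_self rf u arr_in_Mor[of u] arr_in_Mor[of v] by auto
  let ?M = "{roof_rel C W `` {(E, s' \<bullet> u', g' \<bullet> v')} | A s' f' B t' g' E u' v'.
       (A, s', f') \<in> rcl s f \<and> (B, t', g') \<in> rcl t g \<and> E \<in> Ob C \<and> u' \<in> Mor C E A \<inter> W \<and> v' \<in> Mor C E B \<and>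
       f' \<bullet> u' = t' \<bullet> v'}"
  have "?M = {rcl (s \<bullet> u) (g \<bullet> v)}"
  proof (intro equalityI subsetI)
    fix m assume "m \<in> ?M"
    then show "m \<in> {rcl (s \<bullet> u) (g \<bullet> v)}" using e by blast
  next
    fix m assume "m \<in> {rcl (s \<bullet> u) (g \<bullet> v)}"
    then have "m = roof_rel C W `` {(dm u, s \<bullet> u, g \<bullet> v)}" using e[OF ex u(7)] by simp
    then show "m \<in> ?M" using ex u(7) by blast
  qed
  moreover have "Cmp L (rcl t g) (rcl s f) = \<Union>?M" by (simp add: localization_def)
  ultimately show ?thesis by simp
qed

lemma L_Cmp_closed:
  assumes "X \<in> Ob C" "Y \<in> Ob C" "Z \<in> Ob C" "F \<in> Mor L X Y" "G \<in> Mor L Y Z"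
  shows "Cmp L G F \<in> Mor L X Z"
proof -
  obtain s f t g where f: "rf X Y s f" "F = rcl s f" "rf Y Z t g" "G = rcl t g" using assms L_Mor by meson
  note r = f(1,3)[unfolded rf_def]
  obtain u v where u: "arr u" "u \<in> W" "arr v" "cd u = dm f" "cd v = dm t" "dm v = dm u" "f \<bullet> u = t \<bullet> v"
    using W_ore[of f t] r by auto
  have u': "cd u = dm s" using u r by simp
  show ?thesis unfolding f(2,4) L_Cmp[OF f(1,3) u(1,2) u' u(3,5-7)]
    using L_Mor[OF assms(1,3)] rf_comp[OF f(1,3) u(1,2) u' u(3,5,6)] by blast
qed

definition loc :: "'m \<Rightarrow> ('o \<times> 'm \<times> 'm) set" where
  "loc f = rcl (Idt C (dm f)) f"

lemma loc_localize: "arr f \<Longrightarrow> dm f = X \<Longrightarrow> localize_arrow C W X f = loc f"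
  by (auto simp: localize_arrow_def loc_def rcl_def)

lemma loc_Mor: "arr f \<Longrightarrow> dm f = X \<Longrightarrow> cd f = Y \<Longrightarrow> loc f \<in> Mor L X Y"
  using L_Mor[of X Y "loc f"] rf_id[of f] arr_Ob[of f] unfolding loc_def by blast

lemma loc_id: "X \<in> Ob C \<Longrightarrow> Idt L X = loc (Idt C X)"
  by (simp add: loc_def L_Idt)

text \<open>A lift i of e through the denominator gives an Ore square with an identity on the other
  side, so composing with e clears the denominator.\<close>

lemma L_Cmp_loc:
  assumes rf: "rf Y Z t g" and e: "arr e" "cd e = Y" and i: "arr i" "dm i = dm e" "cd i = dm t" "t \<bullet> i = e"
  shows "Cmp L (rcl t g) (loc e) = loc (g \<bullet> i)"
proof -
  have r: "rf (dm e) Y (Idt C (dm e)) e" using rf_id[of e] e by simp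
  have O: "dm e \<in> Ob C" using e by simp
  have "Cmp L (rcl t g) (loc e) = rcl (Idt C (dm e) \<bullet> Idt C (dm e)) (g \<bullet> i)" unfolding loc_def
    by (rule L_Cmp[OF r rf]) (simp_all add: O W_id i e(1))
  moreover have "dm (g \<bullet> i) = dm e" using i(1-3) rf unfolding rf_def by simp
  ultimately show ?thesis using O by (simp add: loc_def)
qed

lemma loc_cmp:
  assumes "arr f" "arr g" "dm g = cd f" shows "Cmp L (loc g) (loc f) = loc (g \<bullet> f)"
  unfolding loc_def[of g] by (rule L_Cmp_loc[OF rf_id[OF assms(2)]]) (use assms in simp_all)

text \<open>\<open>fractions\<close> carries no linear structure, so the scalar enters through its
  effect on C: c f is an arrow z that depends only on the source and is stable under precomposition.
  It will be the scalar 0.\<close>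

lemma L_zero_smult:
  assumes rf: "rf X Y s f"
    and c: "\<And>f. arr f \<Longrightarrow> cd f = Y \<Longrightarrow> c \<odot>\<^bsub>Hom C (dm f) Y\<^esub> f = z (dm f)"
    and z: "\<And>A. A \<in> Ob C \<Longrightarrow> arr (z A) \<and> dm (z A) = A \<and> cd (z A) = Y"
    and zc: "\<And>u. arr u \<Longrightarrow> z (cd u) \<bullet> u = z (dm u)"
  shows "c \<odot>\<^bsub>Hom L X Y\<^esub> (rcl s f) = loc (z X)"
proof -
  have X: "X \<in> Ob C" using rf rf_Ob by blast
  have rz: "rf X Y (Idt C X) (z X)" using rf_id[of "z X"] z X by simp
  have e: "roof_rel C W `` {(A, s', c \<odot>\<^bsub>Hom C A Y\<^esub> f')} = loc (z X)" if h: "(A, s', f') \<in> rcl s f" for A s' f'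
  proof -
    have r: "rf X Y s' f'" "A = dm s'" using h rcl_mem[OF rf] by blast+
    note [simp] = r(1)[unfolded rf_def]
    have "c \<odot>\<^bsub>Hom C A Y\<^esub> f' = z A" using c[of f'] r by simp
    moreover have rz': "rf X Y s' (z A)" using z[of A] r unfolding rf_def by simp
    \<comment> \<open>Precomposition with 1 and s' respectively identifies the roofs (s', z) and (1,
      z).\<close>
    moreover have "req s' (z A) (Idt C X) (z X)" unfolding req_def
      by (rule exI[of _ "Idt C A"], rule exI[of _ s']) (use z[of A] zc[of s'] r(2) X in simp)
    ultimately show ?thesis using rcl_eq[OF rz' rz] r(2) z[OF X] by (simp add: loc_def rcl_def)
  qed
  let ?M = "{roof_rel C W `` {(A, s', c \<odot>\<^bsub>Hom C A Y\<^esub> f')} | A s' f'. (A, s', f') \<in> rcl s f}"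
  have "?M = {loc (z X)}" using e rcl_self[OF rf] by blast
  moreover have "c \<odot>\<^bsub>Hom L X Y\<^esub> (rcl s f) = \<Union>?M" by (simp add: localization_def)
  ultimately show ?thesis by simp
qed

end

section \<open>The homotopy category and its quasi-isomorphisms\<close>

context site
begin

abbreviation "bc X \<equiv> bounded_complex C X"

definition hcl :: "('o, 'm) cochain \<Rightarrow> ('o, 'm) cochain \<Rightarrow> (int \<Rightarrow> 'm) \<Rightarrow> ('o, 'm) ch_arrow set" where
  "hcl X Y f = homotopy C `` {(X, Y, f)}"

lemma chain_map_iff: "cplx X \<Longrightarrow> cplx Y \<Longrightarrow> chain_map C X Y f \<longleftrightarrow> chn X Y f"
  unfolding chain_map_def chn_def hm_def by simp

lemma homotopy_iff: "((X, Y, f), Q) \<in> homotopy C \<longleftrightarrow>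
  (\<exists>g. Q = (X, Y, g) \<and> bc X \<and> bc Y \<and> chn X Y f \<and> chn X Y g \<and> htp X Y f g)"
proof -
  define H where "H g = (\<exists>s. \<forall>n. s n \<in> Mor C (cob X n) (cob Y (n - 1)) \<and>
        f n = g n \<oplus>\<^bsub>Hom C (cob X n) (cob Y n)\<^esub>
          (cdiff Y (n - 1) \<cdot>\<^bsub>C\<^esub> s n \<oplus>\<^bsub>Hom C (cob X n) (cob Y n)\<^esub> s (n + 1) \<cdot>\<^bsub>C\<^esub> cdiff X n))" for g
  have *: "H g \<longleftrightarrow> htp X Y f g" if "bc X" "bc Y" "chn X Y f" "chn X Y g" for g
  proof -
    note [simp] = chnD[OF that(3)] chnD[OF that(4)]
    have "(\<forall>n. s n \<in> Mor C (cob X n) (cob Y (n - 1)) \<and> f n = g n \<oplus>\<^bsub>Hom C (cob X n) (cob Y n)\<^esub>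
          (cdiff Y (n - 1) \<cdot>\<^bsub>C\<^esub> s n \<oplus>\<^bsub>Hom C (cob X n) (cob Y n)\<^esub> s (n + 1) \<cdot>\<^bsub>C\<^esub> cdiff X n)) \<longleftrightarrow>
      (\<forall>n. hm (s n) (cob X n) (cob Y (n - 1)) \<and> f n = g n \<boxplus> (cdiff Y (n - 1) \<bullet> s n \<boxplus> s (n + 1) \<bullet> cdiff X n))" for s
    proof (cases "\<forall>n. hm (s n) (cob X n) (cob Y (n - 1))")
      case True
      then have "arr (s n)" "dm (s n) = cob X n" "cd (s n) = cob Y (n - 1)" for n
        using hm_iff by blast+
      then show ?thesis using True by (simp add: pl_def hm_def)
    next
      case False
      then show ?thesis by (auto simp: hm_def)
    qed
    then show ?thesis unfolding H_def htp_def by simp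
  qed
  have "((X, Y, f), Q) \<in> homotopy C \<longleftrightarrow>
    (\<exists>g. Q = (X, Y, g) \<and> bc X \<and> bc Y \<and> chain_map C X Y f \<and> chain_map C X Y g \<and> H g)"
    unfolding homotopy_def H_def by auto
  also have "\<dots> \<longleftrightarrow> (\<exists>g. Q = (X, Y, g) \<and> bc X \<and> bc Y \<and> chn X Y f \<and> chn X Y g \<and> htp X Y f g)"
    using * chain_map_iff[OF bounded_cplx bounded_cplx] by metis
  finally show ?thesis .
qed

lemma hcl_mem: "Q \<in> hcl X Y f \<longleftrightarrow> (\<exists>g. Q = (X, Y, g) \<and> bc X \<and> bc Y \<and> chn X Y f \<and> chn X Y g \<and> htp X Y f g)"
  unfolding hcl_def using homotopy_iff by auto

lemma hcl_self: "bc X \<Longrightarrow> bc Y \<Longrightarrow> chn X Y f \<Longrightarrow> (X, Y, f) \<in> hcl X Y f"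
  using hcl_mem htp_refl by blast

lemma hcl_eq: "bc X \<Longrightarrow> bc Y \<Longrightarrow> chn X Y f \<Longrightarrow> chn X Y g \<Longrightarrow> hcl X Y f = hcl X Y g \<longleftrightarrow> htp X Y f g"
proof
  assume "bc X" "bc Y" "chn X Y f" "chn X Y g" "hcl X Y f = hcl X Y g"
  then show "htp X Y f g" using hcl_mem hcl_self by blast
next
  assume a: "bc X" "bc Y" "chn X Y f" "chn X Y g" "htp X Y f g"
  show "hcl X Y f = hcl X Y g"
    unfolding set_eq_iff hcl_mem using a htp_sym[of X Y f g] htp_trans[of X Y f g] htp_trans[of X Y g f] by blast
qed

lemma Kb_Ob: "Ob (Kb C) = {X. bc X}" by (simp add: Kb_def quotient_category_def Chb_def)

lemma Kb_Mor: "bc X \<Longrightarrow> bc Y \<Longrightarrow> F \<in> Mor (Kb C) X Y \<longleftrightarrow> (\<exists>f. chn X Y f \<and> F = hcl X Y f)"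
  unfolding Kb_def quotient_category_def Chb_def quotient_def hcl_def
  using chain_map_iff[OF bounded_cplx bounded_cplx] by auto

lemma Kb_Idt: "Idt (Kb C) X = hcl X X (\<lambda>n. Idt C (cob X n))"
  by (simp add: Kb_def quotient_category_def Chb_def hcl_def)

lemma Kb_Cmp:
  assumes b: "bc X" "bc Y" "bc Z" and f: "chn X Y f" and g: "chn Y Z g"
  shows "Cmp (Kb C) (hcl Y Z g) (hcl X Y f) = hcl X Z (\<lambda>n. g n \<bullet> f n)"
proof -
  have *: "homotopy C `` {Cmp (Chb C) G F} = hcl X Z (\<lambda>n. g n \<bullet> f n)" if GF: "G \<in> hcl Y Z g" "F \<in> hcl X Y f" for F G
  proof -
    obtain f' g' where h: "F = (X, Y, f')" "chn X Y f'" "htp X Y f f'" "G = (Y, Z, g')" "chn Y Z g'" "htp Y Z g g'"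
      using GF unfolding hcl_mem by blast
    then have "Cmp (Chb C) G F = (X, Z, \<lambda>n. g' n \<bullet> f' n)" by (simp add: Chb_def)
    moreover have "hcl X Z (\<lambda>n. g n \<bullet> f n) = hcl X Z (\<lambda>n. g' n \<bullet> f' n)"
      using hcl_eq[OF b(1,3) chn_cmp[OF f g] chn_cmp[OF h(2,5)]] htp_cmp[OF f h(2) g h(5,3,6)] by blast
    ultimately show ?thesis by (simp add: hcl_def)
  qed
  have "Cmp (Kb C) (hcl Y Z g) (hcl X Y f) = (\<Union>G \<in> hcl Y Z g. \<Union>F \<in> hcl X Y f. homotopy C `` {Cmp (Chb C) G F})"
    by (simp add: Kb_def quotient_category_def)
  also have "\<dots> = hcl X Z (\<lambda>n. g n \<bullet> f n)"
    using * hcl_self[OF b(1,2) f] hcl_self[OF b(2,3) g] by auto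
  finally show ?thesis .
qed

text \<open>Representatives record their source and target, so disjointness of Hom-sets survives the
  passage to classes.\<close>

lemma hcl_inj:
  assumes "bc X" "bc Y" "chn X Y f" "hcl X Y f = hcl X' Y' f'"
  shows "X' = X \<and> Y' = Y \<and> chn X Y f' \<and> htp X Y f f'"
proof -
  have "(X, Y, f) \<in> hcl X' Y' f'" using hcl_self[OF assms(1-3)] assms(4) by simp
  then show ?thesis using htp_sym[of X Y f' f] assms unfolding hcl_mem by auto
qed

text \<open>\<open>category\<close> is split off from \<open>linear_category\<close> for this
  instance: fractions are formulated over it.\<close>

lemma Kb_category: "category (Kb C)"
proof (unfold_locales, unfold Kb_Ob, simp_all only: mem_Collect_eq Kb_Mor, goal_cases)
  case (1 X Y X' Y' f)
  then obtain g g' where "chn X Y g" "f = hcl X Y g" "f = hcl X' Y' g'" by blast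
  then show ?case using hcl_inj[of X Y g X' Y' g'] 1 by simp
next
  case (2 X) then show ?case using Kb_Idt chn_id[of X] bounded_cplx by blast
next
  case (3 X Y Z f g)
  then obtain f' g' where f: "chn X Y f'" "f = hcl X Y f'" "chn Y Z g'" "g = hcl Y Z g'" by blast
  show ?case unfolding f(2,4) Kb_Cmp[OF 3(1-3) f(1,3)] using chn_cmp[OF f(1,3)] by blast
next
  case (4 X Y f)
  then obtain f' where f: "chn X Y f'" "f = hcl X Y f'" by blast
  then have "(\<lambda>n. f' n \<bullet> Idt C (cob X n)) = f'" using chnD[OF f(1)] by (simp add: fun_eq_iff)
  then show ?case using 4 f Kb_Cmp[OF 4(1,1,2) chn_id f(1)] chnD(1)[OF f(1)] by (simp add: Kb_Idt)
next
  case (5 X Y f)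
  then obtain f' where f: "chn X Y f'" "f = hcl X Y f'" by blast
  then have "(\<lambda>n. Idt C (cob Y n) \<bullet> f' n) = f'" using chnD[OF f(1)] by (simp add: fun_eq_iff)
  then show ?case using 5 f Kb_Cmp[OF 5(1,2,2) f(1) chn_id] chnD(2)[OF f(1)] by (simp add: Kb_Idt)
next
  case (6 W X Y Z f g h)
  then obtain f' g' h' where f: "chn W X f'" "f = hcl W X f'" "chn X Y g'" "g = hcl X Y g'" "chn Y Z h'" "h = hcl Y Z h'" by blast
  have "(\<lambda>n. h' n \<bullet> g' n \<bullet> f' n) = (\<lambda>n. h' n \<bullet> (g' n \<bullet> f' n))"
    using chnD[OF f(1)] chnD[OF f(3)] chnD[OF f(5)] by (simp add: fun_eq_iff)
  then show ?case unfolding f(2,4,6) using Kb_Cmp 6(1-4) f(1,3,5) chn_cmp[OF f(1,3)] chn_cmp[OF f(3,5)] by simp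
qed

sublocale KB: category "Kb C" by (rule Kb_category)

lemma KB_hm: "KB.hm F X Y \<longleftrightarrow> bc X \<and> bc Y \<and> (\<exists>f. chn X Y f \<and> F = hcl X Y f)"
  unfolding KB.hm_def Kb_Ob using Kb_Mor by auto

lemma KB_arrE: assumes "KB.arr F" obtains f where "bc (KB.dm F)" "bc (KB.cd F)" "chn (KB.dm F) (KB.cd F) f" "F = hcl (KB.dm F) (KB.cd F) f"
  using assms KB_hm KB.hm_iff by metis

lemma hcl_arr [simp]:
  assumes "bc X" "bc Y" "chn X Y f"
  shows "KB.arr (hcl X Y f)" "KB.dm (hcl X Y f) = X" "KB.cd (hcl X Y f) = Y"
  using KB_hm KB.hm_iff assms by blast+

text \<open>By \<open>gqi_htp\<close> being a quasi-isomorphism does not depend on the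
  representative.\<close>

lemma Kbq_iff: assumes "bc X" "bc Y" "chn X Y f" shows "hcl X Y f \<in> Kb_quasi_isos C \<longleftrightarrow> gqi X Y f"
proof
  assume "hcl X Y f \<in> Kb_quasi_isos C"
  then obtain X' Y' f' where f: "hcl X Y f = hcl X' Y' f'" "quasi_iso C X' Y' f'"
    unfolding Kb_quasi_isos_def hcl_def by blast
  then have "X' = X" "Y' = Y" "chn X Y f'" "htp X Y f f'" using hcl_inj[OF assms] by blast+
  then show "gqi X Y f" using gqi_htp[of X Y f' f] quasi_iso_gqi[of X Y f'] f assms bounded_cplx htp_sym by metis
next
  assume "gqi X Y f"
  then show "hcl X Y f \<in> Kb_quasi_isos C" unfolding Kb_quasi_isos_def hcl_def
    using gqi_quasi_iso assms by blast
qed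

text \<open>Passing to classes turns the homotopies of \<open>ore_square\<close> and
  \<open>cancellation\<close> into the equations that fractions demand.\<close>

lemma Kb_fractions: "fractions (Kb C) (Kb_quasi_isos C)"
proof (unfold_locales, goal_cases)
  case (1 X)
  then show ?case using Kbq_iff[OF _ _ chn_id] gqi_id bounded_cplx unfolding Kb_Ob Kb_Idt by blast
next
  case (2 s t)
  let ?X = "KB.dm s" and ?Y = "KB.cd s" and ?Z = "KB.cd t"
  obtain f where f: "bc ?X" "bc ?Y" "chn ?X ?Y f" "s = hcl ?X ?Y f" using 2 KB_arrE by metis
  obtain g where g: "bc ?Z" "chn ?Y ?Z g" "t = hcl ?Y ?Z g" using 2 KB_arrE by metis
  have q: "gqi ?X ?Y f" "gqi ?Y ?Z g" using Kbq_iff[OF f(1-3)] Kbq_iff[OF f(2) g(1,2)] 2 f(4) g(3) by simp_all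
  have "Cmp (Kb C) t s = hcl ?X ?Z (\<lambda>n. g n \<bullet> f n)" using Kb_Cmp[OF f(1,2) g(1) f(3) g(2)] f(4) g(3) by simp
  then show ?case using Kbq_iff[OF f(1) g(1) chn_cmp[OF f(3) g(2)]] gqi_cmp[OF q] by simp
next
  case (3 a s)
  let ?X = "KB.dm a" and ?Y = "KB.cd a" and ?Z = "KB.cd s"
  obtain f where f: "bc ?X" "bc ?Y" "chn ?X ?Y f" "a = hcl ?X ?Y f" using 3 KB_arrE by metis
  obtain g where g: "bc ?Z" "chn ?Y ?Z g" "s = hcl ?Y ?Z g" using 3 KB_arrE by metis
  have "Cmp (Kb C) s a = hcl ?X ?Z (\<lambda>n. g n \<bullet> f n)" using Kb_Cmp[OF f(1,2) g(1) f(3) g(2)] f(4) g(3) by simp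
  then have q: "gqi ?X ?Z (\<lambda>n. g n \<bullet> f n)" "gqi ?Y ?Z g"
    using Kbq_iff[OF f(2) g(1,2)] Kbq_iff[OF f(1) g(1) chn_cmp[OF f(3) g(2)]] 3 g(3) by simp_all
  then show ?case using Kbq_iff[OF f(1-3)] gqi_cancel[OF f(3) q(2,1)] f(4) by simp
next
  case (4 f s)
  let ?X = "KB.dm f" and ?Y = "KB.dm s" and ?Z = "KB.cd f"
  obtain f' where f: "bc ?X" "bc ?Z" "chn ?X ?Z f'" "f = hcl ?X ?Z f'" using 4 KB_arrE by metis
  obtain s' where s: "bc ?Y" "chn ?Y ?Z s'" "s = hcl ?Y ?Z s'" using 4 KB_arrE by metis
  have "gqi ?Y ?Z s'" using Kbq_iff[OF s(1) f(2) s(2)] s(3) 4 by simp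
  then obtain E p q where E: "bc E" "gqi E ?X p" "chn E ?Y q" "htp E ?Z (\<lambda>n. f' n \<bullet> p n) (\<lambda>n. s' n \<bullet> q n)"
    using ore_square[OF f(1) s(1) f(2) _ f(3)] by blast
  note p = gqi_chn[OF E(2)]
  have "Cmp (Kb C) f (hcl E ?X p) = hcl E ?Z (\<lambda>n. f' n \<bullet> p n)" using Kb_Cmp[OF E(1) f(1,2) p f(3)] f(4) by simp
  also have "\<dots> = hcl E ?Z (\<lambda>n. s' n \<bullet> q n)" using hcl_eq[OF E(1) f(2) chn_cmp[OF p f(3)] chn_cmp[OF E(3) s(2)]] E(4) by blast
  also have "\<dots> = Cmp (Kb C) s (hcl E ?Y q)" using Kb_Cmp[OF E(1) s(1) f(2) E(3) s(2)] s(3) by simp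
  finally have *: "Cmp (Kb C) f (hcl E ?X p) = Cmp (Kb C) s (hcl E ?Y q)" .
  show ?case
    by (rule exI[of _ "hcl E ?X p"], rule exI[of _ "hcl E ?Y q"])
      (use hcl_arr[OF E(1) f(1) p] hcl_arr[OF E(1) s(1) E(3)] Kbq_iff[OF E(1) f(1) p] E(2) * in simp)
next
  case (5 f g s)
  let ?X = "KB.dm f" and ?Y = "KB.cd f" and ?Z = "KB.cd s"
  obtain f' where f: "bc ?X" "bc ?Y" "chn ?X ?Y f'" "f = hcl ?X ?Y f'" using 5 KB_arrE by metis
  obtain g' where g: "chn ?X ?Y g'" "g = hcl ?X ?Y g'" using 5 KB_arrE by metis
  obtain s' where s: "bc ?Z" "chn ?Y ?Z s'" "s = hcl ?Y ?Z s'" using 5 KB_arrE by metis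
  have q: "gqi ?Y ?Z s'" using Kbq_iff[OF f(2) s(1,2)] s(3) 5 by simp
  have "hcl ?X ?Z (\<lambda>n. s' n \<bullet> f' n) = hcl ?X ?Z (\<lambda>n. s' n \<bullet> g' n)"
    using 5(8) Kb_Cmp[OF f(1,2) s(1) f(3) s(2)] Kb_Cmp[OF f(1,2) s(1) g(1) s(2)] f(4) g(2) s(3) by simp
  then have "htp ?X ?Z (\<lambda>n. s' n \<bullet> f' n) (\<lambda>n. s' n \<bullet> g' n)"
    using hcl_eq[OF f(1) s(1) chn_cmp[OF f(3) s(2)] chn_cmp[OF g(1) s(2)]] by blast
  then obtain E p where E: "bc E" "gqi E ?X p" "htp E ?Y (\<lambda>n. f' n \<bullet> p n) (\<lambda>n. g' n \<bullet> p n)"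
    using cancellation[OF f(1,2) s(1) q f(3) g(1)] by blast
  note p = gqi_chn[OF E(2)]
  have "Cmp (Kb C) f (hcl E ?X p) = hcl E ?Y (\<lambda>n. f' n \<bullet> p n)" using Kb_Cmp[OF E(1) f(1,2) p f(3)] f(4) by simp
  also have "\<dots> = hcl E ?Y (\<lambda>n. g' n \<bullet> p n)" using hcl_eq[OF E(1) f(2) chn_cmp[OF p f(3)] chn_cmp[OF p g(1)]] E(3) by blast
  also have "\<dots> = Cmp (Kb C) g (hcl E ?X p)" using Kb_Cmp[OF E(1) f(1,2) p g(1)] g(2) by simp
  finally have *: "Cmp (Kb C) f (hcl E ?X p) = Cmp (Kb C) g (hcl E ?X p)" .
  show ?case
    by (rule exI[of _ "hcl E ?X p"])
      (use hcl_arr[OF E(1) f(1) p] Kbq_iff[OF E(1) f(1) p] E(2) * in simp)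
qed

sublocale KB: fractions "Kb C" "Kb_quasi_isos C" by (rule Kb_fractions)

end

section \<open>The bounded derived category\<close>

lemma (in linear_category) zero_smult: assumes "arr f" shows "\<zero>\<^bsub>K\<^esub> \<odot>\<^bsub>Hom C (dm f) (cd f)\<^esub> f = zr (dm f) (cd f)"
proof -
  interpret M: module K "Hom C (dm f) (cd f)" using Hom_module assms by simp
  show ?thesis using M.smult_l_null arr_in_Mor[OF assms] by (simp add: zr_def)
qed

context site
begin

lemma Db_simps: "Ob (Db C) = Ob (Db_lin C)" "Hom (Db C) = Hom (Db_lin C)" "Idt (Db C) = Idt (Db_lin C)"
  "Cmp (Db C) = Cmp (Db_lin C)" "shift (Db C) = Db_shift C" "tri (Db C) = Db_tri C"
  by (simp_all add: Db_def lin_cat.extend_def tri_cat.fields_def)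

lemma Db_lin_L: "Db_lin C = KB.L" by (simp add: Db_lin_def)

lemma D_Ob: "Ob (Db_lin C) = {X. bc X}" unfolding Db_lin_L KB.L_Ob Kb_Ob ..

abbreviation "dar \<equiv> Db_arrow C"

lemma dar_loc: "bc X \<Longrightarrow> bc Y \<Longrightarrow> chn X Y f \<Longrightarrow> dar X Y f = KB.loc (hcl X Y f)"
  unfolding Db_arrow_def using KB.loc_localize[of "hcl X Y f" X] by (simp add: hcl_def[symmetric])

lemma dar_Mor: "bc X \<Longrightarrow> bc Y \<Longrightarrow> chn X Y f \<Longrightarrow> dar X Y f \<in> Mor (Db_lin C) X Y"
  unfolding Db_lin_L using dar_loc KB.loc_Mor[of "hcl X Y f" X Y] by simp

lemma dar_cmp: "bc X \<Longrightarrow> bc Y \<Longrightarrow> bc Z \<Longrightarrow> chn X Y f \<Longrightarrow> chn Y Z g \<Longrightarrow>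
    Cmp (Db_lin C) (dar Y Z g) (dar X Y f) = dar X Z (\<lambda>n. g n \<bullet> f n)"
  unfolding Db_lin_L using dar_loc chn_cmp KB.loc_cmp[of "hcl X Y f" "hcl Y Z g"] Kb_Cmp[of X Y Z f g] by simp

lemma dar_id: "bc X \<Longrightarrow> Idt (Db_lin C) X = dar X X (\<lambda>n. Idt C (cob X n))"
  unfolding Db_lin_L using dar_loc[of X X] KB.loc_id[of X] chn_id[OF bounded_cplx] by (simp add: Kb_Idt Kb_Ob)

lemma dar_cmp_id: assumes b: "bc X" "bc Y" and f: "chn X Y f"
  shows "Cmp (Db_lin C) (dar X Y f) (Idt (Db_lin C) X) = dar X Y f" "Cmp (Db_lin C) (Idt (Db_lin C) Y) (dar X Y f) = dar X Y f"
proof -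
  have "(\<lambda>n. f n \<bullet> Idt C (cob X n)) = f" "(\<lambda>n. Idt C (cob Y n) \<bullet> f n) = f" using chnD[OF f] by (simp_all add: fun_eq_iff)
  then show "Cmp (Db_lin C) (dar X Y f) (Idt (Db_lin C) X) = dar X Y f" "Cmp (Db_lin C) (Idt (Db_lin C) Y) (dar X Y f) = dar X Y f"
    using dar_cmp[OF b(1,1,2) chn_id f] dar_cmp[OF b(1,2,2) f chn_id] b bounded_cplx by (simp_all add: dar_id)
qed

lemma D_closed: "bc X \<Longrightarrow> bc Y \<Longrightarrow> bc Z \<Longrightarrow> F \<in> Mor (Db_lin C) X Y \<Longrightarrow> G \<in> Mor (Db_lin C) Y Z \<Longrightarrow> Cmp (Db_lin C) G F \<in> Mor (Db_lin C) X Z"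
  unfolding Db_lin_L using KB.L_Cmp_closed[of X Y Z F G] by (simp add: Kb_Ob)

abbreviation "zch X Y \<equiv> \<lambda>n. zr (cob X n) (cob Y n)"

lemma Kb_zero_smult:
  assumes b: "bc X" "bc Y" and f: "chn X Y f"
  shows "\<zero>\<^bsub>K\<^esub> \<odot>\<^bsub>Hom (Kb C) X Y\<^esub> (hcl X Y f) = hcl X Y (zch X Y)"
proof -
  have *: "homotopy C `` {\<zero>\<^bsub>K\<^esub> \<odot>\<^bsub>Hom (Chb C) X Y\<^esub> F} = hcl X Y (zch X Y)" if F: "F \<in> hcl X Y f" for F
  proof -
    obtain g where g: "F = (X, Y, g)" "chn X Y g" using F unfolding hcl_mem by blast
    have "\<zero>\<^bsub>K\<^esub> \<odot>\<^bsub>Hom C (cob X n) (cob Y n)\<^esub> g n = zr (cob X n) (cob Y n)" for n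
      using zero_smult[of "g n"] chnD[OF g(2)] by simp
    then show ?thesis by (simp add: hcl_def g Chb_def)
  qed
  have "\<zero>\<^bsub>K\<^esub> \<odot>\<^bsub>Hom (Kb C) X Y\<^esub> (hcl X Y f) = (\<Union>F \<in> hcl X Y f. homotopy C `` {\<zero>\<^bsub>K\<^esub> \<odot>\<^bsub>Hom (Chb C) X Y\<^esub> F})"
    by (simp add: Kb_def quotient_category_def)
  then show ?thesis using * hcl_self[OF b f] by auto
qed

lemma D_zero_smult:
  assumes b: "bc X" "bc Y" and F: "F \<in> Mor (Db_lin C) X Y"
  shows "\<zero>\<^bsub>K\<^esub> \<odot>\<^bsub>Hom (Db_lin C) X Y\<^esub> F = dar X Y (zch X Y)"
proof -
  obtain s f where f: "KB.rf X Y s f" "F = KB.rcl s f" using F KB.L_Mor[of X Y F] b by (auto simp: Db_lin_L Kb_Ob)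
  have z: "chn A Y (zch A Y)" if "bc A" for A using chn_zr[of A Y] that b bounded_cplx by blast
  have "\<zero>\<^bsub>K\<^esub> \<odot>\<^bsub>Hom KB.L X Y\<^esub> KB.rcl s f = KB.loc (hcl X Y (zch X Y))"
  proof (rule KB.L_zero_smult[OF f(1), where z = "\<lambda>A. hcl A Y (zch A Y)"])
    fix f assume f: "KB.arr f" "KB.cd f = Y"
    obtain g where "bc (KB.dm f)" "bc (KB.cd f)" "chn (KB.dm f) (KB.cd f) g" "f = hcl (KB.dm f) (KB.cd f) g"
      using KB_arrE[OF f(1)] .
    then show "\<zero>\<^bsub>K\<^esub> \<odot>\<^bsub>Hom (Kb C) (KB.dm f) Y\<^esub> f = hcl (KB.dm f) Y (zch (KB.dm f) Y)"
      using Kb_zero_smult[of "KB.dm f" Y g] f(2) by simp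
  next
    fix A assume "A \<in> Ob (Kb C)"
    then show "KB.arr (hcl A Y (zch A Y)) \<and> KB.dm (hcl A Y (zch A Y)) = A \<and> KB.cd (hcl A Y (zch A Y)) = Y"
      using hcl_arr[OF _ b(2) z, of A] by (simp add: Kb_Ob)
  next
    fix u assume u: "KB.arr u"
    let ?A = "KB.dm u" and ?B = "KB.cd u"
    obtain g where g: "bc ?A" "bc ?B" "chn ?A ?B g" "u = hcl ?A ?B g" using KB_arrE[OF u] by blast
    have "(\<lambda>n. zr (cob ?B n) (cob Y n) \<bullet> g n) = zch ?A Y" using chnD[OF g(3)] bounded_cplx[OF b(2)] by (simp add: fun_eq_iff)
    then show "Cmp (Kb C) (hcl ?B Y (zch ?B Y)) u = hcl ?A Y (zch ?A Y)"
      using Kb_Cmp[OF g(1,2) b(2) g(3) z[OF g(2)]] g(4) by simp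
  qed
  then show ?thesis using dar_loc[OF b z[OF b(1)]] f(2) by (simp add: Db_lin_L)
qed

text \<open>If e = s i, the roof f s^-1 composed with e becomes the chain map f i. Roofs are later
  killed by making f i vanish.\<close>

lemma D_cmp_lift:
  assumes b: "bc Z" "bc Y" "bc E" "bc M" and s: "gqi E Y s" and f: "chn E M f" and e: "chn Z Y e" and i: "chn Z E i"
    and h: "\<And>n. s n \<bullet> i n = e n"
  shows "Cmp (Db_lin C) (KB.rcl (hcl E Y s) (hcl E M f)) (dar Z Y e) = dar Z M (\<lambda>n. f n \<bullet> i n)"
proof -
  note cs = gqi_chn[OF s]
  have rf: "KB.rf Y M (hcl E Y s) (hcl E M f)" unfolding KB.rf_def
    using hcl_arr[OF b(3,2) cs] hcl_arr[OF b(3,4) f] Kbq_iff[OF b(3,2) cs] s by simp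
  have "Cmp (Kb C) (hcl E Y s) (hcl Z E i) = hcl Z Y e" using Kb_Cmp[OF b(1,3,2) i cs] h by simp
  then have "Cmp KB.L (KB.rcl (hcl E Y s) (hcl E M f)) (KB.loc (hcl Z Y e)) = KB.loc (Cmp (Kb C) (hcl E M f) (hcl Z E i))"
    by (intro KB.L_Cmp_loc[OF rf]) (simp_all add: hcl_arr[OF b(1,2) e] hcl_arr[OF b(1,3) i] hcl_arr[OF b(3,2) cs])
  then show ?thesis using dar_loc[OF b(1,2) e] dar_loc[OF b(1,4) chn_cmp[OF i f]] Kb_Cmp[OF b(1,3,4) i f] by (simp add: Db_lin_L)
qed

lemma D_MorE:
  assumes b: "bc Y" "bc M" and F: "F \<in> Mor (Db_lin C) Y M"
  obtains E s f where "bc E" "gqi E Y s" "chn E M f" "F = KB.rcl (hcl E Y s) (hcl E M f)"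
proof -
  obtain s f where r: "KB.rf Y M s f" "F = KB.rcl s f" using F KB.L_Mor[of Y M F] b by (auto simp: Db_lin_L Kb_Ob)
  then have k: "KB.arr s" "KB.arr f" "KB.cd s = Y" "KB.cd f = M" "KB.dm f = KB.dm s" "s \<in> Kb_quasi_isos C" by (auto simp: KB.rf_def)
  let ?E = "KB.dm s"
  obtain s' where s: "bc ?E" "chn ?E Y s'" "s = hcl ?E Y s'" using KB_arrE[OF k(1)] k(3) by metis
  obtain f' where f: "chn ?E M f'" "f = hcl ?E M f'" using KB_arrE[OF k(2)] k(4,5) by metis
  have "gqi ?E Y s'" using Kbq_iff[OF s(1) b(1) s(2)] s(3) k(6) by simp
  then show ?thesis using that s f r(2) by metis
qed

section \<open>Shifts, mapping cones and distinguished triangles\<close>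

lemma shift_complex_reindex: "cplx X \<Longrightarrow> shift_complex C X = reindex 1 X"
proof -
  assume X: "cplx X"
  have "\<ominus>\<^bsub>Hom C (cob X (n + 1)) (cob X (n + 2))\<^esub> cdiff X (n + 1) = mn (cdiff X (n + 1))" for n
    using mn_eq[of "cob X (n + 1)" "cob X (n + 1 + 1)" "cdiff X (n + 1)"] arr_in_Mor[of "cdiff X (n + 1)"] X by (simp add: add.commute)
  then show ?thesis by (simp add: shift_complex_def reindex_def)
qed

lemma shift_bc: "bc X \<Longrightarrow> bc (shift_complex C X)"
  using shift_complex_reindex[OF bounded_cplx] reindex_bounded by simp

lemma shift_chn: "chn X Y f \<Longrightarrow> chn (shift_complex C X) (shift_complex C Y) (\<lambda>n. f (n + 1))"
  using shift_complex_reindex reindex_chn[of X Y f 1] chnD[of X Y f] by simp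

lemma shift_Kb:
  assumes b: "bc X" "bc Y" and f: "chn X Y f"
  shows "shift_Kb_arrow C (hcl X Y f) = hcl (shift_complex C X) (shift_complex C Y) (\<lambda>n. f (n + 1))"
proof -
  let ?S = "shift_complex C"
  have "hcl (?S X) (?S Y) (\<lambda>n. g (n + 1)) = hcl (?S X) (?S Y) (\<lambda>n. f (n + 1))" if "chn X Y g" "htp X Y f g" for g
    using hcl_eq[OF shift_bc[OF b(1)] shift_bc[OF b(2)] shift_chn[OF f] shift_chn[OF that(1)]]
      reindex_htp[OF f that, of 1] shift_complex_reindex[OF bounded_cplx] b by simp
  then have "{homotopy C `` {(?S X', ?S Y', \<lambda>n. f' (n + 1))} | X' Y' f'. (X', Y', f') \<in> hcl X Y f} = {hcl (?S X) (?S Y) (\<lambda>n. f (n + 1))}"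
    unfolding hcl_def[of "?S _", symmetric] hcl_mem using b f htp_refl[OF f] by blast
  then show ?thesis by (simp add: shift_Kb_arrow_def)
qed

text \<open>A cone triangle is distinguished by means of identity isomorphisms, and
  \<open>triangle_iso\<close> applies the shift to one of them. \<open>Db_shift\<close> is a union
  over all representatives (s, f) of the identity, so each of them has to be followed.\<close>

lemma Db_shift_id:
  assumes b: "bc X"
  shows "fmor (Db_shift C) (Idt (Db_lin C) X) = Idt (Db_lin C) (shift_complex C X)"
proof -
  let ?S = "shift_complex C"
  note idc = chn_id[OF bounded_cplx]
  define I where "I = hcl X X (\<lambda>n. Idt C (cob X n))"
  define J where "J = hcl (?S X) (?S X) (\<lambda>n. Idt C (cob (?S X) n))"
  have I: "KB.rf X X I I" unfolding KB.rf_def I_def using hcl_arr[OF b b idc[OF b]] KB.W_id[of X] b by (simp add: Kb_Idt Kb_Ob)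
  have J: "KB.rf (?S X) (?S X) J J" unfolding KB.rf_def J_def
    using hcl_arr[OF shift_bc[OF b] shift_bc[OF b] idc[OF shift_bc[OF b]]] KB.W_id[of "?S X"] shift_bc[OF b] by (simp add: Kb_Idt Kb_Ob)
  have IdI: "Idt (Db_lin C) X = KB.rcl I I" "Idt (Db_lin C) (?S X) = KB.rcl J J"
    unfolding Db_lin_L using KB.L_Idt[of X] KB.L_Idt[of "?S X"] b shift_bc by (simp_all add: Kb_Ob Kb_Idt I_def J_def)
  have *: "roof_rel (Kb C) (Kb_quasi_isos C) `` {(?S B, shift_Kb_arrow C s, shift_Kb_arrow C f)} = KB.rcl J J"
    if h: "(B, s, f) \<in> KB.rcl I I" for B s f
  proof -
    have r: "KB.rf X X s f" "B = KB.dm s" "KB.req I I s f" using KB.rcl_mem[OF I] h by blast+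
    then have k: "KB.arr s" "KB.arr f" "KB.cd s = X" "KB.cd f = X" "KB.dm f = KB.dm s" "s \<in> Kb_quasi_isos C" by (auto simp: KB.rf_def)
    obtain s' where s: "bc B" "chn B X s'" "s = hcl B X s'" using KB_arrE[OF k(1)] k(3) r(2) by metis
    obtain f' where f: "chn B X f'" "f = hcl B X f'" using KB_arrE[OF k(2)] k(4,5) r(2) by metis
    have q: "gqi B X s'" using Kbq_iff[OF s(1) b s(2)] s(3) k(6) by simp
    \<comment> \<open>Here s v and f v are homotopic and s v is a quasi-isomorphism. Shifting keeps
      both facts, and R and P then compare the shifted roof with the identity.\<close>
    obtain u v where uv: "KB.arr u" "KB.arr v" "KB.cd u = KB.dm I" "KB.cd v = KB.dm s" "KB.dm v = KB.dm u"
      "Cmp (Kb C) I u = Cmp (Kb C) s v" "Cmp (Kb C) I u \<in> Kb_quasi_isos C" "Cmp (Kb C) I u = Cmp (Kb C) f v"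
      using r(3) unfolding KB.req_def by blast
    let ?E = "KB.dm v"
    obtain v' where v: "bc ?E" "chn ?E B v'" "v = hcl ?E B v'" using KB_arrE[OF uv(2)] uv(4) r(2) by metis
    have sv: "Cmp (Kb C) s v = hcl ?E X (\<lambda>n. s' n \<bullet> v' n)" "Cmp (Kb C) f v = hcl ?E X (\<lambda>n. f' n \<bullet> v' n)"
      using Kb_Cmp[OF v(1) s(1) b v(2) s(2)] Kb_Cmp[OF v(1) s(1) b v(2) f(1)] v(3) s(3) f(2) by simp_all
    have c: "chn ?E X (\<lambda>n. s' n \<bullet> v' n)" "chn ?E X (\<lambda>n. f' n \<bullet> v' n)" using chn_cmp v(2) s(2) f(1) by blast+
    have g: "gqi ?E X (\<lambda>n. s' n \<bullet> v' n)" using Kbq_iff[OF v(1) b c(1)] uv(6,7) sv by simp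
    have e: "hcl ?E X (\<lambda>n. s' n \<bullet> v' n) = hcl ?E X (\<lambda>n. f' n \<bullet> v' n)" using uv(6,8) sv by simp
    define S where "S = hcl (?S B) (?S X) (\<lambda>n. s' (n + 1))"
    define T where "T = hcl (?S B) (?S X) (\<lambda>n. f' (n + 1))"
    define P where "P = hcl (?S ?E) (?S B) (\<lambda>n. v' (n + 1))"
    define R where "R = hcl (?S ?E) (?S X) (\<lambda>n. s' (n + 1) \<bullet> v' (n + 1))"
    have ST: "shift_Kb_arrow C s = S" "shift_Kb_arrow C f = T" unfolding S_def T_def using shift_Kb s f b by simp_all
    note sb = shift_bc[OF b] shift_bc[OF s(1)] shift_bc[OF v(1)] and sc = shift_chn[OF s(2)] shift_chn[OF f(1)] shift_chn[OF v(2)] shift_chn[OF c(1)]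
    have qs: "gqi (?S B) (?S X) (\<lambda>n. s' (n + 1))" "gqi (?S ?E) (?S X) (\<lambda>n. s' (n + 1) \<bullet> v' (n + 1))"
      using reindex_gqi[OF q, of 1] reindex_gqi[OF g, of 1] shift_complex_reindex[OF bounded_cplx] b s(1) v(1) by simp_all
    have a: "KB.arr S" "KB.dm S = ?S B" "KB.cd S = ?S X" "KB.arr T" "KB.dm T = ?S B" "KB.cd T = ?S X"
       "KB.arr P" "KB.dm P = ?S ?E" "KB.cd P = ?S B" "KB.arr R" "KB.dm R = ?S ?E" "KB.cd R = ?S X"
       "S \<in> Kb_quasi_isos C" "R \<in> Kb_quasi_isos C"
      unfolding S_def T_def P_def R_def using hcl_arr sb sc Kbq_iff[OF sb(2,1) sc(1)] Kbq_iff[OF sb(3,1) sc(4)] qs by simp_all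
    have SP: "Cmp (Kb C) S P = R" "Cmp (Kb C) J R = R" unfolding S_def P_def R_def J_def
      using Kb_Cmp[OF sb(3,2,1) sc(3,1)] Kb_Cmp[OF sb(3,1,1) sc(4) idc[OF sb(1)]]
        KB.cmp_id(2)[of R "?S X"] a(10,12) by (simp_all add: Kb_Idt R_def)
    have TP: "Cmp (Kb C) T P = R"
    proof -
      have "Cmp (Kb C) T P = hcl (?S ?E) (?S X) (\<lambda>n. f' (n + 1) \<bullet> v' (n + 1))"
        unfolding T_def P_def by (rule Kb_Cmp[OF sb(3,2,1) sc(3,2)])
      also have "\<dots> = shift_Kb_arrow C (hcl ?E X (\<lambda>n. f' n \<bullet> v' n))" using shift_Kb[OF v(1) b c(2)] by simp
      also have "\<dots> = R" unfolding e[symmetric] R_def using shift_Kb[OF v(1) b c(1)] by simp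
      finally show ?thesis .
    qed
    have rf: "KB.rf (?S X) (?S X) S T" unfolding KB.rf_def using a by simp
    have "KB.req J J S T" unfolding KB.req_def
      by (rule exI[of _ R], rule exI[of _ P]) (use a SP TP J[unfolded KB.rf_def] in \<open>auto simp: J_def sb hcl_arr[OF sb(1,1) idc[OF sb(1)]]\<close>)
    then have "KB.rcl S T = KB.rcl J J" using KB.rcl_eq[OF J rf] by simp
    then show ?thesis using a(2) by (simp add: ST KB.rcl_def)
  qed
  have "{roof_rel (Kb C) (Kb_quasi_isos C) `` {(?S B, shift_Kb_arrow C s, shift_Kb_arrow C f)} | B s f. (B, s, f) \<in> KB.rcl I I} = {KB.rcl J J}"
    using * KB.rcl_self[OF I] by blast
  then show ?thesis unfolding IdI by (simp add: Db_shift_def)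
qed

lemma mapping_cone_chn:
  assumes b: "bc X" "bc Y" and f: "chn X Y f" and M: "mapping_cone C X Y f M j p"
  shows "bc M" "chn Y M j" "chn M (shift_complex C X) p"
proof -
  let ?S = "shift_complex C X"
  show bM: "bc M" using M by (simp add: mapping_cone_def)
  note cX = bounded_cplx[OF b(1)] and cY = bounded_cplx[OF b(2)] and cM = bounded_cplx[OF bM]
  have cS: "cplx ?S" using shift_bc[OF b(1)] bounded_cplx by blast
  have [simp]: "cob ?S n = cob X (n + 1)" for n by (simp add: shift_complex_def)
  have dS: "arr (cdiff ?S n)" "dm (cdiff ?S n) = cob X (n + 1)" "cd (cdiff ?S n) = cob X (n + 1 + 1)" for n using cplx_simps[OF cS, of n] by simp_all
  note [simp] = cplx_simps[OF cX] cplx_simps[OF cY] cplx_simps[OF cM] chnD[OF f] dS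
  obtain i q where iq: "\<forall>n. biproduct C (cob X (n + 1)) (cob Y n) (cob M n) (i n) (j n) (p n) (q n) \<and>
        cdiff M n = i (n + 1) \<bullet> cdiff ?S n \<bullet> p n \<oplus>\<^bsub>Hom C (cob M n) (cob M (n + 1))\<^esub>
          (j (n + 1) \<bullet> f (n + 1) \<bullet> p n \<oplus>\<^bsub>Hom C (cob M n) (cob M (n + 1))\<^esub> j (n + 1) \<bullet> cdiff Y n \<bullet> q n)"
    using M unfolding mapping_cone_def by blast
  have bp: "hm (i n) (cob X (n + 1)) (cob M n)" "hm (j n) (cob Y n) (cob M n)" "hm (p n) (cob M n) (cob X (n + 1))" "hm (q n) (cob M n) (cob Y n)"
     and pi: "p n \<bullet> i n = Idt C (cob X (n + 1))" and qj: "q n \<bullet> j n = Idt C (cob Y n)"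
     and pj: "p n \<bullet> j n = zr (cob Y n) (cob X (n + 1))" for n
    using biproduct_iff[THEN iffD1, of "cob X (n + 1)" "cob Y n", OF _ _ iq[rule_format, THEN conjunct1, of n]] by simp_all
  note [simp] = bp[unfolded hm_iff]
  have dM: "cdiff M n = i (n + 1) \<bullet> (cdiff ?S n \<bullet> p n) \<boxplus> (j (n + 1) \<bullet> (f (n + 1) \<bullet> p n) \<boxplus> j (n + 1) \<bullet> (cdiff Y n \<bullet> q n))" for n
    using iq by (simp add: pl_def)
  have pit: "p n \<bullet> (i n \<bullet> t) = t" if "arr t" "cd t = cob X (n + 1)" for n t using that cmp_red[OF pi, of t n] by simp
  have pjt: "p n \<bullet> (j n \<bullet> t) = zr (dm t) (cob X (n + 1))" if "arr t" "cd t = cob Y n" for n t using that cmp_red[OF pj, of t n] by simp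
  show "chn Y M j" unfolding chn_def
    using cY cM by (simp add: hm_iff) (simp add: dM pj qj)
  show "chn M ?S p" unfolding chn_def
    using cS cM by (simp add: hm_iff) (simp add: dM pit pjt)
qed

lemma cone_Db_tri:
  assumes b: "bc X" "bc Y" and f: "chn X Y f" and M: "mapping_cone C X Y f M j p"
  shows "Db_tri C X Y M (dar X Y f) (dar Y M j) (dar M (shift_complex C X) p)"
proof -
  note m = mapping_cone_chn[OF b f M]
  note s = shift_bc[OF b(1)]
  have "candidate_triangle (Db_lin C) (Db_shift C) X Y M (dar X Y f) (dar Y M j) (dar M (shift_complex C X) p)"
    unfolding candidate_triangle_def D_Ob using b m s f dar_Mor by (simp add: Db_shift_def)
  moreover have iso: "iso_arrow (Db_lin C) X X (Idt (Db_lin C) X)" if "bc X" for X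
    unfolding iso_arrow_def using dar_Mor[OF that that chn_id] dar_cmp_id[OF that that chn_id] dar_id[OF that] bounded_cplx[OF that] by auto
  ultimately show ?thesis unfolding Db_tri_def triangle_iso_def
    using b f m(1) M iso[OF b(1)] iso[OF b(2)] iso[OF m(1)] bounded_cplx dar_cmp_id[OF b f] dar_cmp_id[OF b(2) m(1,2)] dar_cmp_id[OF m(1) s m(3)]
      Db_shift_id[OF b(1)] chain_map_iff[OF bounded_cplx[OF b(1)] bounded_cplx[OF b(2)], of f] by metis
qed

text \<open>The zero object is the one chosen by \<^const>\<open>stalk_complex\<close>, so that shifts of stalk complexes
  are again of this form on the nose.\<close>

definition stk :: "int \<Rightarrow> 'o \<Rightarrow> ('o, 'm) cochain" where
  "stk k M = (let X = (\<lambda>n::int. if n = k then M else SOME Z. zero_object C Z)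
      in \<lparr>cob = X, cdiff = (\<lambda>n. zr (X n) (X (n + 1)))\<rparr>)"

abbreviation "z0 \<equiv> SOME Z. zero_object C Z"

lemma z0: "zero_object C z0" using site_zero by (rule someI_ex)

lemma z0_Ob [simp]: "z0 \<in> Ob C" using z0 zero_iff by blast

lemma stk_cob: "cob (stk k M) n = (if n = k then M else z0)" by (simp add: stk_def Let_def)

lemma stk_cdiff: "cdiff (stk k M) n = zr (cob (stk k M) n) (cob (stk k M) (n + 1))" by (simp add: stk_def Let_def)

lemma stk_stalk: "stalk_complex C M = stk 0 M" by (simp add: stalk_complex_def stk_def zr_def)

lemma stk_cplx: "M \<in> Ob C \<Longrightarrow> cplx (stk k M)"
  unfolding cplx_def stk_cdiff by (simp add: stk_cob hm_iff)

lemma stk_bc: "M \<in> Ob C \<Longrightarrow> bc (stk k M)"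
  unfolding bounded_iff using stk_cplx finite_subset[of "{n. \<not> zero_object C (cob (stk k M) n)}" "{k}"] z0 by (auto simp: stk_cob)

lemma stk_shift: "M \<in> Ob C \<Longrightarrow> shift_complex C (stk k M) = stk (k - 1) M"
proof -
  assume M: "M \<in> Ob C"
  have [simp]: "n + 1 = k \<longleftrightarrow> n = k - 1" for n by auto
  have c: "cob (shift_complex C (stk k M)) = cob (stk (k - 1) M)" by (auto simp: shift_complex_def stk_cob)
  have "cdiff (shift_complex C (stk k M)) n = cdiff (stk (k - 1) M) n" for n
    unfolding shift_complex_reindex[OF stk_cplx[OF M]] reindex_simps stk_cdiff using M by (auto simp: stk_cob)
  then show ?thesis using c by (intro cochain.equality) auto
qed

text \<open>X itself is a cone of the differential from its lowest term X^m to the remaining complex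
  Y. A cone of S -> Y carries S^(n+1) in degree n, so X^m is placed in degree m + 1.\<close>

lemma stupid_truncation:
  assumes X: "bc X" and min: "\<And>n. n < m \<Longrightarrow> zero_object C (cob X n)"
  shows "\<exists>Y f j p. bc Y \<and> {n. \<not> zero_object C (cob Y n)} = {n. \<not> zero_object C (cob X n)} - {m} \<and>
    chn (stk (m + 1) (cob X m)) Y f \<and> mapping_cone C (stk (m + 1) (cob X m)) Y f X j p"
proof -
  note cX = bounded_cplx[OF X]
  note [simp] = cplx_simps[OF cX]
  let ?S = "stk (m + 1) (cob X m)"
  have S: "cplx ?S" using stk_cplx by simp
  have cS: "cob ?S n = (if n = m + 1 then cob X m else z0)" for n by (simp add: stk_cob)
  define YO where "YO n = (if n = m then z0 else cob X n)" for n
  have YOO [simp]: "YO n \<in> Ob C" for n by (simp add: YO_def)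
  define Y where "Y = \<lparr>cob = YO, cdiff = (\<lambda>n. if n = m \<or> n + 1 = m then zr (YO n) (YO (n + 1)) else cdiff X n)\<rparr>"
  have Yc [simp]: "cob Y n = YO n" for n by (simp add: Y_def)
  have Yd: "cdiff Y n = (if n = m \<or> n + 1 = m then zr (YO n) (YO (n + 1)) else cdiff X n)" for n by (simp add: Y_def)
  have Ya: "arr (cdiff Y n)" "dm (cdiff Y n) = YO n" "cd (cdiff Y n) = YO (n + 1)" for n unfolding Yd by (auto simp: YO_def)
  have cY: "cplx Y" unfolding cplx_def
  proof (intro allI conjI)
    fix n
    show "hm (cdiff Y n) (cob Y n) (cob Y (n + 1))" unfolding hm_iff using Ya by simp
    have e: "n + 2 = n + 1 + 1" by simp
    show "cdiff Y (n + 1) \<bullet> cdiff Y n = zr (cob Y n) (cob Y (n + 2))"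
    proof (cases "n = m \<or> n + 1 = m \<or> n + 1 + 1 = m")
      case True
      then have "cdiff Y n = zr (YO n) (YO (n + 1)) \<or> cdiff Y (n + 1) = zr (YO (n + 1)) (YO (n + 1 + 1))" by (auto simp: Yd)
      then show ?thesis unfolding e Yc using Ya[of n] Ya[of "n + 1"] by auto
    next
      case False
      then show ?thesis unfolding e by (simp add: Yd YO_def cX)
    qed
  qed
  have supp: "{n. \<not> zero_object C (cob Y n)} = {n. \<not> zero_object C (cob X n)} - {m}"
    using z0 by (auto simp: YO_def)
  have bY: "bc Y" unfolding bounded_iff supp using cY X bounded_iff by auto
  define f where "f n = (if n = m + 1 then cdiff X m else zr (cob ?S n) (YO n))" for n
  have fa: "arr (f n)" "dm (f n) = cob ?S n" "cd (f n) = YO n" for n by (auto simp: f_def cS YO_def)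
  have cf: "chn ?S Y f" unfolding chn_def hm_iff
  proof (intro conjI allI)
    fix n
    show "arr (f n)" "dm (f n) = cob ?S n" "cd (f n) = cob Y n" using fa by simp_all
    have "cdiff Y n \<bullet> f n = zr (cob ?S n) (YO (n + 1))"
    proof (cases "n = m + 1")
      case True then show ?thesis by (simp add: f_def Yd YO_def cS cX)
    next
      case False then show ?thesis using Ya[of n] by (simp add: f_def cS)
    qed
    then show "cdiff Y n \<bullet> f n = f (n + 1) \<bullet> cdiff ?S n" unfolding stk_cdiff using fa[of "n + 1"] S by simp
  qed (use S cY in simp_all)
  \<comment> \<open>In every degree one of the two summands is the chosen zero object: Y^m if n = m,
    and the term of the stalk complex otherwise.\<close>
  define i where "i n = (if n = m then Idt C (cob X m) else zr z0 (cob X n))" for n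
  define p where "p n = (if n = m then Idt C (cob X m) else zr (cob X n) z0)" for n
  define j where "j n = (if n = m then zr z0 (cob X m) else Idt C (cob X n))" for n
  define q where "q n = (if n = m then zr (cob X m) z0 else Idt C (cob X n))" for n
  have z0id: "Idt C z0 = zr z0 z0" using z0 zero_iff by blast
  have a: "arr (i n)" "dm (i n) = (if n = m then cob X m else z0)" "cd (i n) = cob X n"
     "arr (p n)" "cd (p n) = (if n = m then cob X m else z0)" "dm (p n) = cob X n"
     "arr (j n)" "dm (j n) = YO n" "cd (j n) = cob X n" "arr (q n)" "cd (q n) = YO n" "dm (q n) = cob X n" for n
    by (auto simp: i_def p_def j_def q_def YO_def)
  have "mapping_cone C ?S Y f X j p"
    unfolding mapping_cone_def
  proof (rule conjI, rule X, rule exI[of _ i], rule exI[of _ q], intro allI conjI)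
    fix n
    show "biproduct C (cob ?S (n + 1)) (cob Y n) (cob X n) (i n) (j n) (p n) (q n)"
      by (subst biproduct_iff) (auto simp: hm_iff a cS YO_def, auto simp: i_def p_def j_def q_def z0id)
    have sd: "cdiff (shift_complex C ?S) n = zr (cob ?S (n + 1)) (cob ?S (n + 1 + 1))"
      unfolding shift_complex_reindex[OF S] using S by (simp add: stk_cdiff)
    have t: "i (n + 1) \<bullet> cdiff (shift_complex C ?S) n \<bullet> p n = zr (cob X n) (cob X (n + 1))"
      unfolding sd using S by (simp add: a cS)
    have "j (n + 1) \<bullet> f (n + 1) \<bullet> p n \<boxplus> j (n + 1) \<bullet> cdiff Y n \<bullet> q n = cdiff X n"
    proof -
      consider "n = m" | "n + 1 = m" | "n \<noteq> m" "n + 1 \<noteq> m" by blast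
      then show ?thesis
      proof cases
        case 1 then show ?thesis by (simp add: f_def j_def p_def q_def Yd YO_def)
      next
        case 2
        \<comment> \<open>X^(m-1) is a zero object, so the differential that Y replaces by zero was
          zero already.\<close>
        have "cdiff X n = zr (cob X n) (cob X (n + 1))" using zero_from[OF min, of n "cdiff X n"] 2 by simp
        then show ?thesis using 2 by (simp add: f_def j_def p_def q_def Yd YO_def cS)
      next
        case 3 then show ?thesis by (simp add: f_def j_def p_def q_def Yd YO_def cS)
      qed
    qed
    moreover have "zr (cob X n) (cob X (n + 1)) \<oplus>\<^bsub>Hom C (cob X n) (cob X (n + 1))\<^esub> cdiff X n = cdiff X n"
      using pl_zr(2)[of "cdiff X n" "cob X n" "cob X (n + 1)"] unfolding pl_def by simp
    ultimately show "cdiff X n = i (n + 1) \<bullet> cdiff (shift_complex C ?S) n \<bullet> p n \<oplus>\<^bsub>Hom C (cob X n) (cob X (n + 1))\<^esub>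
          (j (n + 1) \<bullet> f (n + 1) \<bullet> p n \<oplus>\<^bsub>Hom C (cob X n) (cob X (n + 1))\<^esub> j (n + 1) \<bullet> cdiff Y n \<bullet> q n)"
      unfolding t using fa[of "n + 1"] Ya[of n] a[of n] a[of "n + 1"] by (simp add: pl_def cS zr_def[symmetric])
  qed
  then show ?thesis using bY supp cf by blast
qed

text \<open>Induction on the number of nonzero terms, splitting off the lowest one. The start is a
  separate case because a complex of zero objects need not consist of the zero object chosen in
  \<open>stk\<close>.\<close>

lemma Db_induct:
  assumes X: "bc X"
    and zero: "\<And>X. bc X \<Longrightarrow> (\<And>n. zero_object C (cob X n)) \<Longrightarrow> P X"
    and stalk: "\<And>k M. M \<in> Ob C \<Longrightarrow> P (stk k M)"
    and cone: "\<And>S Y X f g h. Db_tri C S Y X f g h \<Longrightarrow> P S \<Longrightarrow> P Y \<Longrightarrow> P X"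
  shows "P X"
  using X
proof (induction "card {n. \<not> zero_object C (cob X n)}" arbitrary: X)
  case 0
  then have "{n. \<not> zero_object C (cob X n)} = {}" by (simp add: bounded_iff)
  then show ?case using zero 0 by blast
next
  case (Suc c)
  let ?N = "{n. \<not> zero_object C (cob X n)}"
  have fin: "finite ?N" and ne: "?N \<noteq> {}" using Suc(2,3) bounded_iff[of X] by (blast, metis card.empty nat.distinct(1))
  define m where "m = Min ?N"
  have m: "m \<in> ?N" "\<And>n. n < m \<Longrightarrow> zero_object C (cob X n)"
    using Min_in[OF fin ne] Min_le[OF fin] unfolding m_def by (blast, force)
  obtain Y f j p where Y: "bc Y" "{n. \<not> zero_object C (cob Y n)} = ?N - {m}"
    "chn (stk (m + 1) (cob X m)) Y f" "mapping_cone C (stk (m + 1) (cob X m)) Y f X j p"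
    using stupid_truncation[OF Suc(3) m(2)] by blast
  have "c = card (?N - {m})" using Suc(2) fin m(1) by simp
  then have "P Y" using Suc(1)[of Y] Y by simp
  moreover have M: "cob X m \<in> Ob C" using Suc(3) bounded_cplx by simp
  ultimately show ?case using cone[OF cone_Db_tri[OF stk_bc[OF M] Y(1,3,4)]] stalk[OF M] by blast
qed

end

section \<open>Boundedness\<close>

context t_structure_category
begin

sublocale S: site K \<A> surjH by (rule heart_site)

abbreviation "shn n X \<equiv> (fob (shift C) ^^ n) X"

lemma shn_iso: "isomorphic C X Y \<Longrightarrow> X \<in> Ob C \<Longrightarrow> Y \<in> Ob C \<Longrightarrow> isomorphic C (shn n X) (shn n Y)"
  by (induct n) (auto intro: sh_iso)

lemma shn_H0: "X \<in> Ob C \<Longrightarrow> Y \<in> Ob C \<Longrightarrow> H0 (shn n X) (shn n Y) \<longleftrightarrow> H0 X Y"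
  by (induct n) (auto simp: H0_sh)

lemma shn_surj: "Y \<in> Ob C \<Longrightarrow> \<exists>X \<in> Ob C. isomorphic C (shn n X) Y"
proof (induct n arbitrary: Y)
  case 0 then show ?case using iso_refl by force
next
  case (Suc n)
  obtain Y' where Y': "Y' \<in> Ob C" "isomorphic C (sh Y') Y" using sh_surj Suc by blast
  obtain X where X: "X \<in> Ob C" "isomorphic C (shn n X) Y'" using Suc Y' by blast
  have "isomorphic C (shn (Suc n) X) (sh Y')" using sh_iso[OF X(2)] X Y' by simp
  then have "isomorphic C (shn (Suc n) X) Y" using iso_trans[OF _ Y'(2)] X Y' Suc(2) sh_Ob shn_Ob by blast
  then show ?case using X by blast
qed

lemma shn_tri: "tri C X Y Z f g h \<Longrightarrow> \<exists>f g h. tri C (shn n X) (shn n Y) (shn n Z) f g h"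
proof (induct n)
  case (Suc n) then show ?case using tri_sh by fastforce
qed auto

lemma shn_U: "X \<in> U \<Longrightarrow> shn n X \<in> U"
  by (induct n) (auto intro: U_sh)

lemma shn_add: "shn (m + n) X = shn m (shn n X)"
  by (simp add: funpow_add)

lemma shn_Suc: "shn (Suc n) X = shn n (sh X)"
  by (simp add: funpow_swap1)

lemma tri_mid:
  assumes t: "tri C X Y Z f g h" and "isomorphic C Y Y'" "Y' \<in> Ob C"
  shows "\<exists>f g h. tri C X Y' Z f g h"
proof -
  have O: "X \<in> Ob C" "Y \<in> Ob C" "Z \<in> Ob C" using tri_hm[OF t] hm_Ob by blast+
  obtain b b' where b: "hm b Y Y'" "hm b' Y' Y" "b' \<bullet> b = Idt C Y" "b \<bullet> b' = Idt C Y'" using isomorphicE assms O by metis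
  show ?thesis
    by (intro exI, rule tri_iso[OF t _ _ _ _ b, of "Idt C X" X "Idt C X" "Idt C Z" Z "Idt C Z"])
      (use O in \<open>simp_all add: hm_iff\<close>)
qed

definition above_bounded where "above_bounded X \<longleftrightarrow> X \<in> Ob C \<and> (\<exists>n. shn n X \<in> U)"
text \<open>X lies in V[n - 1], written as vanishing of Hom from U[n] so that no desuspension
  occurs.\<close>

definition below_bounded where "below_bounded X \<longleftrightarrow> X \<in> Ob C \<and> (\<exists>n. \<forall>A \<in> U. H0 (shn n A) X)"

lemma above_bounded_iso: "above_bounded X \<Longrightarrow> isomorphic C X Y \<Longrightarrow> Y \<in> Ob C \<Longrightarrow> above_bounded Y"
  unfolding above_bounded_def using shn_iso U_iso shn_Ob by meson

lemma below_bounded_iso: "below_bounded X \<Longrightarrow> isomorphic C X Y \<Longrightarrow> Y \<in> Ob C \<Longrightarrow> below_bounded Y"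
  unfolding below_bounded_def using H0_iso2 U_Ob shn_Ob by meson

lemma above_bounded_sh: assumes "X \<in> Ob C" shows "above_bounded (sh X) \<longleftrightarrow> above_bounded X"
proof
  assume "above_bounded (sh X)"
  then show "above_bounded X" unfolding above_bounded_def using assms shn_Suc by metis
next
  assume "above_bounded X"
  then obtain n where "shn n X \<in> U" using above_bounded_def by blast
  then have "shn (Suc n) X \<in> U" using U_sh by simp
  then have "shn n (sh X) \<in> U" unfolding shn_Suc .
  then show "above_bounded (sh X)" unfolding above_bounded_def using assms by auto
qed

lemma below_bounded_sh: assumes X: "X \<in> Ob C" shows "below_bounded (sh X) \<longleftrightarrow> below_bounded X"
proof
  assume "below_bounded (sh X)"
  then obtain n where n: "\<forall>A \<in> U. H0 (shn n A) (sh X)" unfolding below_bounded_def by blast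
  have "H0 (shn n A) X" if "A \<in> U" for A
    using n[rule_format, OF U_sh[OF that]] H0_sh[of "shn n A" X] X U_Ob[OF that] shn_Suc[of n A] by simp
  then show "below_bounded X" unfolding below_bounded_def using X by blast
next
  assume "below_bounded X"
  then obtain n where "\<forall>A \<in> U. H0 (shn n A) X" unfolding below_bounded_def by blast
  then have "\<forall>A \<in> U. H0 (shn (Suc n) A) (sh X)" using H0_sh X U_Ob by simp
  then show "below_bounded (sh X)" unfolding below_bounded_def using X sh_Ob by blast
qed

lemma below_bounded_mono: "\<forall>A \<in> U. H0 (shn n A) X \<Longrightarrow> \<forall>A \<in> U. H0 (shn (n + k) A) X"
  using shn_U by (simp add: shn_add)

lemma above_bounded_ext: assumes t: "tri C X Y Z f g h" and P: "above_bounded X" "above_bounded Z" shows "above_bounded Y"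
proof -
  obtain n m where "shn n X \<in> U" "shn m Z \<in> U" using P unfolding above_bounded_def by blast
  then have "shn (m + n) X \<in> U" "shn (n + m) Z \<in> U" using shn_U by (simp_all add: shn_add)
  then have "shn (n + m) Y \<in> U" using shn_tri[OF t, of "n + m"] U_ext by (metis add.commute)
  then show ?thesis unfolding above_bounded_def using tri_hm(1)[OF t] hm_Ob by blast
qed

lemma below_bounded_ext: assumes t: "tri C X Y Z f g h" and P: "below_bounded X" "below_bounded Z" shows "below_bounded Y"
proof -
  obtain n m where "\<forall>A \<in> U. H0 (shn n A) X" "\<forall>A \<in> U. H0 (shn m A) Z" using P unfolding below_bounded_def by blast
  then have "\<forall>A \<in> U. H0 (shn (n + m) A) X" "\<forall>A \<in> U. H0 (shn (m + n) A) Z" using below_bounded_mono by blast+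
  then have "\<forall>A \<in> U. H0 (shn (n + m) A) Y" using H0_to[OF t] by (simp add: add.commute)
  then show ?thesis unfolding below_bounded_def using tri_hm(1)[OF t] hm_Ob by blast
qed

lemma above_bounded_shifted: "above_bounded X \<Longrightarrow> \<exists>n. X \<in> shifted C n U"
proof -
  assume "above_bounded X"
  then obtain n where n: "shn n X \<in> U" "X \<in> Ob C" unfolding above_bounded_def by blast
  have "X \<in> shifted C (- int n) U" unfolding shifted_def using n iso_refl[of "shn n X"] iso_refl[of X] by (cases "n = 0") auto
  then show ?thesis by blast
qed

lemma below_bounded_shifted: "below_bounded X \<Longrightarrow> \<exists>n. X \<in> shifted C n V"
proof -
  assume "below_bounded X"
  then obtain n where n: "\<forall>A \<in> U. H0 (shn n A) X" "X \<in> Ob C" unfolding below_bounded_def by blast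
  \<comment> \<open>Membership in V[n] asks for A in V with X isomorphic to A[n]. Any n-fold
    desuspension of X qualifies, by orthogonality.\<close>
  obtain A where A: "A \<in> Ob C" "isomorphic C (shn n A) X" using shn_surj n by blast
  then have i: "isomorphic C X (shn n A)" using iso_sym n by simp
  have "A \<in> V"
  proof (rule V_orth[OF A(1)])
    fix B assume B: "B \<in> U"
    then have "H0 (shn n (sh B)) (shn n A)" using n H0_iso2[OF _ i] U_sh U_Ob A by simp
    then show "H0 (sh B) A" using shn_H0 A U_Ob[OF B] by simp
  qed
  then have "X \<in> shifted C (int n) V" unfolding shifted_def using n i by auto
  then show ?thesis by blast
qed

end

section \<open>Transport along the equivalence\<close>

locale derived_heart = t_structure_category K C U V
  for K :: "('k, 'r) ring_scheme" (structure) and C :: "('o, 'm, 'k, 'z) tri_cat_scheme" and U V +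
  fixes G :: "(('o, 'm) cochain, ('o, 'm) db_arrow, 'o, 'm) lin_functor"
  assumes G_equiv: "triangle_equivalence K (Db (heart C U V)) C G"
    and G_ext: "extends_heart_embedding C U V G"
begin

abbreviation "DD \<equiv> Db_lin \<A>"
abbreviation "bcx \<equiv> bounded_complex \<A>"

lemma G_linear: "linear_functor K (Db \<A>) C G" and G_eq: "equivalence_functor K (Db \<A>) C G" and G_tri: "triangle_functor K (Db \<A>) C G"
  using G_equiv unfolding triangle_equivalence_def equivalence_functor_def \<A>_def by blast+

lemma G_Ob: "bcx X \<Longrightarrow> fob G X \<in> Ob C" and G_Idt: "bcx X \<Longrightarrow> fmor G (Idt DD X) = Idt C (fob G X)"
  and G_hm: "bcx X \<Longrightarrow> bcx Y \<Longrightarrow> F \<in> Mor DD X Y \<Longrightarrow> hm (fmor G F) (fob G X) (fob G Y)"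
  and G_cmp: "bcx X \<Longrightarrow> bcx Y \<Longrightarrow> bcx Z \<Longrightarrow> F \<in> Mor DD X Y \<Longrightarrow> F' \<in> Mor DD Y Z \<Longrightarrow>
    fmor G (Cmp DD F' F) = fmor G F' \<bullet> fmor G F"
  and G_smult: "bcx X \<Longrightarrow> bcx Y \<Longrightarrow> F \<in> Mor DD X Y \<Longrightarrow> fmor G (\<zero> \<odot>\<^bsub>Hom DD X Y\<^esub> F) = \<zero> \<odot>\<^bsub>Hom C (fob G X) (fob G Y)\<^esub> fmor G F"
proof -
  note l = G_linear[unfolded linear_functor_def S.Db_simps S.D_Ob mem_Collect_eq]
  show O: "bcx X \<Longrightarrow> fob G X \<in> Ob C" "bcx X \<Longrightarrow> fmor G (Idt DD X) = Idt C (fob G X)" for X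
    using l by simp_all
  show "bcx X \<Longrightarrow> bcx Y \<Longrightarrow> F \<in> Mor DD X Y \<Longrightarrow> hm (fmor G F) (fob G X) (fob G Y)"
    using l O unfolding hm_def by simp
  show "bcx X \<Longrightarrow> bcx Y \<Longrightarrow> bcx Z \<Longrightarrow> F \<in> Mor DD X Y \<Longrightarrow> F' \<in> Mor DD Y Z \<Longrightarrow> fmor G (Cmp DD F' F) = fmor G F' \<bullet> fmor G F"
    using l by simp
  show "bcx X \<Longrightarrow> bcx Y \<Longrightarrow> F \<in> Mor DD X Y \<Longrightarrow> fmor G (\<zero> \<odot>\<^bsub>Hom DD X Y\<^esub> F) = \<zero> \<odot>\<^bsub>Hom C (fob G X) (fob G Y)\<^esub> fmor G F"
    using l by simp
qed

text \<open>The zero arrow is 0 times itself, and \<open>G\<close> preserves scalar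
  multiples.\<close>

lemma G_zero:
  assumes b: "bcx X" "bcx Y"
  shows "fmor G (S.dar X Y (S.zch X Y)) = zr (fob G X) (fob G Y)"
proof -
  let ?F = "S.dar X Y (S.zch X Y)"
  have F: "?F \<in> Mor DD X Y" using S.dar_Mor b H.chn_zr H.bounded_cplx by blast
  have h: "hm (fmor G ?F) (fob G X) (fob G Y)" using G_hm b F by blast
  have "fmor G ?F = fmor G (\<zero> \<odot>\<^bsub>Hom DD X Y\<^esub> ?F)" using S.D_zero_smult[OF b F] by simp
  also have "\<dots> = \<zero> \<odot>\<^bsub>Hom C (fob G X) (fob G Y)\<^esub> fmor G ?F" by (rule G_smult[OF b F])
  also have "\<dots> = zr (fob G X) (fob G Y)" using zero_smult[of "fmor G ?F"] h by (simp add: hm_iff)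
  finally show ?thesis .
qed

text \<open>The preimage is tau_Y G'(q) tau_X^-1, where q is p corrected by both natural
  isomorphisms so that G G'(q) = G(tau_Y)^-1 p G(tau_X). All cancellations take place in C after
  applying \<open>G\<close>, where associativity is at hand.\<close>

lemma G_full:
  assumes b: "bcx X" "bcx Y" and p: "hm p (fob G X) (fob G Y)"
  shows "\<exists>F \<in> Mor DD X Y. fmor G F = p"
proof -
  obtain G' \<tau> \<sigma> where G': "linear_functor K C (Db \<A>) G'"
    and t: "natural_iso (Db \<A>) (Db \<A>) (functor_comp G' G) inclusion_functor \<tau>"
    and s: "natural_iso C C (functor_comp G G') inclusion_functor \<sigma>"
    using G_eq unfolding equivalence_functor_def naturally_isomorphic_def by blast
  let ?X = "fob G X" and ?Y = "fob G Y"
  have O: "?X \<in> Ob C" "?Y \<in> Ob C" using G_Ob b by blast+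
  have O': "bcx (fob G' ?X)" "bcx (fob G' ?Y)" using G' O unfolding linear_functor_def S.Db_simps S.D_Ob by auto
  have G'm: "fmor G' q \<in> Mor DD (fob G' ?X) (fob G' ?Y)" if "hm q ?X ?Y" for q
    using G' that unfolding linear_functor_def S.Db_simps hm_def by blast
  have "iso_arrow (Db \<A>) (fob G' (fob G X)) X (\<tau> X)" if "bcx X" for X
    using t that unfolding natural_iso_def S.Db_simps S.D_Ob by (auto simp: functor_comp_def inclusion_functor_def)
  then have "\<exists>g. \<tau> X \<in> Mor DD (fob G' (fob G X)) X \<and> g \<in> Mor DD X (fob G' (fob G X)) \<and>
     Cmp DD g (\<tau> X) = Idt DD (fob G' (fob G X)) \<and> Cmp DD (\<tau> X) g = Idt DD X" if "bcx X" for X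
    using that unfolding iso_arrow_def S.Db_simps by blast
  then obtain g g' where g: "\<tau> X \<in> Mor DD (fob G' ?X) X" "g \<in> Mor DD X (fob G' ?X)" "Cmp DD (\<tau> X) g = Idt DD X"
     and g': "\<tau> Y \<in> Mor DD (fob G' ?Y) Y" "g' \<in> Mor DD Y (fob G' ?Y)" "Cmp DD (\<tau> Y) g' = Idt DD Y" using b by meson
  have GO: "fob G (fob G' ?X) \<in> Ob C" "fob G (fob G' ?Y) \<in> Ob C" using G_Ob O' by blast+
  have "iso_arrow C (fob G (fob G' A)) A (\<sigma> A)" if "A \<in> Ob C" for A
    using s that unfolding natural_iso_def by (auto simp: functor_comp_def inclusion_functor_def)
  then obtain r r' where r: "hm (\<sigma> ?X) (fob G (fob G' ?X)) ?X" "hm r ?X (fob G (fob G' ?X))" "r \<bullet> \<sigma> ?X = Idt C (fob G (fob G' ?X))"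
    "\<sigma> ?X \<bullet> r = Idt C ?X"
    and r': "hm (\<sigma> ?Y) (fob G (fob G' ?Y)) ?Y" "hm r' ?Y (fob G (fob G' ?Y))" "r' \<bullet> \<sigma> ?Y = Idt C (fob G (fob G' ?Y))"
    using iso_arrow_iff O GO by metis
  have Gg: "fmor G (\<tau> X) \<bullet> fmor G g = Idt C ?X" "fmor G (\<tau> Y) \<bullet> fmor G g' = Idt C ?Y"
    using G_cmp[OF b(1) O'(1) b(1) g(2,1)] G_cmp[OF b(2) O'(2) b(2) g'(2,1)] g(3) g'(3) G_Idt b by simp_all
  note h = G_hm[OF O'(1) b(1) g(1)] G_hm[OF b(1) O'(1) g(2)] G_hm[OF O'(2) b(2) g'(1)] G_hm[OF b(2) O'(2) g'(2)]
  note [simp] = h[unfolded hm_iff] r(1,2)[unfolded hm_iff] r'(1,2)[unfolded hm_iff] p[unfolded hm_iff] O GO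
  define q where "q = \<sigma> ?Y \<bullet> (fmor G g' \<bullet> (p \<bullet> (fmor G (\<tau> X) \<bullet> r)))"
  have q: "hm q ?X ?Y" unfolding q_def hm_iff by simp
  note G'q = G'm[OF q]
  have qM: "q \<in> Mor C ?X ?Y" using q by (simp add: hm_def)
  have nat: "\<sigma> ?Y \<bullet> fmor G (fmor G' q) = q \<bullet> \<sigma> ?X"
    using s qM O unfolding natural_iso_def by (auto simp: functor_comp_def inclusion_functor_def)
  define w where "w = fmor G (fmor G' q)"
  have w: "hm w (fob G (fob G' ?X)) (fob G (fob G' ?Y))" unfolding w_def by (rule G_hm[OF O' G'q])
  note [simp] = w[unfolded hm_iff]
  have "w = r' \<bullet> (\<sigma> ?Y \<bullet> w)" using cmp_red[OF r'(3), of w] by simp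
  also have "\<dots> = r' \<bullet> (q \<bullet> \<sigma> ?X)" using nat w_def by simp
  also have "\<dots> = fmor G g' \<bullet> (p \<bullet> fmor G (\<tau> X))"
    unfolding q_def using cmp_red[OF r'(3), of "fmor G g' \<bullet> (p \<bullet> fmor G (\<tau> X))"] r(3) by simp
  finally have w2: "w = fmor G g' \<bullet> (p \<bullet> fmor G (\<tau> X))" .
  define F where "F = Cmp DD (\<tau> Y) (Cmp DD (fmor G' q) g)"
  have c: "Cmp DD (fmor G' q) g \<in> Mor DD X (fob G' ?Y)" by (rule S.D_closed[OF b(1) O' g(2) G'q])
  have F: "F \<in> Mor DD X Y" unfolding F_def by (rule S.D_closed[OF b(1) O'(2) b(2) c g'(1)])
  have "fmor G F = fmor G (\<tau> Y) \<bullet> (w \<bullet> fmor G g)"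
    unfolding F_def w_def using G_cmp[OF b(1) O'(2) b(2) c g'(1)] G_cmp[OF b(1) O' g(2) G'q] by simp
  also have "\<dots> = p" unfolding w2 using cmp_red[OF Gg(2), of p] Gg(1) by simp
  finally show ?thesis using F by blast
qed

lemma G_shift: assumes b: "bcx X" shows "isomorphic C (fob G (shift_complex \<A> X)) (sh (fob G X))"
proof -
  obtain \<xi> where "natural_iso (Db \<A>) C (functor_comp G (shift (Db \<A>))) (functor_comp (shift C) G) \<xi>"
    using G_tri unfolding triangle_functor_def by blast
  then have "iso_arrow C (fob G (shift_complex \<A> X)) (sh (fob G X)) (\<xi> X)"
    using b unfolding natural_iso_def S.Db_simps S.D_Ob by (simp add: functor_comp_def Db_shift_def)
  then show ?thesis unfolding isomorphic_def by blast
qed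

lemma G_triangle: assumes "Db_tri \<A> X Y Z f g h" shows "\<exists>f g h. tri C (fob G X) (fob G Y) (fob G Z) f g h"
  using G_tri assms unfolding triangle_functor_def S.Db_simps by blast

text \<open>Naturality of theta on arrows is what later brings a covering of stalk complexes back to
  the heart. The definite description in \<open>stalk_functor\<close> is evaluated through
  disjointness of Hom-sets.\<close>

lemma G_stalk:
  "\<exists>\<theta>. (\<forall>M \<in> \<H>. iso_arrow C (fob G (S.stk 0 M)) M (\<theta> M)) \<and>
    (\<forall>M \<in> \<H>. \<forall>N \<in> \<H>. \<forall>e. hm e M N \<longrightarrow> \<theta> N \<bullet> fmor G (S.dar (S.stk 0 M) (S.stk 0 N)
      (\<lambda>n. if n = 0 then e else zr (cob (S.stk 0 M) n) (cob (S.stk 0 N) n))) = e \<bullet> \<theta> M)"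
proof -
  obtain \<theta> where t: "natural_iso \<A> C (functor_comp G (stalk_functor \<A>)) inclusion_functor \<theta>"
    using G_ext unfolding extends_heart_embedding_def naturally_isomorphic_def \<A>_def by blast
  have 1: "iso_arrow C (fob G (S.stk 0 M)) M (\<theta> M)" if "M \<in> \<H>" for M
    using t that unfolding natural_iso_def heart_simps S.stk_stalk[symmetric]
    by (simp add: functor_comp_def stalk_functor_def inclusion_functor_def)
  have zz: "\<zero>\<^bsub>Hom \<A> A B\<^esub> = zr A B" for A B by (simp add: heart_simps zr_def)
  have 2: "\<theta> N \<bullet> fmor G (S.dar (S.stk 0 M) (S.stk 0 N)
      (\<lambda>n. if n = 0 then e else zr (cob (S.stk 0 M) n) (cob (S.stk 0 N) n))) = e \<bullet> \<theta> M"
    if e: "M \<in> \<H>" "N \<in> \<H>" "hm e M N" for M N e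
  proof -
    have eM: "e \<in> Mor \<A> M N" using e by (simp add: hm_def heart_simps)
    have "fmor (stalk_functor \<A>) e = S.dar (S.stk 0 M) (S.stk 0 N)
      (\<lambda>n. if n = 0 then e else zr (cob (S.stk 0 M) n) (cob (S.stk 0 N) n))"
      unfolding stalk_functor_def lin_functor.simps S.stk_stalk zz
    proof (rule the_equality)
      show "\<exists>M'\<in>Ob \<A>. \<exists>N'\<in>Ob \<A>. e \<in> Mor \<A> M' N' \<and> S.dar (S.stk 0 M) (S.stk 0 N) (\<lambda>n. if n = 0 then e else zr (cob (S.stk 0 M) n) (cob (S.stk 0 N) n)) =
          S.dar (S.stk 0 M') (S.stk 0 N') (\<lambda>n. if n = 0 then e else zr (cob (S.stk 0 M') n) (cob (S.stk 0 N') n))"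
        by (rule bexI[of _ M], rule bexI[of _ N]) (use e eM in \<open>simp_all add: heart_simps\<close>)
      fix F assume "\<exists>M'\<in>Ob \<A>. \<exists>N'\<in>Ob \<A>. e \<in> Mor \<A> M' N' \<and> F =
          S.dar (S.stk 0 M') (S.stk 0 N') (\<lambda>n. if n = 0 then e else zr (cob (S.stk 0 M') n) (cob (S.stk 0 N') n))"
      then obtain M' N' where M': "M' \<in> Ob \<A>" "N' \<in> Ob \<A>" "e \<in> Mor \<A> M' N'" and F: "F =
          S.dar (S.stk 0 M') (S.stk 0 N') (\<lambda>n. if n = 0 then e else zr (cob (S.stk 0 M') n) (cob (S.stk 0 N') n))" by blast
      have e': "M' = M" "N' = N" using H.Hom_disjoint[OF M'(1,2) _ _ M'(3) eM] e by (simp_all add: heart_simps)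
      then show "F = S.dar (S.stk 0 M) (S.stk 0 N) (\<lambda>n. if n = 0 then e else zr (cob (S.stk 0 M) n) (cob (S.stk 0 N) n))"
        unfolding F e' by simp
    qed
    moreover have "\<theta> N \<bullet> fmor G (fmor (stalk_functor \<A>) e) = e \<bullet> \<theta> M"
    proof -
      have "\<forall>X\<in>\<H>. \<forall>Y\<in>\<H>. \<forall>f\<in>Mor C X Y. \<theta> Y \<bullet> fmor G (fmor (stalk_functor \<A>) f) = f \<bullet> \<theta> X"
        using t unfolding natural_iso_def heart_simps by (simp add: functor_comp_def inclusion_functor_def)
      then show ?thesis using e(1,2) eM heart_simps(2) by metis
    qed
    ultimately show ?thesis by simp
  qed
  show ?thesis using 1 2 by (intro exI[of _ \<theta>]) blast
qed

lemma stk_bcx: "M \<in> \<H> \<Longrightarrow> bcx (S.stk k M)" using S.stk_bc by (simp add: heart_simps)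

text \<open>The grading is cohomological: M in degree -n is M[n].\<close>

lemma G_stk_iso: assumes M: "M \<in> \<H>" shows "isomorphic C (fob G (S.stk (- int n) M)) (shn n M)"
proof (induct n)
  case 0
  obtain \<theta> where "\<And>M. M \<in> \<H> \<Longrightarrow> iso_arrow C (fob G (S.stk 0 M)) M (\<theta> M)" using G_stalk by blast
  then show ?case using M unfolding isomorphic_def by auto
next
  case (Suc n)
  note b = stk_bcx[OF M]
  have "- int (Suc n) = - int n - 1" by simp
  then have "S.stk (- int (Suc n)) M = shift_complex \<A> (S.stk (- int n) M)"
    using S.stk_shift[of M "- int n"] M by (simp only: heart_simps)
  then have "isomorphic C (fob G (S.stk (- int (Suc n)) M)) (sh (fob G (S.stk (- int n) M)))" using G_shift[OF b] by simp
  moreover have "isomorphic C (sh (fob G (S.stk (- int n) M))) (sh (shn n M))" using sh_iso[OF Suc] G_Ob[OF b] M U_Ob by simp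
  ultimately show ?case using iso_trans[of _ _ "sh (shn n M)"] G_Ob[OF b] G_Ob[OF stk_bcx[OF M, of "- int (Suc n)"]] M U_Ob by simp
qed

section \<open>Every object is bounded in both directions\<close>

definition fully_bounded where "fully_bounded X \<longleftrightarrow> above_bounded X \<and> below_bounded X"

lemma fully_bounded_sh: "X \<in> Ob C \<Longrightarrow> fully_bounded (sh X) \<longleftrightarrow> fully_bounded X" unfolding fully_bounded_def using above_bounded_sh below_bounded_sh by blast
lemma fully_bounded_iso: "fully_bounded X \<Longrightarrow> isomorphic C X Y \<Longrightarrow> Y \<in> Ob C \<Longrightarrow> fully_bounded Y" unfolding fully_bounded_def using above_bounded_iso below_bounded_iso by blast
lemma fully_bounded_ext: "tri C X Y Z f g h \<Longrightarrow> fully_bounded X \<Longrightarrow> fully_bounded Z \<Longrightarrow> fully_bounded Y" unfolding fully_bounded_def using above_bounded_ext below_bounded_ext by blast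

text \<open>The bounds are 0 above, since M lies in U, and 1 below, since Hom(U[1], M) = 0.\<close>

lemma fully_bounded_H: "M \<in> \<H> \<Longrightarrow> fully_bounded M"
  unfolding fully_bounded_def above_bounded_def below_bounded_def using UV U_Ob by (auto intro: exI[of _ 0] exI[of _ 1])

lemma fully_bounded_G_shift: assumes b: "bcx X" shows "fully_bounded (fob G (shift_complex \<A> X)) \<longleftrightarrow> fully_bounded (fob G X)"
  using fully_bounded_iso[OF _ G_shift[OF b]] fully_bounded_iso[OF _ iso_sym[OF G_shift[OF b]]] fully_bounded_sh G_Ob[OF b] G_Ob[OF S.shift_bc[OF b]] sh_Ob by blast

text \<open>Boundedness is inherited by suspensions and by desuspensions, so degree 0 reaches every
  degree in both directions.\<close>

lemma fully_bounded_stk: assumes M: "M \<in> \<H>" shows "fully_bounded (fob G (S.stk k M))"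
proof (induct k rule: int_induct[where k = 0])
  case base
  have "isomorphic C (fob G (S.stk 0 M)) M" using G_stk_iso[OF M, of 0] by simp
  then show ?case using fully_bounded_iso[OF fully_bounded_H[OF M]] iso_sym G_Ob[OF stk_bcx[OF M]] M U_Ob by blast
next
  case (step1 i)
  then show ?case using fully_bounded_G_shift[OF stk_bcx[OF M, of "i + 1"]] S.stk_shift[of M "i + 1"] M by (simp add: heart_simps)
next
  case (step2 i)
  then show ?case using fully_bounded_G_shift[OF stk_bcx[OF M, of i]] S.stk_shift[of M i] M by (simp add: heart_simps)
qed

lemma fully_bounded_G: assumes "bcx X" shows "fully_bounded (fob G X)"
proof (rule S.Db_induct[OF assms, where P = "\<lambda>X. fully_bounded (fob G X)"], goal_cases)
  case (1 X)
  have z: "Idt \<A> (cob X n) = H.zr (cob X n) (cob X n)" for n using 1 H.zero_iff by blast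
  have "fmor G (Idt DD X) = zr (fob G X) (fob G X)"
    using G_zero[OF 1(1) 1(1)] S.dar_id[OF 1(1)] by (simp add: z)
  then have "zero_object C (fob G X)" using G_Idt[OF 1(1)] G_Ob[OF 1(1)] zero_iff by simp
  then show ?case unfolding fully_bounded_def above_bounded_def below_bounded_def using U_zero H0_zero(2) zero_iff by (metis funpow_0)
next
  case (2 k M) then show ?case using fully_bounded_stk by (simp add: heart_simps)
next
  case (3 S Y X f g h)
  obtain f g h where t: "tri C (fob G S) (fob G Y) (fob G X) f g h" using G_triangle[OF 3(1)] by blast
  have "fob G S \<in> Ob C" using tri_hm(1)[OF t] hm_Ob by blast
  \<comment> \<open>X is the third vertex of the triangle, hence after one rotation an extension of
    S[1] by Y.\<close>
  then have "fully_bounded (sh (fob G S))" using 3(2) fully_bounded_sh by simp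
  then show ?case using fully_bounded_ext[OF tri_rot[OF t] 3(3)] by simp
qed

lemma fully_bounded_all: assumes X: "X \<in> Ob C" shows "fully_bounded X"
proof -
  obtain G' \<sigma> where G': "linear_functor K C (Db \<A>) G'"
    and s: "natural_iso C C (functor_comp G G') inclusion_functor \<sigma>"
    using G_eq unfolding equivalence_functor_def naturally_isomorphic_def by blast
  have b: "bcx (fob G' X)" using G' X unfolding linear_functor_def S.Db_simps S.D_Ob by auto
  have "isomorphic C (fob G (fob G' X)) X" unfolding isomorphic_def
    using s X unfolding natural_iso_def by (auto simp: functor_comp_def inclusion_functor_def)
  then show ?thesis using fully_bounded_iso[OF fully_bounded_G[OF b]] X by blast
qed

lemma t_structure_bounded: "bounded_t_structure C U V"
  unfolding bounded_t_structure_def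
proof (intro conjI equalityI subsetI)
  show "t_structure C U V" using tstr .
  fix X
  show "X \<in> (\<Union>n. shifted C n U) \<Longrightarrow> X \<in> Ob C" "X \<in> (\<Union>n. shifted C n V) \<Longrightarrow> X \<in> Ob C" by (auto simp: shifted_def)
  assume "X \<in> Ob C"
  then have "above_bounded X" "below_bounded X" using fully_bounded_all fully_bounded_def by blast+
  then show "X \<in> (\<Union>n. shifted C n U)" "X \<in> (\<Union>n. shifted C n V)" using above_bounded_shifted below_bounded_shifted by blast+
qed

end

section \<open>Effaceability and Serre duality\<close>

context derived_heart
begin

text \<open>Effaceability, in the sense of Grothendieck, of Hom(-, W) on the heart.\<close>

definition effaceable where
  "effaceable W \<longleftrightarrow> W \<in> Ob C \<and> (\<forall>Y \<in> \<H>. \<forall>\<delta>. hm \<delta> Y W \<longrightarrow> (\<exists>Z e. Z \<in> \<H> \<and> hm e Z Y \<and> surjH e \<and> \<delta> \<bullet> e = zr Z W))"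

lemma surjH_Idt: "Y \<in> \<H> \<Longrightarrow> surjH (Idt C Y)"
  by (rule surjH_iso[of _ Y Y "Idt C Y"]) (auto simp: hm_iff H_Ob)

lemma effaceable_H0: assumes W: "W \<in> Ob C" and H: "\<And>Y. Y \<in> \<H> \<Longrightarrow> H0 Y W" shows "effaceable W"
  unfolding effaceable_def
proof (intro conjI ballI allI impI W)
  fix Y \<delta> assume Y: "Y \<in> \<H>" "hm \<delta> Y W"
  then have "\<delta> = zr Y W" using H H0D by blast
  then show "\<exists>Z e. Z \<in> \<H> \<and> hm e Z Y \<and> surjH e \<and> \<delta> \<bullet> e = zr Z W"
    using Y W surjH_Idt H_Ob by (intro exI[of _ Y] exI[of _ "Idt C Y"]) (auto simp: hm_iff)
qed

lemma effaceable_iso: assumes E: "effaceable W" and i: "isomorphic C W W'" and W': "W' \<in> Ob C" shows "effaceable W'"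
  unfolding effaceable_def
proof (intro conjI ballI allI impI W')
  fix Y \<delta> assume Y: "Y \<in> \<H>" "hm \<delta> Y W'"
  have W: "W \<in> Ob C" using E effaceable_def by blast
  obtain b b' where b: "hm b W W'" "hm b' W' W" "b \<bullet> b' = Idt C W'" using isomorphicE i W W' by metis
  obtain Z e where e: "Z \<in> \<H>" "hm e Z Y" "surjH e" "b' \<bullet> \<delta> \<bullet> e = zr Z W"
    using E hm_cmp[OF Y(2) b(2)] Y(1) unfolding effaceable_def by meson
  have "\<delta> \<bullet> e = b \<bullet> (b' \<bullet> \<delta> \<bullet> e)" using cmp_red[OF b(3), of "\<delta> \<bullet> e"] b(1,2) Y(2) e(2) by (simp add: hm_iff)
  also have "\<dots> = zr Z W'" unfolding e(4) using b(1) e(2) W using H_Ob[OF e(1)] by (simp add: hm_iff)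
  finally show "\<exists>Z e. Z \<in> \<H> \<and> hm e Z Y \<and> surjH e \<and> \<delta> \<bullet> e = zr Z W'" using e by blast
qed

text \<open>An epimorphism e kills the image of delta in the third vertex, so delta e lifts to the
  first one, where a second epimorphism e' kills the lift.\<close>

lemma effaceable_ext: assumes t: "tri C W' W W'' f g h" and E: "effaceable W'" "effaceable W''" shows "effaceable W"
  unfolding effaceable_def
proof (intro conjI ballI allI impI)
  have f: "hm f W' W" "hm g W W''" using tri_hm[OF t] by blast+
  show W: "W \<in> Ob C" using f hm_Ob by blast
  fix Y \<delta> assume Y: "Y \<in> \<H>" "hm \<delta> Y W"
  obtain Z e where e: "Z \<in> \<H>" "hm e Z Y" "surjH e" "g \<bullet> \<delta> \<bullet> e = zr Z W''"
    using E(2) hm_cmp[OF Y(2) f(2)] Y(1) unfolding effaceable_def by meson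
  have "g \<bullet> (\<delta> \<bullet> e) = zr Z W''" using e(2,4) f Y(2) by (simp add: hm_iff)
  then obtain u where u: "hm u Z W'" "f \<bullet> u = \<delta> \<bullet> e" using exact_to[OF t hm_cmp[OF e(2) Y(2)]] by blast
  obtain Z' e' where e': "Z' \<in> \<H>" "hm e' Z' Z" "surjH e'" "u \<bullet> e' = zr Z' W'"
    using E(1) u(1) e(1) unfolding effaceable_def by meson
  have "\<delta> \<bullet> (e \<bullet> e') = f \<bullet> (u \<bullet> e')" using cmp_red[OF u(2), of e'] u(1) e(2) e'(2) f(1) Y(2) by (simp add: hm_iff)
  also have "\<dots> = zr Z' W" unfolding e'(4) using f H_Ob[OF e'(1)] by (simp add: hm_iff)
  finally show "\<exists>Z e. Z \<in> \<H> \<and> hm e Z Y \<and> surjH e \<and> \<delta> \<bullet> e = zr Z W"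
    using e'(1) hm_cmp[OF e'(2) e(2)] surjH_comp[OF e'(3) e(3) e'(2) e(2)] by blast
qed

text \<open>A morphism from \<open>Y\<close> to a shift of \<open>M\<close> is a roof whose denominator \<open>E \<rightarrow> Y\<close> is a quasi-isomorphism;
  the cycles of degree \<open>0\<close> in \<open>E\<close> surject onto \<open>Y\<close>, and the numerator vanishes on them for degree reasons.\<close>

lemma effaceable_G_stalk: assumes M: "M \<in> \<H>" and k: "k \<noteq> 0" shows "effaceable (fob G (S.stk k M))"
  unfolding effaceable_def
proof (intro conjI ballI allI impI)
  let ?W = "fob G (S.stk k M)"
  note bM = stk_bcx[OF M, of k]
  show W: "?W \<in> Ob C" using G_Ob[OF bM] .
  fix Y \<delta> assume Y: "Y \<in> \<H>" "hm \<delta> Y ?W"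
  note bY = stk_bcx[OF Y(1), of 0]
  obtain \<theta> where th0: "\<forall>M \<in> \<H>. iso_arrow C (fob G (S.stk 0 M)) M (\<theta> M)"
    "\<forall>M \<in> \<H>. \<forall>N \<in> \<H>. \<forall>e. hm e M N \<longrightarrow> \<theta> N \<bullet> fmor G (S.dar (S.stk 0 M) (S.stk 0 N)
      (\<lambda>n. if n = 0 then e else zr (cob (S.stk 0 M) n) (cob (S.stk 0 N) n))) = e \<bullet> \<theta> M"
    using G_stalk by blast
  note th = bspec[OF th0(1)]
  have thY: "hm (\<theta> Y) (fob G (S.stk 0 Y)) Y" using th[OF Y(1)] iso_arrow_iff G_Ob[OF bY] H_Ob[OF Y(1)] by blast
  obtain F where F: "F \<in> Mor DD (S.stk 0 Y) (S.stk k M)" "fmor G F = \<delta> \<bullet> \<theta> Y"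
    using G_full[OF bY bM hm_cmp[OF thY Y(2)]] by blast
  obtain E s f where E: "bcx E" "S.gqi E (S.stk 0 Y) s" "H.chn E (S.stk k M) f"
    and Fr: "F = S.KB.rcl (S.hcl E (S.stk 0 Y) s) (S.hcl E (S.stk k M) f)"
    using S.D_MorE[OF bY bM F(1)] by blast
  note cs = H.chnD[OF S.gqi_chn[OF E(2)]] and cf = H.chnD[OF E(3)]
  have YA: "Y \<in> Ob \<A>" "M \<in> Ob \<A>" using Y M by (simp_all add: heart_simps)
  \<comment> \<open>The identity of Y is a cycle of degree 0 in the stalk complex. Lifting it
    through s gives a cover e of Y and a cycle x of E with e = s x; the boundary term vanishes
    because a stalk complex has zero differential.\<close>
  have "S.cyc (S.stk 0 Y) 0 (Idt \<A> Y)" unfolding S.cyc_def using YA H.cplx_simps[OF cs(2), of 0] H.cplx_simps[OF cs(2), of 1]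
    by (simp add: S.stk_cdiff) (simp add: S.stk_cob)
  then obtain e x w where e: "surjH e" "H.cd e = H.dm (Idt \<A> Y)" "S.cyc E 0 x" "H.dm x = H.dm e" "H.arr w" "H.dm w = H.dm e"
       "H.cd w = cob (S.stk 0 Y) (0 - 1)" "Cmp \<A> (Idt \<A> Y) e = H.pl (Cmp \<A> (s 0) x) (Cmp \<A> (cdiff (S.stk 0 Y) (0 - 1)) w)"
    using S.gqi_surE[OF E(2) _ refl] by metis
  note x = S.cycD[OF e(3)]
  let ?Z = "H.dm e"
  have ea: "H.arr e" using e(1) S.surj_arr by blast
  have ZA: "?Z \<in> Ob \<A>" using ea by simp
  then have Z: "?Z \<in> \<H>" by (simp add: heart_simps)
  have ecd: "H.cd e = Y" using e(2) YA by simp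
  have sY: "cob (S.stk 0 Y) 0 = Y" by (simp add: S.stk_cob)
  have dw: "Cmp \<A> (cdiff (S.stk 0 Y) (0 - 1)) w = H.zr ?Z Y"
    unfolding S.stk_cdiff using e(5-7) YA cs(2) by (simp add: sY)
  have sx: "H.arr (Cmp \<A> (s 0) x)" "H.dm (Cmp \<A> (s 0) x) = ?Z" "H.cd (Cmp \<A> (s 0) x) = Y"
    using x(1,2) cs(3-5)[of 0] e(4) sY by simp_all
  have es: "e = Cmp \<A> (s 0) x" using e(8) unfolding dw H.cmp_id(2)[OF ea ecd] H.pl_zr(1)[OF sx] .
  have eh: "hm e ?Z Y" using H_hm H.hm_iff ea ecd by blast
  \<comment> \<open>Extended by zero, x is a chain map from the stalk complex of the source of e to
    E. It lifts e through the denominator s, as \<open>D_cmp_lift\<close> requires.\<close>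
  define i where "i n = (if n = 0 then x else H.zr (cob (S.stk 0 ?Z) n) (cob E n))" for n
  have zc: "cob (S.stk 0 ?Z) n = (if n = 0 then ?Z else S.z0)" for n by (simp add: S.stk_cob)
  have iA: "H.arr (i n)" "H.dm (i n) = cob (S.stk 0 ?Z) n" "H.cd (i n) = cob E n" for n
    using x e(4) ZA H.cplx_simps(1)[OF cs(1), of n] by (auto simp: i_def zc)
  have ci: "H.chn (S.stk 0 ?Z) E i" unfolding H.chn_def H.hm_iff
  proof (intro conjI allI)
    fix n
    show "H.arr (i n)" "H.dm (i n) = cob (S.stk 0 ?Z) n" "H.cd (i n) = cob E n" using iA by blast+
    have "Cmp \<A> (cdiff E n) (i n) = H.zr (cob (S.stk 0 ?Z) n) (cob E (n + 1))"
      using x e(4) H.cplx_simps[OF cs(1)] ZA by (auto simp: i_def zc)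
    then show "Cmp \<A> (cdiff E n) (i n) = Cmp \<A> (i (n + 1)) (cdiff (S.stk 0 ?Z) n)" unfolding S.stk_cdiff
      using iA[of "n + 1"] H.cplx_simps(1)[OF S.stk_cplx[OF ZA], of 0 n] by simp
  qed (use cs(1) S.stk_cplx[OF ZA] in auto)
  define ee where "ee n = (if n = 0 then e else zr (cob (S.stk 0 ?Z) n) (cob (S.stk 0 Y) n))" for n
  have si: "Cmp \<A> (s n) (i n) = ee n" for n
  proof (cases "n = 0")
    case True then show ?thesis using es by (simp add: i_def ee_def)
  next
    case False
    then show ?thesis using cs(3-5)[of n] H.cplx_simps(1)[OF cs(1), of n] ZA by (simp add: i_def ee_def H_zr[symmetric] zc)
  qed
  note bZ = stk_bcx[OF Z, of 0]
  have ce: "H.chn (S.stk 0 ?Z) (S.stk 0 Y) ee" using H.chn_cmp[OF ci S.gqi_chn[OF E(2)]] si by simp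
  have "Cmp DD F (S.dar (S.stk 0 ?Z) (S.stk 0 Y) ee) = S.dar (S.stk 0 ?Z) (S.stk k M) (\<lambda>n. Cmp \<A> (f n) (i n))"
    unfolding Fr by (rule S.D_cmp_lift[OF bZ bY E(1) bM E(2,3) ce ci si])
  also have "(\<lambda>n. Cmp \<A> (f n) (i n)) = S.zch (S.stk 0 ?Z) (S.stk k M)"
  proof
    fix n
    have a: "H.arr (Cmp \<A> (f n) (i n))" "H.dm (Cmp \<A> (f n) (i n)) = cob (S.stk 0 ?Z) n" "H.cd (Cmp \<A> (f n) (i n)) = cob (S.stk k M) n"
      using cf(3-5)[of n] iA[of n] by simp_all
    \<comment> \<open>In degree 0 the target is zero because M sits in degree k, which is not 0; in
      all other degrees i vanishes.\<close>
    show "Cmp \<A> (f n) (i n) = H.zr (cob (S.stk 0 ?Z) n) (cob (S.stk k M) n)"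
    proof (cases "n = 0")
      case True
      then have "zero_object \<A> (cob (S.stk k M) n)" using k S.z0 by (simp add: S.stk_cob)
      then show ?thesis using H.zero_to[OF _ a(1)] a by metis
    next
      case False
      then show ?thesis using cf(3-5)[of n] H.cplx_simps(1)[OF cs(1), of n] by (simp add: i_def zc)
    qed
  qed
  finally have Fe: "Cmp DD F (S.dar (S.stk 0 ?Z) (S.stk 0 Y) ee) = S.dar (S.stk 0 ?Z) (S.stk k M) (S.zch (S.stk 0 ?Z) (S.stk k M))" .
  note eM = S.dar_Mor[OF bZ bY ce]
  let ?e = "fmor G (S.dar (S.stk 0 ?Z) (S.stk 0 Y) ee)"
  have "fmor G F \<bullet> ?e = zr (fob G (S.stk 0 ?Z)) ?W"
    using G_cmp[OF bZ bY bM eM F(1)] Fe G_zero[OF bZ bM] by simp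
  then have dz: "\<delta> \<bullet> (\<theta> Y \<bullet> ?e) = zr (fob G (S.stk 0 ?Z)) ?W"
    using F(2) thY Y(2) G_hm[OF bZ bY eM] by (simp add: hm_iff)
  \<comment> \<open>Naturality of theta replaces the image under \<open>G\<close> of the stalk map
    of e by e itself.\<close>
  have "\<theta> Y \<bullet> ?e = e \<bullet> \<theta> ?Z" using th0(2) Z Y(1) eh unfolding ee_def by blast
  then have dz: "\<delta> \<bullet> (e \<bullet> \<theta> ?Z) = zr (fob G (S.stk 0 ?Z)) ?W" using dz by simp
  obtain r where r: "hm (\<theta> ?Z) (fob G (S.stk 0 ?Z)) ?Z" "hm r ?Z (fob G (S.stk 0 ?Z))" "\<theta> ?Z \<bullet> r = Idt C ?Z"
    using th[OF Z] iso_arrow_iff G_Ob[OF bZ] H_Ob[OF Z] by metis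
  have "\<delta> \<bullet> e = \<delta> \<bullet> (e \<bullet> (\<theta> ?Z \<bullet> r))" unfolding r(3) using eh by (simp add: hm_iff)
  also have "\<dots> = \<delta> \<bullet> (e \<bullet> \<theta> ?Z) \<bullet> r" using r(1,2) eh Y(2) by (simp add: hm_iff)
  also have "\<dots> = zr ?Z ?W" unfolding dz using r(2) W by (simp add: hm_iff)
  finally show "\<exists>Z e. Z \<in> \<H> \<and> hm e Z Y \<and> surjH e \<and> \<delta> \<bullet> e = zr Z ?W" using Z eh e(1) by blast
qed

lemma effaceable_shn: assumes "M \<in> \<H>" shows "effaceable (shn (Suc n) M)"
  using effaceable_iso[OF effaceable_G_stalk[OF assms, of "- int (Suc n)"] G_stk_iso[OF assms, of "Suc n"]] H_Ob[OF assms] by simp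

text \<open>The two hypotheses place W in U[1] and in V[m]. In the induction step W lies in V[n]
  with n the old m plus one; truncating W[-n] splits off A[n] with A in the heart, covered by
  \<open>effaceable_shn\<close>, and leaves B[n] in U[1] and V[n - 1] for the induction hypothesis.
  At the start W lies in U[1] and V, so it is zero.\<close>

lemma effaceable_U1_aux: "W \<in> U1 \<Longrightarrow> \<forall>A \<in> U. H0 (shn (Suc m) A) W \<Longrightarrow> effaceable W"
proof (induct m arbitrary: W)
  case 0
  have W: "W \<in> Ob C" using 0 U1_iff by blast
  have "W \<in> V" using V_orth[OF W] 0 by simp
  then have "zero_object C W" using H0_self[OF W] U1V 0 by blast
  then show ?case using effaceable_H0[OF W] H0_zero by blast
next
  case (Suc m)
  let ?n = "Suc m"
  have W: "W \<in> Ob C" using Suc U1_iff by blast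
  obtain W0 where W0: "W0 \<in> Ob C" "isomorphic C (shn ?n W0) W" using shn_surj W by blast
  obtain A B f g h where *: "A \<in> U" "B \<in> Ob C" "sh B \<in> V" "tri C A W0 B f g h" using trunc W0 by blast
  obtain f g h where "tri C (shn ?n A) (shn ?n W0) (shn ?n B) f g h" using shn_tri[OF *(4)] by blast
  then obtain f g h where t: "tri C (shn ?n A) W (shn ?n B) f g h" using tri_mid[OF _ W0(2) W] by blast
  have AO: "A \<in> Ob C" using * U_Ob by blast
  have HB: "\<forall>A' \<in> U. H0 (shn ?n A') (shn ?n B)" using shn_H0 UVm * U_Ob by blast
  have "shn ?n A \<in> U" using shn_U[OF *(1)] .
  then have "shn ?n B \<in> U1" using U1_ext[OF tri_rot[OF t]] Suc(2) U1_sh by blast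
  then have E2: "effaceable (shn ?n B)" using Suc(1) HB by blast
  have "A \<in> V"
  proof (rule V_orth[OF AO])
    fix A' assume A': "A' \<in> U"
    have O: "A' \<in> Ob C" using A' U_Ob by blast
    have "H0 (shn ?n (sh A')) W" using Suc(3) A' unfolding shn_Suc by blast
    moreover have "sh (shn ?n (sh A')) = shn ?n (sh (sh A'))" using shn_Suc[of ?n "sh A'"] by simp
    then have "H0 (sh (shn ?n (sh A'))) (shn ?n B)" using HB U_sh[OF U_sh[OF A']] by simp
    ultimately have "H0 (shn ?n (sh A')) (shn ?n A)" using H0_fib[OF t] O by simp
    then show "H0 (sh A') A" using shn_H0[of "sh A'" A ?n] O AO by simp
  qed
  then have "effaceable (shn ?n A)" using effaceable_shn * by blast
  then show ?case using effaceable_ext[OF t] E2 by blast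
qed

lemma effaceable_U1: assumes W: "W \<in> U1" shows "effaceable W"
proof -
  have "below_bounded W" using fully_bounded_all W U1_iff fully_bounded_def by blast
  then obtain n where "\<forall>A \<in> U. H0 (shn n A) W" unfolding below_bounded_def by blast
  \<comment> \<open>Raising n by one keeps the vanishing and gives it the successor form of
    \<open>effaceable_U1_aux\<close>.\<close>
  then have "\<forall>A \<in> U. H0 (shn (n + 1) A) W" by (rule below_bounded_mono)
  then show ?thesis using effaceable_U1_aux[OF W] by simp
qed

end

text \<open>Take a minimal generating set B and b in B. The other generators span N, which misses b;
  so M is the direct sum of K b and N, and the coordinate along b is a functional with value 1 at
  b.\<close>

lemma dual_trivial:
  fixes K :: "('k, 'r) ring_scheme" (structure) and M :: "('k, 'a, 'z) module_scheme"
  assumes "field K" "module K M" "finite_dimensional K M"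
    and tr: "\<And>\<phi> x. \<phi> \<in> carrier (dual K M) \<Longrightarrow> x \<in> carrier M \<Longrightarrow> \<phi> x = \<zero>"
  shows "carrier M = {\<zero>\<^bsub>M\<^esub>}"
proof (rule ccontr)
  interpret field K by fact
  interpret M: module K M by fact
  assume nz: "carrier M \<noteq> {\<zero>\<^bsub>M\<^esub>}"
  define sub where "sub S \<longleftrightarrow> S \<subseteq> carrier M \<and> \<zero>\<^bsub>M\<^esub> \<in> S \<and> (\<forall>x \<in> S. \<forall>y \<in> S. x \<oplus>\<^bsub>M\<^esub> y \<in> S) \<and>
    (\<forall>a \<in> carrier K. \<forall>x \<in> S. a \<odot>\<^bsub>M\<^esub> x \<in> S)" for S
  \<comment> \<open>Generation is expressed through submodules, so that linear combinations indexed
    by a generating set are handled once, for \<open>B0\<close>.\<close>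
  define gen where "gen B \<longleftrightarrow> finite B \<and> B \<subseteq> carrier M \<and> (\<forall>S. sub S \<longrightarrow> B \<subseteq> S \<longrightarrow> carrier M \<subseteq> S)" for B
  obtain B0 where B0: "finite B0" "B0 \<subseteq> carrier M"
    "\<forall>x \<in> carrier M. \<exists>c \<in> B0 \<rightarrow> carrier K. x = (\<Oplus>\<^bsub>M\<^esub>b \<in> B0. c b \<odot>\<^bsub>M\<^esub> b)"
    using assms(3) unfolding finite_dimensional_def by blast
  have "gen B0"
    unfolding gen_def
  proof (intro conjI B0 allI impI subsetI)
    fix S x assume S: "sub S" "B0 \<subseteq> S" and x: "x \<in> carrier M"
    have fs: "(\<Oplus>\<^bsub>M\<^esub>b \<in> F. c b \<odot>\<^bsub>M\<^esub> b) \<in> S" if "finite F" "F \<subseteq> B0" "c \<in> B0 \<rightarrow> carrier K" for F c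
      using that(1,2)
    proof induction
      case empty then show ?case using S by (simp add: sub_def)
    next
      case (insert b F)
      have "c b \<odot>\<^bsub>M\<^esub> b \<in> carrier M" if "b \<in> B0" for b using that B0(2) \<open>c \<in> B0 \<rightarrow> carrier K\<close> by auto
      then have "(\<Oplus>\<^bsub>M\<^esub>b \<in> insert b F. c b \<odot>\<^bsub>M\<^esub> b) = c b \<odot>\<^bsub>M\<^esub> b \<oplus>\<^bsub>M\<^esub> (\<Oplus>\<^bsub>M\<^esub>b \<in> F. c b \<odot>\<^bsub>M\<^esub> b)"
        using insert by (intro M.finsum_insert) auto
      moreover have "c b \<odot>\<^bsub>M\<^esub> b \<in> S" using insert S that(3) unfolding sub_def by blast
      ultimately show ?case using insert S unfolding sub_def by simp
    qed
    obtain c where "c \<in> B0 \<rightarrow> carrier K" "x = (\<Oplus>\<^bsub>M\<^esub>b \<in> B0. c b \<odot>\<^bsub>M\<^esub> b)" using B0 x by blast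
    then show "x \<in> S" using fs[OF B0(1)] by simp
  qed
  then obtain B where B: "gen B" and min: "\<And>B'. gen B' \<Longrightarrow> card B \<le> card B'"
    using ex_has_least_nat[of gen B0 card] by blast
  have "B \<noteq> {}"
  proof
    assume "B = {}"
    moreover have "sub {\<zero>\<^bsub>M\<^esub>}" by (auto simp: sub_def)
    ultimately show False using B nz M.zero_closed unfolding gen_def by blast
  qed
  then obtain b where b: "b \<in> B" by blast
  then have bM: "b \<in> carrier M" using B gen_def by blast
  define N where "N = \<Inter>{S. sub S \<and> B - {b} \<subseteq> S}"
  have subM: "sub (carrier M)" by (auto simp: sub_def)
  have BM: "B \<subseteq> carrier M" using B gen_def by blast
  have NM: "N \<subseteq> carrier M" unfolding N_def using subM BM by blast
  have sN: "sub N" unfolding sub_def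
  proof (intro conjI NM)
    show "\<zero>\<^bsub>M\<^esub> \<in> N" "\<forall>x\<in>N. \<forall>y\<in>N. x \<oplus>\<^bsub>M\<^esub> y \<in> N" "\<forall>a\<in>carrier K. \<forall>x\<in>N. a \<odot>\<^bsub>M\<^esub> x \<in> N"
      unfolding N_def sub_def by blast+
  qed
  have BN: "B - {b} \<subseteq> N" unfolding N_def by blast
  have bN: "b \<notin> N"
  proof
    assume bn: "b \<in> N"
    have "gen (B - {b})" unfolding gen_def
    proof (intro conjI allI impI)
      show "finite (B - {b})" "B - {b} \<subseteq> carrier M" using B gen_def by auto
      fix S assume S: "sub S" "B - {b} \<subseteq> S"
      then have "b \<in> S" using bn unfolding N_def by blast
      then have "B \<subseteq> S" using S by blast
      then show "carrier M \<subseteq> S" using B S gen_def by blast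
    qed
    moreover have "card (B - {b}) < card B" using B b unfolding gen_def by (meson card_Diff1_less)
    ultimately show False using min by fastforce
  qed
  \<comment> \<open>If a and a' differ, then (a - a') b lies in N, and dividing by a - a' puts b in
    N.\<close>
  have un: "a = a'" if a: "a \<in> carrier K" "a' \<in> carrier K" "u \<in> N" "u' \<in> N" and e: "a \<odot>\<^bsub>M\<^esub> b \<oplus>\<^bsub>M\<^esub> u = a' \<odot>\<^bsub>M\<^esub> b \<oplus>\<^bsub>M\<^esub> u'" for a a' u u'
  proof (rule ccontr)
    assume ne: "a \<noteq> a'"
    have uM: "u \<in> carrier M" "u' \<in> carrier M" using a NM by blast+
    define d where "d = a \<ominus> a'"
    have "a = d \<oplus> a'" using a by (simp add: d_def a_minus_def a_assoc l_neg)
    then have d: "d \<in> carrier K" "d \<noteq> \<zero>" using a ne l_zero unfolding d_def by (simp, metis)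
    define P where "P = a \<odot>\<^bsub>M\<^esub> b"
    define Q where "Q = a' \<odot>\<^bsub>M\<^esub> b"
    have PQ: "P \<in> carrier M" "Q \<in> carrier M" using a bM by (simp_all add: P_def Q_def)
    have "d \<odot>\<^bsub>M\<^esub> b = P \<oplus>\<^bsub>M\<^esub> \<ominus>\<^bsub>M\<^esub> Q" unfolding d_def P_def Q_def a_minus_def using a bM
      by (simp add: M.smult_l_distr M.smult_l_minus)
    also have "\<dots> = (P \<oplus>\<^bsub>M\<^esub> u) \<oplus>\<^bsub>M\<^esub> (\<ominus>\<^bsub>M\<^esub> u \<oplus>\<^bsub>M\<^esub> \<ominus>\<^bsub>M\<^esub> Q)" using PQ uM by (simp add: M.a_assoc M.r_neg2)
    also have "\<dots> = (u' \<oplus>\<^bsub>M\<^esub> Q) \<oplus>\<^bsub>M\<^esub> (\<ominus>\<^bsub>M\<^esub> Q \<oplus>\<^bsub>M\<^esub> \<ominus>\<^bsub>M\<^esub> u)" using e PQ uM by (simp add: P_def[symmetric] Q_def[symmetric] M.a_comm)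
    also have "\<dots> = u' \<oplus>\<^bsub>M\<^esub> \<ominus>\<^bsub>M\<^esub> u" using PQ uM by (simp add: M.a_assoc M.r_neg2)
    also have "\<dots> = u' \<oplus>\<^bsub>M\<^esub> (\<ominus> \<one>) \<odot>\<^bsub>M\<^esub> u" using uM by (simp add: M.smult_l_minus)
    also have "\<dots> \<in> N" using a sN unfolding sub_def by simp
    finally have "inv d \<odot>\<^bsub>M\<^esub> (d \<odot>\<^bsub>M\<^esub> b) \<in> N" using sN d field_Units unfolding sub_def by simp
    moreover have "inv d \<odot>\<^bsub>M\<^esub> (d \<odot>\<^bsub>M\<^esub> b) = b"
      using M.smult_assoc1[of "inv d" d b] d bM field_Units Units_l_inv[of d] by simp
    ultimately show False using bN by simp
  qed
  have ex: "\<exists>a \<in> carrier K. \<exists>u \<in> N. x = a \<odot>\<^bsub>M\<^esub> b \<oplus>\<^bsub>M\<^esub> u" if "x \<in> carrier M" for x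
  proof -
    let ?S = "{a \<odot>\<^bsub>M\<^esub> b \<oplus>\<^bsub>M\<^esub> u | a u. a \<in> carrier K \<and> u \<in> N}"
    have "sub ?S" unfolding sub_def
    proof (intro conjI ballI subsetI)
      fix x assume "x \<in> ?S" then show "x \<in> carrier M" using NM bM by auto
    next
      have "\<zero>\<^bsub>M\<^esub> = \<zero> \<odot>\<^bsub>M\<^esub> b \<oplus>\<^bsub>M\<^esub> \<zero>\<^bsub>M\<^esub>" using bM by simp
      then show "\<zero>\<^bsub>M\<^esub> \<in> ?S" using sN unfolding sub_def by blast
    next
      fix x y assume "x \<in> ?S" "y \<in> ?S"
      then obtain a u a' u' where x: "a \<in> carrier K" "u \<in> N" "x = a \<odot>\<^bsub>M\<^esub> b \<oplus>\<^bsub>M\<^esub> u"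
        "a' \<in> carrier K" "u' \<in> N" "y = a' \<odot>\<^bsub>M\<^esub> b \<oplus>\<^bsub>M\<^esub> u'" by blast
      then have "x \<oplus>\<^bsub>M\<^esub> y = (a \<oplus> a') \<odot>\<^bsub>M\<^esub> b \<oplus>\<^bsub>M\<^esub> (u \<oplus>\<^bsub>M\<^esub> u')"
        using bM NM by (simp add: M.smult_l_distr M.a_ac subset_iff)
      moreover have "u \<oplus>\<^bsub>M\<^esub> u' \<in> N" using x sN unfolding sub_def by blast
      ultimately show "x \<oplus>\<^bsub>M\<^esub> y \<in> ?S" using x(1,4) a_closed by blast
    next
      fix c x assume c: "c \<in> carrier K" "x \<in> ?S"
      then obtain a u where x: "a \<in> carrier K" "u \<in> N" "x = a \<odot>\<^bsub>M\<^esub> b \<oplus>\<^bsub>M\<^esub> u" by blast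
      then have "c \<odot>\<^bsub>M\<^esub> x = (c \<otimes> a) \<odot>\<^bsub>M\<^esub> b \<oplus>\<^bsub>M\<^esub> c \<odot>\<^bsub>M\<^esub> u"
        using bM NM c by (simp add: M.smult_r_distr M.smult_assoc1 subset_iff)
      moreover have "c \<odot>\<^bsub>M\<^esub> u \<in> N" using x sN c unfolding sub_def by blast
      ultimately show "c \<odot>\<^bsub>M\<^esub> x \<in> ?S" using x(1) c(1) m_closed by blast
    qed
    moreover have "B \<subseteq> ?S"
    proof
      fix y assume "y \<in> B"
      show "y \<in> ?S"
      proof (cases "y = b")
        case True
        then have "y = \<one> \<odot>\<^bsub>M\<^esub> b \<oplus>\<^bsub>M\<^esub> \<zero>\<^bsub>M\<^esub>" using bM by simp
        then show ?thesis using sN unfolding sub_def by blast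
      next
        case False
        then have "y \<in> N" using BN \<open>y \<in> B\<close> by blast
        moreover have "y = \<zero> \<odot>\<^bsub>M\<^esub> b \<oplus>\<^bsub>M\<^esub> y" using bM BM \<open>y \<in> B\<close> by auto
        ultimately show ?thesis by blast
      qed
    qed
    ultimately show ?thesis using B that unfolding gen_def by blast
  qed
  define c where "c x = (THE a. a \<in> carrier K \<and> (\<exists>u \<in> N. x = a \<odot>\<^bsub>M\<^esub> b \<oplus>\<^bsub>M\<^esub> u))" for x
  have c: "c x = a" if "a \<in> carrier K" "u \<in> N" "x = a \<odot>\<^bsub>M\<^esub> b \<oplus>\<^bsub>M\<^esub> u" for x a u
    unfolding c_def by (rule the_equality) (use that un in blast)+
  define \<phi> where "\<phi> = (\<lambda>x \<in> carrier M. c x)"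
  have "\<phi> \<in> carrier (dual K M)"
    unfolding dual_def linear_map_def ground_module_def
  proof (simp, intro conjI ballI)
    show "\<phi> \<in> carrier M \<rightarrow> carrier K" unfolding \<phi>_def using ex c by fastforce
    show "\<phi> \<in> extensional (carrier M)" by (simp add: \<phi>_def)
  next
    fix x y assume xy: "x \<in> carrier M" "y \<in> carrier M"
    then obtain a u a' u' where x: "a \<in> carrier K" "u \<in> N" "x = a \<odot>\<^bsub>M\<^esub> b \<oplus>\<^bsub>M\<^esub> u"
        "a' \<in> carrier K" "u' \<in> N" "y = a' \<odot>\<^bsub>M\<^esub> b \<oplus>\<^bsub>M\<^esub> u'" using ex by meson
    have "x \<oplus>\<^bsub>M\<^esub> y = (a \<oplus> a') \<odot>\<^bsub>M\<^esub> b \<oplus>\<^bsub>M\<^esub> (u \<oplus>\<^bsub>M\<^esub> u')"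
      using x bM NM by (simp add: M.smult_l_distr M.a_ac subset_iff)
    moreover have "u \<oplus>\<^bsub>M\<^esub> u' \<in> N" using x sN unfolding sub_def by blast
    ultimately have "c (x \<oplus>\<^bsub>M\<^esub> y) = a \<oplus> a'" using x c[of "a \<oplus> a'" "u \<oplus>\<^bsub>M\<^esub> u'"] by simp
    then show "\<phi> (x \<oplus>\<^bsub>M\<^esub> y) = \<phi> x \<oplus> \<phi> y" using xy c[OF x(1-3)] c[OF x(4-6)] by (simp add: \<phi>_def)
  next
    fix k x assume k: "k \<in> carrier K" "x \<in> carrier M"
    then obtain a u where x: "a \<in> carrier K" "u \<in> N" "x = a \<odot>\<^bsub>M\<^esub> b \<oplus>\<^bsub>M\<^esub> u" using ex by meson
    have "k \<odot>\<^bsub>M\<^esub> x = (k \<otimes> a) \<odot>\<^bsub>M\<^esub> b \<oplus>\<^bsub>M\<^esub> k \<odot>\<^bsub>M\<^esub> u"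
      using x bM NM k by (simp add: M.smult_r_distr M.smult_assoc1 subset_iff)
    moreover have "k \<odot>\<^bsub>M\<^esub> u \<in> N" using x sN k unfolding sub_def by blast
    ultimately have "c (k \<odot>\<^bsub>M\<^esub> x) = k \<otimes> a" using x k c[of "k \<otimes> a" "k \<odot>\<^bsub>M\<^esub> u"] by simp
    then show "\<phi> (k \<odot>\<^bsub>M\<^esub> x) = k \<otimes> \<phi> x" using k c[OF x] by (simp add: \<phi>_def)
  qed
  then have "\<phi> b = \<zero>" using tr bM by blast
  moreover have "\<zero>\<^bsub>M\<^esub> \<in> N" using sN by (simp add: sub_def)
  then have "c b = \<one>" using c[of \<one> "\<zero>\<^bsub>M\<^esub>" b] bM by simp
  ultimately show False using bM by (simp add: \<phi>_def)
qed

section \<open>Serre duality\<close>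

context triangulated_category
begin

lemma serre_Ob: "serre_functor K C S \<Longrightarrow> X \<in> Ob C \<Longrightarrow> fob S X \<in> Ob C"
  using linear_functorD(1) unfolding serre_functor_def equivalence_functor_def by blast

text \<open>The dual of Hom(B, S X) is in bijection with Hom(X, B) = 0, so it contains the zero
  functional alone; by finite dimension the space itself vanishes.\<close>

lemma serre_H0:
  assumes hf: "hom_finite K C" and S: "serre_functor K C S" and O: "X \<in> Ob C" "B \<in> Ob C" and H: "H0 X B"
  shows "H0 B (fob S X)"
proof -
  have SX: "fob S X \<in> Ob C" using serre_Ob S O by blast
  let ?M = "Hom C B (fob S X)"
  obtain \<eta> where \<eta>: "bij_betw \<eta> (Mor C X B) (carrier (dual K ?M))" using S O unfolding serre_functor_def by blast
  have M1: "Mor C X B = {zr X B}" using H O Mor_iff unfolding H0_def hm_def by auto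
  have c1: "carrier (dual K ?M) = {\<eta> (zr X B)}" using \<eta> unfolding M1 bij_betw_def by simp
  interpret M: module K ?M using Hom_module O SX by blast
  have "(\<lambda>x \<in> carrier ?M. \<zero>) \<in> carrier (dual K ?M)"
    by (auto simp: dual_def linear_map_def ground_module_def)
  then have "\<phi> x = \<zero>" if "\<phi> \<in> carrier (dual K ?M)" "x \<in> carrier ?M" for \<phi> x
    using that c1 by (metis (no_types, lifting) restrict_apply' singletonD)
  then have "carrier ?M = {\<zero>\<^bsub>?M\<^esub>}"
    using dual_trivial[OF field_axioms, of ?M] hf O SX M.module_axioms unfolding hom_finite_def by blast
  then show ?thesis unfolding H0_def hm_def zr_def by blast
qed

end

context derived_heart
begin

lemma serre_U:
  assumes hf: "hom_finite K C" and S: "serre_functor K C S" and X: "X \<in> U"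
  shows "fob S X \<in> U"
proof -
  have XO: "X \<in> Ob C" using X U_Ob by blast
  have SX: "fob S X \<in> Ob C" using serre_Ob S XO by blast
  have step: "shn n (fob S X) \<in> U" if T: "shn (Suc n) (fob S X) \<in> U" for n
  proof -
    let ?T = "shn (Suc n) (fob S X)"
    have TO: "?T \<in> Ob C" using T U_Ob by blast
    obtain A Y f g h where t: "A \<in> U" "Y \<in> V" "tri C (sh A) ?T Y f g h" using trunc1[OF TO] by blast
    have "Y \<in> U" using U_cone[OF t(3)] T U_sh t by blast
    then have Y: "Y \<in> \<H>" using t by blast
    have YO: "Y \<in> Ob C" using Y H_Ob by blast
    have gh: "hm g ?T Y" "hm h Y (sh (sh A))" using tri_hm t by blast+
    obtain Z e where e: "Z \<in> \<H>" "hm e Z Y" "surjH e" "h \<bullet> e = zr Z (sh (sh A))"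
      using effaceable_U1[OF U1_sh[OF U_sh[OF t(1)]]] Y gh(2) unfolding effaceable_def by blast
    have ZO: "Z \<in> Ob C" using e H_Ob by blast
    obtain u where u: "hm u Z ?T" "g \<bullet> u = e" using exact_to2[OF t(3) e(2,4)] by blast
    \<comment> \<open>T is a suspension of S X, not S of a suspension. The n + 1 suspensions are
      therefore moved from X to Z, and Serre duality is applied to X and a desuspension Z0 of
      Z.\<close>
    obtain Z0 where Z0: "Z0 \<in> Ob C" "isomorphic C (shn (Suc n) Z0) Z" using shn_surj ZO by blast
    have "H0 (shn (Suc n) X) Z" using UV[OF shn_U[OF X]] e by simp
    then have "H0 (shn (Suc n) X) (shn (Suc n) Z0)" using H0_iso2 iso_sym[OF Z0(2)] Z0 ZO XO shn_Ob by blast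
    then have "H0 X Z0" using shn_H0 XO Z0 by blast
    then have "H0 Z0 (fob S X)" by (rule serre_H0[OF hf S XO Z0(1)])
    then have "H0 (shn (Suc n) Z0) ?T" using shn_H0 Z0 SX by blast
    then have "H0 Z ?T" using H0_iso1 Z0 ZO TO shn_Ob by blast
    then have "u = zr Z ?T" using H0D u by blast
    \<comment> \<open>The epimorphism e = g u onto Y is zero, which forces Y = 0.\<close>
    then have "e = zr Z Y" using u(2) gh(1) ZO by (simp add: hm_iff)
    then have "Idt C Y = zr Y Y" using surjH_epi[OF e(3,2), of "Idt C Y" Y] Y YO e(2) by (simp add: hm_iff)
    then have "zero_object C Y" using zero_iff YO by blast
    \<comment> \<open>For B in V the space Hom(T, B) is caught between Hom(A[1], B) and Hom(Y, B),
      and both are zero.\<close>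
    then have "?T \<in> U1" using U1_orth[OF TO] H0_from[OF t(3)] UV[OF t(1)] H0_zero by blast
    then show ?thesis using sh_U1[of "shn n (fob S X)"] SX by simp
  qed
  have "above_bounded (fob S X)" using fully_bounded_all[OF SX] fully_bounded_def by blast
  then obtain n where "shn n (fob S X) \<in> U" unfolding above_bounded_def by blast
  then have "shn 0 (fob S X) \<in> U" using step by (induct n) auto
  then show ?thesis by simp
qed

end

theorem corollary4p13:
  fixes K :: "('k, 'r) ring_scheme"
    and C :: "('o, 'm, 'k, 'z) tri_cat_scheme"
    and S :: "('o, 'm, 'o, 'm) lin_functor"
    and U V :: "'o set"
    and G :: "(('o, 'm) cochain, ('o, 'm) db_arrow, 'o, 'm) lin_functor"
  assumes "triangulated_category K C"
    and "hom_finite K C"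
    and "serre_functor K C S"
    and "t_structure C U V"
    and "triangle_equivalence K (Db (heart C U V)) C G"
    and "extends_heart_embedding C U V G"
  shows "bounded_t_structure C U V \<and> fob S ` U \<subseteq> U"
proof -
  interpret derived_heart K C U V G
    using assms by (intro derived_heart.intro t_structure_category.intro t_structure_category_axioms.intro derived_heart_axioms.intro)
  show ?thesis using t_structure_bounded serre_U assms by blast
qed

end
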